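(* Suppose that Assumptions 1 and 2 (stated in the context) hold for some $\kappa\ge 4$. Then there exists $\sigma_h>0$ such that for every $x\in\mathcal X$, under $\mathbb P_x$, $$e^{-\lambda t/2}\bigl(Z_t(h)-e^{\lambda t}W\bigr)\longrightarrow \sigma_h\sqrt{W}\,\mathcal Z$$ in distribution as $t\to+\infty$, where $\mathcal Z$ is a standard Gaussian random variable independent of $W$. Moreover, there exists $K>0$ such that for all $t>0$ and all $x\in\mathcal X$, under $\mathbb P_x$, $$\mathbf d\Bigl(e^{-\lambda t/2}\bigl(Z_t(h)-e^{\lambda t}W\bigr),\ \sigma_h\sqrt W\,\mathcal Z\Bigr)\le K\exp\Bigl(-\frac{\lambda\rho}{2\rho+\lambda}\,t\Bigr)\,\mathbb E_x\bigl(Z_0(V^* )\bigr),$$ where $V^*(x)=\max\{\sqrt{V(x)},V^3(x)\}$.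
   Context: **Process.** $(Z_t)_{t\ge0}$ is a branching Markov process on a measurable space $\mathcal X$: $Z_t=\sum_{u\in\mathcal N_t}\delta_{X_t^u}$ is a point measure, where $\mathcal N_t$ is the (at most countable) random set of individuals alive at time $t$ and $X_t^u\in\mathcal X$ is the trait of $u$. Branching property: for all $t,s\ge0$, $Z_{t+s}=\sum_{u\in\mathcal N_t}Z^u_{t,t+s}$, where $Z^u_{t,t+s}$ is the point measure of the traits at time $t+s$ of the descendants of $u$ (itself included) and, conditionally on $\mathcal F_t=\sigma(Z_r,\,r\le t)$, the processes $(Z^u_{t,t+s})_{s\ge0}$, $u\in\mathcal N_t$, are independent, each distributed as the process started from a single particle at $X_t^u$. $\mathbb P_x,\mathbb E_x$ denote law and expectation when $Z_0=\delta_x$. Write $Z_t(f)=\sum_{u\in\mathcal N_t}f(X_t^u)$ and $\mu(f)=\int f\,d\mu$. **Weights.** A function $V:\mathcal X\to(0,+\infty)$ is fixed. For an integer $k\ge1$, $\mathcal B(V^k)$ is the set of (measurable) $f:\mathcal X\to\mathbb R$ with $\|f\|_{V^k}:=\sup_x|f(x)|/V^k(x)<\infty$. For $\kappa\ge1$, $\underline V^{(\kappa)}=\min_{1\le k\le\kappa}V^k$ and $\overline V^{(\kappa)}=\max_{1\le k\le\kappa}V^k$. **Assumption 1 (for $\kappa$).** There exist $t^*>0$, $a_1>0$ such that for all $x\in\mathcal X$ and $1\le k\le\kappa$, $\sup_{t\le t^*}\mathbb E_x(Z_t(V)^k)\le a_1V^k(x)$. The mean semigroup is $\mathfrak M_tf(x)=\mathbb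 E_x(Z_t(f))$. **Assumption 2 (for $\kappa$).** There exist a positive measure $\gamma$ with $\gamma(\overline V^{(\kappa)})<\infty$, a non-negative function $h$ with $\sup_x h(x)/\underline V^{(\kappa)}(x)<\infty$, and $\lambda>0$ with $\mathfrak M_th=e^{\lambda t}h$, $\gamma\mathfrak M_t=e^{\lambda t}\gamma$, $\gamma(h)=\|h\|_V=1$, and constants $a_2>0$, $\rho>0$ such that for all $x\in\mathcal X$, $1\le k\le\kappa$, $f\in\mathcal B(V^k)$ and $t>0$, $$|e^{-\lambda t}\mathfrak M_tf(x)-\gamma(f)h(x)|\le a_2e^{-\rho t}\|f\|_{V^k}V^k(x).$$ **Limit $W$.** $W_t:=e^{-\lambda t}Z_t(h)$ is a non-negative martingale and $W$ denotes its limit (almost surely and in $L^4(\mathbb P_x)$) as $t\to\infty$. **Distance.** For real random variables $X,Y$, $\mathbf d(X,Y)=\sup_{F}|\mathbb E(F(X))-\mathbb E(F(Y))|$, the supremum being over $F:\mathbb R\to\mathbb R$ with $\max\{\|F\|_\infty,\|F'\|_\infty,\|F''\|_\infty,\|F'''\|_\infty\}\le1$.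
   Formalization: The claim σ_h > 0 is replaced by: σ_h > 0, or σ_h = 0 and W = h(x) P_x-almost surely for γ-almost every x, since σ_h > 0 fails e.g. for mass-conserving growth-fragmentation, where Z_t(h) = e^{λt}W identically. *)

theory Defs
  imports "HOL-Probability.Probability"
begin

section \<open>Point measures and their path space\<close>

text \<open>The pushforward of the counting measure on \<open>S\<close> along \<open>f\<close> is the sum over \<open>u \<in> S\<close> of the
  Dirac masses at \<open>f u\<close>.\<close>

definition point_measure :: "'x measure \<Rightarrow> 'u set \<Rightarrow> ('u \<Rightarrow> 'x) \<Rightarrow> 'x measure" where
  "point_measure X S f = distr (count_space S) X f"

text \<open>The sigma-algebra generated by the evaluations \<open>\<mu> \<mapsto> \<mu> B\<close>, as in the library's
  \<open>subprob_algebra\<close> but without the bound on the total mass.\<close>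

definition measure_algebra :: "'x measure \<Rightarrow> 'x measure measure" where
  "measure_algebra X =
     (SUP B\<in>sets X. vimage_algebra {\<mu>. sets \<mu> = sets X} (\<lambda>\<mu>. emeasure \<mu> B) borel)"

definition path_algebra :: "'x measure \<Rightarrow> (real \<Rightarrow> 'x measure) measure" where
  "path_algebra X = (\<Pi>\<^sub>M s\<in>{0..}. measure_algebra X)"

text \<open>The sigma-algebra generated by \<open>Z r\<close>, \<open>0 \<le> r \<le> t\<close>.\<close>

definition past :: "'x measure \<Rightarrow> 'w measure \<Rightarrow> (real \<Rightarrow> 'w \<Rightarrow> 'x measure) \<Rightarrow> real \<Rightarrow> 'w measure" where
  "past X \<Omega> Z t =
     vimage_algebra (space \<Omega>) (\<lambda>\<omega>. \<lambda>r\<in>{0..t}. Z r \<omega>) (\<Pi>\<^sub>M r\<in>{0..t}. measure_algebra X)"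


section \<open>Branching Markov processes\<close>

text \<open>Data: \<open>N t \<omega>\<close> is the set of labels of the individuals alive at time \<open>t\<close>, \<open>trait t \<omega> u\<close> the
  trait of \<open>u\<close> at that time (relevant only if \<open>u \<in> N t \<omega>\<close>), and \<open>desc \<omega> u v\<close> says that \<open>v\<close> is
  \<open>u\<close> or a descendant of \<open>u\<close>. Labels are taken from a countable type, e.g. Ulam-Harris words
  with the prefix order. \<open>P x\<close> is the law on \<open>\<Omega>\<close> under which the process starts from one individual
  with trait \<open>x\<close>.\<close>

definition population ::
  "'x measure \<Rightarrow> (real \<Rightarrow> 'w \<Rightarrow> 'u set) \<Rightarrow> (real \<Rightarrow> 'w \<Rightarrow> 'u \<Rightarrow> 'x) \<Rightarrow> real \<Rightarrow> 'w \<Rightarrow> 'x measure" where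
  "population X N trait t \<omega> = point_measure X (N t \<omega>) (trait t \<omega>)"

definition offspring ::
  "'x measure \<Rightarrow> (real \<Rightarrow> 'w \<Rightarrow> 'u set) \<Rightarrow> (real \<Rightarrow> 'w \<Rightarrow> 'u \<Rightarrow> 'x) \<Rightarrow> ('w \<Rightarrow> 'u \<Rightarrow> 'u \<Rightarrow> bool) \<Rightarrow>
   real \<Rightarrow> 'u \<Rightarrow> real \<Rightarrow> 'w \<Rightarrow> 'x measure" where
  "offspring X N trait desc t u s \<omega> =
     point_measure X {v \<in> N (t + s) \<omega>. desc \<omega> u v} (trait (t + s) \<omega>)"

definition process_law ::
  "'x measure \<Rightarrow> ('x \<Rightarrow> 'w measure) \<Rightarrow> (real \<Rightarrow> 'w \<Rightarrow> 'x measure) \<Rightarrow> 'x \<Rightarrow> (real \<Rightarrow> 'x measure) measure"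
  where
  "process_law X P Z x = distr (P x) (path_algebra X) (\<lambda>\<omega>. \<lambda>s\<in>{0..}. Z s \<omega>)"

text \<open>The last clause of the definition below is the branching property: given the past up to time
  \<open>t\<close>, the processes \<open>(offspring t u s)\<close>, \<open>s \<ge> 0\<close>, for \<open>u\<close> alive at time \<open>t\<close>, are independent and
  distributed as the process started from the trait of \<open>u\<close>. As for every family, independence is
  the product formula for finite subfamilies \<open>U\<close>. The conditioning is written in integrated form
  over the events \<open>A\<close> of the past, because neither the event that \<open>U\<close> is alive nor the traits of
  the labelled individuals need be measurable with respect to the past of the point measure.\<close>

definition branching_markov_process ::
  "'x measure \<Rightarrow> 'w measure \<Rightarrow> ('x \<Rightarrow> 'w measure) \<Rightarrow> (real \<Rightarrow> 'w \<Rightarrow> ('u::countable) set) \<Rightarrow>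
   (real \<Rightarrow> 'w \<Rightarrow> 'u \<Rightarrow> 'x) \<Rightarrow> ('w \<Rightarrow> 'u \<Rightarrow> 'u \<Rightarrow> bool) \<Rightarrow> bool" where
  "branching_markov_process X \<Omega> P N trait desc \<longleftrightarrow>
     (let Z = population X N trait; Zd = offspring X N trait desc; law = process_law X P Z in
       (\<forall>x\<in>space X. prob_space (P x) \<and> sets (P x) = sets \<Omega>) \<and>
       (\<forall>t\<ge>0. \<forall>u. {\<omega> \<in> space \<Omega>. u \<in> N t \<omega>} \<in> sets \<Omega> \<and>
          (\<lambda>\<omega>. trait t \<omega> u) \<in> restrict_space \<Omega> {\<omega> \<in> space \<Omega>. u \<in> N t \<omega>} \<rightarrow>\<^sub>M X) \<and>
       (\<forall>u v. {\<omega> \<in> space \<Omega>. desc \<omega> u v} \<in> sets \<Omega>) \<and>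
       (\<forall>\<omega>\<in>space \<Omega>. reflp (desc \<omega>) \<and> transp (desc \<omega>)) \<and>
       law \<in> X \<rightarrow>\<^sub>M prob_algebra (path_algebra X) \<and>
       (\<forall>x\<in>space X. AE \<omega> in P x. Z 0 \<omega> = return X x) \<and>
       (\<forall>x\<in>space X. \<forall>t\<ge>0. \<forall>s\<ge>0. AE \<omega> in P x. \<forall>B\<in>sets X.
          emeasure (Z (t + s) \<omega>) B = (\<integral>\<^sup>+u. emeasure (Zd t u s \<omega>) B \<partial>count_space (N t \<omega>))) \<and>
       (\<forall>x\<in>space X. \<forall>t\<ge>0. \<forall>A\<in>sets (past X \<Omega> Z t). \<forall>U. finite U \<longrightarrow>
          (\<forall>B. (\<forall>u\<in>U. B u \<in> sets (path_algebra X)) \<longrightarrow>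
             emeasure (P x) {\<omega> \<in> A. U \<subseteq> N t \<omega> \<and> (\<forall>u\<in>U. (\<lambda>s\<in>{0..}. Zd t u s \<omega>) \<in> B u)} =
             (\<integral>\<^sup>+\<omega>. indicator {\<omega> \<in> A. U \<subseteq> N t \<omega>} \<omega> *
                 (\<Prod>u\<in>U. emeasure (law (trait t \<omega> u)) (B u)) \<partial>P x))))"


section \<open>Weights, mean semigroup and the two assumptions\<close>

definition weighted_space :: "'x measure \<Rightarrow> ('x \<Rightarrow> real) \<Rightarrow> ('x \<Rightarrow> real) set" where
  "weighted_space X w = {f \<in> borel_measurable X. bdd_above ((\<lambda>x. \<bar>f x\<bar> / w x) ` space X)}"

definition weighted_norm :: "'x measure \<Rightarrow> ('x \<Rightarrow> real) \<Rightarrow> ('x \<Rightarrow> real) \<Rightarrow> real" where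
  "weighted_norm X w f = (SUP x\<in>space X. \<bar>f x\<bar> / w x)"

definition min_weight :: "('x \<Rightarrow> real) \<Rightarrow> nat \<Rightarrow> 'x \<Rightarrow> real" where
  "min_weight V \<kappa> x = (MIN k\<in>{1..\<kappa>}. V x ^ k)"

definition max_weight :: "('x \<Rightarrow> real) \<Rightarrow> nat \<Rightarrow> 'x \<Rightarrow> real" where
  "max_weight V \<kappa> x = (MAX k\<in>{1..\<kappa>}. V x ^ k)"

definition mean_semigroup ::
  "('x \<Rightarrow> 'w measure) \<Rightarrow> (real \<Rightarrow> 'w \<Rightarrow> 'x measure) \<Rightarrow> real \<Rightarrow> ('x \<Rightarrow> real) \<Rightarrow> 'x \<Rightarrow> real" where
  "mean_semigroup P Z t f x = (\<integral>\<omega>. (\<integral>y. f y \<partial>Z t \<omega>) \<partial>P x)"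

text \<open>Extended nonnegative integrals, so that the bound includes the finiteness of the moments.\<close>

definition assumption1 ::
  "'x measure \<Rightarrow> ('x \<Rightarrow> 'w measure) \<Rightarrow> (real \<Rightarrow> 'w \<Rightarrow> 'x measure) \<Rightarrow> ('x \<Rightarrow> real) \<Rightarrow> nat \<Rightarrow> bool" where
  "assumption1 X P Z V \<kappa> \<longleftrightarrow>
     (\<exists>tstar>0. \<exists>a\<^sub>1>0. \<forall>x\<in>space X. \<forall>k\<in>{1..\<kappa>}.
        (SUP t\<in>{0..tstar}. \<integral>\<^sup>+\<omega>. (\<integral>\<^sup>+y. ennreal (V y) \<partial>Z t \<omega>) ^ k \<partial>P x) \<le> ennreal (a\<^sub>1 * V x ^ k))"

text \<open>The eigenmeasure relation is an equality of measures, with the mean kernel evaluated on sets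
  in the extended nonnegative reals.\<close>

definition assumption2 ::
  "'x measure \<Rightarrow> ('x \<Rightarrow> 'w measure) \<Rightarrow> (real \<Rightarrow> 'w \<Rightarrow> 'x measure) \<Rightarrow> ('x \<Rightarrow> real) \<Rightarrow> nat \<Rightarrow>
   'x measure \<Rightarrow> ('x \<Rightarrow> real) \<Rightarrow> real \<Rightarrow> real \<Rightarrow> bool" where
  "assumption2 X P Z V \<kappa> \<gamma> h lam \<rho> \<longleftrightarrow>
     sets \<gamma> = sets X \<and> (\<integral>\<^sup>+x. ennreal (max_weight V \<kappa> x) \<partial>\<gamma>) < \<infinity> \<and>
     (\<forall>x\<in>space X. 0 \<le> h x) \<and> h \<in> weighted_space X (min_weight V \<kappa>) \<and>
     lam > 0 \<and> \<rho> > 0 \<and>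
     (\<forall>t\<ge>0. \<forall>x\<in>space X. mean_semigroup P Z t h x = exp (lam * t) * h x) \<and>
     (\<forall>t\<ge>0. \<forall>B\<in>sets X. (\<integral>\<^sup>+x. (\<integral>\<^sup>+\<omega>. emeasure (Z t \<omega>) B \<partial>P x) \<partial>\<gamma>) =
        ennreal (exp (lam * t)) * emeasure \<gamma> B) \<and>
     (\<integral>x. h x \<partial>\<gamma>) = 1 \<and> weighted_norm X V h = 1 \<and>
     (\<exists>a\<^sub>2>0. \<forall>x\<in>space X. \<forall>k\<in>{1..\<kappa>}. \<forall>f\<in>weighted_space X (\<lambda>y. V y ^ k). \<forall>t>0.
        \<bar>exp (- lam * t) * mean_semigroup P Z t f x - (\<integral>y. f y \<partial>\<gamma>) * h x\<bar>
          \<le> a\<^sub>2 * exp (- \<rho> * t) * weighted_norm X (\<lambda>y. V y ^ k) f * V x ^ k)"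


section \<open>The limit martingale and the laws to be compared\<close>

definition martingale_limit ::
  "'x measure \<Rightarrow> 'w measure \<Rightarrow> ('x \<Rightarrow> 'w measure) \<Rightarrow> (real \<Rightarrow> 'w \<Rightarrow> 'x measure) \<Rightarrow>
   ('x \<Rightarrow> real) \<Rightarrow> real \<Rightarrow> ('w \<Rightarrow> real) \<Rightarrow> bool" where
  "martingale_limit X \<Omega> P Z h lam W \<longleftrightarrow>
     W \<in> borel_measurable \<Omega> \<and>
     (\<forall>x\<in>space X. AE \<omega> in P x. ((\<lambda>t. exp (- lam * t) * (\<integral>y. h y \<partial>Z t \<omega>)) \<longlongrightarrow> W \<omega>) at_top)"

definition fluctuation_law ::
  "('x \<Rightarrow> 'w measure) \<Rightarrow> (real \<Rightarrow> 'w \<Rightarrow> 'x measure) \<Rightarrow> ('x \<Rightarrow> real) \<Rightarrow> real \<Rightarrow> ('w \<Rightarrow> real) \<Rightarrow>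
   'x \<Rightarrow> real \<Rightarrow> real measure" where
  "fluctuation_law P Z h lam W x t =
     distr (P x) borel (\<lambda>\<omega>. exp (- lam * t / 2) * ((\<integral>y. h y \<partial>Z t \<omega>) - exp (lam * t) * W \<omega>))"

text \<open>The law of \<open>\<sigma> sqrt(W) G\<close> under \<open>P x\<close>, where \<open>G\<close> is standard Gaussian and independent of \<open>W\<close>;
  the independent \<open>G\<close> lives on the second factor of the product space.\<close>

definition gaussian_mixture_law :: "('x \<Rightarrow> 'w measure) \<Rightarrow> ('w \<Rightarrow> real) \<Rightarrow> real \<Rightarrow> 'x \<Rightarrow> real measure" where
  "gaussian_mixture_law P W \<sigma> x =
     distr (P x \<Otimes>\<^sub>M density lborel std_normal_density) borel (\<lambda>(\<omega>, z). \<sigma> * sqrt (W \<omega>) * z)"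

text \<open>Convergence in distribution as in the library's \<open>weak_conv_m\<close>, along a real parameter.\<close>

definition weak_conv_at_top :: "(real \<Rightarrow> real measure) \<Rightarrow> real measure \<Rightarrow> bool" where
  "weak_conv_at_top \<mu> \<nu> \<longleftrightarrow> (\<forall>y. isCont (cdf \<nu>) y \<longrightarrow> ((\<lambda>t. cdf (\<mu> t) y) \<longlongrightarrow> cdf \<nu> y) at_top)"

definition smooth_tests :: "(real \<Rightarrow> real) set" where
  "smooth_tests = {F. (\<forall>j<3. \<forall>y. ((deriv ^^ j) F) differentiable (at y)) \<and>
                      (\<forall>j\<le>3. \<forall>y. \<bar>(deriv ^^ j) F y\<bar> \<le> 1)}"

text \<open>The distance of two random variables, as a function of their laws.\<close>

definition smooth_dist :: "real measure \<Rightarrow> real measure \<Rightarrow> real" where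
  "smooth_dist \<mu> \<nu> = (SUP F\<in>smooth_tests. \<bar>(\<integral>y. F y \<partial>\<mu>) - (\<integral>y. F y \<partial>\<nu>)\<bar>)"

end

theory Submission
  imports Defs
begin

text \<open>Write \<open>W t = exp (- lam * t) * Z t (h)\<close>. By the branching property \<open>W\<close> is, up to the factor
  \<open>exp (- lam * t)\<close>, a sum over the individuals \<open>u\<close> alive at time \<open>t\<close> of terms which, given the
  population at that time, are independent with mean \<open>h (X u)\<close>. So the fluctuation
  \<open>exp (- lam * t / 2) * (Z t (h) - exp (lam * t) * W)\<close> is a sum of conditionally independent centred
  terms, its conditional variance is \<open>exp (- lam * t)\<close> times the sum of the variances \<open>v (X u)\<close>, and
  this variance converges to \<open>\<gamma> (v) * W\<close> by the ergodic assumption on the mean semigroup. Hence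
  the limit is a Gaussian mixture with \<open>\<sigma> ^ 2 = \<gamma> (v)\<close>. If \<open>\<gamma> (v) = 0\<close>, then \<open>W = h x\<close> almost surely
  under \<open>P x\<close> for \<open>\<gamma>\<close>-almost every \<open>x\<close>.

  Three points of the quantitative argument deserve mention. First, \<open>W\<close> is replaced by
  \<open>W (t + n * \<tau>)\<close>, so that only one-time marginals of the offspring processes occur; the bound is
  proved uniformly in \<open>n\<close>, and \<open>n\<close> tends to infinity at the end (\<open>horizon_error\<close>). The variance \<open>v\<close>
  is then replaced by the variance \<open>vr n\<close> of \<open>W (n * \<tau>)\<close>, which is nondecreasing in \<open>n\<close>. Second, the
  Lindeberg replacement exchanges one summand at a time with a Gaussian of the same conditional
  variance (\<open>lindeberg_step\<close>). It needs only that each summand has conditional mean zero and the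
  right conditional variance given all the other summands and the labelled population, which is
  the content of \<open>nn_integral_others\<close>; the error is of order
  \<open>exp (- 3 * lam * t / 2) * Z t (V ^ 3)\<close> and has expectation of order
  \<open>exp (- lam * t / 2) * V x ^ 3\<close> (\<open>lindeberg_error\<close>). Third, the convergence of the conditional
  variance is obtained by conditioning at an intermediate time \<open>r\<close>, with \<open>t = r + s\<close>: the deviation
  from the conditional mean costs \<open>exp (- lam * r / 2)\<close> and the deviation of the mean semigroup from
  its limit costs \<open>exp (- \<rho> * s)\<close> (\<open>variance_error\<close>). Balancing \<open>lam * r / 2 = \<rho> * s\<close> gives the rate
  \<open>lam * \<rho> / (2 * \<rho> + lam)\<close>.

  All moment bounds come from expanding powers of the sum \<open>Z (t + s) (f)\<close> over the individuals alive
  at time \<open>t\<close>. As \<open>f\<close> is nonnegative, everything takes place in the extended nonnegative reals, and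
  only inequalities are needed (\<open>zmom_2_add\<close>, \<open>zmom_3_add\<close>). Convergence in law follows from that of
  the characteristic functions, since multiples of cosines are admissible test functions.\<close>

section \<open>Gaussian smoothing of test functions\<close>

text \<open>The expectation of \<open>G (y + sqrt a * g)\<close> for a standard Gaussian \<open>g\<close>, that is, the heat semigroup
  at time \<open>a\<close>.\<close>

definition gauss_smooth :: "(real \<Rightarrow> real) \<Rightarrow> real \<Rightarrow> real \<Rightarrow> real" where
  "gauss_smooth G a y = (\<integral>g. G (y + sqrt a * g) \<partial>std_normal_distribution)"

interpretation gauss: real_distribution std_normal_distribution
  by (rule real_dist_normal_dist)

lemma smooth_tests_DERIV:
  assumes "F \<in> smooth_tests" "j < 3"
  shows "((deriv ^^ j) F has_real_derivative (deriv ^^ Suc j) F y) (at y)"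
  using assms by (auto simp: smooth_tests_def DERIV_deriv_iff_real_differentiable)

lemma smooth_tests_bound:
  assumes "F \<in> smooth_tests" "j \<le> 3"
  shows "\<bar>(deriv ^^ j) F y\<bar> \<le> 1"
  using assms by (auto simp: smooth_tests_def)

lemma smooth_tests_measurable:
  assumes "F \<in> smooth_tests" "j < 3"
  shows "(deriv ^^ j) F \<in> borel_measurable borel"
  by (intro borel_measurable_continuous_onI continuous_at_imp_continuous_on ballI)
     (meson DERIV_isCont assms smooth_tests_DERIV)

lemma smooth_tests_taylor:
  assumes F: "F \<in> smooth_tests" and n: "n \<le> 3"
  shows "\<bar>F (y + z) - (\<Sum>m<n. (deriv ^^ m) F y / fact m * z ^ m)\<bar> \<le> \<bar>z\<bar> ^ n / fact n"
proof -
  have "\<exists>t. \<bar>t\<bar> \<le> \<bar>z\<bar> \<and> F (y + z) =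
      (\<Sum>m<n. (deriv ^^ m) F (y + 0) / fact m * z ^ m) + (deriv ^^ n) F (y + t) / fact n * z ^ n"
  proof (rule Maclaurin_bi_le[where diff = "\<lambda>m z. (deriv ^^ m) F (y + z)"])
    show "\<forall>m t. m < n \<and> \<bar>t\<bar> \<le> \<bar>z\<bar> \<longrightarrow>
      ((\<lambda>z. (deriv ^^ m) F (y + z)) has_real_derivative (deriv ^^ Suc m) F (y + t)) (at t)"
    proof (intro allI impI)
      fix m t assume "m < n \<and> \<bar>t\<bar> \<le> \<bar>z\<bar>"
      then have "((deriv ^^ m) F has_real_derivative (deriv ^^ Suc m) F (t + y)) (at (t + y))"
        using n by (intro smooth_tests_DERIV[OF F]) auto
      then show "((\<lambda>z. (deriv ^^ m) F (y + z)) has_real_derivative (deriv ^^ Suc m) F (y + t)) (at t)"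
        by (simp only: DERIV_shift add.commute[of y])
    qed
  qed auto
  then obtain t where t: "F (y + z) =
      (\<Sum>m<n. (deriv ^^ m) F y / fact m * z ^ m) + (deriv ^^ n) F (y + t) / fact n * z ^ n"
    by auto
  have "\<bar>F (y + z) - (\<Sum>m<n. (deriv ^^ m) F y / fact m * z ^ m)\<bar>
      = \<bar>(deriv ^^ n) F (y + t)\<bar> * (\<bar>z\<bar> ^ n / fact n)"
    unfolding t by (simp add: abs_mult power_abs)
  also have "\<dots> \<le> 1 * (\<bar>z\<bar> ^ n / fact n)"
    by (intro mult_right_mono smooth_tests_bound F n) auto
  finally show ?thesis by simp
qed

lemma smooth_tests_taylor1:
  assumes F: "F \<in> smooth_tests"
  shows "\<bar>F y - F z\<bar> \<le> \<bar>y - z\<bar>"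
  using smooth_tests_taylor[OF F, of 1 z "y - z"] by simp

lemma smooth_tests_taylor2:
  assumes F: "F \<in> smooth_tests"
  shows "\<bar>F (y + z) - F y - deriv F y * z\<bar> \<le> z\<^sup>2 / 2"
  using smooth_tests_taylor[OF F, of 2 y z] by (simp add: numeral_2_eq_2 algebra_simps)

lemma smooth_tests_taylor3:
  assumes F: "F \<in> smooth_tests"
  shows "\<bar>F (y + z) - F y - deriv F y * z - deriv (deriv F) y * z\<^sup>2 / 2\<bar> \<le> \<bar>z\<bar> ^ 3 / 6"
  using smooth_tests_taylor[OF F, of 3 y z]
  by (simp add: numeral_3_eq_3 numeral_2_eq_2 algebra_simps)

lemma smooth_tests_integrable:
  assumes F: "F \<in> smooth_tests" "j < 3" and M: "finite_measure M" and g: "g \<in> borel_measurable M"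
  shows "integrable M (\<lambda>x. (deriv ^^ j) F (g x))"
proof -
  interpret finite_measure M by fact
  note [measurable] = g smooth_tests_measurable[OF F]
  show ?thesis
    by (rule integrable_const_bound[where B = 1]) (use smooth_tests_bound[OF F(1), of j] F(2) in auto)
qed

lemma smooth_tests_gauss_integrable:
  assumes F: "F \<in> smooth_tests"
  shows "integrable std_normal_distribution (\<lambda>g. F (y + c * g))"
    and "integrable std_normal_distribution (\<lambda>g. deriv F (y + c * g))"
    and "integrable std_normal_distribution (\<lambda>g. deriv (deriv F) (y + c * g))"
proof -
  have *: "integrable std_normal_distribution (\<lambda>g. (deriv ^^ j) F (y + c * g))" if "j < 3" for j
    by (intro smooth_tests_integrable F that gauss.finite_measure_axioms) measurable
  show "integrable std_normal_distribution (\<lambda>g. F (y + c * g))" using *[of 0] by simp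
  show "integrable std_normal_distribution (\<lambda>g. deriv F (y + c * g))" using *[of 1] by simp
  show "integrable std_normal_distribution (\<lambda>g. deriv (deriv F) (y + c * g))"
    using *[of 2] by (simp add: numeral_2_eq_2)
qed

lemma gauss_smooth_bound:
  assumes F: "F \<in> smooth_tests" "j < 3"
  shows "\<bar>gauss_smooth ((deriv ^^ j) F) a y\<bar> \<le> 1"
proof -
  have "\<bar>gauss_smooth ((deriv ^^ j) F) a y\<bar>
      \<le> (\<integral>g. \<bar>(deriv ^^ j) F (y + sqrt a * g)\<bar> \<partial>std_normal_distribution)"
    unfolding gauss_smooth_def by (rule integral_abs_bound)
  also have "\<dots> \<le> (\<integral>g. 1 \<partial>std_normal_distribution)"
  proof (rule integral_mono)
    show "integrable std_normal_distribution (\<lambda>g. \<bar>(deriv ^^ j) F (y + sqrt a * g)\<bar>)"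
      by (intro integrable_abs smooth_tests_integrable F gauss.finite_measure_axioms) measurable
  qed (use smooth_tests_bound[OF F(1), of j] F(2) in auto)
  finally show ?thesis using gauss.prob_space by simp
qed

lemma gauss_smooth_measurable [measurable]:
  assumes [measurable]: "G \<in> borel_measurable borel" "a \<in> borel_measurable M" "y \<in> borel_measurable M"
  shows "(\<lambda>x. gauss_smooth G (a x) (y x)) \<in> borel_measurable M"
  unfolding gauss_smooth_def
  by (rule gauss.borel_measurable_lebesgue_integral) measurable

lemma gauss_smooth_0: "gauss_smooth G 0 y = G y"
  using gauss.prob_space by (simp add: gauss_smooth_def)

text \<open>The convolution of two centred Gaussian laws, with variances that may vanish.\<close>

lemma gauss_distr_sum:
  assumes "0 \<le> a" "0 \<le> b"
  shows "distr (std_normal_distribution \<Otimes>\<^sub>M std_normal_distribution) borel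
           (\<lambda>(g, g'). sqrt a * g + sqrt b * g')
       = distr std_normal_distribution borel (\<lambda>g. sqrt (a + b) * g)" (is "?L = ?R")
proof (rule Levy_uniqueness)
  interpret P: pair_prob_space std_normal_distribution std_normal_distribution ..
  have m: "(\<lambda>(g, g'). sqrt a * g + sqrt b * g')
      \<in> borel_measurable (std_normal_distribution \<Otimes>\<^sub>M std_normal_distribution)"
    by measurable
  show "real_distribution ?L"
    by (rule P.real_distribution_distr) (rule m)
  show "real_distribution ?R"
    by (rule gauss.real_distribution_distr) simp
  have ch: "(\<integral>g. iexp (t * (sqrt c * g)) \<partial>std_normal_distribution) = exp (- (c * t\<^sup>2) / 2)"
    if "0 \<le> c" for c t
  proof -
    have "(\<integral>g. iexp (t * (sqrt c * g)) \<partial>std_normal_distribution)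
        = char std_normal_distribution (t * sqrt c)"
      unfolding char_def by (simp add: mult_ac)
    also have "\<dots> = exp (- (c * t\<^sup>2) / 2)"
      using that by (simp add: char_std_normal_distribution power_mult_distrib mult_ac)
    finally show ?thesis .
  qed
  show "char ?L = char ?R"
  proof
    fix t
    have "char ?L t = (\<integral>p. iexp (t * (case p of (g, g') \<Rightarrow> sqrt a * g + sqrt b * g'))
        \<partial>(std_normal_distribution \<Otimes>\<^sub>M std_normal_distribution))"
      unfolding char_def by (subst integral_distr) (auto simp: m)
    also have "\<dots> = (\<integral>p. (case p of (g, g') \<Rightarrow> iexp (t * (sqrt a * g)) * iexp (t * (sqrt b * g')))
        \<partial>(std_normal_distribution \<Otimes>\<^sub>M std_normal_distribution))"
      by (intro Bochner_Integration.integral_cong refl)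
         (auto simp: exp_add[symmetric] algebra_simps)
    also have "\<dots> = (\<integral>g. (\<integral>g'. iexp (t * (sqrt a * g)) * iexp (t * (sqrt b * g'))
        \<partial>std_normal_distribution) \<partial>std_normal_distribution)"
    proof (rule P.integral_fst[symmetric])
      show "integrable (std_normal_distribution \<Otimes>\<^sub>M std_normal_distribution)
         (\<lambda>p. case p of (g, g') \<Rightarrow> iexp (t * (sqrt a * g)) * iexp (t * (sqrt b * g')))"
        by (rule P.integrable_const_bound[where B = 1]) (auto simp: norm_mult)
    qed
    also have "\<dots> = exp (- (a * t\<^sup>2) / 2) * exp (- (b * t\<^sup>2) / 2)"
      using ch[OF assms(1), of t] ch[OF assms(2), of t] by simp
    also have "\<dots> = exp (- ((a + b) * t\<^sup>2) / 2)"
      by (simp add: exp_add[symmetric] field_simps flip: of_real_mult)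
    also have "\<dots> = (\<integral>g. iexp (t * (sqrt (a + b) * g)) \<partial>std_normal_distribution)"
      using ch[of "a + b" t] assms by simp
    also have "\<dots> = char ?R t"
      unfolding char_def by (subst integral_distr) auto
    finally show "char ?L t = char ?R t" .
  qed
qed

lemma gauss_smooth_add:
  assumes [measurable]: "G \<in> borel_measurable borel" and B: "\<And>y. \<bar>G y\<bar> \<le> B" and "0 \<le> a" "0 \<le> b"
  shows "gauss_smooth G (a + b) y
       = (\<integral>g. \<integral>g'. G (y + sqrt a * g + sqrt b * g') \<partial>std_normal_distribution \<partial>std_normal_distribution)"
proof -
  interpret P: pair_prob_space std_normal_distribution std_normal_distribution ..
  have "gauss_smooth G (a + b) y
      = (\<integral>s. G (y + s) \<partial>distr std_normal_distribution borel (\<lambda>g. sqrt (a + b) * g))"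
    unfolding gauss_smooth_def by (subst integral_distr) auto
  also have "\<dots> = (\<integral>p. G (y + (case p of (g, g') \<Rightarrow> sqrt a * g + sqrt b * g'))
        \<partial>(std_normal_distribution \<Otimes>\<^sub>M std_normal_distribution))"
    unfolding gauss_distr_sum[OF assms(3,4), symmetric] by (subst integral_distr) auto
  also have "\<dots> = (\<integral>p. (case p of (g, g') \<Rightarrow> G (y + sqrt a * g + sqrt b * g'))
        \<partial>(std_normal_distribution \<Otimes>\<^sub>M std_normal_distribution))"
    by (intro Bochner_Integration.integral_cong refl) (auto simp: add.assoc)
  also have "\<dots> = (\<integral>g. \<integral>g'. G (y + sqrt a * g + sqrt b * g') \<partial>std_normal_distribution \<partial>std_normal_distribution)"
  proof (rule P.integral_fst[symmetric])
    show "integrable (std_normal_distribution \<Otimes>\<^sub>M std_normal_distribution)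
         (\<lambda>p. case p of (g, g') \<Rightarrow> G (y + sqrt a * g + sqrt b * g'))"
      by (rule P.integrable_const_bound[where B = B]) (auto simp: B)
  qed
  finally show ?thesis .
qed

lemma gauss_moments:
  shows "(\<integral>g. g \<partial>std_normal_distribution) = 0" "(\<integral>g. g\<^sup>2 \<partial>std_normal_distribution) = 1"
    and "integrable std_normal_distribution (\<lambda>g. g)" "integrable std_normal_distribution (\<lambda>g. g\<^sup>2)"
    and "integrable std_normal_distribution (\<lambda>g. \<bar>g\<bar> ^ 3)"
proof -
  show "(\<integral>g. g \<partial>std_normal_distribution) = 0"
    using integral_std_normal_distribution_moment_odd[of 1] by simp
  have "(\<integral>g. g ^ (2 * 1) \<partial>std_normal_distribution) = fact (2 * 1) / (2 ^ 1 * fact 1)"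
    by (rule std_normal_distribution_even_moments)
  then show "(\<integral>g. g\<^sup>2 \<partial>std_normal_distribution) = 1"
    by (simp add: fact_numeral del: One_nat_def)
  show "integrable std_normal_distribution (\<lambda>g. g)"
    using integrable_std_normal_distribution_moment[of 1] by (simp only: power_one_right)
  show "integrable std_normal_distribution (\<lambda>g. g\<^sup>2)"
    by (rule integrable_std_normal_distribution_moment)
  show "integrable std_normal_distribution (\<lambda>g. \<bar>g\<bar> ^ 3)"
    using integrable_abs[OF integrable_std_normal_distribution_moment[of 3]] by (simp only: power_abs)
qed

text \<open>The third absolute moment of the standard Gaussian law; its value plays no role.\<close>

definition gauss_abs_moment3 :: real where
  "gauss_abs_moment3 = (\<integral>g. \<bar>g\<bar> ^ 3 \<partial>std_normal_distribution)"

lemma gauss_abs_moment3_nonneg: "0 \<le> gauss_abs_moment3"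
  unfolding gauss_abs_moment3_def by (rule Bochner_Integration.integral_nonneg) auto

text \<open>Adding an independent centred Gaussian of variance \<open>b\<close>: the term of first order integrates to \<open>0\<close>.\<close>

lemma gauss_taylor3:
  assumes F: "F \<in> smooth_tests" and b: "0 \<le> b"
  shows "\<bar>gauss_smooth F b y - F y - b * deriv (deriv F) y / 2\<bar> \<le> gauss_abs_moment3 / 6 * (b * sqrt b)"
proof -
  have e: "gauss_smooth F b y - F y - b * deriv (deriv F) y / 2
      = (\<integral>g. F (y + sqrt b * g) - F y - deriv F y * (sqrt b * g)
          - deriv (deriv F) y * (sqrt b * g)\<^sup>2 / 2 \<partial>std_normal_distribution)"
    using gauss_moments smooth_tests_gauss_integrable[OF F, of y "sqrt b"] b gauss.prob_space
    by (simp add: gauss_smooth_def power_mult_distrib)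
  have "\<bar>gauss_smooth F b y - F y - b * deriv (deriv F) y / 2\<bar>
      \<le> (\<integral>g. \<bar>F (y + sqrt b * g) - F y - deriv F y * (sqrt b * g)
          - deriv (deriv F) y * (sqrt b * g)\<^sup>2 / 2\<bar> \<partial>std_normal_distribution)"
    unfolding e by (rule integral_abs_bound)
  also have "\<dots> \<le> (\<integral>g. (sqrt b) ^ 3 / 6 * \<bar>g\<bar> ^ 3 \<partial>std_normal_distribution)"
  proof (rule integral_mono)
    show "integrable std_normal_distribution (\<lambda>g. \<bar>F (y + sqrt b * g) - F y - deriv F y * (sqrt b * g)
          - deriv (deriv F) y * (sqrt b * g)\<^sup>2 / 2\<bar>)"
      using gauss_moments smooth_tests_gauss_integrable[OF F, of y "sqrt b"] by (simp add: power_mult_distrib)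
    show "integrable std_normal_distribution (\<lambda>g. (sqrt b) ^ 3 / 6 * \<bar>g\<bar> ^ 3)"
      using gauss_moments by simp
    show "\<bar>F (y + sqrt b * g) - F y - deriv F y * (sqrt b * g)
          - deriv (deriv F) y * (sqrt b * g)\<^sup>2 / 2\<bar> \<le> (sqrt b) ^ 3 / 6 * \<bar>g\<bar> ^ 3" for g
      using smooth_tests_taylor3[OF F, of y "sqrt b * g"] b
      by (simp add: abs_mult power_mult_distrib)
  qed
  also have "\<dots> = gauss_abs_moment3 / 6 * (b * sqrt b)"
    using b by (simp add: gauss_abs_moment3_def power3_eq_cube)
  finally show ?thesis .
qed

lemma gauss_smooth_taylor2:
  assumes F: "F \<in> smooth_tests" and b: "0 \<le> b"
  shows "\<bar>gauss_smooth F b y - F y\<bar> \<le> b / 2"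
proof -
  have e: "gauss_smooth F b y - F y
      = (\<integral>g. F (y + sqrt b * g) - F y - deriv F y * (sqrt b * g) \<partial>std_normal_distribution)"
    using gauss_moments smooth_tests_gauss_integrable[OF F, of y "sqrt b"] b gauss.prob_space
    by (simp add: gauss_smooth_def)
  have "\<bar>gauss_smooth F b y - F y\<bar>
      \<le> (\<integral>g. \<bar>F (y + sqrt b * g) - F y - deriv F y * (sqrt b * g)\<bar> \<partial>std_normal_distribution)"
    unfolding e by (rule integral_abs_bound)
  also have "\<dots> \<le> (\<integral>g. b / 2 * g\<^sup>2 \<partial>std_normal_distribution)"
  proof (rule integral_mono)
    show "integrable std_normal_distribution (\<lambda>g. \<bar>F (y + sqrt b * g) - F y - deriv F y * (sqrt b * g)\<bar>)"
      using gauss_moments smooth_tests_gauss_integrable[OF F, of y "sqrt b"] by simp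
    show "\<bar>F (y + sqrt b * g) - F y - deriv F y * (sqrt b * g)\<bar> \<le> b / 2 * g\<^sup>2" for g
      using smooth_tests_taylor2[OF F, of y "sqrt b * g"] b
      by (simp add: power_mult_distrib)
  qed (use gauss_moments in simp)
  also have "\<dots> = b / 2" using gauss_moments by simp
  finally show ?thesis .
qed

lemma gauss_smooth_add_expand:
  assumes F: "F \<in> smooth_tests" and "0 \<le> a" "0 \<le> b"
  shows "gauss_smooth F (a + b) y = (\<integral>g. gauss_smooth F b (y + sqrt a * g) \<partial>std_normal_distribution)"
  using smooth_tests_measurable[OF F, of 0] smooth_tests_bound[OF F, of 0]
  by (subst gauss_smooth_add[where B = 1]) (use assms in \<open>auto simp: gauss_smooth_def\<close>)

lemma gauss_smooth_integrable:
  assumes F: "F \<in> smooth_tests" "j < 3" and M: "finite_measure M"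
    and [measurable]: "a \<in> borel_measurable M" "y \<in> borel_measurable M"
  shows "integrable M (\<lambda>x. gauss_smooth ((deriv ^^ j) F) (a x) (y x))"
proof -
  interpret finite_measure M by fact
  show ?thesis
    using gauss_smooth_bound[OF F] smooth_tests_measurable[OF F]
    by (intro integrable_const_bound[where B = 1]) auto
qed

lemma gauss_smooth_add_taylor3:
  assumes F: "F \<in> smooth_tests" and a: "0 \<le> a" and b: "0 \<le> b"
  shows "\<bar>gauss_smooth F (a + b) y - gauss_smooth F a y - b * gauss_smooth (deriv (deriv F)) a y / 2\<bar>
       \<le> gauss_abs_moment3 / 6 * (b * sqrt b)"
proof -
  let ?N = std_normal_distribution
  have i: "integrable ?N (\<lambda>g. gauss_smooth F b (y + sqrt a * g))" using gauss_smooth_integrable[OF F, of 0 std_normal_distribution "\<lambda>_. b" "\<lambda>g. y + sqrt a * g"] gauss.finite_measure_axioms by simp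
  have j: "integrable ?N (\<lambda>g. F (y + sqrt a * g))" by (rule smooth_tests_gauss_integrable[OF F])
  have k: "integrable ?N (\<lambda>g. deriv (deriv F) (y + sqrt a * g))" by (rule smooth_tests_gauss_integrable[OF F])
  have e: "gauss_smooth F (a + b) y - gauss_smooth F a y - b * gauss_smooth (deriv (deriv F)) a y / 2
     = (\<integral>g. gauss_smooth F b (y + sqrt a * g) - F (y + sqrt a * g)
          - b * deriv (deriv F) (y + sqrt a * g) / 2 \<partial>?N)"
    using i j k by (simp add: gauss_smooth_add_expand[OF F a b] gauss_smooth_def[of _ a])
  have "\<bar>gauss_smooth F (a + b) y - gauss_smooth F a y - b * gauss_smooth (deriv (deriv F)) a y / 2\<bar>
    \<le> (\<integral>g. \<bar>gauss_smooth F b (y + sqrt a * g) - F (y + sqrt a * g)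
          - b * deriv (deriv F) (y + sqrt a * g) / 2\<bar> \<partial>?N)"
    unfolding e by (rule integral_abs_bound)
  also have "\<dots> \<le> (\<integral>g. gauss_abs_moment3 / 6 * (b * sqrt b) \<partial>?N)"
    using i j k by (intro integral_mono gauss_taylor3[OF F b]) auto
  finally show ?thesis using gauss.prob_space by simp
qed

lemma gauss_smooth_lipschitz:
  assumes F: "F \<in> smooth_tests" and a: "0 \<le> a" and b: "0 \<le> b"
  shows "\<bar>gauss_smooth F a y - gauss_smooth F b y\<bar> \<le> \<bar>a - b\<bar> / 2"
proof -
  have *: "\<bar>gauss_smooth F (a + b) y - gauss_smooth F a y\<bar> \<le> b / 2" if a: "0 \<le> a" and b: "0 \<le> b" for a b
  proof -
    let ?N = std_normal_distribution
    have i: "integrable ?N (\<lambda>g. gauss_smooth F b (y + sqrt a * g))" using gauss_smooth_integrable[OF F, of 0 std_normal_distribution "\<lambda>_. b" "\<lambda>g. y + sqrt a * g"] gauss.finite_measure_axioms by simp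
    have j: "integrable ?N (\<lambda>g. F (y + sqrt a * g))" by (rule smooth_tests_gauss_integrable[OF F])
    have e: "gauss_smooth F (a + b) y - gauss_smooth F a y
       = (\<integral>g. gauss_smooth F b (y + sqrt a * g) - F (y + sqrt a * g) \<partial>?N)"
      using i j by (simp add: gauss_smooth_add_expand[OF F a b] gauss_smooth_def[of _ a])
    have "\<bar>gauss_smooth F (a + b) y - gauss_smooth F a y\<bar>
      \<le> (\<integral>g. \<bar>gauss_smooth F b (y + sqrt a * g) - F (y + sqrt a * g)\<bar> \<partial>?N)"
      unfolding e by (rule integral_abs_bound)
    also have "\<dots> \<le> (\<integral>g. b / 2 \<partial>?N)"
      using i j by (intro integral_mono gauss_smooth_taylor2[OF F b]) auto
    finally show ?thesis using gauss.prob_space by simp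
  qed
  show ?thesis
  proof (cases "a \<le> b")
    case True
    then have "\<bar>gauss_smooth F (a + (b - a)) y - gauss_smooth F a y\<bar> \<le> (b - a) / 2"
      by (intro * a) simp
    moreover have "a + (b - a) = b" by simp
    moreover have "\<bar>a - b\<bar> = b - a" using True by simp
    ultimately show ?thesis by (simp only: abs_minus_commute[of "gauss_smooth F a y"])
  next
    case False
    then have "\<bar>gauss_smooth F (b + (a - b)) y - gauss_smooth F b y\<bar> \<le> (a - b) / 2"
      by (intro * b) simp
    moreover have "b + (a - b) = a" by simp
    moreover have "\<bar>a - b\<bar> = a - b" using False by simp
    ultimately show ?thesis by (simp only:)
  qed
qed

text \<open>Smoothing commutes with differentiation, so the Taylor expansion of the smoothed function has the
  smoothed derivatives as coefficients.\<close>

lemma gauss_smooth_increment_taylor3: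
  assumes F: "F \<in> smooth_tests"
  shows "\<bar>gauss_smooth F a (y + z) - gauss_smooth F a y - gauss_smooth (deriv F) a y * z
           - gauss_smooth (deriv (deriv F)) a y * z\<^sup>2 / 2\<bar> \<le> \<bar>z\<bar> ^ 3 / 6"
proof -
  let ?N = std_normal_distribution
  have h: "integrable ?N (\<lambda>g. F (y + z + sqrt a * g))" by (rule smooth_tests_gauss_integrable[OF F])
  have i: "integrable ?N (\<lambda>g. F (y + sqrt a * g))" by (rule smooth_tests_gauss_integrable[OF F])
  have j: "integrable ?N (\<lambda>g. deriv F (y + sqrt a * g))" by (rule smooth_tests_gauss_integrable[OF F])
  have k: "integrable ?N (\<lambda>g. deriv (deriv F) (y + sqrt a * g))" by (rule smooth_tests_gauss_integrable[OF F])
  have e: "gauss_smooth F a (y + z) - gauss_smooth F a y - gauss_smooth (deriv F) a y * z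
           - gauss_smooth (deriv (deriv F)) a y * z\<^sup>2 / 2
     = (\<integral>g. F (y + z + sqrt a * g) - F (y + sqrt a * g) - deriv F (y + sqrt a * g) * z
          - deriv (deriv F) (y + sqrt a * g) * z\<^sup>2 / 2 \<partial>?N)"
    using h i j k by (simp add: gauss_smooth_def)
  have "\<bar>gauss_smooth F a (y + z) - gauss_smooth F a y - gauss_smooth (deriv F) a y * z
           - gauss_smooth (deriv (deriv F)) a y * z\<^sup>2 / 2\<bar>
    \<le> (\<integral>g. \<bar>F (y + z + sqrt a * g) - F (y + sqrt a * g) - deriv F (y + sqrt a * g) * z
          - deriv (deriv F) (y + sqrt a * g) * z\<^sup>2 / 2\<bar> \<partial>?N)"
    unfolding e by (rule integral_abs_bound)
  also have "\<dots> \<le> (\<integral>g. \<bar>z\<bar> ^ 3 / 6 \<partial>?N)"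
  proof (rule integral_mono)
    show "\<bar>F (y + z + sqrt a * g) - F (y + sqrt a * g) - deriv F (y + sqrt a * g) * z
          - deriv (deriv F) (y + sqrt a * g) * z\<^sup>2 / 2\<bar> \<le> \<bar>z\<bar> ^ 3 / 6" for g
      using smooth_tests_taylor3[OF F, of "y + sqrt a * g" z] by (simp add: algebra_simps)
  qed (use h i j k in auto)
  finally show ?thesis using gauss.prob_space by simp
qed

section \<open>Lindeberg replacement for conditionally centred sequences\<close>

lemma le_one_plus_cube:
  fixes z :: real
  assumes "0 \<le> z"
  shows "z \<le> 1 + z ^ 3" "z\<^sup>2 \<le> 1 + z ^ 3"
proof -
  show "z \<le> 1 + z ^ 3"
  proof (cases "z \<le> 1")
    case True
    then show ?thesis using assms by (smt (verit) zero_le_power)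
  next
    case False
    then show ?thesis using power_increasing[of 1 3 z] by simp
  qed
  show "z\<^sup>2 \<le> 1 + z ^ 3"
  proof (cases "z \<le> 1")
    case True
    then show ?thesis using assms power_le_one[of z 2] by (smt (verit) zero_le_power)
  next
    case False
    then have "z\<^sup>2 \<le> z ^ 3" by (intro power_increasing) auto
    then show ?thesis by simp
  qed
qed

lemma abs_mult_le_of_le_one:
  fixes a x :: real
  assumes "\<bar>a\<bar> \<le> 1"
  shows "\<bar>a * x\<bar> \<le> \<bar>x\<bar>"
  using mult_right_mono[OF assms, of "\<bar>x\<bar>"] by (simp add: abs_mult)

lemma (in prob_space) integrable_powers_of_cube:
  fixes f :: "'a \<Rightarrow> real"
  assumes [measurable]: "f \<in> borel_measurable M" and "integrable M (\<lambda>\<omega>. \<bar>f \<omega>\<bar> ^ 3)"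
  shows "integrable M f" "integrable M (\<lambda>\<omega>. (f \<omega>)\<^sup>2)"
proof -
  have i: "integrable M (\<lambda>\<omega>. 1 + \<bar>f \<omega>\<bar> ^ 3)" using assms by simp
  show "integrable M f"
    by (rule Bochner_Integration.integrable_bound[OF i]) (use le_one_plus_cube in auto)
  show "integrable M (\<lambda>\<omega>. (f \<omega>)\<^sup>2)"
    by (rule Bochner_Integration.integrable_bound[OF i])
       (use le_one_plus_cube(2)[of "\<bar>f _\<bar>"] in auto)
qed

text \<open>One Lindeberg exchange: \<open>\<xi>\<close> is centred with variance \<open>v\<close> given \<open>G\<close>, and it is replaced by a Gaussian
  of variance \<open>v\<close> that is already integrated out in \<open>gauss_smooth\<close>. The conditional moments enter as
  orthogonality to bounded functions measurable with respect to \<open>G\<close>.\<close>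

lemma (in prob_space) lindeberg_step:
  assumes F: "F \<in> smooth_tests" and sub: "subalgebra M G"
    and [measurable]: "S \<in> borel_measurable G" "a \<in> borel_measurable G" "v \<in> borel_measurable G"
    and [measurable]: "\<xi> \<in> borel_measurable M"
    and a: "\<And>\<omega>. 0 \<le> a \<omega>" and v: "\<And>\<omega>. 0 \<le> v \<omega>"
    and cent: "\<And>\<Psi>. \<Psi> \<in> borel_measurable G \<Longrightarrow> (\<And>\<omega>. \<bar>\<Psi> \<omega>\<bar> \<le> (1::real)) \<Longrightarrow> (\<integral>\<omega>. \<Psi> \<omega> * \<xi> \<omega> \<partial>M) = 0"
    and var: "\<And>\<Psi>. \<Psi> \<in> borel_measurable G \<Longrightarrow> (\<And>\<omega>. \<bar>\<Psi> \<omega>\<bar> \<le> (1::real)) \<Longrightarrow>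
                (\<integral>\<omega>. \<Psi> \<omega> * ((\<xi> \<omega>)\<^sup>2 - v \<omega>) \<partial>M) = 0"
    and int3: "integrable M (\<lambda>\<omega>. \<bar>\<xi> \<omega>\<bar> ^ 3)" and intv: "integrable M (\<lambda>\<omega>. v \<omega> * sqrt (v \<omega>))"
  shows "\<bar>expectation (\<lambda>\<omega>. gauss_smooth F (a \<omega>) (S \<omega> + \<xi> \<omega>))
          - expectation (\<lambda>\<omega>. gauss_smooth F (a \<omega> + v \<omega>) (S \<omega>))\<bar>
       \<le> expectation (\<lambda>\<omega>. \<bar>\<xi> \<omega>\<bar> ^ 3) / 6
          + gauss_abs_moment3 / 6 * expectation (\<lambda>\<omega>. v \<omega> * sqrt (v \<omega>))"
proof -
  have [measurable]: "S \<in> borel_measurable M" "a \<in> borel_measurable M" "v \<in> borel_measurable M"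
    by (auto intro: measurable_from_subalg[OF sub])
  have d: "(deriv ^^ 0) F = F" "(deriv ^^ 1) F = deriv F" "(deriv ^^ 2) F = deriv (deriv F)"
    by (simp_all add: numeral_2_eq_2)
  note [measurable] = smooth_tests_measurable[OF F, of 0, unfolded d, simplified]
     smooth_tests_measurable[OF F, of 1, unfolded d, simplified]
     smooth_tests_measurable[OF F, of 2, unfolded d, simplified]
  define D1 where "D1 \<omega> = gauss_smooth (deriv F) (a \<omega>) (S \<omega>)" for \<omega>
  define D2 where "D2 \<omega> = gauss_smooth (deriv (deriv F)) (a \<omega>) (S \<omega>)" for \<omega>
  have D1_G: "D1 \<in> borel_measurable G" and D2_G: "D2 \<in> borel_measurable G"
    unfolding D1_def[abs_def] D2_def[abs_def] by measurable
  have [measurable]: "D1 \<in> borel_measurable M" "D2 \<in> borel_measurable M"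
    using D1_G D2_G by (auto intro: measurable_from_subalg[OF sub])
  have b1: "\<bar>D1 \<omega>\<bar> \<le> 1" and b2: "\<bar>D2 \<omega>\<bar> \<le> 1" for \<omega>
    using gauss_smooth_bound[OF F, of 1, unfolded d] gauss_smooth_bound[OF F, of 2, unfolded d]
    by (auto simp: D1_def D2_def)
  note int12 = integrable_powers_of_cube[OF _ int3]
  have vi: "integrable M v"
  proof (rule Bochner_Integration.integrable_bound)
    show "integrable M (\<lambda>\<omega>. 1 + v \<omega> * sqrt (v \<omega>))" using intv by simp
    have "v \<omega> \<le> 1 + v \<omega> * sqrt (v \<omega>)" for \<omega>
      using le_one_plus_cube(2)[of "sqrt (v \<omega>)"] v[of \<omega>]
      by (simp add: power3_eq_cube)
    then show "AE \<omega> in M. norm (v \<omega>) \<le> norm (1 + v \<omega> * sqrt (v \<omega>))" using v by auto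
  qed measurable
  have i1: "integrable M (\<lambda>\<omega>. D1 \<omega> * \<xi> \<omega>)"
  proof (rule Bochner_Integration.integrable_bound[OF int12(1)])
    show "AE \<omega> in M. norm (D1 \<omega> * \<xi> \<omega>) \<le> norm (\<xi> \<omega>)"
      unfolding real_norm_def by (intro AE_I2 abs_mult_le_of_le_one b1)
  qed measurable
  have i2: "integrable M (\<lambda>\<omega>. D2 \<omega> * (\<xi> \<omega>)\<^sup>2)"
  proof (rule Bochner_Integration.integrable_bound[OF int12(2)])
    show "AE \<omega> in M. norm (D2 \<omega> * (\<xi> \<omega>)\<^sup>2) \<le> norm ((\<xi> \<omega>)\<^sup>2)"
      unfolding real_norm_def by (intro AE_I2 abs_mult_le_of_le_one b2)
  qed measurable
  have i3: "integrable M (\<lambda>\<omega>. D2 \<omega> * v \<omega>)"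
  proof (rule Bochner_Integration.integrable_bound[OF vi])
    show "AE \<omega> in M. norm (D2 \<omega> * v \<omega>) \<le> norm (v \<omega>)"
      unfolding real_norm_def by (intro AE_I2 abs_mult_le_of_le_one b2)
  qed measurable
  have j1: "integrable M (\<lambda>\<omega>. gauss_smooth F (a \<omega>) (S \<omega> + \<xi> \<omega>))"
    and j2: "integrable M (\<lambda>\<omega>. gauss_smooth F (a \<omega> + v \<omega>) (S \<omega>))"
    and j3: "integrable M (\<lambda>\<omega>. gauss_smooth F (a \<omega>) (S \<omega>))"
    by (rule gauss_smooth_integrable[OF F, of 0, unfolded d];
        (rule finite_measure_axioms | measurable | simp))+
  have c1: "(\<integral>\<omega>. D1 \<omega> * \<xi> \<omega> \<partial>M) = 0" by (rule cent[OF D1_G b1])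
  have c2: "(\<integral>\<omega>. D2 \<omega> * (\<xi> \<omega>)\<^sup>2 \<partial>M) = (\<integral>\<omega>. D2 \<omega> * v \<omega> \<partial>M)"
    using var[OF D2_G b2] i2 i3 by (simp add: right_diff_distrib)
  have e: "expectation (\<lambda>\<omega>. gauss_smooth F (a \<omega>) (S \<omega> + \<xi> \<omega>))
          - expectation (\<lambda>\<omega>. gauss_smooth F (a \<omega> + v \<omega>) (S \<omega>))
      = expectation (\<lambda>\<omega>. (gauss_smooth F (a \<omega>) (S \<omega> + \<xi> \<omega>) - gauss_smooth F (a \<omega>) (S \<omega>)
            - D1 \<omega> * \<xi> \<omega> - D2 \<omega> * (\<xi> \<omega>)\<^sup>2 / 2)
          - (gauss_smooth F (a \<omega> + v \<omega>) (S \<omega>) - gauss_smooth F (a \<omega>) (S \<omega>)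
            - D2 \<omega> * v \<omega> / 2))"
    using i1 i2 i3 j1 j2 j3 c1 c2 by simp
  have "\<bar>expectation (\<lambda>\<omega>. gauss_smooth F (a \<omega>) (S \<omega> + \<xi> \<omega>))
          - expectation (\<lambda>\<omega>. gauss_smooth F (a \<omega> + v \<omega>) (S \<omega>))\<bar>
      \<le> expectation (\<lambda>\<omega>. \<bar>(gauss_smooth F (a \<omega>) (S \<omega> + \<xi> \<omega>) - gauss_smooth F (a \<omega>) (S \<omega>)
            - D1 \<omega> * \<xi> \<omega> - D2 \<omega> * (\<xi> \<omega>)\<^sup>2 / 2)
          - (gauss_smooth F (a \<omega> + v \<omega>) (S \<omega>) - gauss_smooth F (a \<omega>) (S \<omega>)
            - D2 \<omega> * v \<omega> / 2)\<bar>)"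
    unfolding e by (rule integral_abs_bound)
  also have "\<dots> \<le> expectation (\<lambda>\<omega>. \<bar>\<xi> \<omega>\<bar> ^ 3 / 6 + gauss_abs_moment3 / 6 * (v \<omega> * sqrt (v \<omega>)))"
  proof (rule integral_mono)
    fix \<omega>
    have "\<bar>gauss_smooth F (a \<omega>) (S \<omega> + \<xi> \<omega>) - gauss_smooth F (a \<omega>) (S \<omega>)
            - D1 \<omega> * \<xi> \<omega> - D2 \<omega> * (\<xi> \<omega>)\<^sup>2 / 2\<bar> \<le> \<bar>\<xi> \<omega>\<bar> ^ 3 / 6"
      unfolding D1_def D2_def by (rule gauss_smooth_increment_taylor3[OF F])
    moreover have "\<bar>gauss_smooth F (a \<omega> + v \<omega>) (S \<omega>) - gauss_smooth F (a \<omega>) (S \<omega>)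
            - D2 \<omega> * v \<omega> / 2\<bar> \<le> gauss_abs_moment3 / 6 * (v \<omega> * sqrt (v \<omega>))"
      using gauss_smooth_add_taylor3[OF F a v, of \<omega> \<omega> "S \<omega>"] unfolding D2_def
      by (simp only: mult.commute)
    ultimately show "\<bar>(gauss_smooth F (a \<omega>) (S \<omega> + \<xi> \<omega>) - gauss_smooth F (a \<omega>) (S \<omega>)
            - D1 \<omega> * \<xi> \<omega> - D2 \<omega> * (\<xi> \<omega>)\<^sup>2 / 2)
          - (gauss_smooth F (a \<omega> + v \<omega>) (S \<omega>) - gauss_smooth F (a \<omega>) (S \<omega>)
            - D2 \<omega> * v \<omega> / 2)\<bar> \<le> \<bar>\<xi> \<omega>\<bar> ^ 3 / 6 + gauss_abs_moment3 / 6 * (v \<omega> * sqrt (v \<omega>))"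
      by linarith
  next
    show "integrable M (\<lambda>\<omega>. \<bar>(gauss_smooth F (a \<omega>) (S \<omega> + \<xi> \<omega>) - gauss_smooth F (a \<omega>) (S \<omega>)
            - D1 \<omega> * \<xi> \<omega> - D2 \<omega> * (\<xi> \<omega>)\<^sup>2 / 2)
          - (gauss_smooth F (a \<omega> + v \<omega>) (S \<omega>) - gauss_smooth F (a \<omega>) (S \<omega>)
            - D2 \<omega> * v \<omega> / 2)\<bar>)"
      by (intro integrable_abs Bochner_Integration.integrable_diff integrable_divide i1 i2 i3 j1 j2 j3)
    show "integrable M (\<lambda>\<omega>. \<bar>\<xi> \<omega>\<bar> ^ 3 / 6 + gauss_abs_moment3 / 6 * (v \<omega> * sqrt (v \<omega>)))"
      by (intro Bochner_Integration.integrable_add integrable_divide integrable_mult_right int3 intv)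
  qed
  finally show ?thesis using int3 intv by simp
qed

text \<open>The \<open>\<sigma>\<close>-algebras \<open>G i\<close> need not be ordered: \<open>G i\<close> has to contain the summands before \<open>i\<close> and all
  the variances.\<close>

lemma (in prob_space) lindeberg_swapping:
  fixes \<xi> v :: "nat \<Rightarrow> 'a \<Rightarrow> real"
  assumes F: "F \<in> smooth_tests" and sub: "\<And>i. subalgebra M (G i)"
    and \<xi>G: "\<And>i j. j < i \<Longrightarrow> \<xi> j \<in> borel_measurable (G i)"
    and vG: "\<And>i j. v j \<in> borel_measurable (G i)"
    and \<xi>M: "\<And>i. \<xi> i \<in> borel_measurable M"
    and v: "\<And>i \<omega>. 0 \<le> v i \<omega>"
    and cent: "\<And>i \<Psi>. \<Psi> \<in> borel_measurable (G i) \<Longrightarrow> (\<And>\<omega>. \<bar>\<Psi> \<omega>\<bar> \<le> (1::real)) \<Longrightarrow>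
                (\<integral>\<omega>. \<Psi> \<omega> * \<xi> i \<omega> \<partial>M) = 0"
    and var: "\<And>i \<Psi>. \<Psi> \<in> borel_measurable (G i) \<Longrightarrow> (\<And>\<omega>. \<bar>\<Psi> \<omega>\<bar> \<le> (1::real)) \<Longrightarrow>
                (\<integral>\<omega>. \<Psi> \<omega> * ((\<xi> i \<omega>)\<^sup>2 - v i \<omega>) \<partial>M) = 0"
    and int3: "\<And>i. integrable M (\<lambda>\<omega>. \<bar>\<xi> i \<omega>\<bar> ^ 3)"
    and intv: "\<And>i. integrable M (\<lambda>\<omega>. v i \<omega> * sqrt (v i \<omega>))"
  shows "\<bar>expectation (\<lambda>\<omega>. F (\<Sum>i<n. \<xi> i \<omega>)) - expectation (\<lambda>\<omega>. gauss_smooth F (\<Sum>i<n. v i \<omega>) 0)\<bar>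
       \<le> (\<Sum>i<n. expectation (\<lambda>\<omega>. \<bar>\<xi> i \<omega>\<bar> ^ 3) / 6
          + gauss_abs_moment3 / 6 * expectation (\<lambda>\<omega>. v i \<omega> * sqrt (v i \<omega>)))"
proof -
  define T where "T k = expectation (\<lambda>\<omega>. gauss_smooth F (\<Sum>i=k..<n. v i \<omega>) (\<Sum>i<k. \<xi> i \<omega>))" for k
  define b where "b i = expectation (\<lambda>\<omega>. \<bar>\<xi> i \<omega>\<bar> ^ 3) / 6
          + gauss_abs_moment3 / 6 * expectation (\<lambda>\<omega>. v i \<omega> * sqrt (v i \<omega>))" for i
  have step: "\<bar>T (Suc k) - T k\<bar> \<le> b k" if "k < n" for k
  proof -
    have "(\<Sum>i=k..<n. v i \<omega>) = (\<Sum>i=Suc k..<n. v i \<omega>) + v k \<omega>" for \<omega>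
      using that by (simp add: sum.atLeast_Suc_lessThan)
    then have T: "T k = expectation (\<lambda>\<omega>. gauss_smooth F ((\<Sum>i=Suc k..<n. v i \<omega>) + v k \<omega>) (\<Sum>i<k. \<xi> i \<omega>))"
      "T (Suc k) = expectation (\<lambda>\<omega>. gauss_smooth F (\<Sum>i=Suc k..<n. v i \<omega>) ((\<Sum>i<k. \<xi> i \<omega>) + \<xi> k \<omega>))"
      by (simp_all add: T_def)
    show ?thesis
      unfolding T b_def
    proof (rule lindeberg_step[OF F sub[of k] _ _ _ \<xi>M _ v cent var int3 intv])
      show "(\<lambda>\<omega>. \<Sum>i<k. \<xi> i \<omega>) \<in> borel_measurable (G k)"
        by (intro borel_measurable_sum \<xi>G) auto
      show "(\<lambda>\<omega>. \<Sum>i=Suc k..<n. v i \<omega>) \<in> borel_measurable (G k)"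
        by (intro borel_measurable_sum vG)
    qed (auto simp: vG intro!: sum_nonneg v)
  qed
  have "\<bar>T m - T 0\<bar> \<le> (\<Sum>i<m. b i)" if "m \<le> n" for m
    using that
  proof (induction m)
    case (Suc m)
    then show ?case using step[of m] by simp
  qed simp
  from this[of n] show ?thesis
    by (simp add: T_def b_def gauss_smooth_0 atLeast0LessThan)
qed

lemma (in prob_space) lindeberg_series:
  fixes \<xi> v :: "nat \<Rightarrow> 'a \<Rightarrow> real"
  assumes F: "F \<in> smooth_tests" and sub: "\<And>i. subalgebra M (G i)"
    and \<xi>G: "\<And>i j. j < i \<Longrightarrow> \<xi> j \<in> borel_measurable (G i)"
    and vG: "\<And>i j. v j \<in> borel_measurable (G i)"
    and \<xi>M [measurable]: "\<And>i. \<xi> i \<in> borel_measurable M"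
    and v: "\<And>i \<omega>. 0 \<le> v i \<omega>"
    and cent: "\<And>i \<Psi>. \<Psi> \<in> borel_measurable (G i) \<Longrightarrow> (\<And>\<omega>. \<bar>\<Psi> \<omega>\<bar> \<le> (1::real)) \<Longrightarrow>
                (\<integral>\<omega>. \<Psi> \<omega> * \<xi> i \<omega> \<partial>M) = 0"
    and var: "\<And>i \<Psi>. \<Psi> \<in> borel_measurable (G i) \<Longrightarrow> (\<And>\<omega>. \<bar>\<Psi> \<omega>\<bar> \<le> (1::real)) \<Longrightarrow>
                (\<integral>\<omega>. \<Psi> \<omega> * ((\<xi> i \<omega>)\<^sup>2 - v i \<omega>) \<partial>M) = 0"
    and int3: "\<And>i. integrable M (\<lambda>\<omega>. \<bar>\<xi> i \<omega>\<bar> ^ 3)"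
    and intv: "\<And>i. integrable M (\<lambda>\<omega>. v i \<omega> * sqrt (v i \<omega>))"
    and [measurable]: "S \<in> borel_measurable M" "A \<in> borel_measurable M"
    and limS: "AE \<omega> in M. (\<lambda>i. \<xi> i \<omega>) sums S \<omega>" and limA: "AE \<omega> in M. (\<lambda>i. v i \<omega>) sums A \<omega>"
    and bnd: "\<And>n. (\<Sum>i<n. expectation (\<lambda>\<omega>. \<bar>\<xi> i \<omega>\<bar> ^ 3) / 6
          + gauss_abs_moment3 / 6 * expectation (\<lambda>\<omega>. v i \<omega> * sqrt (v i \<omega>))) \<le> B"
  shows "\<bar>expectation (\<lambda>\<omega>. F (S \<omega>)) - expectation (\<lambda>\<omega>. gauss_smooth F (A \<omega>) 0)\<bar> \<le> B"
proof -
  have [measurable]: "v i \<in> borel_measurable M" for i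
    using measurable_from_subalg[OF sub vG] .
  have d: "(deriv ^^ 0) F = F" by simp
  note Fm [measurable] = smooth_tests_measurable[OF F, of 0, unfolded d, simplified]
  have 1: "(\<lambda>n. expectation (\<lambda>\<omega>. F (\<Sum>i<n. \<xi> i \<omega>))) \<longlonglongrightarrow> expectation (\<lambda>\<omega>. F (S \<omega>))"
  proof (rule integral_dominated_convergence[where w = "\<lambda>_. 1"])
    show "AE \<omega> in M. (\<lambda>n. F (\<Sum>i<n. \<xi> i \<omega>)) \<longlonglongrightarrow> F (S \<omega>)"
      using limS
    proof eventually_elim
      case (elim \<omega>)
      have "isCont F (S \<omega>)"
        using smooth_tests_DERIV[OF F, of 0] by (auto intro: DERIV_isCont)
      then show ?case
        using elim unfolding sums_def by (rule isCont_tendsto_compose)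
    qed
  qed (use smooth_tests_bound[OF F, of 0] in auto)
  have 2: "(\<lambda>n. expectation (\<lambda>\<omega>. gauss_smooth F (\<Sum>i<n. v i \<omega>) 0))
      \<longlonglongrightarrow> expectation (\<lambda>\<omega>. gauss_smooth F (A \<omega>) 0)"
  proof (rule integral_dominated_convergence[where w = "\<lambda>_. 1"])
    show "AE \<omega> in M. (\<lambda>n. gauss_smooth F (\<Sum>i<n. v i \<omega>) 0) \<longlonglongrightarrow> gauss_smooth F (A \<omega>) 0"
      using limA
    proof eventually_elim
      case (elim \<omega>)
      have A: "0 \<le> A \<omega>" using elim v by (metis sums_iff suminf_nonneg)
      have "(\<lambda>n. (\<Sum>i<n. v i \<omega>) - A \<omega>) \<longlonglongrightarrow> 0"
        using elim unfolding sums_def by (simp add: LIM_zero)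
      then have "(\<lambda>n. \<bar>(\<Sum>i<n. v i \<omega>) - A \<omega>\<bar> / 2) \<longlonglongrightarrow> 0"
        by (intro tendsto_divide_zero tendsto_rabs_zero)
      then have "(\<lambda>n. gauss_smooth F (\<Sum>i<n. v i \<omega>) 0 - gauss_smooth F (A \<omega>) 0) \<longlonglongrightarrow> 0"
      proof (rule Lim_null_comparison[rotated])
        have "\<bar>gauss_smooth F (\<Sum>i<n. v i \<omega>) 0 - gauss_smooth F (A \<omega>) 0\<bar>
            \<le> \<bar>(\<Sum>i<n. v i \<omega>) - A \<omega>\<bar> / 2" for n
          by (intro gauss_smooth_lipschitz[OF F _ A] sum_nonneg v)
        then show "\<forall>\<^sub>F n in sequentially.
            norm (gauss_smooth F (\<Sum>i<n. v i \<omega>) 0 - gauss_smooth F (A \<omega>) 0)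
              \<le> \<bar>(\<Sum>i<n. v i \<omega>) - A \<omega>\<bar> / 2"
          unfolding real_norm_def by (intro always_eventually allI)
      qed
      then show ?case by (rule LIM_zero_cancel)
    qed
  qed (use gauss_smooth_bound[OF F, of 0, unfolded d] in auto)
  have "(\<lambda>n. \<bar>expectation (\<lambda>\<omega>. F (\<Sum>i<n. \<xi> i \<omega>)) - expectation (\<lambda>\<omega>. gauss_smooth F (\<Sum>i<n. v i \<omega>) 0)\<bar>)
      \<longlonglongrightarrow> \<bar>expectation (\<lambda>\<omega>. F (S \<omega>)) - expectation (\<lambda>\<omega>. gauss_smooth F (A \<omega>) 0)\<bar>"
    by (intro tendsto_rabs tendsto_diff 1 2)
  moreover have "\<bar>expectation (\<lambda>\<omega>. F (\<Sum>i<n. \<xi> i \<omega>)) - expectation (\<lambda>\<omega>. gauss_smooth F (\<Sum>i<n. v i \<omega>) 0)\<bar> \<le> B" for n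
  proof (rule order_trans[OF _ bnd])
    show "\<bar>expectation (\<lambda>\<omega>. F (\<Sum>i<n. \<xi> i \<omega>)) - expectation (\<lambda>\<omega>. gauss_smooth F (\<Sum>i<n. v i \<omega>) 0)\<bar>
       \<le> (\<Sum>i<n. expectation (\<lambda>\<omega>. \<bar>\<xi> i \<omega>\<bar> ^ 3) / 6
          + gauss_abs_moment3 / 6 * expectation (\<lambda>\<omega>. v i \<omega> * sqrt (v i \<omega>)))"
      by (rule lindeberg_swapping[where G = G]) (fact F sub \<xi>G vG \<xi>M v cent var int3 intv)+
  qed
  ultimately show ?thesis
    by (intro LIMSEQ_le_const2[of _ _ B]) auto
qed


section \<open>Independent descendants given the labelled population\<close>

text \<open>A population at a fixed time with labels in the natural numbers: \<open>al i\<close> is the event that \<open>i\<close> is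
  alive, \<open>tr i\<close> the trait of \<open>i\<close>, and \<open>Y i\<close> a nonnegative functional of the descendants of \<open>i\<close>. The
  assumption \<open>cylinder\<close> says that, given which individuals are alive and their traits, the \<open>Y i\<close> of
  the living individuals are independent with the laws \<open>\<kappa> (tr i)\<close>. A label that is not alive
  carries a fixed trait \<open>x0\<close> and the value \<open>0\<close>, which makes \<open>tr i\<close> and \<open>Y i\<close> random variables on
  the whole space.\<close>

locale labelled_branching = prob_space M for M :: "'w measure" +
  fixes X :: "'x measure" and al :: "nat \<Rightarrow> 'w set" and tr :: "nat \<Rightarrow> 'w \<Rightarrow> 'x"
    and Y :: "nat \<Rightarrow> 'w \<Rightarrow> ennreal" and \<kappa> :: "'x \<Rightarrow> ennreal measure" and x0 :: 'x
  assumes al [measurable]: "\<And>i. al i \<in> sets M"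
    and tr [measurable]: "\<And>i. tr i \<in> M \<rightarrow>\<^sub>M X"
    and Y [measurable]: "\<And>i. Y i \<in> borel_measurable M"
    and \<kappa>: "\<kappa> \<in> X \<rightarrow>\<^sub>M prob_algebra borel"
    and x0: "x0 \<in> space X"
    and dead_tr: "\<And>i \<omega>. \<omega> \<notin> al i \<Longrightarrow> tr i \<omega> = x0"
    and dead_Y: "\<And>i \<omega>. \<omega> \<notin> al i \<Longrightarrow> Y i \<omega> = 0"
    and cylinder: "\<And>U C B. finite U \<Longrightarrow> (\<And>u. C u \<in> sets X) \<Longrightarrow> (\<And>u. B u \<in> sets borel) \<Longrightarrow>
      emeasure M {\<omega>\<in>space M. \<forall>u\<in>U. \<omega> \<in> al u \<and> tr u \<omega> \<in> C u \<and> Y u \<omega> \<in> B u} =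
      (\<integral>\<^sup>+\<omega>. (\<Prod>u\<in>U. indicator (al u) \<omega> * indicator (C u) (tr u \<omega>) * emeasure (\<kappa> (tr u \<omega>)) (B u)) \<partial>M)"
begin

lemma \<kappa>_subprob [measurable]: "\<kappa> \<in> X \<rightarrow>\<^sub>M subprob_algebra borel"
  using \<kappa> by (rule measurable_prob_algebraD)

lemma \<kappa>_prob: "x \<in> space X \<Longrightarrow> prob_space (\<kappa> x)" and \<kappa>_sets: "x \<in> space X \<Longrightarrow> sets (\<kappa> x) = sets borel"
  using measurable_space[OF \<kappa>, of x] by (auto simp: space_prob_algebra)

lemma tr_space [simp]: "\<omega> \<in> space M \<Longrightarrow> tr i \<omega> \<in> space X"
  by (rule measurable_space[OF tr])

lemma \<kappa>_UNIV [simp]: "x \<in> space X \<Longrightarrow> emeasure (\<kappa> x) UNIV = 1"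
  using prob_space.emeasure_space_1[OF \<kappa>_prob] sets_eq_imp_space_eq[OF \<kappa>_sets] by simp

text \<open>Cylinder events: all individuals of \<open>U\<close> are alive, with traits in \<open>C\<close> and values in \<open>B\<close>.\<close>

definition cyl :: "nat set \<Rightarrow> (nat \<Rightarrow> 'x set) \<Rightarrow> (nat \<Rightarrow> ennreal set) \<Rightarrow> 'w set" where
  "cyl U C B = {\<omega>\<in>space M. \<forall>u\<in>U. \<omega> \<in> al u \<and> tr u \<omega> \<in> C u \<and> Y u \<omega> \<in> B u}"

text \<open>The cylinders that put no constraint on the value of \<open>w\<close>; its trait may be constrained.\<close>

definition cyls :: "nat \<Rightarrow> 'w set set" where
  "cyls w = {cyl U C B |U C B. finite U \<and> (\<forall>u. C u \<in> sets X) \<and> (\<forall>u. B u \<in> sets borel) \<and> B w = UNIV}"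

text \<open>The \<open>\<sigma>\<close>-algebra generated by the labelled population and the values of all individuals but \<open>w\<close>.\<close>

definition others :: "nat \<Rightarrow> 'w measure" where
  "others w = sigma (space M) (cyls w)"

lemma cyl_sets [measurable]:
  assumes "finite U" "\<And>u. C u \<in> sets X" "\<And>u. B u \<in> sets borel"
  shows "cyl U C B \<in> sets M"
  unfolding cyl_def using assms by measurable

lemma cyls_sets: "cyls w \<subseteq> sets M"
  unfolding cyls_def using cyl_sets by blast

lemma cyls_Pow: "cyls w \<subseteq> Pow (space M)"
  using cyls_sets sets.space_closed by blast

lemma space_others [simp]: "space (others w) = space M"
  unfolding others_def by (rule space_measure_of[OF cyls_Pow])

lemma sets_others: "sets (others w) = sigma_sets (space M) (cyls w)"
  unfolding others_def by (rule sets_measure_of[OF cyls_Pow])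

lemma subalgebra_others: "subalgebra M (others w)"
  unfolding subalgebra_def sets_others using sets.sigma_sets_subset[OF cyls_sets] by simp

lemma Int_stable_cyls: "Int_stable (cyls w)"
proof (rule Int_stableI)
  fix a b assume "a \<in> cyls w" "b \<in> cyls w"
  then obtain U C B U' C' B' where a: "a = cyl U C B" "finite U" "\<And>u. C u \<in> sets X" "\<And>u. B u \<in> sets borel" "B w = UNIV"
    and b: "b = cyl U' C' B'" "finite U'" "\<And>u. C' u \<in> sets X" "\<And>u. B' u \<in> sets borel" "B' w = UNIV"
    unfolding cyls_def by blast
  let ?C = "\<lambda>u. (if u \<in> U then C u else space X) \<inter> (if u \<in> U' then C' u else space X)"
  let ?B = "\<lambda>u. (if u \<in> U then B u else UNIV) \<inter> (if u \<in> U' then B' u else UNIV)"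
  have "a \<inter> b = cyl (U \<union> U') ?C ?B"
    unfolding a b cyl_def by (auto split: if_splits)
  moreover have "cyl (U \<union> U') ?C ?B \<in> cyls w"
    unfolding cyls_def using a b by (intro CollectI exI[of _ "U \<union> U'"] exI[of _ ?C] exI[of _ ?B]) auto
  ultimately show "a \<inter> b \<in> cyls w" by simp
qed

text \<open>On cylinders, the conditional law of the value of \<open>w\<close> is \<open>\<kappa> (tr w)\<close>. The cylinder formula for
  all constraints \<open>D\<close> on the trait of \<open>w\<close> identifies the law of this trait on the event \<open>A\<close> with the
  image of a density \<open>J\<close>, and \<open>\<kappa>\<close> can then be integrated against either of them.\<close>

lemma cyl_cond:
  assumes A: "A \<in> cyls w" and B [measurable]: "B \<in> sets borel"
  shows "emeasure M (A \<inter> {\<omega>\<in>space M. \<omega> \<in> al w \<and> Y w \<omega> \<in> B}) =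
    (\<integral>\<^sup>+\<omega>. indicator A \<omega> * (indicator (al w) \<omega> * emeasure (\<kappa> (tr w \<omega>)) B) \<partial>M)"
proof -
  obtain U C B0 where A_eq: "A = cyl U C B0" and U: "finite U" and C: "\<And>u. C u \<in> sets X"
    and B0: "\<And>u. B0 u \<in> sets borel" "B0 w = UNIV"
    using A unfolding cyls_def by blast
  note [measurable] = C B0
  have A_M [measurable]: "A \<in> sets M" using A cyls_sets by auto
  define C' where "C' = C (w := if w \<in> U then C w else space X)"
  have C' [measurable]: "C' u \<in> sets X" for u using C by (auto simp: C'_def)
  have \<kappa>m [measurable]: "(\<lambda>x. emeasure (\<kappa> x) D) \<in> borel_measurable X" if "D \<in> sets borel" for D
    by (rule measurable_emeasure_kernel[OF \<kappa>_subprob that])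
  \<comment> \<open>The density that remains after integrating out the values of the other individuals.\<close>
  define J where "J \<omega> = indicator (al w) \<omega> * indicator (C' w) (tr w \<omega>) *
    (\<Prod>u\<in>U - {w}. indicator (al u) \<omega> * indicator (C u) (tr u \<omega>) * emeasure (\<kappa> (tr u \<omega>)) (B0 u) :: ennreal)" for \<omega>
  have J [measurable]: "J \<in> borel_measurable M"
    unfolding J_def[abs_def] using U by measurable
  have *: "emeasure M (A \<inter> {\<omega>\<in>space M. \<omega> \<in> al w \<and> tr w \<omega> \<in> D \<and> Y w \<omega> \<in> B}) =
      (\<integral>\<^sup>+\<omega>. J \<omega> * (indicator D (tr w \<omega>) * emeasure (\<kappa> (tr w \<omega>)) B) \<partial>M)"
    if D: "D \<in> sets X" and B: "B \<in> sets borel" for D B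
  proof -
    have A_cyl: "A \<inter> {\<omega>\<in>space M. \<omega> \<in> al w \<and> tr w \<omega> \<in> D \<and> Y w \<omega> \<in> B}
      = {\<omega>\<in>space M. \<forall>u\<in>insert w (U - {w}). \<omega> \<in> al u \<and> tr u \<omega> \<in> (C(w := C' w \<inter> D)) u \<and> Y u \<omega> \<in> (B0(w := B)) u}"
      unfolding A_eq cyl_def C'_def using B0 by (auto split: if_splits)
    have "emeasure M (A \<inter> {\<omega>\<in>space M. \<omega> \<in> al w \<and> tr w \<omega> \<in> D \<and> Y w \<omega> \<in> B})
      = (\<integral>\<^sup>+\<omega>. (\<Prod>u\<in>insert w (U - {w}). indicator (al u) \<omega> * indicator ((C(w := C' w \<inter> D)) u) (tr u \<omega>)
        * emeasure (\<kappa> (tr u \<omega>)) ((B0(w := B)) u)) \<partial>M)"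
      unfolding A_cyl
    proof (rule cylinder)
      show "finite (insert w (U - {w}))" using U by simp
      show "(C(w := C' w \<inter> D)) u \<in> sets X" for u
        using C[of u] sets.Int[OF C'[of w] D] by (cases "u = w") simp_all
      show "(B0(w := B)) u \<in> sets borel" for u
        using B0(1)[of u] B by (cases "u = w") simp_all
    qed
    also have "\<dots> = (\<integral>\<^sup>+\<omega>. J \<omega> * (indicator D (tr w \<omega>) * emeasure (\<kappa> (tr w \<omega>)) B) \<partial>M)"
    proof (rule nn_integral_cong)
      fix \<omega>
      have "(\<Prod>u\<in>U - {w}. indicator (al u) \<omega> * indicator ((C(w := C' w \<inter> D)) u) (tr u \<omega>)
          * emeasure (\<kappa> (tr u \<omega>)) ((B0(w := B)) u)) =
        (\<Prod>u\<in>U - {w}. indicator (al u) \<omega> * indicator (C u) (tr u \<omega>) * emeasure (\<kappa> (tr u \<omega>)) (B0 u) :: ennreal)"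
        by (rule prod.cong) auto
      then show "(\<Prod>u\<in>insert w (U - {w}). indicator (al u) \<omega> * indicator ((C(w := C' w \<inter> D)) u) (tr u \<omega>)
        * emeasure (\<kappa> (tr u \<omega>)) ((B0(w := B)) u)) = J \<omega> * (indicator D (tr w \<omega>) * emeasure (\<kappa> (tr w \<omega>)) B)"
        using U by (subst prod.insert) (auto simp: J_def indicator_inter_arith mult_ac)
    qed
    finally show ?thesis .
  qed
  have eq: "distr (density M (\<lambda>\<omega>. indicator A \<omega> * indicator (al w) \<omega>)) X (tr w) = distr (density M J) X (tr w)"
  proof (rule measure_eqI)
    fix D assume "D \<in> sets (distr (density M (\<lambda>\<omega>. indicator A \<omega> * indicator (al w) \<omega>)) X (tr w))"
    then have D [measurable]: "D \<in> sets X" by simp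
    have "emeasure (distr (density M (\<lambda>\<omega>. indicator A \<omega> * indicator (al w) \<omega>)) X (tr w)) D
       = (\<integral>\<^sup>+\<omega>. indicator (A \<inter> {\<omega>\<in>space M. \<omega> \<in> al w \<and> tr w \<omega> \<in> D \<and> Y w \<omega> \<in> UNIV}) \<omega> \<partial>M)"
      by (subst emeasure_distr, simp, simp, subst emeasure_density, simp, simp)
         (auto intro!: nn_integral_cong simp del: nn_integral_indicator simp: indicator_def)
    also have "\<dots> = emeasure M (A \<inter> {\<omega>\<in>space M. \<omega> \<in> al w \<and> tr w \<omega> \<in> D \<and> Y w \<omega> \<in> UNIV})"
      by (rule nn_integral_indicator) measurable
    also have "\<dots> = (\<integral>\<^sup>+\<omega>. J \<omega> * (indicator D (tr w \<omega>) * emeasure (\<kappa> (tr w \<omega>)) UNIV) \<partial>M)"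
      by (rule *) (use D in auto)
    also have "\<dots> = emeasure (distr (density M J) X (tr w)) D"
      by (subst emeasure_distr, simp, simp, subst emeasure_density, simp, simp)
         (auto intro!: nn_integral_cong simp del: nn_integral_indicator simp: indicator_def)
    finally show "emeasure (distr (density M (\<lambda>\<omega>. indicator A \<omega> * indicator (al w) \<omega>)) X (tr w)) D
       = emeasure (distr (density M J) X (tr w)) D" .
  qed simp
  have "emeasure M (A \<inter> {\<omega>\<in>space M. \<omega> \<in> al w \<and> Y w \<omega> \<in> B})
      = emeasure M (A \<inter> {\<omega>\<in>space M. \<omega> \<in> al w \<and> tr w \<omega> \<in> space X \<and> Y w \<omega> \<in> B})"
    by (rule arg_cong[where f = "emeasure M"]) auto
  also have "\<dots> = (\<integral>\<^sup>+\<omega>. J \<omega> * (indicator (space X) (tr w \<omega>) * emeasure (\<kappa> (tr w \<omega>)) B) \<partial>M)"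
    by (rule *) auto
  also have "\<dots> = (\<integral>\<^sup>+\<omega>. J \<omega> * emeasure (\<kappa> (tr w \<omega>)) B \<partial>M)"
    by (rule nn_integral_cong) simp
  also have "\<dots> = (\<integral>\<^sup>+x. emeasure (\<kappa> x) B \<partial>distr (density M J) X (tr w))"
    by (subst nn_integral_distr, simp, simp, subst nn_integral_density, simp_all)
  also have "\<dots> = (\<integral>\<^sup>+x. emeasure (\<kappa> x) B \<partial>distr (density M (\<lambda>\<omega>. indicator A \<omega> * indicator (al w) \<omega>)) X (tr w))"
    unfolding eq ..
  also have "\<dots> = (\<integral>\<^sup>+\<omega>. indicator A \<omega> * (indicator (al w) \<omega> * emeasure (\<kappa> (tr w \<omega>)) B) \<partial>M)"
    by (subst nn_integral_distr, simp, simp, subst nn_integral_density, simp_all add: mult_ac)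
  finally show ?thesis .
qed

lemma others_measurable_M [measurable_dest]: "f \<in> others w \<rightarrow>\<^sub>M N \<Longrightarrow> f \<in> M \<rightarrow>\<^sub>M N"
  by (rule measurable_from_subalg[OF subalgebra_others])

lemma distr_others_eq:
  assumes B [measurable]: "B \<in> sets borel"
  shows "distr (density M (\<lambda>\<omega>. indicator (al w) \<omega> * indicator B (Y w \<omega>))) (others w) (\<lambda>\<omega>. \<omega>)
       = distr (density M (\<lambda>\<omega>. indicator (al w) \<omega> * emeasure (\<kappa> (tr w \<omega>)) B)) (others w) (\<lambda>\<omega>. \<omega>)"
    (is "?L = ?R")
proof (rule measure_eqI_generator_eq[where E = "cyls w" and \<Omega> = "space M" and A = "\<lambda>_. space M"])
  have [measurable]: "(\<lambda>x. emeasure (\<kappa> x) B) \<in> borel_measurable X"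
    by (rule measurable_emeasure_kernel[OF \<kappa>_subprob B])
  have id [measurable]: "(\<lambda>\<omega>. \<omega>) \<in> M \<rightarrow>\<^sub>M others w"
    by (rule others_measurable_M[of _ w]) simp
  have id' [measurable]: "(\<lambda>\<omega>. \<omega>) \<in> density M f \<rightarrow>\<^sub>M others w" for f
    using id by simp
  show eq: "emeasure ?L A = emeasure ?R A" if A: "A \<in> cyls w" for A
  proof -
    have Ao [measurable]: "A \<in> sets (others w)" using A by (auto simp: sets_others)
    have [measurable]: "A \<in> sets M" using A cyls_sets by auto
    have "emeasure ?L A = (\<integral>\<^sup>+\<omega>. indicator (A \<inter> {\<omega>\<in>space M. \<omega> \<in> al w \<and> Y w \<omega> \<in> B}) \<omega> \<partial>M)"
      by (subst emeasure_distr[OF id' Ao], subst emeasure_density)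
         (auto intro!: nn_integral_cong simp del: nn_integral_indicator simp: indicator_def)
    also have "\<dots> = emeasure M (A \<inter> {\<omega>\<in>space M. \<omega> \<in> al w \<and> Y w \<omega> \<in> B})"
      by (rule nn_integral_indicator) measurable
    also have "\<dots> = (\<integral>\<^sup>+\<omega>. indicator A \<omega> * (indicator (al w) \<omega> * emeasure (\<kappa> (tr w \<omega>)) B) \<partial>M)"
      by (rule cyl_cond[OF A B])
    also have "\<dots> = emeasure ?R A"
      by (subst emeasure_distr[OF id' Ao], subst emeasure_density)
         (auto intro!: nn_integral_cong simp del: nn_integral_indicator simp: indicator_def)
    finally show ?thesis .
  qed
  have "cyl {} (\<lambda>_. space X) (\<lambda>_. UNIV) \<in> cyls w"
    unfolding cyls_def
    by (rule CollectI, rule exI[of _ "{}"], rule exI[of _ "\<lambda>_. space X"], rule exI[of _ "\<lambda>_. UNIV"]) simp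
  then show "range (\<lambda>_. space M) \<subseteq> cyls w" by (simp add: cyl_def)
  show "emeasure ?L (space M) \<noteq> \<infinity>"
  proof -
    have "emeasure ?L (space M) = (\<integral>\<^sup>+\<omega>. indicator (al w) \<omega> * indicator B (Y w \<omega>) \<partial>M)"
      using sets.top[of "others w"]
      by (subst emeasure_distr[OF id'], simp, subst emeasure_density)
         (auto intro!: nn_integral_cong simp del: nn_integral_indicator simp: indicator_def)
    also have "\<dots> \<le> (\<integral>\<^sup>+\<omega>. 1 \<partial>M)"
      by (intro nn_integral_mono) (auto simp: indicator_def)
    finally show ?thesis by (auto simp: emeasure_space_1 top_unique)
  qed
qed (auto simp: Int_stable_cyls cyls_Pow sets_others)

text \<open>Conditionally on the labelled population and on the values of the other individuals, the
  value attached to \<open>w\<close> has the law prescribed by the trait of \<open>w\<close>.\<close>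

lemma nn_integral_others:
  assumes \<Psi> [measurable]: "\<Psi> \<in> borel_measurable (others w)" and g: "g \<in> borel_measurable borel"
  shows "(\<integral>\<^sup>+\<omega>. \<Psi> \<omega> * (indicator (al w) \<omega> * g (Y w \<omega>)) \<partial>M) =
    (\<integral>\<^sup>+\<omega>. \<Psi> \<omega> * (indicator (al w) \<omega> * (\<integral>\<^sup>+y. g y \<partial>\<kappa> (tr w \<omega>))) \<partial>M)"
  using g
proof (induction g rule: borel_measurable_induct)
  case (cong f g)
  then have "f = g" by auto
  then show ?case using cong by simp
next
  case (set B)
  then have B [measurable]: "B \<in> sets borel" by simp
  have [measurable]: "(\<lambda>x. emeasure (\<kappa> x) B) \<in> borel_measurable X"
    by (rule measurable_emeasure_kernel[OF \<kappa>_subprob B])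
  have id [measurable]: "(\<lambda>\<omega>. \<omega>) \<in> M \<rightarrow>\<^sub>M others w"
    by (rule others_measurable_M[of _ w]) simp
  have id' [measurable]: "(\<lambda>\<omega>. \<omega>) \<in> density M f \<rightarrow>\<^sub>M others w" for f
    using id by simp
  have "(\<integral>\<^sup>+\<omega>. \<Psi> \<omega> * (indicator (al w) \<omega> * indicator B (Y w \<omega>)) \<partial>M)
     = (\<integral>\<^sup>+\<omega>. \<Psi> \<omega> \<partial>distr (density M (\<lambda>\<omega>. indicator (al w) \<omega> * indicator B (Y w \<omega>))) (others w) (\<lambda>\<omega>. \<omega>))"
    by (subst nn_integral_distr[OF id'], simp, subst nn_integral_density) (auto simp: mult_ac)
  also have "\<dots> = (\<integral>\<^sup>+\<omega>. \<Psi> \<omega> * (indicator (al w) \<omega> * emeasure (\<kappa> (tr w \<omega>)) B) \<partial>M)"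
    unfolding distr_others_eq[OF B]
    by (subst nn_integral_distr[OF id'], simp, subst nn_integral_density) (auto simp: mult_ac)
  also have "\<dots> = (\<integral>\<^sup>+\<omega>. \<Psi> \<omega> * (indicator (al w) \<omega> * (\<integral>\<^sup>+y. indicator B y \<partial>\<kappa> (tr w \<omega>))) \<partial>M)"
    by (rule nn_integral_cong) (simp add: \<kappa>_sets)
  finally show ?case .
next
  case (mult u c)
  note [measurable] = mult.hyps
  have "(\<integral>\<^sup>+\<omega>. \<Psi> \<omega> * (indicator (al w) \<omega> * (c * u (Y w \<omega>))) \<partial>M)
      = c * (\<integral>\<^sup>+\<omega>. \<Psi> \<omega> * (indicator (al w) \<omega> * u (Y w \<omega>)) \<partial>M)"
    by (subst nn_integral_cmult[symmetric]) (auto simp: mult_ac)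
  also have "\<dots> = (\<integral>\<^sup>+\<omega>. c * (\<Psi> \<omega> * (indicator (al w) \<omega> * (\<integral>\<^sup>+y. u y \<partial>\<kappa> (tr w \<omega>)))) \<partial>M)"
    unfolding mult.IH by (rule nn_integral_cmult[symmetric]) measurable
  also have "\<dots> = (\<integral>\<^sup>+\<omega>. \<Psi> \<omega> * (indicator (al w) \<omega> * (\<integral>\<^sup>+y. c * u y \<partial>\<kappa> (tr w \<omega>))) \<partial>M)"
    by (rule nn_integral_cong) (subst nn_integral_cmult, auto simp: mult_ac measurable_cong_sets[OF \<kappa>_sets])
  finally show ?case .
next
  case (add u v)
  note [measurable] = add.hyps
  have "(\<integral>\<^sup>+\<omega>. \<Psi> \<omega> * (indicator (al w) \<omega> * (v (Y w \<omega>) + u (Y w \<omega>))) \<partial>M)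
      = (\<integral>\<^sup>+\<omega>. \<Psi> \<omega> * (indicator (al w) \<omega> * v (Y w \<omega>)) \<partial>M) + (\<integral>\<^sup>+\<omega>. \<Psi> \<omega> * (indicator (al w) \<omega> * u (Y w \<omega>)) \<partial>M)"
    by (subst nn_integral_add[symmetric]) (auto simp: distrib_left)
  also have "\<dots> = (\<integral>\<^sup>+\<omega>. \<Psi> \<omega> * (indicator (al w) \<omega> * (\<integral>\<^sup>+y. v y \<partial>\<kappa> (tr w \<omega>)))
       + \<Psi> \<omega> * (indicator (al w) \<omega> * (\<integral>\<^sup>+y. u y \<partial>\<kappa> (tr w \<omega>))) \<partial>M)"
    unfolding add.IH by (rule nn_integral_add[symmetric]) measurable
  also have "\<dots> = (\<integral>\<^sup>+\<omega>. \<Psi> \<omega> * (indicator (al w) \<omega> * (\<integral>\<^sup>+y. v y + u y \<partial>\<kappa> (tr w \<omega>))) \<partial>M)"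
    by (rule nn_integral_cong) (subst nn_integral_add, auto simp: distrib_left measurable_cong_sets[OF \<kappa>_sets])
  finally show ?case .
next
  case (seq U)
  note [measurable] = seq.hyps
  have inc: "incseq (\<lambda>i. (\<lambda>\<omega>. \<Psi> \<omega> * (indicator (al w) \<omega> * U i (Y w \<omega>))))"
    using \<open>incseq U\<close> by (auto simp: incseq_def le_fun_def intro!: mult_left_mono)
  have inc2: "incseq (\<lambda>i. (\<lambda>\<omega>. \<Psi> \<omega> * (indicator (al w) \<omega> * (\<integral>\<^sup>+y. U i y \<partial>\<kappa> (tr w \<omega>)))))"
    using \<open>incseq U\<close> by (auto simp: incseq_def le_fun_def intro!: mult_left_mono nn_integral_mono)
  have "(\<integral>\<^sup>+\<omega>. \<Psi> \<omega> * (indicator (al w) \<omega> * (SUP i. U i) (Y w \<omega>)) \<partial>M)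
      = (\<integral>\<^sup>+\<omega>. (SUP i. \<Psi> \<omega> * (indicator (al w) \<omega> * U i (Y w \<omega>))) \<partial>M)"
    by (simp add: SUP_mult_left_ennreal image_comp)
  also have "\<dots> = (SUP i. \<integral>\<^sup>+\<omega>. \<Psi> \<omega> * (indicator (al w) \<omega> * U i (Y w \<omega>)) \<partial>M)"
    using inc by (rule nn_integral_monotone_convergence_SUP) measurable
  also have "\<dots> = (SUP i. \<integral>\<^sup>+\<omega>. \<Psi> \<omega> * (indicator (al w) \<omega> * (\<integral>\<^sup>+y. U i y \<partial>\<kappa> (tr w \<omega>))) \<partial>M)"
    unfolding seq.IH ..
  also have "\<dots> = (\<integral>\<^sup>+\<omega>. (SUP i. \<Psi> \<omega> * (indicator (al w) \<omega> * (\<integral>\<^sup>+y. U i y \<partial>\<kappa> (tr w \<omega>)))) \<partial>M)"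
    using inc2 by (rule nn_integral_monotone_convergence_SUP[symmetric]) measurable
  also have "\<dots> = (\<integral>\<^sup>+\<omega>. \<Psi> \<omega> * (indicator (al w) \<omega> * (\<integral>\<^sup>+y. (SUP i. U i) y \<partial>\<kappa> (tr w \<omega>))) \<partial>M)"
  proof (rule nn_integral_cong)
    fix \<omega> assume "\<omega> \<in> space M"
    then have "(\<integral>\<^sup>+y. (SUP i. U i y) \<partial>\<kappa> (tr w \<omega>)) = (SUP i. \<integral>\<^sup>+y. U i y \<partial>\<kappa> (tr w \<omega>))"
      using \<open>incseq U\<close>
      by (intro nn_integral_monotone_convergence_SUP) (auto simp: measurable_cong_sets[OF \<kappa>_sets])
    then show "(SUP i. \<Psi> \<omega> * (indicator (al w) \<omega> * (\<integral>\<^sup>+y. U i y \<partial>\<kappa> (tr w \<omega>)))) =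
       \<Psi> \<omega> * (indicator (al w) \<omega> * (\<integral>\<^sup>+y. (SUP i. U i) y \<partial>\<kappa> (tr w \<omega>)))"
      by (simp add: SUP_mult_left_ennreal image_comp)
  qed
  finally show ?case .
qed

lemma cyl_in_others:
  assumes "finite U" "\<And>u. C u \<in> sets X" "\<And>u. B u \<in> sets borel" "B w = UNIV"
  shows "cyl U C B \<in> sets (others w)"
  unfolding sets_others cyls_def using assms
  by (intro sigma_sets.Basic CollectI exI[of _ U] exI[of _ C] exI[of _ B]) simp

lemma al_others [measurable]: "al u \<in> sets (others w)"
proof -
  have "al u = cyl {u} (\<lambda>_. space X) (\<lambda>_. UNIV)"
    using sets.sets_into_space[OF al, of u] unfolding cyl_def by auto
  then show ?thesis using cyl_in_others[of "{u}" "\<lambda>_. space X" "\<lambda>_. UNIV" w] by simp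
qed

lemma tr_others [measurable]: "tr u \<in> others w \<rightarrow>\<^sub>M X"
proof (rule measurableI)
  fix D assume D: "D \<in> sets X"
  have "tr u -` D \<inter> space (others w) = cyl {u} (\<lambda>_. D) (\<lambda>_. UNIV) \<union> (if x0 \<in> D then space (others w) - al u else {})"
    unfolding cyl_def using dead_tr[of _ u] by (auto split: if_splits)
  moreover have "cyl {u} (\<lambda>_. D) (\<lambda>_. UNIV) \<in> sets (others w)"
    using D by (intro cyl_in_others) auto
  ultimately show "tr u -` D \<inter> space (others w) \<in> sets (others w)"
    using sets.compl_sets[OF al_others[of u w]] by (auto simp del: space_others)
qed simp

lemma Y_others [measurable]:
  assumes "u \<noteq> w"
  shows "Y u \<in> borel_measurable (others w)"
proof (rule measurableI)
  fix D :: "ennreal set" assume D: "D \<in> sets borel"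
  have "Y u -` D \<inter> space (others w) = cyl {u} (\<lambda>_. space X) (\<lambda>v. if v = u then D else UNIV)
      \<union> (if 0 \<in> D then space (others w) - al u else {})"
    unfolding cyl_def using dead_Y[of _ u] by (auto split: if_splits) (metis)+
  moreover have "cyl {u} (\<lambda>_. space X) (\<lambda>v. if v = u then D else UNIV) \<in> sets (others w)"
    using D assms by (intro cyl_in_others) auto
  ultimately show "Y u -` D \<inter> space (others w) \<in> sets (others w)"
    using sets.compl_sets[OF al_others[of u w]] by (auto simp del: space_others)
qed simp

subsection \<open>Moments of the total mass\<close>

text \<open>Moments of the laws \<open>\<kappa> x\<close>.\<close>

definition mom :: "nat \<Rightarrow> 'x \<Rightarrow> ennreal" where
  "mom k x = (\<integral>\<^sup>+y. y ^ k \<partial>\<kappa> x)"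

text \<open>The sum of \<open>f\<close> over the traits of the living individuals.\<close>

definition pop :: "('x \<Rightarrow> ennreal) \<Rightarrow> 'w \<Rightarrow> ennreal" where
  "pop f \<omega> = (\<Sum>u. indicator (al u) \<omega> * f (tr u \<omega>))"

text \<open>The sum of the values of all living individuals.\<close>

definition tot :: "'w \<Rightarrow> ennreal" where
  "tot \<omega> = (\<Sum>u. Y u \<omega>)"

lemma mom_measurable [measurable]: "mom k \<in> borel_measurable X"
  unfolding mom_def[abs_def]
  by (rule measurable_compose[OF \<kappa>_subprob]) (rule nn_integral_measurable_subprob_algebra, measurable)

lemma pop_measurable [measurable]:
  assumes [measurable]: "f \<in> borel_measurable X"
  shows "pop f \<in> borel_measurable M"
  unfolding pop_def[abs_def] by measurable

lemma tot_measurable [measurable]: "tot \<in> borel_measurable M"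
  unfolding tot_def[abs_def] by measurable

lemma alive_Y: "indicator (al u) \<omega> * Y u \<omega> ^ k = Y u \<omega> ^ k" if "0 < k"
  using dead_Y[of \<omega> u] that by (cases "\<omega> \<in> al u") auto

lemma cond_mom:
  assumes "\<Psi> \<in> borel_measurable (others w)" "0 < k"
  shows "(\<integral>\<^sup>+\<omega>. \<Psi> \<omega> * Y w \<omega> ^ k \<partial>M) = (\<integral>\<^sup>+\<omega>. \<Psi> \<omega> * (indicator (al w) \<omega> * mom k (tr w \<omega>)) \<partial>M)"
  using nn_integral_others[OF assms(1), of "\<lambda>y. y ^ k"] alive_Y[OF assms(2)] by (simp add: mom_def)

lemma cond_mom1:
  assumes "\<Psi> \<in> borel_measurable (others w)"
  shows "(\<integral>\<^sup>+\<omega>. \<Psi> \<omega> * Y w \<omega> \<partial>M) = (\<integral>\<^sup>+\<omega>. \<Psi> \<omega> * (indicator (al w) \<omega> * mom 1 (tr w \<omega>)) \<partial>M)"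
  using cond_mom[OF assms, of 1] by simp

text \<open>The indicator of the event that \<open>u\<close> is alive.\<close>

abbreviation I :: "nat \<Rightarrow> 'w \<Rightarrow> ennreal" where "I u \<omega> \<equiv> indicator (al u) \<omega>"

lemma integral_Y_power: "0 < k \<Longrightarrow> (\<integral>\<^sup>+\<omega>. Y w \<omega> ^ k \<partial>M) = (\<integral>\<^sup>+\<omega>. I w \<omega> * mom k (tr w \<omega>) \<partial>M)"
  using cond_mom[of "\<lambda>_. 1" w k] by simp

lemma integral_tot_pop:
  assumes f [measurable]: "f \<in> borel_measurable X"
  shows "(\<integral>\<^sup>+\<omega>. tot \<omega> * pop f \<omega> \<partial>M) = (\<integral>\<^sup>+\<omega>. pop (mom 1) \<omega> * pop f \<omega> \<partial>M)"
proof -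
  have "(\<integral>\<^sup>+\<omega>. tot \<omega> * pop f \<omega> \<partial>M) = (\<integral>\<^sup>+\<omega>. (\<Sum>u. pop f \<omega> * Y u \<omega>) \<partial>M)"
    by (simp add: tot_def mult.commute)
  also have "\<dots> = (\<Sum>u. \<integral>\<^sup>+\<omega>. pop f \<omega> * Y u \<omega> \<partial>M)"
    by (rule nn_integral_suminf) measurable
  also have "\<dots> = (\<Sum>u. \<integral>\<^sup>+\<omega>. pop f \<omega> * (I u \<omega> * mom 1 (tr u \<omega>)) \<partial>M)"
    by (intro suminf_cong cond_mom1) (unfold pop_def[abs_def], measurable)
  also have "\<dots> = (\<integral>\<^sup>+\<omega>. (\<Sum>u. pop f \<omega> * (I u \<omega> * mom 1 (tr u \<omega>))) \<partial>M)"
    by (rule nn_integral_suminf[symmetric]) measurable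
  also have "\<dots> = (\<integral>\<^sup>+\<omega>. pop (mom 1) \<omega> * pop f \<omega> \<partial>M)"
    by (simp add: pop_def[of "mom 1"] mult.commute del: One_nat_def)
  finally show ?thesis .
qed

lemma integral_tot: "(\<integral>\<^sup>+\<omega>. tot \<omega> \<partial>M) = (\<integral>\<^sup>+\<omega>. pop (mom 1) \<omega> \<partial>M)"
proof -
  have "(\<integral>\<^sup>+\<omega>. tot \<omega> \<partial>M) = (\<Sum>u. \<integral>\<^sup>+\<omega>. Y u \<omega> \<partial>M)"
    unfolding tot_def by (rule nn_integral_suminf) measurable
  also have "\<dots> = (\<Sum>u. \<integral>\<^sup>+\<omega>. I u \<omega> * mom 1 (tr u \<omega>) \<partial>M)"
    using integral_Y_power[of 1] by simp
  also have "\<dots> = (\<integral>\<^sup>+\<omega>. pop (mom 1) \<omega> \<partial>M)"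
    unfolding pop_def by (rule nn_integral_suminf[symmetric]) measurable
  finally show ?thesis .
qed

text \<open>For distinct \<open>u\<close> and \<open>v\<close> both values are integrated out in turn; the diagonal gives the second
  moment. The diagonal part of the product of means on the right is superfluous, but its presence
  turns the sum over all pairs into the square of a sum.\<close>

lemma pair_moment:
  "(\<integral>\<^sup>+\<omega>. Y u \<omega> * Y v \<omega> \<partial>M) \<le>
     (\<integral>\<^sup>+\<omega>. (if v = u then I u \<omega> * mom 2 (tr u \<omega>) else 0)
        + (I u \<omega> * mom 1 (tr u \<omega>)) * (I v \<omega> * mom 1 (tr v \<omega>)) \<partial>M)"
proof (cases "v = u")
  case True
  have "(\<integral>\<^sup>+\<omega>. Y u \<omega> * Y v \<omega> \<partial>M) = (\<integral>\<^sup>+\<omega>. I u \<omega> * mom 2 (tr u \<omega>) \<partial>M)"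
    using integral_Y_power[of 2 u] True by (simp add: power2_eq_square)
  then show ?thesis using True by (auto intro: nn_integral_mono)
next
  case False
  have [measurable]: "Y u \<in> borel_measurable (others v)" "Y v \<in> borel_measurable (others u)"
    using False by auto
  have "(\<integral>\<^sup>+\<omega>. Y u \<omega> * Y v \<omega> \<partial>M) = (\<integral>\<^sup>+\<omega>. Y u \<omega> * (I v \<omega> * mom 1 (tr v \<omega>)) \<partial>M)"
    by (rule cond_mom1) measurable
  also have "\<dots> = (\<integral>\<^sup>+\<omega>. (I v \<omega> * mom 1 (tr v \<omega>)) * Y u \<omega> \<partial>M)" by (simp add: mult.commute)
  also have "\<dots> = (\<integral>\<^sup>+\<omega>. (I v \<omega> * mom 1 (tr v \<omega>)) * (I u \<omega> * mom 1 (tr u \<omega>)) \<partial>M)"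
    by (rule cond_mom1) measurable
  finally show ?thesis using False by (simp add: mult.commute)
qed

lemma suminf_if_eq: "(\<Sum>v. if v = u then (f v :: ennreal) else 0) = f u"
  using sums_single[of u f] by (simp add: sums_iff)

lemma integral_tot2:
  "(\<integral>\<^sup>+\<omega>. tot \<omega> ^ 2 \<partial>M) \<le> (\<integral>\<^sup>+\<omega>. pop (mom 2) \<omega> \<partial>M) + (\<integral>\<^sup>+\<omega>. pop (mom 1) \<omega> ^ 2 \<partial>M)"
proof -
  have "(\<integral>\<^sup>+\<omega>. tot \<omega> ^ 2 \<partial>M) = (\<integral>\<^sup>+\<omega>. (\<Sum>u. \<Sum>v. Y u \<omega> * Y v \<omega>) \<partial>M)"
    by (simp add: tot_def power2_eq_square)
  also have "\<dots> = (\<Sum>u. \<Sum>v. \<integral>\<^sup>+\<omega>. Y u \<omega> * Y v \<omega> \<partial>M)"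
    by (simp add: nn_integral_suminf del: ennreal_suminf_cmult ennreal_suminf_multc)
  also have "\<dots> \<le> (\<Sum>u. \<Sum>v. \<integral>\<^sup>+\<omega>. (if v = u then I u \<omega> * mom 2 (tr u \<omega>) else 0)
        + (I u \<omega> * mom 1 (tr u \<omega>)) * (I v \<omega> * mom 1 (tr v \<omega>)) \<partial>M)"
    by (intro suminf_le pair_moment) auto
  also have "\<dots> = (\<integral>\<^sup>+\<omega>. (\<Sum>u. \<Sum>v. (if v = u then I u \<omega> * mom 2 (tr u \<omega>) else 0)
        + (I u \<omega> * mom 1 (tr u \<omega>)) * (I v \<omega> * mom 1 (tr v \<omega>))) \<partial>M)"
    by (simp add: nn_integral_suminf del: ennreal_suminf_cmult ennreal_suminf_multc One_nat_def)
  also have "\<dots> = (\<integral>\<^sup>+\<omega>. pop (mom 2) \<omega> + pop (mom 1) \<omega> ^ 2 \<partial>M)"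
  proof (rule nn_integral_cong)
    fix \<omega>
    have "(\<Sum>v. (if v = u then I u \<omega> * mom 2 (tr u \<omega>) else 0)
        + (I u \<omega> * mom 1 (tr u \<omega>)) * (I v \<omega> * mom 1 (tr v \<omega>)))
       = I u \<omega> * mom 2 (tr u \<omega>) + (I u \<omega> * mom 1 (tr u \<omega>)) * pop (mom 1) \<omega>" for u
      by (subst suminf_add[symmetric]) (auto simp: pop_def suminf_if_eq)
    then show "(\<Sum>u. \<Sum>v. (if v = u then I u \<omega> * mom 2 (tr u \<omega>) else 0)
        + (I u \<omega> * mom 1 (tr u \<omega>)) * (I v \<omega> * mom 1 (tr v \<omega>))) = pop (mom 2) \<omega> + pop (mom 1) \<omega> ^ 2"
      by (simp add: suminf_add[symmetric] power2_eq_square) (simp add: pop_def)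
  qed
  also have "\<dots> = (\<integral>\<^sup>+\<omega>. pop (mom 2) \<omega> \<partial>M) + (\<integral>\<^sup>+\<omega>. pop (mom 1) \<omega> ^ 2 \<partial>M)"
    by (rule nn_integral_add) measurable
  finally show ?thesis .
qed

text \<open>As in \<open>pair_moment\<close>, with one term for each pattern of equalities between the three labels.\<close>

lemma triple_moment:
  "(\<integral>\<^sup>+\<omega>. Y u \<omega> * Y v \<omega> * Y w \<omega> \<partial>M) \<le>
     (\<integral>\<^sup>+\<omega>. (if w = u then if v = u then I u \<omega> * mom 3 (tr u \<omega>) else 0 else 0)
        + (if v = u then I u \<omega> * mom 2 (tr u \<omega>) else 0) * (I w \<omega> * mom 1 (tr w \<omega>))
        + (if w = u then (I u \<omega> * mom 2 (tr u \<omega>)) * (I v \<omega> * mom 1 (tr v \<omega>)) else 0)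
        + (if w = v then (I u \<omega> * mom 1 (tr u \<omega>)) * (I v \<omega> * mom 2 (tr v \<omega>)) else 0)
        + (I u \<omega> * mom 1 (tr u \<omega>)) * (I v \<omega> * mom 1 (tr v \<omega>)) * (I w \<omega> * mom 1 (tr w \<omega>)) \<partial>M)"
    (is "_ \<le> (\<integral>\<^sup>+\<omega>. ?R u v w \<omega> \<partial>M)")
proof -
  define E where "E k u \<omega> = I u \<omega> * mom k (tr u \<omega>)" for k u \<omega>
  have E_others [measurable]: "E k u \<in> borel_measurable (others w)" for k u w
    unfolding E_def[abs_def] by measurable
  have c: "(\<integral>\<^sup>+\<omega>. \<Psi> \<omega> * Y w \<omega> ^ k \<partial>M) = (\<integral>\<^sup>+\<omega>. \<Psi> \<omega> * E k w \<omega> \<partial>M)"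
    if "\<Psi> \<in> borel_measurable (others w)" "0 < k" for \<Psi> w k
    using cond_mom[OF that] by (simp add: E_def)
  have c1: "(\<integral>\<^sup>+\<omega>. \<Psi> \<omega> * Y w \<omega> \<partial>M) = (\<integral>\<^sup>+\<omega>. \<Psi> \<omega> * E 1 w \<omega> \<partial>M)"
    if "\<Psi> \<in> borel_measurable (others w)" for \<Psi> w
    using c[OF that, of 1] by simp
  have two: "(\<integral>\<^sup>+\<omega>. Y u \<omega> ^ 2 * Y v \<omega> \<partial>M) = (\<integral>\<^sup>+\<omega>. E 2 u \<omega> * E 1 v \<omega> \<partial>M)" if "u \<noteq> v" for u v
  proof -
    have [measurable]: "Y u \<in> borel_measurable (others v)" using that by auto
    have "(\<integral>\<^sup>+\<omega>. Y u \<omega> ^ 2 * Y v \<omega> \<partial>M) = (\<integral>\<^sup>+\<omega>. Y u \<omega> ^ 2 * E 1 v \<omega> \<partial>M)"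
      by (rule c1) measurable
    also have "\<dots> = (\<integral>\<^sup>+\<omega>. E 1 v \<omega> * Y u \<omega> ^ 2 \<partial>M)" by (simp add: mult.commute)
    also have "\<dots> = (\<integral>\<^sup>+\<omega>. E 1 v \<omega> * E 2 u \<omega> \<partial>M)" by (rule c) measurable
    finally show ?thesis by (simp add: mult.commute)
  qed
  consider "u = v" "v = w" | "u = v" "v \<noteq> w" | "u = w" "v \<noteq> w" | "v = w" "u \<noteq> v"
    | "u \<noteq> v" "v \<noteq> w" "u \<noteq> w" by blast
  then show ?thesis
  proof cases
    case 1
    have "(\<integral>\<^sup>+\<omega>. Y u \<omega> * Y v \<omega> * Y w \<omega> \<partial>M) = (\<integral>\<^sup>+\<omega>. E 3 u \<omega> \<partial>M)"
      using integral_Y_power[of 3 u] 1 by (simp add: power3_eq_cube E_def)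
    also have "\<dots> \<le> (\<integral>\<^sup>+\<omega>. ?R u v w \<omega> \<partial>M)"
      using 1 by (intro nn_integral_mono) (simp add: E_def add_increasing2 add.assoc)
    finally show ?thesis .
  next
    case 2
    have "(\<integral>\<^sup>+\<omega>. Y u \<omega> * Y v \<omega> * Y w \<omega> \<partial>M) = (\<integral>\<^sup>+\<omega>. E 2 u \<omega> * E 1 w \<omega> \<partial>M)"
      using two[of u w] 2 by (simp add: power2_eq_square)
    also have "\<dots> \<le> (\<integral>\<^sup>+\<omega>. ?R u v w \<omega> \<partial>M)"
      using 2 by (intro nn_integral_mono) (simp add: E_def)
    finally show ?thesis .
  next
    case 3
    have "(\<integral>\<^sup>+\<omega>. Y u \<omega> * Y v \<omega> * Y w \<omega> \<partial>M) = (\<integral>\<^sup>+\<omega>. E 2 u \<omega> * E 1 v \<omega> \<partial>M)"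
      using two[of u v] 3 by (simp add: power2_eq_square mult_ac)
    also have "\<dots> \<le> (\<integral>\<^sup>+\<omega>. ?R u v w \<omega> \<partial>M)"
      using 3 by (intro nn_integral_mono) (auto simp: E_def)
    finally show ?thesis .
  next
    case 4
    have "(\<integral>\<^sup>+\<omega>. Y u \<omega> * Y v \<omega> * Y w \<omega> \<partial>M) = (\<integral>\<^sup>+\<omega>. E 2 v \<omega> * E 1 u \<omega> \<partial>M)"
      using two[of v u] 4 by (simp add: power2_eq_square mult_ac)
    also have "\<dots> \<le> (\<integral>\<^sup>+\<omega>. ?R u v w \<omega> \<partial>M)"
      using 4 by (intro nn_integral_mono) (auto simp: E_def mult.commute)
    finally show ?thesis .
  next
    case 5
    have [measurable]: "Y u \<in> borel_measurable (others v)" "Y u \<in> borel_measurable (others w)"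
      "Y v \<in> borel_measurable (others w)"
      using 5 by auto
    have "(\<integral>\<^sup>+\<omega>. Y u \<omega> * Y v \<omega> * Y w \<omega> \<partial>M) = (\<integral>\<^sup>+\<omega>. Y u \<omega> * Y v \<omega> * E 1 w \<omega> \<partial>M)"
      by (rule c1) measurable
    also have "\<dots> = (\<integral>\<^sup>+\<omega>. Y u \<omega> * E 1 w \<omega> * Y v \<omega> \<partial>M)" by (simp add: mult_ac)
    also have "\<dots> = (\<integral>\<^sup>+\<omega>. Y u \<omega> * E 1 w \<omega> * E 1 v \<omega> \<partial>M)" by (rule c1) measurable
    also have "\<dots> = (\<integral>\<^sup>+\<omega>. E 1 w \<omega> * E 1 v \<omega> * Y u \<omega> \<partial>M)" by (simp add: mult_ac)
    also have "\<dots> = (\<integral>\<^sup>+\<omega>. E 1 w \<omega> * E 1 v \<omega> * E 1 u \<omega> \<partial>M)" by (rule c1) measurable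
    also have "\<dots> \<le> (\<integral>\<^sup>+\<omega>. ?R u v w \<omega> \<partial>M)"
      using 5 by (intro nn_integral_mono) (auto simp: E_def mult_ac)
    finally show ?thesis .
  qed
qed

lemma integral_tot3:
  "(\<integral>\<^sup>+\<omega>. tot \<omega> ^ 3 \<partial>M) \<le> (\<integral>\<^sup>+\<omega>. pop (mom 3) \<omega> \<partial>M)
     + 3 * (\<integral>\<^sup>+\<omega>. pop (mom 2) \<omega> * pop (mom 1) \<omega> \<partial>M) + (\<integral>\<^sup>+\<omega>. pop (mom 1) \<omega> ^ 3 \<partial>M)"
proof -
  define E where "E k u \<omega> = I u \<omega> * mom k (tr u \<omega>)" for k u \<omega>
  have [measurable]: "E k u \<in> borel_measurable M" for k u
    unfolding E_def[abs_def] by measurable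
  have pop: "(\<Sum>u. E k u \<omega>) = pop (mom k) \<omega>" for k \<omega>
    by (simp add: E_def pop_def)
  \<comment> \<open>The three patterns with exactly two equal labels contribute equally.\<close>
  have three: "p + a * b + a * b + b * a + b * b * b = p + 3 * (a * b) + b ^ 3" for p a b :: ennreal
  proof -
    have "3 * (a * b) = (1 + 1 + 1) * (a * b)" by simp
    also have "\<dots> = a * b + a * b + b * a" by (simp only: distrib_right mult_1 mult.commute[of b a])
    finally show ?thesis by (simp only: power3_eq_cube add.assoc)
  qed
  let ?R = "\<lambda>u v w \<omega>. (if w = u then if v = u then E 3 u \<omega> else 0 else 0)
        + (if v = u then E 2 u \<omega> else 0) * E 1 w \<omega>
        + (if w = u then E 2 u \<omega> * E 1 v \<omega> else 0)
        + (if w = v then E 1 u \<omega> * E 2 v \<omega> else 0)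
        + E 1 u \<omega> * E 1 v \<omega> * E 1 w \<omega>"
  have "(\<integral>\<^sup>+\<omega>. tot \<omega> ^ 3 \<partial>M) = (\<integral>\<^sup>+\<omega>. (\<Sum>u. \<Sum>v. \<Sum>w. Y u \<omega> * Y v \<omega> * Y w \<omega>) \<partial>M)"
    by (simp add: tot_def power3_eq_cube)
  also have "\<dots> = (\<Sum>u. \<Sum>v. \<Sum>w. \<integral>\<^sup>+\<omega>. Y u \<omega> * Y v \<omega> * Y w \<omega> \<partial>M)"
    by (simp add: nn_integral_suminf del: ennreal_suminf_cmult ennreal_suminf_multc)
  also have "\<dots> \<le> (\<Sum>u. \<Sum>v. \<Sum>w. \<integral>\<^sup>+\<omega>. ?R u v w \<omega> \<partial>M)"
    unfolding E_def by (intro suminf_le triple_moment summableI)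
  also have "\<dots> = (\<integral>\<^sup>+\<omega>. (\<Sum>u. \<Sum>v. \<Sum>w. ?R u v w \<omega>) \<partial>M)"
    by (simp add: nn_integral_suminf del: ennreal_suminf_cmult ennreal_suminf_multc)
  also have "\<dots> = (\<integral>\<^sup>+\<omega>. pop (mom 3) \<omega> + 3 * (pop (mom 2) \<omega> * pop (mom 1) \<omega>) + pop (mom 1) \<omega> ^ 3 \<partial>M)"
  proof (rule nn_integral_cong)
    fix \<omega>
    have s1: "(\<Sum>w. ?R u v w \<omega>) = (if v = u then E 3 u \<omega> else 0)
        + (if v = u then E 2 u \<omega> else 0) * pop (mom 1) \<omega> + E 2 u \<omega> * E 1 v \<omega> + E 1 u \<omega> * E 2 v \<omega>
        + E 1 u \<omega> * E 1 v \<omega> * pop (mom 1) \<omega>" for u v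
      by (simp only: suminf_add[OF summableI summableI, symmetric] suminf_if_eq ennreal_suminf_cmult pop)
    have s2: "(\<Sum>v. (if v = u then E 3 u \<omega> else 0)
        + (if v = u then E 2 u \<omega> else 0) * pop (mom 1) \<omega> + E 2 u \<omega> * E 1 v \<omega> + E 1 u \<omega> * E 2 v \<omega>
        + E 1 u \<omega> * E 1 v \<omega> * pop (mom 1) \<omega>)
      = E 3 u \<omega> + E 2 u \<omega> * pop (mom 1) \<omega> + E 2 u \<omega> * pop (mom 1) \<omega> + E 1 u \<omega> * pop (mom 2) \<omega>
        + E 1 u \<omega> * pop (mom 1) \<omega> * pop (mom 1) \<omega>" for u
      by (simp only: suminf_add[OF summableI summableI, symmetric] suminf_if_eq ennreal_suminf_cmult ennreal_suminf_multc pop)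
    have s3: "(\<Sum>u. E 3 u \<omega> + E 2 u \<omega> * pop (mom 1) \<omega> + E 2 u \<omega> * pop (mom 1) \<omega> + E 1 u \<omega> * pop (mom 2) \<omega>
        + E 1 u \<omega> * pop (mom 1) \<omega> * pop (mom 1) \<omega>)
      = pop (mom 3) \<omega> + pop (mom 2) \<omega> * pop (mom 1) \<omega> + pop (mom 2) \<omega> * pop (mom 1) \<omega> + pop (mom 1) \<omega> * pop (mom 2) \<omega>
        + pop (mom 1) \<omega> * pop (mom 1) \<omega> * pop (mom 1) \<omega>"
      by (simp only: suminf_add[OF summableI summableI, symmetric] suminf_if_eq ennreal_suminf_cmult ennreal_suminf_multc pop)
    show "(\<Sum>u. \<Sum>v. \<Sum>w. ?R u v w \<omega>)
        = pop (mom 3) \<omega> + 3 * (pop (mom 2) \<omega> * pop (mom 1) \<omega>) + pop (mom 1) \<omega> ^ 3"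
      unfolding s1 s2 s3 by (rule three)
  qed
  also have "\<dots> = (\<integral>\<^sup>+\<omega>. pop (mom 3) \<omega> \<partial>M)
     + 3 * (\<integral>\<^sup>+\<omega>. pop (mom 2) \<omega> * pop (mom 1) \<omega> \<partial>M) + (\<integral>\<^sup>+\<omega>. pop (mom 1) \<omega> ^ 3 \<partial>M)"
    by (subst nn_integral_add, measurable, subst nn_integral_add, measurable, subst nn_integral_cmult, measurable)
  finally show ?thesis .
qed

text \<open>The variance of the sum given the population is at most the sum of the second moments.\<close>

lemma integral_tot_centred:
  assumes fin: "(\<integral>\<^sup>+\<omega>. pop (mom 1) \<omega> ^ 2 \<partial>M) < \<infinity>" and fin2: "(\<integral>\<^sup>+\<omega>. pop (mom 2) \<omega> \<partial>M) < \<infinity>"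
  shows "(\<integral>\<^sup>+\<omega>. ennreal ((enn2real (tot \<omega>) - enn2real (pop (mom 1) \<omega>))\<^sup>2) \<partial>M) \<le> (\<integral>\<^sup>+\<omega>. pop (mom 2) \<omega> \<partial>M)"
proof -
  let ?T = "pop (mom 1)"
  have q: "(\<integral>\<^sup>+\<omega>. tot \<omega> ^ 2 \<partial>M) < \<infinity>"
    using integral_tot2 fin fin2 by (simp add: le_less_trans ennreal_add_eq_top less_top)
  have "AE \<omega> in M. tot \<omega> ^ 2 \<noteq> \<infinity>" "AE \<omega> in M. ?T \<omega> ^ 2 \<noteq> \<infinity>"
    using q fin by (intro nn_integral_noteq_infinite; simp)+
  then have ae: "AE \<omega> in M. ennreal ((enn2real (tot \<omega>) - enn2real (?T \<omega>))\<^sup>2) + 2 * (tot \<omega> * ?T \<omega>) = tot \<omega> ^ 2 + ?T \<omega> ^ 2"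
  proof eventually_elim
    case (elim \<omega>)
    then have "tot \<omega> \<noteq> top" "?T \<omega> \<noteq> top" by (auto simp: power2_eq_square)
    then obtain s t where st: "0 \<le> s" "0 \<le> t" "tot \<omega> = ennreal s" "?T \<omega> = ennreal t"
      by (metis ennreal_cases)
    have "ennreal ((s - t)\<^sup>2) + 2 * (ennreal s * ennreal t) = ennreal ((s - t)\<^sup>2 + 2 * (s * t))"
      using st by (simp add: ennreal_mult ennreal_plus)
    also have "(s - t)\<^sup>2 + 2 * (s * t) = s\<^sup>2 + t\<^sup>2" by (simp add: power2_eq_square algebra_simps)
    also have "ennreal (s\<^sup>2 + t\<^sup>2) = ennreal s ^ 2 + ennreal t ^ 2"
      using st by (simp add: ennreal_power ennreal_plus)
    finally show ?case using st by simp
  qed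
  have "(\<integral>\<^sup>+\<omega>. ennreal ((enn2real (tot \<omega>) - enn2real (?T \<omega>))\<^sup>2) \<partial>M) + 2 * (\<integral>\<^sup>+\<omega>. ?T \<omega> ^ 2 \<partial>M)
     = (\<integral>\<^sup>+\<omega>. ennreal ((enn2real (tot \<omega>) - enn2real (?T \<omega>))\<^sup>2) \<partial>M) + 2 * (\<integral>\<^sup>+\<omega>. tot \<omega> * ?T \<omega> \<partial>M)"
    by (subst integral_tot_pop) (auto simp: power2_eq_square)
  also have "\<dots> = (\<integral>\<^sup>+\<omega>. ennreal ((enn2real (tot \<omega>) - enn2real (?T \<omega>))\<^sup>2) + 2 * (tot \<omega> * ?T \<omega>) \<partial>M)"
    by (subst nn_integral_add) (auto simp: nn_integral_cmult)
  also have "\<dots> = (\<integral>\<^sup>+\<omega>. tot \<omega> ^ 2 + ?T \<omega> ^ 2 \<partial>M)"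
    by (rule nn_integral_cong_AE[OF ae])
  also have "\<dots> = (\<integral>\<^sup>+\<omega>. tot \<omega> ^ 2 \<partial>M) + (\<integral>\<^sup>+\<omega>. ?T \<omega> ^ 2 \<partial>M)"
    by (rule nn_integral_add) measurable
  also have "\<dots> \<le> (\<integral>\<^sup>+\<omega>. pop (mom 2) \<omega> \<partial>M) + 2 * (\<integral>\<^sup>+\<omega>. ?T \<omega> ^ 2 \<partial>M)"
    using add_right_mono[OF integral_tot2, of "\<integral>\<^sup>+\<omega>. ?T \<omega> ^ 2 \<partial>M"] by (simp add: mult_2 add.assoc)
  finally show ?thesis
    using fin by (auto simp: ennreal_add_left_cancel_le add.commute[of _ "2 * _"] ennreal_mult_eq_top_iff)
qed

subsection \<open>Lindeberg replacement for the descendants\<close>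

lemma cond_mom_real_nonneg:
  fixes \<Psi> :: "'w \<Rightarrow> real"
  assumes \<Psi> [measurable]: "\<Psi> \<in> borel_measurable (others w)" and k: "0 < k" and pos: "\<And>\<omega>. 0 \<le> \<Psi> \<omega>"
    and fin: "(\<integral>\<^sup>+\<omega>. ennreal (\<Psi> \<omega>) * (I w \<omega> * mom k (tr w \<omega>)) \<partial>M) < \<infinity>"
    and finY: "AE \<omega> in M. Y w \<omega> < \<infinity>" and finm: "AE \<omega> in M. I w \<omega> * mom k (tr w \<omega>) < \<infinity>"
  shows "integrable M (\<lambda>\<omega>. \<Psi> \<omega> * enn2real (Y w \<omega>) ^ k)"
    and "integrable M (\<lambda>\<omega>. \<Psi> \<omega> * enn2real (I w \<omega> * mom k (tr w \<omega>)))"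
    and "(\<integral>\<omega>. \<Psi> \<omega> * enn2real (Y w \<omega>) ^ k \<partial>M) = (\<integral>\<omega>. \<Psi> \<omega> * enn2real (I w \<omega> * mom k (tr w \<omega>)) \<partial>M)"
proof -
  have [measurable]: "\<Psi> \<in> borel_measurable M" by (rule others_measurable_M[OF \<Psi>])
  have 1: "(\<integral>\<^sup>+\<omega>. ennreal (\<Psi> \<omega> * enn2real (Y w \<omega>) ^ k) \<partial>M) = (\<integral>\<^sup>+\<omega>. ennreal (\<Psi> \<omega>) * Y w \<omega> ^ k \<partial>M)"
    by (rule nn_integral_cong_AE, use finY in eventually_elim)
       (simp add: ennreal_mult pos ennreal_power[symmetric])
  have 2: "(\<integral>\<^sup>+\<omega>. ennreal (\<Psi> \<omega> * enn2real (I w \<omega> * mom k (tr w \<omega>))) \<partial>M)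
      = (\<integral>\<^sup>+\<omega>. ennreal (\<Psi> \<omega>) * (I w \<omega> * mom k (tr w \<omega>)) \<partial>M)"
    by (rule nn_integral_cong_AE, use finm in eventually_elim)
       (simp add: ennreal_mult pos del: enn2real_mult)
  have 3: "(\<integral>\<^sup>+\<omega>. ennreal (\<Psi> \<omega>) * Y w \<omega> ^ k \<partial>M) = (\<integral>\<^sup>+\<omega>. ennreal (\<Psi> \<omega>) * (I w \<omega> * mom k (tr w \<omega>)) \<partial>M)"
    by (rule cond_mom) (use k in measurable)
  show "integrable M (\<lambda>\<omega>. \<Psi> \<omega> * enn2real (Y w \<omega>) ^ k)"
    using fin 1 3 by (intro integrableI_nonneg) (auto simp: pos)
  show "integrable M (\<lambda>\<omega>. \<Psi> \<omega> * enn2real (I w \<omega> * mom k (tr w \<omega>)))"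
    using fin 2 by (intro integrableI_nonneg) (auto simp: pos)
  show "(\<integral>\<omega>. \<Psi> \<omega> * enn2real (Y w \<omega>) ^ k \<partial>M) = (\<integral>\<omega>. \<Psi> \<omega> * enn2real (I w \<omega> * mom k (tr w \<omega>)) \<partial>M)"
    using 1 2 3 by (subst (1 2) integral_eq_nn_integral) (auto simp: pos)
qed

lemma cond_mom_real:
  fixes \<Psi> :: "'w \<Rightarrow> real"
  assumes \<Psi> [measurable]: "\<Psi> \<in> borel_measurable (others w)" and k: "0 < k"
    and fin: "(\<integral>\<^sup>+\<omega>. ennreal \<bar>\<Psi> \<omega>\<bar> * (I w \<omega> * mom k (tr w \<omega>)) \<partial>M) < \<infinity>"
    and finY: "AE \<omega> in M. Y w \<omega> < \<infinity>" and finm: "AE \<omega> in M. I w \<omega> * mom k (tr w \<omega>) < \<infinity>"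
  shows "integrable M (\<lambda>\<omega>. \<Psi> \<omega> * enn2real (Y w \<omega>) ^ k)"
    and "integrable M (\<lambda>\<omega>. \<Psi> \<omega> * enn2real (I w \<omega> * mom k (tr w \<omega>)))"
    and "(\<integral>\<omega>. \<Psi> \<omega> * enn2real (Y w \<omega>) ^ k \<partial>M) = (\<integral>\<omega>. \<Psi> \<omega> * enn2real (I w \<omega> * mom k (tr w \<omega>)) \<partial>M)"
proof -
  have f1: "(\<integral>\<^sup>+\<omega>. ennreal (max 0 (\<Psi> \<omega>)) * (I w \<omega> * mom k (tr w \<omega>)) \<partial>M) < \<infinity>"
    by (rule le_less_trans[OF nn_integral_mono fin]) (auto intro!: mult_right_mono ennreal_leI)
  have f2: "(\<integral>\<^sup>+\<omega>. ennreal (max 0 (- \<Psi> \<omega>)) * (I w \<omega> * mom k (tr w \<omega>)) \<partial>M) < \<infinity>"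
    by (rule le_less_trans[OF nn_integral_mono fin]) (auto intro!: mult_right_mono ennreal_leI)
  note p = cond_mom_real_nonneg[OF _ k _ f1 finY finm]
  note n = cond_mom_real_nonneg[OF _ k _ f2 finY finm]
  have split: "(\<lambda>\<omega>. \<Psi> \<omega> * f \<omega>) = (\<lambda>\<omega>. max 0 (\<Psi> \<omega>) * f \<omega> - max 0 (- \<Psi> \<omega>) * f \<omega>)" for f
    by (rule ext) (simp add: max_def)
  have m: "(\<lambda>\<omega>. max 0 (\<Psi> \<omega>)) \<in> borel_measurable (others w)"
    "(\<lambda>\<omega>. max 0 (- \<Psi> \<omega>)) \<in> borel_measurable (others w)" by measurable
  show "integrable M (\<lambda>\<omega>. \<Psi> \<omega> * enn2real (Y w \<omega>) ^ k)"
    unfolding split using p(1)[OF m(1)] n(1)[OF m(2)] by (intro Bochner_Integration.integrable_diff) auto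
  show "integrable M (\<lambda>\<omega>. \<Psi> \<omega> * enn2real (I w \<omega> * mom k (tr w \<omega>)))"
    unfolding split using p(2)[OF m(1)] n(2)[OF m(2)] by (intro Bochner_Integration.integrable_diff) auto
  show "(\<integral>\<omega>. \<Psi> \<omega> * enn2real (Y w \<omega>) ^ k \<partial>M) = (\<integral>\<omega>. \<Psi> \<omega> * enn2real (I w \<omega> * mom k (tr w \<omega>)) \<partial>M)"
    unfolding split using p[OF m(1)] n[OF m(2)]
    by (subst (1 2) Bochner_Integration.integral_diff) auto
qed

lemma ennreal_le_suminf: "f i \<le> (\<Sum>i. f i :: ennreal)"
  using sum_le_suminf[of f "{i}"] by (simp add: summableI)

lemma sums_enn2real:
  assumes "(\<Sum>i. f i) < (\<infinity> :: ennreal)"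
  shows "(\<lambda>i. enn2real (f i)) sums enn2real (\<Sum>i. f i)"
proof -
  have fi: "f i < \<infinity>" for i
    using ennreal_le_suminf assms by (rule le_less_trans)
  then have e: "f i = ennreal (enn2real (f i))" for i by simp
  have "(\<Sum>i. ennreal (enn2real (f i))) \<noteq> top" using assms e by simp
  then have s: "summable (\<lambda>i. enn2real (f i))"
    by (intro summable_suminf_not_top) auto
  have "(\<Sum>i. f i) = (\<Sum>i. ennreal (enn2real (f i)))" using e by simp
  also have "\<dots> = ennreal (\<Sum>i. enn2real (f i))" by (rule suminf_ennreal2[OF _ s]) simp
  finally have "enn2real (\<Sum>i. f i) = (\<Sum>i. enn2real (f i))" using s by (simp add: suminf_nonneg)
  then show ?thesis using s by (simp add: summable_sums)
qed

lemma abs_diff_cube_le: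
  fixes a b :: real
  assumes "0 \<le> a" "0 \<le> b"
  shows "\<bar>a - b\<bar> ^ 3 \<le> a ^ 3 + b ^ 3"
proof (cases "a \<le> b")
  case True
  then have "\<bar>a - b\<bar> ^ 3 \<le> b ^ 3" using assms by (intro power_mono) auto
  then show ?thesis using assms by (simp add: add_increasing)
next
  case False
  then have "\<bar>a - b\<bar> ^ 3 \<le> a ^ 3" using assms by (intro power_mono) auto
  then show ?thesis using assms by (simp add: add_increasing2)
qed

text \<open>The Lindeberg replacement for \<open>c * (pop h - tot)\<close>, where \<open>h\<close>, \<open>s\<close> are the first two moments of
  \<open>\<kappa>\<close> and \<open>\<beta>\<close> dominates the third moments. The infinite sums are represented by real numbers through
  \<open>enn2real\<close>; they are almost surely finite.\<close>

lemma lindeberg_labelled: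
  fixes h s \<beta> :: "'x \<Rightarrow> real" and c :: real
  assumes F: "F \<in> smooth_tests" and c: "0 \<le> c"
    and [measurable]: "h \<in> borel_measurable X" "s \<in> borel_measurable X" "\<beta> \<in> borel_measurable X"
    and h: "\<And>x. x \<in> space X \<Longrightarrow> 0 \<le> h x" and s: "\<And>x. x \<in> space X \<Longrightarrow> (h x)\<^sup>2 \<le> s x"
    and mom1: "\<And>x. x \<in> space X \<Longrightarrow> mom 1 x = ennreal (h x)"
    and mom2: "\<And>x. x \<in> space X \<Longrightarrow> mom 2 x = ennreal (s x)"
    and mom3: "\<And>x. x \<in> space X \<Longrightarrow> mom 3 x \<le> ennreal (\<beta> x)"
    and h3: "\<And>x. x \<in> space X \<Longrightarrow> h x ^ 3 \<le> \<beta> x"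
    and v3: "\<And>x. x \<in> space X \<Longrightarrow> (s x - (h x)\<^sup>2) * sqrt (s x - (h x)\<^sup>2) \<le> \<beta> x"
    and fin1: "(\<integral>\<^sup>+\<omega>. pop (\<lambda>x. ennreal (h x)) \<omega> \<partial>M) < \<infinity>"
    and fin2: "(\<integral>\<^sup>+\<omega>. pop (\<lambda>x. ennreal (s x)) \<omega> \<partial>M) < \<infinity>"
    and fin3: "(\<integral>\<^sup>+\<omega>. pop (\<lambda>x. ennreal (\<beta> x)) \<omega> \<partial>M) < \<infinity>"
  shows "\<bar>expectation (\<lambda>\<omega>. F (c * (enn2real (pop (\<lambda>x. ennreal (h x)) \<omega>) - enn2real (tot \<omega>))))
      - expectation (\<lambda>\<omega>. gauss_smooth F (c\<^sup>2 * enn2real (pop (\<lambda>x. ennreal (s x - (h x)\<^sup>2)) \<omega>)) 0)\<bar>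
    \<le> c ^ 3 * ((2 + gauss_abs_moment3) / 6) * enn2real (\<integral>\<^sup>+\<omega>. pop (\<lambda>x. ennreal (\<beta> x)) \<omega> \<partial>M)"
proof -
  define J :: "nat \<Rightarrow> 'w \<Rightarrow> real" where "J i \<omega> = indicator (al i) \<omega>" for i \<omega>
  define y where "y i \<omega> = enn2real (Y i \<omega>)" for i \<omega>
  define vr where "vr x = s x - (h x)\<^sup>2" for x
  define b where "b i = (\<integral>\<omega>. J i \<omega> * \<beta> (tr i \<omega>) \<partial>M)" for i
  have [measurable]: "J i \<in> borel_measurable (others w)" "J i \<in> borel_measurable M" for i w
    unfolding J_def[abs_def] by measurable
  have [measurable]: "vr \<in> borel_measurable X" unfolding vr_def[abs_def] by measurable
  have y_others [measurable]: "i \<noteq> w \<Longrightarrow> y i \<in> borel_measurable (others w)"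
    and [measurable]: "y i \<in> borel_measurable M" for i w
    unfolding y_def[abs_def] by measurable
  have J_space: "J i \<omega> = 0 \<or> (J i \<omega> = 1 \<and> \<omega> \<in> space M)" for i \<omega>
    using sets.sets_into_space[OF al, of i] by (auto simp: J_def indicator_def)
  have J2: "J i \<omega> * J i \<omega> = J i \<omega>" for i \<omega> using J_space[of i \<omega>] by auto
  have Jy: "J i \<omega> * y i \<omega> = y i \<omega>" for i \<omega>
    using dead_Y[of \<omega> i] by (auto simp: J_def y_def indicator_def)
  have I_J: "I i \<omega> * ennreal (f (tr i \<omega>)) = ennreal (J i \<omega> * f (tr i \<omega>))" for i \<omega> and f :: "'x \<Rightarrow> real"
    by (simp add: J_def indicator_def)
  have s0: "0 \<le> s x" if "x \<in> space X" for x using s[OF that] by (rule order_trans[rotated]) simp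
  have \<beta>0: "0 \<le> \<beta> x" if "x \<in> space X" for x
    using order_trans[OF zero_le_power[OF h[OF that], of 3] h3[OF that]] .
  have vr0: "0 \<le> vr x" if "x \<in> space X" for x using s[OF that] by (simp add: vr_def)
  have J_nonneg: "0 \<le> J i \<omega> * f (tr i \<omega>)" if "\<And>x. x \<in> space X \<Longrightarrow> 0 \<le> f x" for i \<omega> and f :: "'x \<Rightarrow> real"
    using J_space[of i \<omega>] that[OF tr_space, of \<omega> i] by auto
  have pop_i: "(\<integral>\<^sup>+\<omega>. ennreal (J i \<omega> * f (tr i \<omega>)) \<partial>M) < \<infinity>"
    if "(\<integral>\<^sup>+\<omega>. pop (\<lambda>x. ennreal (f x)) \<omega> \<partial>M) < \<infinity>" for i and f :: "'x \<Rightarrow> real"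
  proof (rule le_less_trans[OF nn_integral_mono that])
    fix \<omega>
    show "ennreal (J i \<omega> * f (tr i \<omega>)) \<le> pop (\<lambda>x. ennreal (f x)) \<omega>"
      unfolding pop_def I_J[symmetric]
      by (rule ennreal_le_suminf)
  qed
  have int_J: "integrable M (\<lambda>\<omega>. J i \<omega> * f (tr i \<omega>))"
    if "(\<integral>\<^sup>+\<omega>. pop (\<lambda>x. ennreal (f x)) \<omega> \<partial>M) < \<infinity>" "\<And>x. x \<in> space X \<Longrightarrow> 0 \<le> f x"
      and [measurable]: "f \<in> borel_measurable X" for i and f :: "'x \<Rightarrow> real"
  proof (intro integrableI_nonneg AE_I2 pop_i[OF that(1)])
    show "0 \<le> J i \<omega> * f (tr i \<omega>)" for \<omega> by (rule J_nonneg) (rule that(2))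
  qed measurable
  have m1: "I i \<omega> * mom 1 (tr i \<omega>) = ennreal (J i \<omega> * h (tr i \<omega>))"
    and m2: "I i \<omega> * mom 2 (tr i \<omega>) = ennreal (J i \<omega> * s (tr i \<omega>))"
    and m3: "I i \<omega> * mom 3 (tr i \<omega>) \<le> ennreal (J i \<omega> * \<beta> (tr i \<omega>))" if "\<omega> \<in> space M" for i \<omega>
    using mom1[OF tr_space[OF that], of i] mom2[OF tr_space[OF that], of i] mom3[OF tr_space[OF that], of i]
    unfolding I_J[symmetric] by (auto intro: mult_left_mono)
  have Y_fin: "AE \<omega> in M. Y i \<omega> < \<infinity>" for i
  proof -
    have "(\<integral>\<^sup>+\<omega>. Y i \<omega> \<partial>M) = (\<integral>\<^sup>+\<omega>. ennreal (J i \<omega> * h (tr i \<omega>)) \<partial>M)"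
      using integral_Y_power[of 1 i] m1 by (simp cong: nn_integral_cong)
    then have "(\<integral>\<^sup>+\<omega>. Y i \<omega> \<partial>M) \<noteq> \<infinity>" using pop_i[OF fin1, of i] by simp
    then show ?thesis using nn_integral_noteq_infinite[of "Y i" M] by (simp add: less_top)
  qed
  have e1: "enn2real (I i \<omega> * mom 1 (tr i \<omega>)) = J i \<omega> * h (tr i \<omega>)" if "\<omega> \<in> space M" for i \<omega>
    unfolding m1[OF that] by (rule enn2real_ennreal, rule J_nonneg, rule h)
  have e2: "enn2real (I i \<omega> * mom 2 (tr i \<omega>)) = J i \<omega> * s (tr i \<omega>)" if "\<omega> \<in> space M" for i \<omega>
    unfolding m2[OF that] by (rule enn2real_ennreal, rule J_nonneg, rule s0)
  \<comment> \<open>Real-valued forms of the conditional moments, with signed weights measurable with respect to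
    the other individuals.\<close>
  have c1: "integrable M (\<lambda>\<omega>. \<Psi> \<omega> * y i \<omega>)"
      "(\<integral>\<omega>. \<Psi> \<omega> * y i \<omega> \<partial>M) = (\<integral>\<omega>. \<Psi> \<omega> * (J i \<omega> * h (tr i \<omega>)) \<partial>M)"
    if \<Psi>: "\<Psi> \<in> borel_measurable (others i)" and
      fin: "(\<integral>\<^sup>+\<omega>. ennreal \<bar>\<Psi> \<omega>\<bar> * ennreal (J i \<omega> * h (tr i \<omega>)) \<partial>M) < \<infinity>" for \<Psi> i
  proof -
    have f: "(\<integral>\<^sup>+\<omega>. ennreal \<bar>\<Psi> \<omega>\<bar> * (I i \<omega> * mom 1 (tr i \<omega>)) \<partial>M) < \<infinity>"
      using fin m1 by (simp cong: nn_integral_cong)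
    have g: "AE \<omega> in M. I i \<omega> * mom 1 (tr i \<omega>) < \<infinity>" by (rule AE_I2) (simp only: m1, simp)
    note c = cond_mom_real[OF \<Psi> _ f Y_fin g]
    show "integrable M (\<lambda>\<omega>. \<Psi> \<omega> * y i \<omega>)" using c(1) by (simp add: y_def)
    show "(\<integral>\<omega>. \<Psi> \<omega> * y i \<omega> \<partial>M) = (\<integral>\<omega>. \<Psi> \<omega> * (J i \<omega> * h (tr i \<omega>)) \<partial>M)"
      using c(3) e1 by (simp add: y_def cong: Bochner_Integration.integral_cong)
  qed
  have c2: "integrable M (\<lambda>\<omega>. \<Psi> \<omega> * (y i \<omega>)\<^sup>2)"
      "(\<integral>\<omega>. \<Psi> \<omega> * (y i \<omega>)\<^sup>2 \<partial>M) = (\<integral>\<omega>. \<Psi> \<omega> * (J i \<omega> * s (tr i \<omega>)) \<partial>M)"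
    if \<Psi>: "\<Psi> \<in> borel_measurable (others i)" and
      fin: "(\<integral>\<^sup>+\<omega>. ennreal \<bar>\<Psi> \<omega>\<bar> * ennreal (J i \<omega> * s (tr i \<omega>)) \<partial>M) < \<infinity>" for \<Psi> i
  proof -
    have f: "(\<integral>\<^sup>+\<omega>. ennreal \<bar>\<Psi> \<omega>\<bar> * (I i \<omega> * mom 2 (tr i \<omega>)) \<partial>M) < \<infinity>"
      using fin m2 by (simp cong: nn_integral_cong)
    have g: "AE \<omega> in M. I i \<omega> * mom 2 (tr i \<omega>) < \<infinity>" by (rule AE_I2) (simp only: m2, simp)
    note c = cond_mom_real[OF \<Psi> _ f Y_fin g]
    show "integrable M (\<lambda>\<omega>. \<Psi> \<omega> * (y i \<omega>)\<^sup>2)" using c(1) by (simp add: y_def)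
    show "(\<integral>\<omega>. \<Psi> \<omega> * (y i \<omega>)\<^sup>2 \<partial>M) = (\<integral>\<omega>. \<Psi> \<omega> * (J i \<omega> * s (tr i \<omega>)) \<partial>M)"
      using c(3) e2 by (simp add: y_def cong: Bochner_Integration.integral_cong)
  qed
  have bounded_fin: "(\<integral>\<^sup>+\<omega>. ennreal \<bar>\<Psi> \<omega>\<bar> * ennreal (J i \<omega> * f (tr i \<omega>)) \<partial>M) < \<infinity>"
    if b: "\<forall>\<omega>. \<bar>\<Psi> \<omega>\<bar> \<le> 1" and f: "(\<integral>\<^sup>+\<omega>. pop (\<lambda>x. ennreal (f x)) \<omega> \<partial>M) < \<infinity>" for \<Psi> i and f :: "'x \<Rightarrow> real"
  proof (rule le_less_trans[OF nn_integral_mono pop_i[OF f, of i]])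
    fix \<omega>
    have "ennreal \<bar>\<Psi> \<omega>\<bar> * ennreal (J i \<omega> * f (tr i \<omega>)) \<le> 1 * ennreal (J i \<omega> * f (tr i \<omega>))"
      using b by (intro mult_right_mono) auto
    then show "ennreal \<bar>\<Psi> \<omega>\<bar> * ennreal (J i \<omega> * f (tr i \<omega>)) \<le> ennreal (J i \<omega> * f (tr i \<omega>))" by simp
  qed
  have int_bJ: "integrable M (\<lambda>\<omega>. \<Psi> \<omega> * (J i \<omega> * f (tr i \<omega>)))"
    if [measurable]: "\<Psi> \<in> borel_measurable M" and b: "\<forall>\<omega>. \<bar>\<Psi> \<omega>\<bar> \<le> 1"
      and f: "integrable M (\<lambda>\<omega>. J i \<omega> * f (tr i \<omega>))" for \<Psi> i and f :: "'x \<Rightarrow> real"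
  proof (rule Bochner_Integration.integrable_bound[OF f])
    show "(\<lambda>\<omega>. \<Psi> \<omega> * (J i \<omega> * f (tr i \<omega>))) \<in> borel_measurable M"
      by (rule borel_measurable_times[OF that(1) borel_measurable_integrable[OF f]])
    show "AE \<omega> in M. norm (\<Psi> \<omega> * (J i \<omega> * f (tr i \<omega>))) \<le> norm (J i \<omega> * f (tr i \<omega>))"
      unfolding real_norm_def by (intro AE_I2 abs_mult_le_of_le_one b[rule_format])
  qed
  have h2fin: "(\<integral>\<^sup>+\<omega>. pop (\<lambda>x. ennreal ((h x)\<^sup>2)) \<omega> \<partial>M) < \<infinity>"
  proof (rule le_less_trans[OF nn_integral_mono fin2])
    fix \<omega> assume "\<omega> \<in> space M"
    then show "pop (\<lambda>x. ennreal ((h x)\<^sup>2)) \<omega> \<le> pop (\<lambda>x. ennreal (s x)) \<omega>"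
      unfolding pop_def by (intro suminf_le mult_left_mono ennreal_leI s summableI) auto
  qed
  define \<xi> where "\<xi> i \<omega> = c * (J i \<omega> * h (tr i \<omega>) - y i \<omega>)" for i \<omega>
  define v where "v i \<omega> = c\<^sup>2 * (J i \<omega> * vr (tr i \<omega>))" for i \<omega>
  have \<xi>_M [measurable]: "\<xi> i \<in> borel_measurable M" for i unfolding \<xi>_def[abs_def] by measurable
  have v_nonneg: "0 \<le> v i \<omega>" for i \<omega> unfolding v_def by (intro mult_nonneg_nonneg J_nonneg vr0) auto
  have int_b: "integrable M (\<lambda>\<omega>. J i \<omega> * \<beta> (tr i \<omega>))" for i
    by (rule int_J[OF fin3 \<beta>0]) auto
  have y3: "integrable M (\<lambda>\<omega>. (y i \<omega>) ^ 3)" "(\<integral>\<omega>. (y i \<omega>) ^ 3 \<partial>M) \<le> b i" for i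
  proof -
    have "(\<integral>\<^sup>+\<omega>. ennreal ((y i \<omega>) ^ 3) \<partial>M) = (\<integral>\<^sup>+\<omega>. Y i \<omega> ^ 3 \<partial>M)"
      by (rule nn_integral_cong_AE, use Y_fin[of i] in eventually_elim)
         (simp add: y_def ennreal_power[symmetric])
    also have "\<dots> = (\<integral>\<^sup>+\<omega>. I i \<omega> * mom 3 (tr i \<omega>) \<partial>M)" by (rule integral_Y_power) simp
    also have "\<dots> \<le> (\<integral>\<^sup>+\<omega>. ennreal (J i \<omega> * \<beta> (tr i \<omega>)) \<partial>M)" by (intro nn_integral_mono m3)
    also have "\<dots> = ennreal (b i)"
      unfolding b_def by (rule nn_integral_eq_integral[OF int_b]) (simp add: J_nonneg \<beta>0)
    finally have le: "(\<integral>\<^sup>+\<omega>. ennreal ((y i \<omega>) ^ 3) \<partial>M) \<le> ennreal (b i)" .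
    show i: "integrable M (\<lambda>\<omega>. (y i \<omega>) ^ 3)"
      using le by (intro integrableI_nonneg) (auto simp: y_def intro: le_less_trans)
    have "0 \<le> b i" unfolding b_def by (intro Bochner_Integration.integral_nonneg J_nonneg \<beta>0)
    moreover have "ennreal (\<integral>\<omega>. (y i \<omega>) ^ 3 \<partial>M) \<le> ennreal (b i)"
      using le by (subst nn_integral_eq_integral[OF i, symmetric]) (auto simp: y_def)
    ultimately show "(\<integral>\<omega>. (y i \<omega>) ^ 3 \<partial>M) \<le> b i" by (simp add: ennreal_le_iff)
  qed
  have \<xi>3: "\<bar>\<xi> i \<omega>\<bar> ^ 3 \<le> c ^ 3 * (J i \<omega> * \<beta> (tr i \<omega>) + (y i \<omega>) ^ 3)" for i \<omega>
  proof -
    have "\<bar>J i \<omega> * h (tr i \<omega>) - y i \<omega>\<bar> ^ 3 \<le> (J i \<omega> * h (tr i \<omega>)) ^ 3 + (y i \<omega>) ^ 3"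
      by (rule abs_diff_cube_le) (auto intro: J_nonneg h simp: y_def)
    also have "(J i \<omega> * h (tr i \<omega>)) ^ 3 \<le> J i \<omega> * \<beta> (tr i \<omega>)"
      using J_space[of i \<omega>] h3[OF tr_space, of \<omega> i] by auto
    finally have "c ^ 3 * \<bar>J i \<omega> * h (tr i \<omega>) - y i \<omega>\<bar> ^ 3 \<le> c ^ 3 * (J i \<omega> * \<beta> (tr i \<omega>) + (y i \<omega>) ^ 3)"
      using c by (intro mult_left_mono) auto
    then show ?thesis using c by (simp add: \<xi>_def abs_mult power_mult_distrib)
  qed
  have \<xi>3_int: "integrable M (\<lambda>\<omega>. \<bar>\<xi> i \<omega>\<bar> ^ 3)" for i
  proof (rule Bochner_Integration.integrable_bound)
    show "integrable M (\<lambda>\<omega>. c ^ 3 * (J i \<omega> * \<beta> (tr i \<omega>) + (y i \<omega>) ^ 3))"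
      using int_b y3 by auto
    show "AE \<omega> in M. norm (\<bar>\<xi> i \<omega>\<bar> ^ 3) \<le> norm (c ^ 3 * (J i \<omega> * \<beta> (tr i \<omega>) + (y i \<omega>) ^ 3))"
      using order_trans[OF \<xi>3 abs_ge_self] by (intro AE_I2) (simp only: real_norm_def power_abs abs_idempotent)
  qed measurable
  have \<xi>3_le: "expectation (\<lambda>\<omega>. \<bar>\<xi> i \<omega>\<bar> ^ 3) \<le> c ^ 3 * (2 * b i)" for i
  proof -
    have "expectation (\<lambda>\<omega>. \<bar>\<xi> i \<omega>\<bar> ^ 3) \<le> expectation (\<lambda>\<omega>. c ^ 3 * (J i \<omega> * \<beta> (tr i \<omega>) + (y i \<omega>) ^ 3))"
      by (intro integral_mono \<xi>3_int \<xi>3) (use int_b y3 in auto)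
    also have "\<dots> = c ^ 3 * (b i + (\<integral>\<omega>. (y i \<omega>) ^ 3 \<partial>M))" using int_b y3 by (simp add: b_def)
    also have "\<dots> \<le> c ^ 3 * (2 * b i)" using y3(2)[of i] c by (intro mult_left_mono) auto
    finally show ?thesis .
  qed
  have vs: "v i \<omega> * sqrt (v i \<omega>) \<le> c ^ 3 * (J i \<omega> * \<beta> (tr i \<omega>))" for i \<omega>
  proof -
    have "v i \<omega> * sqrt (v i \<omega>) = c ^ 3 * ((J i \<omega> * vr (tr i \<omega>)) * sqrt (J i \<omega> * vr (tr i \<omega>)))"
      using c by (simp add: v_def real_sqrt_mult power3_eq_cube power2_eq_square)
    also have "(J i \<omega> * vr (tr i \<omega>)) * sqrt (J i \<omega> * vr (tr i \<omega>)) \<le> J i \<omega> * \<beta> (tr i \<omega>)"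
      using J_space[of i \<omega>] v3[OF tr_space, of \<omega> i] by (auto simp: vr_def)
    finally show ?thesis using c by (simp add: mult_left_mono)
  qed
  have vs0: "0 \<le> v i \<omega> * sqrt (v i \<omega>)" for i \<omega> using v_nonneg by simp
  have [measurable]: "v i \<in> borel_measurable M" for i unfolding v_def[abs_def] by measurable
  have vs_int: "integrable M (\<lambda>\<omega>. v i \<omega> * sqrt (v i \<omega>))" for i
  proof (rule Bochner_Integration.integrable_bound)
    show "integrable M (\<lambda>\<omega>. c ^ 3 * (J i \<omega> * \<beta> (tr i \<omega>)))" using int_b by auto
    show "AE \<omega> in M. norm (v i \<omega> * sqrt (v i \<omega>)) \<le> norm (c ^ 3 * (J i \<omega> * \<beta> (tr i \<omega>)))"
      using order_trans[OF vs abs_ge_self] vs0 by (intro AE_I2) (simp only: real_norm_def abs_of_nonneg)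
  qed measurable
  have vs_le: "expectation (\<lambda>\<omega>. v i \<omega> * sqrt (v i \<omega>)) \<le> c ^ 3 * b i" for i
  proof -
    have "expectation (\<lambda>\<omega>. v i \<omega> * sqrt (v i \<omega>)) \<le> expectation (\<lambda>\<omega>. c ^ 3 * (J i \<omega> * \<beta> (tr i \<omega>)))"
      by (intro integral_mono vs_int vs) (use int_b in auto)
    then show ?thesis by (simp add: b_def)
  qed
  have sum_b: "(\<Sum>i<n. b i) \<le> enn2real (\<integral>\<^sup>+\<omega>. pop (\<lambda>x. ennreal (\<beta> x)) \<omega> \<partial>M)" for n
  proof -
    have b0: "0 \<le> b i" for i unfolding b_def by (intro Bochner_Integration.integral_nonneg J_nonneg \<beta>0)
    have "ennreal (\<Sum>i<n. b i) = (\<Sum>i<n. \<integral>\<^sup>+\<omega>. ennreal (J i \<omega> * \<beta> (tr i \<omega>)) \<partial>M)"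
      unfolding sum_ennreal[OF b0, symmetric]
      by (rule sum.cong[OF refl], unfold b_def, rule nn_integral_eq_integral[OF int_b, symmetric])
         (simp add: J_nonneg \<beta>0)
    also have "\<dots> = (\<integral>\<^sup>+\<omega>. (\<Sum>i<n. I i \<omega> * ennreal (\<beta> (tr i \<omega>))) \<partial>M)"
      unfolding I_J by (rule nn_integral_sum[symmetric]) measurable
    also have "\<dots> \<le> (\<integral>\<^sup>+\<omega>. pop (\<lambda>x. ennreal (\<beta> x)) \<omega> \<partial>M)"
      unfolding pop_def by (intro nn_integral_mono sum_le_suminf) (auto simp: summableI)
    finally have "enn2real (ennreal (\<Sum>i<n. b i)) \<le> enn2real (\<integral>\<^sup>+\<omega>. pop (\<lambda>x. ennreal (\<beta> x)) \<omega> \<partial>M)"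
      using fin3 by (intro enn2real_mono) auto
    then show ?thesis using b0 by (simp add: sum_nonneg)
  qed
  have pop_sums: "AE \<omega> in M. (\<lambda>i. J i \<omega> * f (tr i \<omega>)) sums enn2real (pop (\<lambda>x. ennreal (f x)) \<omega>)"
    if f: "(\<integral>\<^sup>+\<omega>. pop (\<lambda>x. ennreal (f x)) \<omega> \<partial>M) < \<infinity>" "\<And>x. x \<in> space X \<Longrightarrow> 0 \<le> f x"
      and [measurable]: "f \<in> borel_measurable X" for f :: "'x \<Rightarrow> real"
  proof -
    have "AE \<omega> in M. pop (\<lambda>x. ennreal (f x)) \<omega> \<noteq> \<infinity>"
      by (rule nn_integral_noteq_infinite) (use f in auto)
    then show ?thesis
    proof eventually_elim
      case (elim \<omega>)
      then have fin: "(\<Sum>i. ennreal (J i \<omega> * f (tr i \<omega>))) < \<infinity>"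
        by (simp add: pop_def I_J less_top)
      have nn: "0 \<le> J i \<omega> * f (tr i \<omega>)" for i by (rule J_nonneg) (rule f(2))
      from sums_enn2real[OF fin] show ?case
        by (simp add: pop_def I_J nn)
    qed
  qed
  have tot_sums: "AE \<omega> in M. (\<lambda>i. y i \<omega>) sums enn2real (tot \<omega>)"
  proof -
    have "(\<integral>\<^sup>+\<omega>. tot \<omega> \<partial>M) = (\<integral>\<^sup>+\<omega>. pop (\<lambda>x. ennreal (h x)) \<omega> \<partial>M)"
      unfolding integral_tot
      by (rule nn_integral_cong) (use mom1 tr_space in \<open>auto simp: pop_def\<close>)
    then have "AE \<omega> in M. tot \<omega> \<noteq> \<infinity>"
      using fin1 by (intro nn_integral_noteq_infinite) auto
    then show ?thesis
      by eventually_elim (use sums_enn2real in \<open>simp add: tot_def y_def less_top\<close>)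
  qed
  have vfin: "(\<integral>\<^sup>+\<omega>. pop (\<lambda>x. ennreal (vr x)) \<omega> \<partial>M) < \<infinity>"
  proof (rule le_less_trans[OF nn_integral_mono fin2])
    fix \<omega> assume "\<omega> \<in> space M"
    then show "pop (\<lambda>x. ennreal (vr x)) \<omega> \<le> pop (\<lambda>x. ennreal (s x)) \<omega>"
      unfolding pop_def vr_def by (intro suminf_le mult_left_mono ennreal_leI summableI) auto
  qed
  have int_h: "integrable M (\<lambda>\<omega>. J i \<omega> * h (tr i \<omega>))"
    and int_s: "integrable M (\<lambda>\<omega>. J i \<omega> * s (tr i \<omega>))"
    and int_h2: "integrable M (\<lambda>\<omega>. J i \<omega> * (h (tr i \<omega>))\<^sup>2)"
    and int_vr: "integrable M (\<lambda>\<omega>. J i \<omega> * vr (tr i \<omega>))" for i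
    by (rule int_J[OF fin1 h] int_J[OF fin2 s0] int_J[OF h2fin] int_J[OF vfin vr0]; simp)+
  have "\<bar>expectation (\<lambda>\<omega>. F (c * (enn2real (pop (\<lambda>x. ennreal (h x)) \<omega>) - enn2real (tot \<omega>))))
      - expectation (\<lambda>\<omega>. gauss_smooth F (c\<^sup>2 * enn2real (pop (\<lambda>x. ennreal (vr x)) \<omega>)) 0)\<bar>
    \<le> c ^ 3 * ((2 + gauss_abs_moment3) / 6) * enn2real (\<integral>\<^sup>+\<omega>. pop (\<lambda>x. ennreal (\<beta> x)) \<omega> \<partial>M)"
  proof (rule lindeberg_series[where G = others and \<xi> = \<xi> and v = v])
    show "F \<in> smooth_tests" by (rule F)
    show "subalgebra M (others i)" for i by (rule subalgebra_others)
    show "\<xi> j \<in> borel_measurable (others i)" if "j < i" for i j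
    proof -
      have [measurable]: "y j \<in> borel_measurable (others i)" using that by (intro y_others) auto
      show ?thesis unfolding \<xi>_def[abs_def] by measurable
    qed
    show "v j \<in> borel_measurable (others i)" for i j
      unfolding v_def[abs_def] by measurable
    show "0 \<le> v i \<omega>" for i \<omega> by (rule v_nonneg)
    show "(\<integral>\<omega>. \<Psi> \<omega> * \<xi> i \<omega> \<partial>M) = 0"
      if \<Psi>: "\<Psi> \<in> borel_measurable (others i)" "\<And>\<omega>. \<bar>\<Psi> \<omega>\<bar> \<le> 1" for i \<Psi>
    proof -
      note \<Psi>M = others_measurable_M[OF \<Psi>(1)]
      have \<Psi>1: "\<forall>\<omega>. \<bar>\<Psi> \<omega>\<bar> \<le> 1" using \<Psi>(2) by blast
      have e: "(\<lambda>\<omega>. \<Psi> \<omega> * \<xi> i \<omega>) = (\<lambda>\<omega>. c * (\<Psi> \<omega> * (J i \<omega> * h (tr i \<omega>)) - \<Psi> \<omega> * y i \<omega>))"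
        by (rule ext) (simp add: \<xi>_def algebra_simps)
      show ?thesis
        unfolding e using c1[OF \<Psi>(1) bounded_fin[OF \<Psi>1 fin1]] int_bJ[OF \<Psi>M \<Psi>1 int_h] by simp
    qed
    show "(\<integral>\<omega>. \<Psi> \<omega> * ((\<xi> i \<omega>)\<^sup>2 - v i \<omega>) \<partial>M) = 0"
      if \<Psi>: "\<Psi> \<in> borel_measurable (others i)" "\<And>\<omega>. \<bar>\<Psi> \<omega>\<bar> \<le> 1" for i \<Psi>
    proof -
      note [measurable] = \<Psi>(1)
      note \<Psi>M = others_measurable_M[OF \<Psi>(1)]
      have \<Psi>1: "\<forall>\<omega>. \<bar>\<Psi> \<omega>\<bar> \<le> 1" using \<Psi>(2) by blast
      have alg: "(a * hh - z)\<^sup>2 - a * (ss - hh\<^sup>2) = 2 * (a * hh\<^sup>2) - 2 * (a * hh * z) + z\<^sup>2 - a * ss"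
        if "a * a = a" "a * z = z" for a hh ss z :: real
      proof -
        have "(a * hh - z)\<^sup>2 = (a * a) * hh\<^sup>2 - 2 * (a * hh * z) + z\<^sup>2"
          by (simp add: power2_eq_square algebra_simps)
        then show ?thesis using that by (simp add: algebra_simps)
      qed
      have e: "(\<lambda>\<omega>. \<Psi> \<omega> * ((\<xi> i \<omega>)\<^sup>2 - v i \<omega>)) = (\<lambda>\<omega>. c\<^sup>2 * (2 * (\<Psi> \<omega> * (J i \<omega> * (h (tr i \<omega>))\<^sup>2))
          - 2 * ((\<Psi> \<omega> * (J i \<omega> * h (tr i \<omega>))) * y i \<omega>)
          + \<Psi> \<omega> * (y i \<omega>)\<^sup>2 - \<Psi> \<omega> * (J i \<omega> * s (tr i \<omega>))))"
      proof
        fix \<omega>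
        have "(\<xi> i \<omega>)\<^sup>2 - v i \<omega> = c\<^sup>2 * ((J i \<omega> * h (tr i \<omega>) - y i \<omega>)\<^sup>2
            - J i \<omega> * (s (tr i \<omega>) - (h (tr i \<omega>))\<^sup>2))"
          by (simp only: \<xi>_def v_def vr_def power_mult_distrib right_diff_distrib[of "c\<^sup>2"])
        also have "\<dots> = c\<^sup>2 * (2 * (J i \<omega> * (h (tr i \<omega>))\<^sup>2) - 2 * (J i \<omega> * h (tr i \<omega>) * y i \<omega>)
            + (y i \<omega>)\<^sup>2 - J i \<omega> * s (tr i \<omega>))"
          unfolding alg[OF J2 Jy] ..
        finally have z: "(\<xi> i \<omega>)\<^sup>2 - v i \<omega> = c\<^sup>2 * (2 * (J i \<omega> * (h (tr i \<omega>))\<^sup>2) - 2 * (J i \<omega> * h (tr i \<omega>) * y i \<omega>)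
            + (y i \<omega>)\<^sup>2 - J i \<omega> * s (tr i \<omega>))" .
        show "\<Psi> \<omega> * ((\<xi> i \<omega>)\<^sup>2 - v i \<omega>) = c\<^sup>2 * (2 * (\<Psi> \<omega> * (J i \<omega> * (h (tr i \<omega>))\<^sup>2))
          - 2 * ((\<Psi> \<omega> * (J i \<omega> * h (tr i \<omega>))) * y i \<omega>)
          + \<Psi> \<omega> * (y i \<omega>)\<^sup>2 - \<Psi> \<omega> * (J i \<omega> * s (tr i \<omega>)))"
          unfolding z by (simp add: algebra_simps)
      qed
      have \<Psi>'m: "(\<lambda>\<omega>. \<Psi> \<omega> * (J i \<omega> * h (tr i \<omega>))) \<in> borel_measurable (others i)" by measurable
      have \<Psi>'f: "(\<integral>\<^sup>+\<omega>. ennreal \<bar>\<Psi> \<omega> * (J i \<omega> * h (tr i \<omega>))\<bar> * ennreal (J i \<omega> * h (tr i \<omega>)) \<partial>M) < \<infinity>"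
      proof (rule le_less_trans[OF nn_integral_mono])
        show "(\<integral>\<^sup>+\<omega>. ennreal \<bar>\<Psi> \<omega>\<bar> * ennreal (J i \<omega> * (h (tr i \<omega>))\<^sup>2) \<partial>M) < \<infinity>"
          by (rule bounded_fin[OF \<Psi>1]) (rule h2fin)
        fix \<omega>
        have Jh: "0 \<le> J i \<omega> * h (tr i \<omega>)" by (rule J_nonneg) (rule h)
        have "ennreal \<bar>\<Psi> \<omega> * (J i \<omega> * h (tr i \<omega>))\<bar> * ennreal (J i \<omega> * h (tr i \<omega>))
           = ennreal (\<bar>\<Psi> \<omega>\<bar> * (J i \<omega> * (h (tr i \<omega>))\<^sup>2))"
          using Jh J_space[of i \<omega>]
          by (subst ennreal_mult[symmetric]) (auto simp: abs_mult power2_eq_square mult_ac)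
        also have "\<dots> = ennreal \<bar>\<Psi> \<omega>\<bar> * ennreal (J i \<omega> * (h (tr i \<omega>))\<^sup>2)"
          using J_space[of i \<omega>] by (intro ennreal_mult) auto
        finally show "ennreal \<bar>\<Psi> \<omega> * (J i \<omega> * h (tr i \<omega>))\<bar> * ennreal (J i \<omega> * h (tr i \<omega>))
           \<le> ennreal \<bar>\<Psi> \<omega>\<bar> * ennreal (J i \<omega> * (h (tr i \<omega>))\<^sup>2)" by simp
      qed
      have k: "(\<integral>\<omega>. (\<Psi> \<omega> * (J i \<omega> * h (tr i \<omega>))) * y i \<omega> \<partial>M) = (\<integral>\<omega>. \<Psi> \<omega> * (J i \<omega> * (h (tr i \<omega>))\<^sup>2) \<partial>M)"
        unfolding c1(2)[OF \<Psi>'m \<Psi>'f]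
      proof (rule Bochner_Integration.integral_cong[OF refl])
        fix \<omega>
        show "\<Psi> \<omega> * (J i \<omega> * h (tr i \<omega>)) * (J i \<omega> * h (tr i \<omega>)) = \<Psi> \<omega> * (J i \<omega> * (h (tr i \<omega>))\<^sup>2)"
          using J_space[of i \<omega>] by (auto simp: power2_eq_square)
      qed
      show ?thesis
        unfolding e
        using c1(1)[OF \<Psi>'m \<Psi>'f] k c2[OF \<Psi>(1) bounded_fin[OF \<Psi>1 fin2]]
          int_bJ[OF \<Psi>M \<Psi>1 int_h2] int_bJ[OF \<Psi>M \<Psi>1 int_s]
        by simp
    qed
    show "integrable M (\<lambda>\<omega>. \<bar>\<xi> i \<omega>\<bar> ^ 3)" for i by (rule \<xi>3_int)
    show "integrable M (\<lambda>\<omega>. v i \<omega> * sqrt (v i \<omega>))" for i by (rule vs_int)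
    show "AE \<omega> in M. (\<lambda>i. \<xi> i \<omega>) sums (c * (enn2real (pop (\<lambda>x. ennreal (h x)) \<omega>) - enn2real (tot \<omega>)))"
      using pop_sums[OF fin1 h] tot_sums
      by (auto simp: \<xi>_def intro!: sums_mult sums_diff elim: AE_mp)
    show "AE \<omega> in M. (\<lambda>i. v i \<omega>) sums (c\<^sup>2 * enn2real (pop (\<lambda>x. ennreal (vr x)) \<omega>))"
      using pop_sums[OF vfin vr0] by (auto simp: v_def intro!: sums_mult)
    show "(\<Sum>i<n. expectation (\<lambda>\<omega>. \<bar>\<xi> i \<omega>\<bar> ^ 3) / 6
          + gauss_abs_moment3 / 6 * expectation (\<lambda>\<omega>. v i \<omega> * sqrt (v i \<omega>)))
       \<le> c ^ 3 * ((2 + gauss_abs_moment3) / 6) * enn2real (\<integral>\<^sup>+\<omega>. pop (\<lambda>x. ennreal (\<beta> x)) \<omega> \<partial>M)" for n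
    proof -
      have "(\<Sum>i<n. expectation (\<lambda>\<omega>. \<bar>\<xi> i \<omega>\<bar> ^ 3) / 6
          + gauss_abs_moment3 / 6 * expectation (\<lambda>\<omega>. v i \<omega> * sqrt (v i \<omega>)))
        \<le> (\<Sum>i<n. c ^ 3 * (2 * b i) / 6 + gauss_abs_moment3 / 6 * (c ^ 3 * b i))"
        using gauss_abs_moment3_nonneg
        by (intro sum_mono add_mono mult_left_mono divide_right_mono \<xi>3_le vs_le) auto
      also have "\<dots> = (\<Sum>i<n. c ^ 3 * ((2 + gauss_abs_moment3) / 6) * b i)"
        by (intro sum.cong refl) (simp add: field_simps)
      also have "\<dots> = c ^ 3 * ((2 + gauss_abs_moment3) / 6) * (\<Sum>i<n. b i)"
        by (rule sum_distrib_left[symmetric])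
      also have "\<dots> \<le> c ^ 3 * ((2 + gauss_abs_moment3) / 6) * enn2real (\<integral>\<^sup>+\<omega>. pop (\<lambda>x. ennreal (\<beta> x)) \<omega> \<partial>M)"
        using c gauss_abs_moment3_nonneg by (intro mult_left_mono sum_b) auto
      finally show ?thesis .
    qed
  qed measurable
  then show ?thesis by (simp add: vr_def)
qed

end


section \<open>Point measures and their measurability\<close>

lemma space_measure_algebra: "space (measure_algebra X) = {\<mu>. sets \<mu> = sets X}"
  by (auto simp add: measure_algebra_def space_Sup_eq_UN)

lemma measurable_emeasure_measure_algebra [measurable]:
  "B \<in> sets X \<Longrightarrow> (\<lambda>\<mu>. emeasure \<mu> B) \<in> borel_measurable (measure_algebra X)"
  by (auto intro!: measurable_Sup1 measurable_vimage_algebra1 simp: measure_algebra_def)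

lemma measurable_measure_algebra:
  "(\<And>a. a \<in> space M \<Longrightarrow> sets (K a) = sets X) \<Longrightarrow>
  (\<And>B. B \<in> sets X \<Longrightarrow> (\<lambda>a. emeasure (K a) B) \<in> borel_measurable M) \<Longrightarrow>
  K \<in> M \<rightarrow>\<^sub>M measure_algebra X"
  by (auto intro!: measurable_Sup2 measurable_vimage_algebra2 simp: measure_algebra_def)

lemma nn_integral_measurable_measure_algebra [measurable]:
  assumes f: "f \<in> borel_measurable X"
  shows "(\<lambda>\<mu>. integral\<^sup>N \<mu> f) \<in> borel_measurable (measure_algebra X)" (is "_ \<in> ?B")
  using f
proof induct
  case (cong f g)
  moreover have "(\<lambda>\<mu>. \<integral>\<^sup>+y. f y \<partial>\<mu>) \<in> ?B \<longleftrightarrow> (\<lambda>\<mu>. \<integral>\<^sup>+y. g y \<partial>\<mu>) \<in> ?B"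
    by (intro measurable_cong nn_integral_cong cong)
       (auto simp: space_measure_algebra dest!: sets_eq_imp_space_eq)
  ultimately show ?case by simp
next
  case (set B)
  then have "(\<lambda>\<mu>. \<integral>\<^sup>+y. indicator B y \<partial>\<mu>) \<in> ?B \<longleftrightarrow> (\<lambda>\<mu>. emeasure \<mu> B) \<in> ?B"
    by (intro measurable_cong nn_integral_indicator) (simp add: space_measure_algebra)
  with set show ?case
    by (simp add: measurable_emeasure_measure_algebra)
next
  case (mult f c)
  then have "(\<lambda>\<mu>. \<integral>\<^sup>+y. c * f y \<partial>\<mu>) \<in> ?B \<longleftrightarrow> (\<lambda>\<mu>. c * \<integral>\<^sup>+y. f y \<partial>\<mu>) \<in> ?B"
    by (intro measurable_cong nn_integral_cmult)
       (auto simp add: space_measure_algebra cong: measurable_cong_sets)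
  with mult show ?case
    by simp
next
  case (add f g)
  then have "(\<lambda>\<mu>. \<integral>\<^sup>+y. f y + g y \<partial>\<mu>) \<in> ?B \<longleftrightarrow> (\<lambda>\<mu>. (\<integral>\<^sup>+y. f y \<partial>\<mu>) + (\<integral>\<^sup>+y. g y \<partial>\<mu>)) \<in> ?B"
    by (intro measurable_cong nn_integral_add)
       (auto simp add: space_measure_algebra cong: measurable_cong_sets)
  with add show ?case
    by (simp add: ac_simps)
next
  case (seq F)
  then have "(\<lambda>\<mu>. \<integral>\<^sup>+y. (SUP i. F i) y \<partial>\<mu>) \<in> ?B \<longleftrightarrow> (\<lambda>\<mu>. SUP i. (\<integral>\<^sup>+y. F i y \<partial>\<mu>)) \<in> ?B"
    unfolding SUP_apply
    by (intro measurable_cong nn_integral_monotone_convergence_SUP)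
       (auto simp add: space_measure_algebra cong: measurable_cong_sets)
  with seq show ?case
    by (simp add: ac_simps)
qed

lemma path_algebra_eval [measurable]: "0 \<le> s \<Longrightarrow> (\<lambda>z. z s) \<in> path_algebra X \<rightarrow>\<^sub>M measure_algebra X"
  unfolding path_algebra_def by (rule measurable_component_singleton) simp

lemma sets_point_measure [simp]: "sets (point_measure X S f) = sets X"
  and space_point_measure [simp]: "space (point_measure X S f) = space X"
  by (simp_all add: point_measure_def)

lemma nn_integral_point_measure:
  assumes "\<And>u. u \<in> S \<Longrightarrow> f u \<in> space X" and "g \<in> borel_measurable X"
  shows "(\<integral>\<^sup>+y. g y \<partial>point_measure X S f) = (\<integral>\<^sup>+u. g (f u) \<partial>count_space S)"
  unfolding point_measure_def by (rule nn_integral_distr) (use assms in auto)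

text \<open>Sums over a set of labels as series over the codes of the labels.\<close>

lemma nn_integral_count_space_countable:
  fixes S :: "'u::countable set" and F :: "'u \<Rightarrow> ennreal"
  shows "(\<integral>\<^sup>+u. F u \<partial>count_space S) = (\<Sum>i. if i \<in> to_nat ` S then F (from_nat i) else 0)"
proof -
  have "bij_betw (from_nat :: nat \<Rightarrow> 'u) (to_nat ` S) S"
    by (rule bij_betwI[where g = to_nat]) auto
  then have "(\<integral>\<^sup>+u. F u \<partial>count_space S) = (\<integral>\<^sup>+i. F (from_nat i) \<partial>count_space (to_nat ` S))"
    by (rule nn_integral_bij_count_space[symmetric])
  also have "\<dots> = (\<integral>\<^sup>+i. F (from_nat i) * indicator (to_nat ` S) i \<partial>count_space UNIV)"
    by (rule nn_integral_count_space_indicator) simp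
  also have "\<dots> = (\<Sum>i. F (from_nat i) * indicator (to_nat ` S) i)"
    by (rule nn_integral_count_space_nat)
  also have "\<dots> = (\<Sum>i. if i \<in> to_nat ` S then F (from_nat i) else 0)"
    by (intro suminf_cong) (auto simp: indicator_def)
  finally show ?thesis .
qed

section \<open>The branching property at a fixed time\<close>

text \<open>A branching Markov process. The conditioning on the past is not needed beyond the population at the
  fixed time, so the branching property is applied with the trivial event of the past.\<close>

locale branching_process =
  fixes X :: "'x measure" and \<Omega> :: "'w measure" and P :: "'x \<Rightarrow> 'w measure"
    and N :: "real \<Rightarrow> 'w \<Rightarrow> ('u::countable) set" and trait :: "real \<Rightarrow> 'w \<Rightarrow> 'u \<Rightarrow> 'x"
    and desc :: "'w \<Rightarrow> 'u \<Rightarrow> 'u \<Rightarrow> bool"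
  assumes bmp: "branching_markov_process X \<Omega> P N trait desc"
begin

abbreviation Z :: "real \<Rightarrow> 'w \<Rightarrow> 'x measure" where "Z \<equiv> population X N trait"
abbreviation Zd :: "real \<Rightarrow> 'u \<Rightarrow> real \<Rightarrow> 'w \<Rightarrow> 'x measure" where "Zd \<equiv> offspring X N trait desc"
abbreviation law :: "'x \<Rightarrow> (real \<Rightarrow> 'x measure) measure" where "law \<equiv> process_law X P Z"

lemma P_prob: "x \<in> space X \<Longrightarrow> prob_space (P x)"
  and P_sets: "x \<in> space X \<Longrightarrow> sets (P x) = sets \<Omega>"
  and alive_sets: "0 \<le> t \<Longrightarrow> {\<omega>\<in>space \<Omega>. u \<in> N t \<omega>} \<in> sets \<Omega>"
  and trait_restrict: "0 \<le> t \<Longrightarrow>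
    (\<lambda>\<omega>. trait t \<omega> u) \<in> restrict_space \<Omega> {\<omega>\<in>space \<Omega>. u \<in> N t \<omega>} \<rightarrow>\<^sub>M X"
  and desc_sets: "{\<omega>\<in>space \<Omega>. desc \<omega> u v} \<in> sets \<Omega>"
  and desc_refl: "\<omega> \<in> space \<Omega> \<Longrightarrow> desc \<omega> u u"
  and law_measurable: "law \<in> X \<rightarrow>\<^sub>M prob_algebra (path_algebra X)"
  and Z_start: "x \<in> space X \<Longrightarrow> AE \<omega> in P x. Z 0 \<omega> = return X x"
  and Z_add: "x \<in> space X \<Longrightarrow> 0 \<le> t \<Longrightarrow> 0 \<le> s \<Longrightarrow> AE \<omega> in P x. \<forall>B\<in>sets X.
      emeasure (Z (t + s) \<omega>) B = (\<integral>\<^sup>+u. emeasure (Zd t u s \<omega>) B \<partial>count_space (N t \<omega>))"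
  and branching: "x \<in> space X \<Longrightarrow> 0 \<le> t \<Longrightarrow> A \<in> sets (past X \<Omega> Z t) \<Longrightarrow> finite U \<Longrightarrow>
      (\<And>u. u \<in> U \<Longrightarrow> B u \<in> sets (path_algebra X)) \<Longrightarrow>
      emeasure (P x) {\<omega> \<in> A. U \<subseteq> N t \<omega> \<and> (\<forall>u\<in>U. (\<lambda>s\<in>{0..}. Zd t u s \<omega>) \<in> B u)} =
        (\<integral>\<^sup>+\<omega>. indicator {\<omega> \<in> A. U \<subseteq> N t \<omega>} \<omega> * (\<Prod>u\<in>U. emeasure (law (trait t \<omega> u)) (B u)) \<partial>P x)"
  using bmp unfolding branching_markov_process_def Let_def by (auto simp: reflp_def)

lemma P_space: "x \<in> space X \<Longrightarrow> space (P x) = space \<Omega>"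
  using P_sets by (rule sets_eq_imp_space_eq)

lemma P_measurable: "x \<in> space X \<Longrightarrow> f \<in> \<Omega> \<rightarrow>\<^sub>M M \<Longrightarrow> f \<in> P x \<rightarrow>\<^sub>M M"
  using measurable_cong_sets[OF P_sets refl] by auto

lemma trait_space: "\<omega> \<in> space \<Omega> \<Longrightarrow> 0 \<le> t \<Longrightarrow> u \<in> N t \<omega> \<Longrightarrow> trait t \<omega> u \<in> space X"
  using measurable_space[OF trait_restrict[of t u], of \<omega>] by (simp add: space_restrict_space)

lemma trait_measurable:
  assumes "0 \<le> t" "x0 \<in> space X"
  shows "(\<lambda>\<omega>. if \<omega> \<in> {\<omega>\<in>space \<Omega>. u \<in> N t \<omega>} then trait t \<omega> u else x0) \<in> \<Omega> \<rightarrow>\<^sub>M X"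
  using trait_restrict[OF assms(1), of u] alive_sets[OF assms(1), of u] assms(2)
  by (subst measurable_restrict_space_iff[symmetric]) auto

text \<open>Sums over a random set of individuals alive at time \<open>t\<close> are measurable.\<close>

lemma label_sum_measurable:
  assumes t: "0 \<le> t" and S: "\<And>u. {\<omega>\<in>space \<Omega>. u \<in> S \<omega>} \<in> sets \<Omega>"
    and SN: "\<And>\<omega>. S \<omega> \<subseteq> N t \<omega>" and g [measurable]: "g \<in> borel_measurable X"
    and x0: "x0 \<in> space X"
  shows "(\<lambda>\<omega>. \<integral>\<^sup>+u. g (trait t \<omega> u) \<partial>count_space (S \<omega>)) \<in> borel_measurable \<Omega>"
proof -
  note [measurable] = trait_measurable[OF t x0] S
  have "(\<lambda>\<omega>. \<Sum>i. indicator {\<omega>\<in>space \<Omega>. (from_nat i :: 'u) \<in> S \<omega> \<and> i \<in> range (to_nat :: 'u \<Rightarrow> nat)} \<omega> *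
      g (if \<omega> \<in> {\<omega>\<in>space \<Omega>. from_nat i \<in> N t \<omega>} then trait t \<omega> (from_nat i) else x0)) \<in> borel_measurable \<Omega>"
    by measurable
  also have "?this \<longleftrightarrow> ?thesis"
  proof (rule measurable_cong)
    fix \<omega> assume \<omega>: "\<omega> \<in> space \<Omega>"
    have "i \<in> to_nat ` S \<omega> \<longleftrightarrow> from_nat i \<in> S \<omega> \<and> i \<in> range (to_nat :: 'u \<Rightarrow> nat)" for i
      by (auto simp: image_iff)
    then show "(\<Sum>i. indicator {\<omega>\<in>space \<Omega>. (from_nat i :: 'u) \<in> S \<omega> \<and> i \<in> range (to_nat :: 'u \<Rightarrow> nat)} \<omega> *
      g (if \<omega> \<in> {\<omega>\<in>space \<Omega>. from_nat i \<in> N t \<omega>} then trait t \<omega> (from_nat i) else x0))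
      = (\<integral>\<^sup>+u. g (trait t \<omega> u) \<partial>count_space (S \<omega>))"
      unfolding nn_integral_count_space_countable using \<omega> SN[of \<omega>]
      by (intro suminf_cong) (auto simp: indicator_def)
  qed
  finally show ?thesis .
qed

text \<open>\<open>Z t (f)\<close> for nonnegative \<open>f\<close>, with values in the extended nonnegative reals.\<close>

definition zint :: "real \<Rightarrow> ('x \<Rightarrow> ennreal) \<Rightarrow> 'w \<Rightarrow> ennreal" where
  "zint t f \<omega> = (\<integral>\<^sup>+y. f y \<partial>Z t \<omega>)"

lemma zint_eq:
  assumes "\<omega> \<in> space \<Omega>" "0 \<le> t" "f \<in> borel_measurable X"
  shows "zint t f \<omega> = (\<integral>\<^sup>+u. f (trait t \<omega> u) \<partial>count_space (N t \<omega>))"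
  unfolding zint_def population_def using assms trait_space
  by (intro nn_integral_point_measure) auto

lemma Zd_eq:
  assumes "\<omega> \<in> space \<Omega>" "0 \<le> t" "0 \<le> s" "f \<in> borel_measurable X"
  shows "(\<integral>\<^sup>+y. f y \<partial>Zd t u s \<omega>) =
    (\<integral>\<^sup>+v. f (trait (t + s) \<omega> v) \<partial>count_space {v \<in> N (t + s) \<omega>. desc \<omega> u v})"
  unfolding offspring_def using assms trait_space
  by (intro nn_integral_point_measure) auto

lemma zint_measurable:
  assumes "0 \<le> t" "f \<in> borel_measurable X" "x0 \<in> space X"
  shows "zint t f \<in> borel_measurable \<Omega>"
proof -
  have "(\<lambda>\<omega>. \<integral>\<^sup>+u. f (trait t \<omega> u) \<partial>count_space (N t \<omega>)) \<in> borel_measurable \<Omega>"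
    using assms by (intro label_sum_measurable alive_sets) auto
  then show ?thesis using zint_eq[OF _ assms(1,2)] by (simp cong: measurable_cong)
qed

lemma zint_measurable_P:
  "0 \<le> t \<Longrightarrow> f \<in> borel_measurable X \<Longrightarrow> x \<in> space X \<Longrightarrow> zint t f \<in> borel_measurable (P x)"
  by (intro P_measurable zint_measurable)

lemma Zd_integral_measurable:
  assumes "0 \<le> t" "0 \<le> s" "f \<in> borel_measurable X" "x0 \<in> space X"
  shows "(\<lambda>\<omega>. \<integral>\<^sup>+y. f y \<partial>Zd t u s \<omega>) \<in> borel_measurable \<Omega>"
proof -
  have "(\<lambda>\<omega>. \<integral>\<^sup>+v. f (trait (t + s) \<omega> v) \<partial>count_space {v \<in> N (t + s) \<omega>. desc \<omega> u v}) \<in> borel_measurable \<Omega>"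
  proof (rule label_sum_measurable)
    show "{\<omega> \<in> space \<Omega>. v \<in> {v \<in> N (t + s) \<omega>. desc \<omega> u v}} \<in> sets \<Omega>" for v
      using sets.Int[OF alive_sets[of "t + s" v] desc_sets[of u v]] assms
      by (simp add: Int_def conj_ac cong: conj_cong)
  qed (use assms in auto)
  then show ?thesis using Zd_eq[OF _ assms(1-3)] by (simp cong: measurable_cong)
qed

lemma Z_path_measurable:
  assumes "x0 \<in> space X"
  shows "(\<lambda>\<omega>. \<lambda>s\<in>{0..}. Z s \<omega>) \<in> \<Omega> \<rightarrow>\<^sub>M path_algebra X"
  unfolding path_algebra_def
proof (intro measurable_restrict measurable_measure_algebra)
  fix s :: real and B assume s: "s \<in> {0..}" and B: "B \<in> sets X"
  have "zint s (indicator B) \<in> borel_measurable \<Omega>" using s B assms by (intro zint_measurable) auto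
  then show "(\<lambda>\<omega>. emeasure (Z s \<omega>) B) \<in> borel_measurable \<Omega>"
    using B by (simp add: zint_def population_def cong: measurable_cong)
qed (simp add: population_def)

lemma Zd_path_measurable:
  assumes "0 \<le> t" "x0 \<in> space X"
  shows "(\<lambda>\<omega>. \<lambda>s\<in>{0..}. Zd t u s \<omega>) \<in> \<Omega> \<rightarrow>\<^sub>M path_algebra X"
  unfolding path_algebra_def
proof (intro measurable_restrict measurable_measure_algebra)
  fix s :: real and B assume s: "s \<in> {0..}" and B: "B \<in> sets X"
  have "(\<lambda>\<omega>. \<integral>\<^sup>+y. indicator B y \<partial>Zd t u s \<omega>) \<in> borel_measurable \<Omega>"
    using s B assms by (intro Zd_integral_measurable) auto
  then show "(\<lambda>\<omega>. emeasure (Zd t u s \<omega>) B) \<in> borel_measurable \<Omega>"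
    using B by (simp add: offspring_def cong: measurable_cong)
qed (simp add: offspring_def)

lemma emeasure_law:
  assumes x: "x \<in> space X" and B: "B \<in> sets (path_algebra X)"
  shows "emeasure (law x) B = emeasure (P x) {\<omega>\<in>space \<Omega>. (\<lambda>s\<in>{0..}. Z s \<omega>) \<in> B}"
  unfolding process_law_def
  using P_measurable[OF x Z_path_measurable[OF x]] B
  by (subst emeasure_distr) (auto simp: P_space[OF x] intro!: arg_cong[where f = "emeasure (P x)"])

text \<open>The sets of paths used below constrain the positions at time \<open>0\<close> and one linear functional at
  time \<open>s\<close>. The condition \<open>1 \<le> emeasure (z 0) C\<close> stands for an individual in \<open>C\<close> at time \<open>0\<close>.\<close>

lemma path_set:
  assumes [measurable]: "C \<in> sets X" "f \<in> borel_measurable X" "B \<in> sets borel" and [measurable, simp]: "0 \<le> s"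
  shows "{z\<in>space (path_algebra X). 1 \<le> emeasure (z 0) C \<and> (\<integral>\<^sup>+y. f y \<partial>z s) \<in> B} \<in> sets (path_algebra X)"
proof -
  have [measurable]: "(\<lambda>z. emeasure (z 0) C) \<in> borel_measurable (path_algebra X)"
    by (rule measurable_compose[OF path_algebra_eval measurable_emeasure_measure_algebra]) auto
  have [measurable]: "(\<lambda>z. \<integral>\<^sup>+y. f y \<partial>z s) \<in> borel_measurable (path_algebra X)"
    by (rule measurable_compose[OF path_algebra_eval nn_integral_measurable_measure_algebra]) auto
  show ?thesis by measurable
qed

lemma law_path_set:
  assumes x: "x \<in> space X" and C: "C \<in> sets X" and f: "f \<in> borel_measurable X" and B: "B \<in> sets borel"
    and s: "0 \<le> s"
  shows "emeasure (law x) {z\<in>space (path_algebra X). 1 \<le> emeasure (z 0) C \<and> (\<integral>\<^sup>+y. f y \<partial>z s) \<in> B}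
    = indicator C x * emeasure (distr (P x) borel (zint s f)) B"
proof -
  note [measurable] = C B zint_measurable_P[OF s f x]
  have c0: "(\<lambda>\<omega>. emeasure (Z 0 \<omega>) C) \<in> borel_measurable (P x)"
    using zint_measurable_P[of 0 "indicator C" x] x C
    by (simp add: zint_def population_def cong: measurable_cong)
  note [measurable] = c0
  have "emeasure (law x) {z\<in>space (path_algebra X). 1 \<le> emeasure (z 0) C \<and> (\<integral>\<^sup>+y. f y \<partial>z s) \<in> B}
      = emeasure (P x) {\<omega>\<in>space (P x). 1 \<le> emeasure (Z 0 \<omega>) C \<and> zint s f \<omega> \<in> B}"
    unfolding emeasure_law[OF x path_set[OF C f B s]]
    using measurable_space[OF Z_path_measurable[OF x]] s
    by (intro arg_cong[where f = "emeasure (P x)"]) (auto simp: P_space[OF x] zint_def)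
  also have "\<dots> = emeasure (P x) {\<omega>\<in>space (P x). x \<in> C \<and> zint s f \<omega> \<in> B}"
  proof (rule emeasure_Collect_eq_AE)
    show "AE \<omega> in P x. (1 \<le> emeasure (Z 0 \<omega>) C \<and> zint s f \<omega> \<in> B) = (x \<in> C \<and> zint s f \<omega> \<in> B)"
      using Z_start[OF x] by eventually_elim (use C in \<open>auto simp: indicator_def\<close>)
  qed measurable
  also have "\<dots> = indicator C x * emeasure (distr (P x) borel (zint s f)) B"
    by (cases "x \<in> C") (auto simp: emeasure_distr vimage_def Int_def conj_commute)
  finally show ?thesis .
qed

lemma space_in_past: "space \<Omega> \<in> sets (past X \<Omega> Z t)"
  unfolding past_def by (metis sets.top space_vimage_algebra)

text \<open>At time \<open>0\<close> the descendants of \<open>u\<close> are \<open>u\<close> alone, so the trait of \<open>u\<close> can be read off from the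
  offspring process. One inclusion of events holds because \<open>u\<close> is among its own descendants; both
  events have the same probability by the branching property, as a process started from \<open>y\<close> is at
  time \<open>0\<close> the unit mass at \<open>y\<close>.\<close>

lemma offspring_start:
  assumes x: "x \<in> space X" and t: "0 \<le> t" and C: "C \<in> sets X"
  shows "AE \<omega> in P x. u \<in> N t \<omega> \<longrightarrow> (1 \<le> emeasure (Zd t u 0 \<omega>) C \<longleftrightarrow> trait t \<omega> u \<in> C)"
proof -
  interpret prob_space "P x" by (rule P_prob[OF x])
  note [measurable] = C
  have aliveM [measurable]: "{\<omega>\<in>space (P x). u \<in> N t \<omega>} \<in> sets (P x)"
    using alive_sets[OF t, of u] by (simp add: P_space[OF x] P_sets[OF x])
  have trm [measurable]: "(\<lambda>\<omega>. if \<omega> \<in> {\<omega>\<in>space \<Omega>. u \<in> N t \<omega>} then trait t \<omega> u else x) \<in> P x \<rightarrow>\<^sub>M X"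
    by (rule P_measurable[OF x trait_measurable[OF t x]])
  have zd [measurable]: "(\<lambda>\<omega>. emeasure (Zd t u 0 \<omega>) C) \<in> borel_measurable (P x)"
    using P_measurable[OF x Zd_integral_measurable[OF t order_refl _ x, of "indicator C" u]] C
    by (simp add: offspring_def cong: measurable_cong)
  let ?A = "{\<omega>\<in>space (P x). u \<in> N t \<omega> \<and> 1 \<le> emeasure (Zd t u 0 \<omega>) C}"
  let ?B = "{\<omega>\<in>space (P x). u \<in> N t \<omega> \<and> trait t \<omega> u \<in> C}"
  have A [measurable]: "?A \<in> sets (P x)" by measurable
  have "{\<omega>\<in>space (P x). u \<in> N t \<omega> \<and> (if \<omega> \<in> {\<omega>\<in>space \<Omega>. u \<in> N t \<omega>} then trait t \<omega> u else x) \<in> C} \<in> sets (P x)"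
    by measurable
  also have "{\<omega>\<in>space (P x). u \<in> N t \<omega> \<and> (if \<omega> \<in> {\<omega>\<in>space \<Omega>. u \<in> N t \<omega>} then trait t \<omega> u else x) \<in> C} = ?B"
    by (auto simp: P_space[OF x])
  finally have B [measurable]: "?B \<in> sets (P x)" .
  have BA: "?B \<subseteq> ?A"
  proof
    fix \<omega> assume \<omega>: "\<omega> \<in> ?B"
    then have \<omega>s: "\<omega> \<in> space \<Omega>" by (simp add: P_space[OF x])
    have "(1 :: ennreal) = indicator C (trait t \<omega> u)" using \<omega> by simp
    also have "\<dots> \<le> (\<integral>\<^sup>+v. indicator C (trait (t + 0) \<omega> v) \<partial>count_space {v \<in> N (t + 0) \<omega>. desc \<omega> u v})"
      using \<omega> desc_refl[OF \<omega>s]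
        nn_integral_ge_point[of u "{v \<in> N (t + 0) \<omega>. desc \<omega> u v}" "\<lambda>v. indicator C (trait (t + 0) \<omega> v)"]
      by simp
    also have "\<dots> = (\<integral>\<^sup>+y. indicator C y \<partial>Zd t u 0 \<omega>)"
      by (rule Zd_eq[OF \<omega>s t order_refl, symmetric]) measurable
    also have "\<dots> = emeasure (Zd t u 0 \<omega>) C" using C by (simp add: offspring_def)
    finally show "\<omega> \<in> ?A" using \<omega> by simp
  qed
  let ?S = "{z\<in>space (path_algebra X). 1 \<le> emeasure (z 0) C \<and> (\<integral>\<^sup>+y. 0 \<partial>z 0) \<in> (UNIV :: ennreal set)}"
  have S: "?S \<in> sets (path_algebra X)" by (rule path_set) (use C in auto)
  have "emeasure (P x) ?A = emeasure (P x) {\<omega> \<in> space \<Omega>. {u} \<subseteq> N t \<omega> \<and> (\<forall>u\<in>{u}. (\<lambda>s\<in>{0..}. Zd t u s \<omega>) \<in> ?S)}"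
    using measurable_space[OF Zd_path_measurable[OF t x]]
    by (intro arg_cong[where f = "emeasure (P x)"]) (auto simp: P_space[OF x])
  also have "\<dots> = (\<integral>\<^sup>+\<omega>. indicator {\<omega> \<in> space \<Omega>. {u} \<subseteq> N t \<omega>} \<omega> * (\<Prod>u\<in>{u}. emeasure (law (trait t \<omega> u)) ?S) \<partial>P x)"
    by (rule branching[OF x t space_in_past]) (use S in auto)
  also have "\<dots> = (\<integral>\<^sup>+\<omega>. indicator ?B \<omega> \<partial>P x)"
  proof (rule nn_integral_cong)
    fix \<omega> assume "\<omega> \<in> space (P x)"
    then have \<omega>s: "\<omega> \<in> space \<Omega>" by (simp add: P_space[OF x])
    show "indicator {\<omega> \<in> space \<Omega>. {u} \<subseteq> N t \<omega>} \<omega> * (\<Prod>u\<in>{u}. emeasure (law (trait t \<omega> u)) ?S) = indicator ?B \<omega>"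
    proof (cases "u \<in> N t \<omega>")
      case True
      have y: "trait t \<omega> u \<in> space X" by (rule trait_space[OF \<omega>s t True])
      interpret Py: prob_space "P (trait t \<omega> u)" by (rule P_prob[OF y])
      have "emeasure (law (trait t \<omega> u)) ?S = indicator C (trait t \<omega> u) * emeasure (distr (P (trait t \<omega> u)) borel (zint 0 (\<lambda>_. 0))) UNIV"
        by (rule law_path_set[OF y C]) auto
      also have "emeasure (distr (P (trait t \<omega> u)) borel (zint 0 (\<lambda>_. 0))) UNIV = 1"
        using prob_space.emeasure_space_1[OF Py.prob_space_distr[OF zint_measurable_P[of 0 "\<lambda>_. 0", OF _ _ y]]]
        by simp
      finally show ?thesis using True \<omega>s by (simp add: indicator_def P_space[OF x])
    qed simp
  qed
  also have "\<dots> = emeasure (P x) ?B" by (rule nn_integral_indicator[OF B])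
  finally have "emeasure (P x) (?A - ?B) = 0"
    using emeasure_Diff[OF _ A B BA] by (simp add: ennreal_minus_eq_0)
  then have "AE \<omega> in P x. \<not> (\<omega> \<in> ?A - ?B)"
    by (intro AE_not_in) (auto simp: null_sets_def)
  then show ?thesis
    using AE_space
  proof eventually_elim
    case (elim \<omega>)
    then show ?case using BA by auto
  qed
qed

text \<open>The data of \<open>labelled_branching\<close> for the population at time \<open>t\<close>. The labels are replaced by their
  codes \<open>to_nat\<close>; a number that is not the code of a label is never alive.\<close>

definition alive :: "real \<Rightarrow> nat \<Rightarrow> 'w set" where
  "alive t i = {\<omega>\<in>space \<Omega>. i \<in> to_nat ` N t \<omega>}"

text \<open>The trait at time \<open>t\<close> of the individual with code \<open>i\<close>, and \<open>x0\<close> if it is not alive.\<close>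

definition ntrait :: "'x \<Rightarrow> real \<Rightarrow> nat \<Rightarrow> 'w \<Rightarrow> 'x" where
  "ntrait x0 t i \<omega> = (if \<omega> \<in> alive t i then trait t \<omega> (from_nat i) else x0)"

text \<open>The integral of \<open>f\<close> over the descendants at time \<open>t + s\<close> of the individual with code \<open>i\<close>.\<close>

definition noff :: "real \<Rightarrow> real \<Rightarrow> ('x \<Rightarrow> ennreal) \<Rightarrow> nat \<Rightarrow> 'w \<Rightarrow> ennreal" where
  "noff t s f i \<omega> = (if \<omega> \<in> alive t i then \<integral>\<^sup>+y. f y \<partial>Zd t (from_nat i) s \<omega> else 0)"

text \<open>The law of \<open>Z s (f)\<close> under \<open>P y\<close>.\<close>

definition kern :: "real \<Rightarrow> ('x \<Rightarrow> ennreal) \<Rightarrow> 'x \<Rightarrow> ennreal measure" where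
  "kern s f y = distr (P y) borel (zint s f)"

lemma alive_iff: "\<omega> \<in> alive t i \<longleftrightarrow> \<omega> \<in> space \<Omega> \<and> from_nat i \<in> N t \<omega> \<and> i \<in> range (to_nat :: 'u \<Rightarrow> nat)"
  by (auto simp: alive_def image_iff)

lemma alive_measurable:
  assumes "0 \<le> t"
  shows "alive t i \<in> sets \<Omega>"
proof -
  have "alive t i = (if i \<in> range (to_nat :: 'u \<Rightarrow> nat) then {\<omega>\<in>space \<Omega>. (from_nat i :: 'u) \<in> N t \<omega>} else {})"
    by (auto simp: alive_iff)
  then show ?thesis using alive_sets[OF assms, of "from_nat i"] by auto
qed

lemma ntrait_measurable:
  assumes t: "0 \<le> t" and x: "x0 \<in> space X"
  shows "ntrait x0 t i \<in> \<Omega> \<rightarrow>\<^sub>M X"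
proof -
  note [measurable] = trait_measurable[OF t x] alive_measurable[OF t]
  have "(\<lambda>\<omega>. if \<omega> \<in> alive t i then (if \<omega> \<in> {\<omega>\<in>space \<Omega>. from_nat i \<in> N t \<omega>} then trait t \<omega> (from_nat i) else x0) else x0) \<in> \<Omega> \<rightarrow>\<^sub>M X"
    using x by measurable
  also have "(\<lambda>\<omega>. if \<omega> \<in> alive t i then (if \<omega> \<in> {\<omega>\<in>space \<Omega>. from_nat i \<in> N t \<omega>} then trait t \<omega> (from_nat i) else x0) else x0)
      = ntrait x0 t i"
    by (rule ext) (auto simp: ntrait_def alive_iff)
  finally show ?thesis .
qed

lemma noff_measurable:
  assumes "0 \<le> t" "0 \<le> s" "f \<in> borel_measurable X" "x0 \<in> space X"
  shows "noff t s f i \<in> borel_measurable \<Omega>"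
proof -
  note [measurable] = alive_measurable[OF assms(1)] Zd_integral_measurable[OF assms]
  show ?thesis unfolding noff_def[abs_def] by measurable
qed

lemma kern_measurable:
  assumes f: "f \<in> borel_measurable X" and s: "0 \<le> s"
  shows "kern s f \<in> X \<rightarrow>\<^sub>M prob_algebra borel"
proof -
  have m: "(\<lambda>z. \<integral>\<^sup>+y. f y \<partial>z s) \<in> borel_measurable (path_algebra X)"
    by (rule measurable_compose[OF path_algebra_eval nn_integral_measurable_measure_algebra]) (use s f in auto)
  have "(\<lambda>y. distr (law y) borel (\<lambda>z. \<integral>\<^sup>+y. f y \<partial>z s)) \<in> X \<rightarrow>\<^sub>M prob_algebra borel"
    by (rule measurable_compose[OF law_measurable measurable_distr_prob_space[OF m]])
  also have "?this \<longleftrightarrow> ?thesis"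
  proof (rule measurable_cong)
    fix y assume y: "y \<in> space X"
    show "distr (law y) borel (\<lambda>z. \<integral>\<^sup>+y. f y \<partial>z s) = kern s f y"
      unfolding process_law_def kern_def
      by (subst distr_distr[OF m P_measurable[OF y Z_path_measurable[OF y]]])
         (use s in \<open>simp add: comp_def zint_def[abs_def]\<close>)
  qed
  finally show ?thesis .
qed

text \<open>The constraints on the traits, which the branching property does not mention, are turned into
  constraints on the offspring processes at time \<open>0\<close>.\<close>

lemma cylinder_formula:
  assumes x: "x \<in> space X" and t: "0 \<le> t" and s: "0 \<le> s" and f: "f \<in> borel_measurable X"
    and U: "finite U" and C: "\<And>u. C u \<in> sets X" and B: "\<And>u. B u \<in> sets borel"
  shows "emeasure (P x) {\<omega>\<in>space (P x). \<forall>i\<in>U. \<omega> \<in> alive t i \<and> ntrait x t i \<omega> \<in> C i \<and> noff t s f i \<omega> \<in> B i} =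
      (\<integral>\<^sup>+\<omega>. (\<Prod>i\<in>U. indicator (alive t i) \<omega> * indicator (C i) (ntrait x t i \<omega>) * emeasure (kern s f (ntrait x t i \<omega>)) (B i)) \<partial>P x)"
proof (cases "U \<subseteq> range (to_nat :: 'u \<Rightarrow> nat)")
  case False
  then obtain i where i: "i \<in> U" "i \<notin> range (to_nat :: 'u \<Rightarrow> nat)" by auto
  then have e: "alive t i = {}" by (auto simp: alive_iff)
  have e1: "{\<omega>\<in>space (P x). \<forall>i\<in>U. \<omega> \<in> alive t i \<and> ntrait x t i \<omega> \<in> C i \<and> noff t s f i \<omega> \<in> B i} = {}"
    using i e by auto
  have e2: "(\<Prod>i\<in>U. indicator (alive t i) \<omega> * indicator (C i) (ntrait x t i \<omega>) * emeasure (kern s f (ntrait x t i \<omega>)) (B i)) = 0" for \<omega>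
    using i e U by (intro prod_zero bexI[of _ i]) auto
  show ?thesis unfolding e1 e2 by simp
next
  case True
  define V where "V = (from_nat ` U :: 'u set)"
  have "to_nat (from_nat i :: 'u) = i" if "i \<in> U" for i using True that by auto
  then have UV: "U = to_nat ` V" by (simp add: V_def image_image)
  have V: "finite V" using U by (simp add: V_def)
  have inj: "inj_on (to_nat :: 'u \<Rightarrow> nat) V" by (rule inj_on_subset[OF inj_to_nat]) simp
  let ?S = "\<lambda>u. {z\<in>space (path_algebra X). 1 \<le> emeasure (z 0) (C (to_nat u)) \<and> (\<integral>\<^sup>+y. f y \<partial>z s) \<in> B (to_nat u)}"
  have S: "?S u \<in> sets (path_algebra X)" for u by (rule path_set) (use C B f s in auto)
  have sp: "space (P x) = space \<Omega>" by (rule P_space[OF x])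
  note [measurable] = C B P_measurable[OF x Zd_integral_measurable[OF t s f x]]
    P_measurable[OF x noff_measurable[OF t s f x]] P_measurable[OF x ntrait_measurable[OF t x]]
  have [measurable]: "alive t i \<in> sets (P x)" for i using alive_measurable[OF t] P_sets[OF x] by simp
  have [measurable]: "{\<omega>\<in>space (P x). u \<in> N t \<omega>} \<in> sets (P x)" for u
    using alive_sets[OF t, of u] by (simp add: sp P_sets[OF x])
  have [measurable]: "(\<lambda>\<omega>. emeasure (Zd t u 0 \<omega>) (C i)) \<in> borel_measurable (P x)" for u i
    using P_measurable[OF x Zd_integral_measurable[OF t order_refl _ x, of "indicator (C i)" u]] C
    by (simp add: offspring_def cong: measurable_cong)
  have "AE \<omega> in P x. \<forall>u\<in>V. u \<in> N t \<omega> \<longrightarrow> (1 \<le> emeasure (Zd t u 0 \<omega>) (C (to_nat u)) \<longleftrightarrow> trait t \<omega> u \<in> C (to_nat u))"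
    using V by (intro AE_finite_allI offspring_start[OF x t C])
  then have "emeasure (P x) {\<omega>\<in>space (P x). \<forall>i\<in>U. \<omega> \<in> alive t i \<and> ntrait x t i \<omega> \<in> C i \<and> noff t s f i \<omega> \<in> B i}
    = emeasure (P x) {\<omega>\<in>space (P x). \<forall>u\<in>V. u \<in> N t \<omega> \<and> 1 \<le> emeasure (Zd t u 0 \<omega>) (C (to_nat u))
         \<and> (\<integral>\<^sup>+y. f y \<partial>Zd t u s \<omega>) \<in> B (to_nat u)}"
  proof (intro emeasure_Collect_eq_AE)
    assume "AE \<omega> in P x. \<forall>u\<in>V. u \<in> N t \<omega> \<longrightarrow> (1 \<le> emeasure (Zd t u 0 \<omega>) (C (to_nat u)) \<longleftrightarrow> trait t \<omega> u \<in> C (to_nat u))"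
    then show "AE \<omega> in P x. (\<forall>i\<in>U. \<omega> \<in> alive t i \<and> ntrait x t i \<omega> \<in> C i \<and> noff t s f i \<omega> \<in> B i) \<longleftrightarrow>
       (\<forall>u\<in>V. u \<in> N t \<omega> \<and> 1 \<le> emeasure (Zd t u 0 \<omega>) (C (to_nat u)) \<and> (\<integral>\<^sup>+y. f y \<partial>Zd t u s \<omega>) \<in> B (to_nat u))"
      using AE_space
    proof eventually_elim
      case (elim \<omega>)
      have "(\<omega> \<in> alive t (to_nat u) \<and> ntrait x t (to_nat u) \<omega> \<in> C (to_nat u) \<and> noff t s f (to_nat u) \<omega> \<in> B (to_nat u))
        \<longleftrightarrow> (u \<in> N t \<omega> \<and> 1 \<le> emeasure (Zd t u 0 \<omega>) (C (to_nat u)) \<and> (\<integral>\<^sup>+y. f y \<partial>Zd t u s \<omega>) \<in> B (to_nat u))"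
        if "u \<in> V" for u
        using elim that by (auto simp: alive_iff sp ntrait_def noff_def)
      then show ?case unfolding UV by simp
    qed
    show "Measurable.pred (P x) (\<lambda>\<omega>. \<forall>i\<in>U. \<omega> \<in> alive t i \<and> ntrait x t i \<omega> \<in> C i \<and> noff t s f i \<omega> \<in> B i)"
      using U by (intro pred_intros_finite) measurable
    show "Measurable.pred (P x) (\<lambda>\<omega>. \<forall>u\<in>V. u \<in> N t \<omega> \<and> 1 \<le> emeasure (Zd t u 0 \<omega>) (C (to_nat u))
         \<and> (\<integral>\<^sup>+y. f y \<partial>Zd t u s \<omega>) \<in> B (to_nat u))"
      using V by (intro pred_intros_finite) measurable
  qed
  also have "\<dots> = emeasure (P x) {\<omega> \<in> space \<Omega>. V \<subseteq> N t \<omega> \<and> (\<forall>u\<in>V. (\<lambda>s\<in>{0..}. Zd t u s \<omega>) \<in> ?S u)}"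
    using measurable_space[OF Zd_path_measurable[OF t x]] s
    by (intro arg_cong[where f = "emeasure (P x)"]) (auto simp: sp)
  also have "\<dots> = (\<integral>\<^sup>+\<omega>. indicator {\<omega> \<in> space \<Omega>. V \<subseteq> N t \<omega>} \<omega> * (\<Prod>u\<in>V. emeasure (law (trait t \<omega> u)) (?S u)) \<partial>P x)"
    by (rule branching[OF x t space_in_past V S])
  also have "\<dots> = (\<integral>\<^sup>+\<omega>. (\<Prod>i\<in>U. indicator (alive t i) \<omega> * indicator (C i) (ntrait x t i \<omega>) * emeasure (kern s f (ntrait x t i \<omega>)) (B i)) \<partial>P x)"
  proof (rule nn_integral_cong)
    fix \<omega> assume "\<omega> \<in> space (P x)"
    then have \<omega>: "\<omega> \<in> space \<Omega>" by (simp add: sp)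
    show "indicator {\<omega> \<in> space \<Omega>. V \<subseteq> N t \<omega>} \<omega> * (\<Prod>u\<in>V. emeasure (law (trait t \<omega> u)) (?S u))
      = (\<Prod>i\<in>U. indicator (alive t i) \<omega> * indicator (C i) (ntrait x t i \<omega>) * emeasure (kern s f (ntrait x t i \<omega>)) (B i))"
    proof (cases "V \<subseteq> N t \<omega>")
      case True
      have "(\<Prod>u\<in>V. emeasure (law (trait t \<omega> u)) (?S u)) = (\<Prod>u\<in>V. indicator (alive t (to_nat u)) \<omega> *
          indicator (C (to_nat u)) (ntrait x t (to_nat u) \<omega>) * emeasure (kern s f (ntrait x t (to_nat u) \<omega>)) (B (to_nat u)))"
      proof (rule prod.cong[OF refl])
        fix u assume u: "u \<in> V"
        with True have uN: "u \<in> N t \<omega>" by auto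
        have y: "trait t \<omega> u \<in> space X" by (rule trait_space[OF \<omega> t uN])
        have a: "\<omega> \<in> alive t (to_nat u)" using \<omega> uN by (simp add: alive_iff)
        have "emeasure (law (trait t \<omega> u)) (?S u)
           = indicator (C (to_nat u)) (trait t \<omega> u) * emeasure (kern s f (trait t \<omega> u)) (B (to_nat u))"
          unfolding kern_def by (rule law_path_set[OF y C f B s])
        then show "emeasure (law (trait t \<omega> u)) (?S u) = indicator (alive t (to_nat u)) \<omega> *
          indicator (C (to_nat u)) (ntrait x t (to_nat u) \<omega>) * emeasure (kern s f (ntrait x t (to_nat u) \<omega>)) (B (to_nat u))"
          using a by (simp add: ntrait_def)
      qed
      also have "\<dots> = (\<Prod>i\<in>U. indicator (alive t i) \<omega> * indicator (C i) (ntrait x t i \<omega>) * emeasure (kern s f (ntrait x t i \<omega>)) (B i))"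
        unfolding UV by (subst prod.reindex[OF inj]) simp
      finally show ?thesis using True \<omega> by simp
    next
      case False
      then obtain u where u: "u \<in> V" "u \<notin> N t \<omega>" by auto
      then have "\<omega> \<notin> alive t (to_nat u)" by (simp add: alive_iff)
      then have "(\<Prod>i\<in>U. indicator (alive t i) \<omega> * indicator (C i) (ntrait x t i \<omega>) * emeasure (kern s f (ntrait x t i \<omega>)) (B i)) = 0"
        using u U by (intro prod_zero) (auto simp: UV intro!: bexI[of _ u])
      then show ?thesis using False by simp
    qed
  qed
  finally show ?thesis .
qed

lemma labelled:
  assumes x: "x \<in> space X" and t: "0 \<le> t" and s: "0 \<le> s" and f: "f \<in> borel_measurable X"
  shows "labelled_branching (P x) X (alive t) (ntrait x t) (noff t s f) (kern s f) x"
proof -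
  interpret prob_space "P x" by (rule P_prob[OF x])
  show ?thesis
  proof
    show "alive t i \<in> sets (P x)" for i using alive_measurable[OF t] P_sets[OF x] by simp
    show "ntrait x t i \<in> P x \<rightarrow>\<^sub>M X" for i by (rule P_measurable[OF x ntrait_measurable[OF t x]])
    show "noff t s f i \<in> borel_measurable (P x)" for i by (rule P_measurable[OF x noff_measurable[OF t s f x]])
    show "kern s f \<in> X \<rightarrow>\<^sub>M prob_algebra borel" by (rule kern_measurable[OF f s])
    show "x \<in> space X" by (rule x)
    show "ntrait x t i \<omega> = x" "noff t s f i \<omega> = 0" if "\<omega> \<notin> alive t i" for i \<omega>
      using that by (simp_all add: ntrait_def noff_def)
  qed (rule cylinder_formula[OF x t s f])
qed

lemma zint_suminf:
  assumes \<omega>: "\<omega> \<in> space \<Omega>" and t: "0 \<le> t" and f: "f \<in> borel_measurable X"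
  shows "(\<Sum>i. indicator (alive t i) \<omega> * f (ntrait x0 t i \<omega>)) = zint t f \<omega>"
  unfolding zint_eq[OF assms] nn_integral_count_space_countable
  using \<omega> by (intro suminf_cong) (auto simp: alive_def ntrait_def indicator_def)

text \<open>The branching property extends from measurable sets to nonnegative functions.\<close>

lemma zint_add:
  assumes x: "x \<in> space X" and t: "0 \<le> t" and s: "0 \<le> s" and f: "f \<in> borel_measurable X"
  shows "AE \<omega> in P x. (\<Sum>i. noff t s f i \<omega>) = zint (t + s) f \<omega>"
  using Z_add[OF x t s] AE_space
proof eventually_elim
  case (elim \<omega>)
  then have \<omega>: "\<omega> \<in> space \<Omega>" by (simp add: P_space[OF x])
  have "zint (t + s) f \<omega> = (\<integral>\<^sup>+u. (\<integral>\<^sup>+y. f y \<partial>Zd t u s \<omega>) \<partial>count_space (N t \<omega>))"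
    unfolding zint_def using f
  proof (induction f rule: borel_measurable_induct)
    case (cong f g)
    then have e: "f y = g y" if "y \<in> space X" for y using that by auto
    have "(\<integral>\<^sup>+y. f y \<partial>Z (t + s) \<omega>) = (\<integral>\<^sup>+y. g y \<partial>Z (t + s) \<omega>)"
      by (rule nn_integral_cong) (simp add: e population_def)
    moreover have "(\<integral>\<^sup>+y. f y \<partial>Zd t u s \<omega>) = (\<integral>\<^sup>+y. g y \<partial>Zd t u s \<omega>)" for u
      by (rule nn_integral_cong) (simp add: e offspring_def)
    ultimately show ?case using cong by simp
  next
    case (set A)
    then show ?case using elim(1) by (simp add: population_def offspring_def)
  next
    case (mult u c)
    then show ?case
      by (simp add: nn_integral_cmult population_def offspring_def cong: measurable_cong_sets)
  next
    case (add u v)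
    then show ?case
      by (simp add: nn_integral_add population_def offspring_def cong: measurable_cong_sets)
  next
    case (seq U)
    have m: "U i \<in> borel_measurable (Z (t + s) \<omega>)" "U i \<in> borel_measurable (Zd t u s \<omega>)" for i u
      using seq by (simp_all add: population_def offspring_def cong: measurable_cong_sets)
    have "(\<integral>\<^sup>+y. (SUP i. U i) y \<partial>Z (t + s) \<omega>) = (SUP i. \<integral>\<^sup>+y. U i y \<partial>Z (t + s) \<omega>)"
      unfolding SUP_apply by (rule nn_integral_monotone_convergence_SUP[OF seq.hyps(3) m(1)])
    also have "\<dots> = (SUP i. \<integral>\<^sup>+u. (\<integral>\<^sup>+y. U i y \<partial>Zd t u s \<omega>) \<partial>count_space (N t \<omega>))"
      using seq by simp
    also have "\<dots> = (\<integral>\<^sup>+u. (SUP i. \<integral>\<^sup>+y. U i y \<partial>Zd t u s \<omega>) \<partial>count_space (N t \<omega>))"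
    proof (rule nn_integral_monotone_convergence_SUP[symmetric])
      show "incseq (\<lambda>i u. \<integral>\<^sup>+y. U i y \<partial>Zd t u s \<omega>)"
        using seq.hyps(3) by (auto simp: incseq_def le_fun_def intro!: nn_integral_mono)
    qed simp
    also have "\<dots> = (\<integral>\<^sup>+u. (\<integral>\<^sup>+y. (SUP i. U i) y \<partial>Zd t u s \<omega>) \<partial>count_space (N t \<omega>))"
      unfolding SUP_apply
      by (intro nn_integral_cong nn_integral_monotone_convergence_SUP[symmetric] seq.hyps(3) m(2))
    finally show ?case .
  qed
  also have "\<dots> = (\<Sum>i. noff t s f i \<omega>)"
    unfolding nn_integral_count_space_countable
    using \<omega> by (intro suminf_cong) (auto simp: alive_def noff_def)
  finally show ?case by simp
qed

subsection \<open>Moments of linear functionals\<close>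

text \<open>The \<open>k\<close>-th moment of \<open>Z t (f)\<close> under \<open>P x\<close>; for \<open>k = 1\<close> this is the mean semigroup.\<close>

definition zmom :: "nat \<Rightarrow> real \<Rightarrow> ('x \<Rightarrow> ennreal) \<Rightarrow> 'x \<Rightarrow> ennreal" where
  "zmom k t f x = (\<integral>\<^sup>+\<omega>. zint t f \<omega> ^ k \<partial>P x)"

lemma mom_eq_zmom:
  fixes t s :: real and f :: "'x \<Rightarrow> ennreal"
  assumes x: "x \<in> space X" and t: "0 \<le> t" and s: "0 \<le> s" and f: "f \<in> borel_measurable X" and y: "y \<in> space X"
  shows "labelled_branching.mom (kern s f) k y = zmom k s f y"
proof -
  interpret labelled_branching "P x" X "alive t" "ntrait x t" "noff t s f" "kern s f" x
    by (rule labelled[OF x t s f])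
  show ?thesis
    unfolding mom_def zmom_def kern_def
    using zint_measurable_P[OF s f y] by (subst nn_integral_distr) auto
qed

lemma zmom_measurable:
  assumes s: "0 \<le> s" and f: "f \<in> borel_measurable X"
  shows "zmom k s f \<in> borel_measurable X"
proof (cases "space X = {}")
  case True
  then show ?thesis by (auto simp: measurable_def)
next
  case False
  then obtain x where x: "x \<in> space X" by auto
  interpret labelled_branching "P x" X "alive 0" "ntrait x 0" "noff 0 s f" "kern s f" x
    by (rule labelled[OF x order_refl s f])
  show ?thesis
    using mom_measurable[of k] mom_eq_zmom[OF x order_refl s f] by (simp cong: measurable_cong)
qed

lemma pop_eq_zint:
  fixes t s :: real and f :: "'x \<Rightarrow> ennreal"
  assumes x: "x \<in> space X" and t: "0 \<le> t" and s: "0 \<le> s" and f: "f \<in> borel_measurable X"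
    and g: "g \<in> borel_measurable X" and eq: "\<And>y. y \<in> space X \<Longrightarrow> g' y = g y" and \<omega>: "\<omega> \<in> space (P x)"
  shows "labelled_branching.pop (alive t) (ntrait x t) g' \<omega> = zint t g \<omega>"
proof -
  interpret labelled_branching "P x" X "alive t" "ntrait x t" "noff t s f" "kern s f" x
    by (rule labelled[OF x t s f])
  show ?thesis
    unfolding pop_def using zint_suminf[of \<omega> t g x] \<omega> t g eq[OF tr_space[OF \<omega>]]
    by (simp add: P_space[OF x])
qed

lemma tot_eq_zint:
  fixes t s :: real and f :: "'x \<Rightarrow> ennreal"
  assumes x: "x \<in> space X" and t: "0 \<le> t" and s: "0 \<le> s" and f: "f \<in> borel_measurable X"
  shows "AE \<omega> in P x. labelled_branching.tot (noff t s f) \<omega> = zint (t + s) f \<omega>"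
proof -
  interpret labelled_branching "P x" X "alive t" "ntrait x t" "noff t s f" "kern s f" x
    by (rule labelled[OF x t s f])
  show ?thesis unfolding tot_def by (rule zint_add[OF assms])
qed

context
  fixes x :: 'x and t s :: real and f :: "'x \<Rightarrow> ennreal"
  assumes x: "x \<in> space X" and t: "0 \<le> t" and s: "0 \<le> s" and f: "f \<in> borel_measurable X"
begin

interpretation labelled_branching "P x" X "alive t" "ntrait x t" "noff t s f" "kern s f" x
  by (rule labelled[OF x t s f])

lemma pop_mom: "\<omega> \<in> space (P x) \<Longrightarrow> pop (mom k) \<omega> = zint t (zmom k s f) \<omega>"
  by (rule pop_eq_zint[OF x t s f zmom_measurable[OF s f] mom_eq_zmom[OF x t s f]])

lemma zmom_1_add: "zmom 1 (t + s) f x = zmom 1 t (zmom 1 s f) x"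
proof -
  have "zmom 1 (t + s) f x = (\<integral>\<^sup>+\<omega>. tot \<omega> \<partial>P x)"
    unfolding zmom_def using tot_eq_zint[OF x t s f] by (intro nn_integral_cong_AE) auto
  also have "\<dots> = zmom 1 t (zmom 1 s f) x"
    unfolding integral_tot zmom_def[of 1 t]
    by (intro nn_integral_cong) (simp only: pop_mom power_one_right)
  finally show ?thesis .
qed

lemma zmom_2_add: "zmom 2 (t + s) f x \<le> zmom 1 t (zmom 2 s f) x + zmom 2 t (zmom 1 s f) x"
proof -
  have "zmom 2 (t + s) f x = (\<integral>\<^sup>+\<omega>. tot \<omega> ^ 2 \<partial>P x)"
    unfolding zmom_def using tot_eq_zint[OF x t s f] by (intro nn_integral_cong_AE) auto
  also have "\<dots> \<le> (\<integral>\<^sup>+\<omega>. pop (mom 2) \<omega> \<partial>P x) + (\<integral>\<^sup>+\<omega>. pop (mom 1) \<omega> ^ 2 \<partial>P x)"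
    by (rule integral_tot2)
  also have "\<dots> = zmom 1 t (zmom 2 s f) x + zmom 2 t (zmom 1 s f) x"
    unfolding zmom_def[of _ t]
    by (intro arg_cong2[where f = "(+)"] nn_integral_cong) (simp_all only: pop_mom power_one_right)
  finally show ?thesis .
qed

lemma zmom_3_add: "zmom 3 (t + s) f x \<le> zmom 1 t (zmom 3 s f) x
    + 3 * (\<integral>\<^sup>+\<omega>. zint t (zmom 2 s f) \<omega> * zint t (zmom 1 s f) \<omega> \<partial>P x) + zmom 3 t (zmom 1 s f) x"
proof -
  have "zmom 3 (t + s) f x = (\<integral>\<^sup>+\<omega>. tot \<omega> ^ 3 \<partial>P x)"
    unfolding zmom_def using tot_eq_zint[OF x t s f] by (intro nn_integral_cong_AE) auto
  also have "\<dots> \<le> (\<integral>\<^sup>+\<omega>. pop (mom 3) \<omega> \<partial>P x)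
     + 3 * (\<integral>\<^sup>+\<omega>. pop (mom 2) \<omega> * pop (mom 1) \<omega> \<partial>P x) + (\<integral>\<^sup>+\<omega>. pop (mom 1) \<omega> ^ 3 \<partial>P x)"
    by (rule integral_tot3)
  also have "\<dots> = zmom 1 t (zmom 3 s f) x
    + 3 * (\<integral>\<^sup>+\<omega>. zint t (zmom 2 s f) \<omega> * zint t (zmom 1 s f) \<omega> \<partial>P x) + zmom 3 t (zmom 1 s f) x"
    unfolding zmom_def[of _ t]
    by (intro arg_cong2[where f = "(+)"] arg_cong2[where f = "(*)"] refl nn_integral_cong)
       (simp_all only: pop_mom power_one_right)
  finally show ?thesis .
qed

lemma zint_centred:
  assumes "zmom 2 t (zmom 1 s f) x < \<infinity>" "zmom 1 t (zmom 2 s f) x < \<infinity>"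
  shows "(\<integral>\<^sup>+\<omega>. ennreal ((enn2real (zint (t + s) f \<omega>) - enn2real (zint t (zmom 1 s f) \<omega>))\<^sup>2) \<partial>P x)
      \<le> zmom 1 t (zmom 2 s f) x"
proof -
  have 1: "(\<integral>\<^sup>+\<omega>. pop (mom 1) \<omega> ^ 2 \<partial>P x) = zmom 2 t (zmom 1 s f) x"
    unfolding zmom_def[of _ t] by (intro nn_integral_cong) (simp_all only: pop_mom)
  have 2: "(\<integral>\<^sup>+\<omega>. pop (mom 2) \<omega> \<partial>P x) = zmom 1 t (zmom 2 s f) x"
    unfolding zmom_def[of _ t] by (intro nn_integral_cong) (simp_all only: pop_mom power_one_right)
  have "(\<integral>\<^sup>+\<omega>. ennreal ((enn2real (zint (t + s) f \<omega>) - enn2real (zint t (zmom 1 s f) \<omega>))\<^sup>2) \<partial>P x)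
    = (\<integral>\<^sup>+\<omega>. ennreal ((enn2real (tot \<omega>) - enn2real (pop (mom 1) \<omega>))\<^sup>2) \<partial>P x)"
  proof (rule nn_integral_cong_AE)
    show "AE \<omega> in P x. ennreal ((enn2real (zint (t + s) f \<omega>) - enn2real (zint t (zmom 1 s f) \<omega>))\<^sup>2)
        = ennreal ((enn2real (tot \<omega>) - enn2real (pop (mom 1) \<omega>))\<^sup>2)"
      using tot_eq_zint[OF x t s f] AE_space by eventually_elim (simp only: pop_mom)
  qed
  also have "\<dots> \<le> zmom 1 t (zmom 2 s f) x"
    using integral_tot_centred assms unfolding 1 2 by blast
  finally show ?thesis .
qed

lemma zint_lindeberg:
  fixes h v \<beta> :: "'x \<Rightarrow> real"
  assumes F: "F \<in> smooth_tests" and c: "0 \<le> c"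
    and [measurable]: "h \<in> borel_measurable X" "v \<in> borel_measurable X" "\<beta> \<in> borel_measurable X"
    and h: "\<And>y. y \<in> space X \<Longrightarrow> 0 \<le> h y" and v: "\<And>y. y \<in> space X \<Longrightarrow> 0 \<le> v y"
    and zmom1: "\<And>y. y \<in> space X \<Longrightarrow> zmom 1 s f y = ennreal (h y)"
    and zmom2: "\<And>y. y \<in> space X \<Longrightarrow> zmom 2 s f y = ennreal ((h y)\<^sup>2 + v y)"
    and zmom3: "\<And>y. y \<in> space X \<Longrightarrow> zmom 3 s f y \<le> ennreal (\<beta> y)"
    and h3: "\<And>y. y \<in> space X \<Longrightarrow> h y ^ 3 \<le> \<beta> y"
    and v3: "\<And>y. y \<in> space X \<Longrightarrow> v y * sqrt (v y) \<le> \<beta> y"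
    and fin1: "zmom 1 t (\<lambda>y. ennreal (h y)) x < \<infinity>"
    and fin2: "zmom 1 t (\<lambda>y. ennreal ((h y)\<^sup>2 + v y)) x < \<infinity>"
    and fin3: "zmom 1 t (\<lambda>y. ennreal (\<beta> y)) x < \<infinity>"
  shows "\<bar>(\<integral>\<omega>. F (c * (enn2real (zint t (\<lambda>y. ennreal (h y)) \<omega>) - enn2real (zint (t + s) f \<omega>))) \<partial>P x)
      - (\<integral>\<omega>. gauss_smooth F (c\<^sup>2 * enn2real (zint t (\<lambda>y. ennreal (v y)) \<omega>)) 0 \<partial>P x)\<bar>
    \<le> c ^ 3 * ((2 + gauss_abs_moment3) / 6) * enn2real (zmom 1 t (\<lambda>y. ennreal (\<beta> y)) x)"
proof -
  have p: "pop (\<lambda>y. ennreal (g y)) \<omega> = zint t (\<lambda>y. ennreal (g y)) \<omega>"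
    if [measurable]: "g \<in> borel_measurable X" and \<omega>: "\<omega> \<in> space (P x)" for g \<omega>
    by (rule pop_eq_zint[OF x t s f _ refl \<omega>]) measurable
  have i: "(\<integral>\<^sup>+\<omega>. pop (\<lambda>y. ennreal (g y)) \<omega> \<partial>P x) = zmom 1 t (\<lambda>y. ennreal (g y)) x"
    if "g \<in> borel_measurable X" for g
    unfolding zmom_def using p[OF that] by (intro nn_integral_cong) simp
  have "F \<in> borel_measurable borel" using smooth_tests_measurable[OF F, of 0] by simp
  moreover have "zint (t + s) f \<in> borel_measurable (P x)"
    using t s by (intro zint_measurable_P[OF _ f x]) simp
  ultimately have mF [measurable]: "F \<in> borel_measurable borel" and [measurable]: "zint (t + s) f \<in> borel_measurable (P x)"
    by auto
  note [measurable] = zint_measurable_P[OF t _ x]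
  have "\<bar>expectation (\<lambda>\<omega>. F (c * (enn2real (pop (\<lambda>x. ennreal (h x)) \<omega>) - enn2real (tot \<omega>))))
      - expectation (\<lambda>\<omega>. gauss_smooth F (c\<^sup>2 * enn2real (pop (\<lambda>x. ennreal ((h x)\<^sup>2 + v x - (h x)\<^sup>2)) \<omega>)) 0)\<bar>
    \<le> c ^ 3 * ((2 + gauss_abs_moment3) / 6) * enn2real (\<integral>\<^sup>+\<omega>. pop (\<lambda>x. ennreal (\<beta> x)) \<omega> \<partial>P x)"
  proof (rule lindeberg_labelled[OF F c])
    show "mom 1 y = ennreal (h y)" "mom 2 y = ennreal ((h y)\<^sup>2 + v y)" "mom 3 y \<le> ennreal (\<beta> y)"
      if y: "y \<in> space X" for y
      using zmom1[OF y] zmom2[OF y] zmom3[OF y] by (simp_all only: mom_eq_zmom[OF x t s f y])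
    show "(\<integral>\<^sup>+\<omega>. pop (\<lambda>x. ennreal (h x)) \<omega> \<partial>P x) < \<infinity>"
      using fin1 by (subst i) auto
    show "(\<integral>\<^sup>+\<omega>. pop (\<lambda>x. ennreal ((h x)\<^sup>2 + v x)) \<omega> \<partial>P x) < \<infinity>"
      using fin2 by (subst i) auto
    show "(\<integral>\<^sup>+\<omega>. pop (\<lambda>x. ennreal (\<beta> x)) \<omega> \<partial>P x) < \<infinity>"
      using fin3 by (subst i) auto
  qed (use h v h3 v3 in auto)
  moreover have "expectation (\<lambda>\<omega>. F (c * (enn2real (pop (\<lambda>x. ennreal (h x)) \<omega>) - enn2real (tot \<omega>))))
     = (\<integral>\<omega>. F (c * (enn2real (zint t (\<lambda>y. ennreal (h y)) \<omega>) - enn2real (zint (t + s) f \<omega>))) \<partial>P x)"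
  proof (rule integral_cong_AE)
    show "AE \<omega> in P x. F (c * (enn2real (pop (\<lambda>x. ennreal (h x)) \<omega>) - enn2real (tot \<omega>)))
      = F (c * (enn2real (zint t (\<lambda>y. ennreal (h y)) \<omega>) - enn2real (zint (t + s) f \<omega>)))"
      using tot_eq_zint[OF x t s f] AE_space by eventually_elim (simp add: p)
  qed measurable
  moreover have "expectation (\<lambda>\<omega>. gauss_smooth F (c\<^sup>2 * enn2real (pop (\<lambda>x. ennreal ((h x)\<^sup>2 + v x - (h x)\<^sup>2)) \<omega>)) 0)
     = (\<integral>\<omega>. gauss_smooth F (c\<^sup>2 * enn2real (zint t (\<lambda>y. ennreal (v y)) \<omega>)) 0 \<partial>P x)"
    by (intro Bochner_Integration.integral_cong refl) (simp add: p)
  ultimately show ?thesis by (simp only: i[OF assms(5)])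
qed

end

lemma zmom_0:
  assumes x: "x \<in> space X" and f: "f \<in> borel_measurable X"
  shows "zmom k 0 f x = f x ^ k"
proof -
  have "zmom k 0 f x = (\<integral>\<^sup>+\<omega>. f x ^ k \<partial>P x)"
    unfolding zmom_def
  proof (rule nn_integral_cong_AE)
    show "AE \<omega> in P x. zint 0 f \<omega> ^ k = f x ^ k"
      using Z_start[OF x] by eventually_elim (use x f in \<open>simp add: zint_def nn_integral_return\<close>)
  qed
  then show ?thesis using prob_space.emeasure_space_1[OF P_prob[OF x]] by simp
qed

end


section \<open>Moment bounds\<close>

lemma ennreal_two_mult_le: "2 * (a * b) \<le> a ^ 2 + b ^ 2" for a b :: ennreal
proof (cases "a = top \<or> b = top")
  case True
  then show ?thesis by (auto simp: power2_eq_square)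
next
  case False
  then obtain r s where "0 \<le> r" "a = ennreal r" "0 \<le> s" "b = ennreal s"
    by (metis ennreal_cases)
  moreover have "ennreal (2 * (r * s)) \<le> ennreal (r\<^sup>2 + s\<^sup>2)"
    using sum_squares_bound[of r s] by (intro ennreal_leI) simp
  ultimately show ?thesis by (simp add: ennreal_mult ennreal_power ennreal_plus)
qed

text \<open>A weighted form of the arithmetic-geometric mean inequality replaces Cauchy-Schwarz.\<close>

lemma ennreal_two_mult_le_weighted:
  fixes a b :: ennreal
  assumes "0 < e"
  shows "2 * (a * b) \<le> ennreal (1 / e) * a ^ 2 + ennreal e * b ^ 2"
proof -
  define s where "s = ennreal (sqrt e)"
  define s' where "s' = ennreal (1 / sqrt e)"
  have "s * s' = 1" using assms by (simp add: s_def s'_def ennreal_mult[symmetric])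
  then have "2 * (a * b) = 2 * ((s' * a) * (s * b))" by (simp add: mult_ac)
  also have "\<dots> \<le> (s' * a) ^ 2 + (s * b) ^ 2" by (rule ennreal_two_mult_le)
  also have "\<dots> = ennreal (1 / e) * a ^ 2 + ennreal e * b ^ 2"
    using assms by (simp add: s_def s'_def power_mult_distrib ennreal_power power_divide)
  finally show ?thesis .
qed

lemma (in prob_space) nn_integral_abs_le_of_square:
  fixes D :: "'a \<Rightarrow> real"
  assumes [measurable]: "D \<in> borel_measurable M" and e: "0 < e" and K: "0 \<le> K"
    and le: "(\<integral>\<^sup>+\<omega>. ennreal ((D \<omega>)\<^sup>2) \<partial>M) \<le> ennreal (K * e\<^sup>2)"
  shows "(\<integral>\<^sup>+\<omega>. ennreal \<bar>D \<omega>\<bar> \<partial>M) \<le> ennreal ((K + 1) * e)"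
proof -
  have "\<bar>d\<bar> \<le> 1 / e * d\<^sup>2 + e" for d :: real
  proof (cases "\<bar>d\<bar> \<le> e")
    case True
    have "0 \<le> 1 / e * d\<^sup>2" using e by simp
    with True show ?thesis by linarith
  next
    case False
    then have "\<bar>d\<bar> * e \<le> \<bar>d\<bar> * \<bar>d\<bar>" by (intro mult_left_mono) auto
    then have "\<bar>d\<bar> * e \<le> d\<^sup>2" by (simp add: power2_eq_square)
    then have "\<bar>d\<bar> \<le> d\<^sup>2 / e" using e by (simp add: pos_le_divide_eq)
    then show ?thesis using e by simp
  qed
  then have "(\<integral>\<^sup>+\<omega>. ennreal \<bar>D \<omega>\<bar> \<partial>M) \<le> (\<integral>\<^sup>+\<omega>. ennreal (1 / e) * ennreal ((D \<omega>)\<^sup>2) + ennreal e \<partial>M)"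
    using e by (intro nn_integral_mono) (simp add: ennreal_mult[symmetric] ennreal_plus[symmetric] ennreal_leI del: ennreal_plus)
  also have "\<dots> = ennreal (1 / e) * (\<integral>\<^sup>+\<omega>. ennreal ((D \<omega>)\<^sup>2) \<partial>M) + ennreal e"
    by (subst nn_integral_add) (auto simp: nn_integral_cmult emeasure_space_1)
  also have "\<dots> \<le> ennreal (1 / e) * ennreal (K * e\<^sup>2) + ennreal e"
    by (intro add_mono mult_left_mono le) auto
  also have "\<dots> = ennreal ((K + 1) * e)"
    using e K by (simp add: ennreal_mult[symmetric] ennreal_plus[symmetric] power2_eq_square distrib_right del: ennreal_plus)
  finally show ?thesis .
qed

context branching_process
begin

lemma space_Z [simp]: "space (Z t \<omega>) = space X"
  by (simp add: population_def)

lemma sets_Z [simp, measurable_cong]: "sets (Z t \<omega>) = sets X"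
  by (simp add: population_def)

lemma zint_mono: "(\<And>y. y \<in> space X \<Longrightarrow> f y \<le> g y) \<Longrightarrow> zint t f \<omega> \<le> zint t g \<omega>"
  unfolding zint_def by (intro nn_integral_mono) simp

lemma zint_cong: "(\<And>y. y \<in> space X \<Longrightarrow> f y = g y) \<Longrightarrow> zint t f \<omega> = zint t g \<omega>"
  unfolding zint_def by (intro nn_integral_cong) simp

lemma zint_cmult: "f \<in> borel_measurable X \<Longrightarrow> zint t (\<lambda>y. c * f y) \<omega> = c * zint t f \<omega>"
  unfolding zint_def by (intro nn_integral_cmult) simp

lemma zint_add_fun: "f \<in> borel_measurable X \<Longrightarrow> g \<in> borel_measurable X \<Longrightarrow>
    zint t (\<lambda>y. f y + g y) \<omega> = zint t f \<omega> + zint t g \<omega>"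
  unfolding zint_def by (intro nn_integral_add) simp_all

lemma zmom_mono: "(\<And>y. y \<in> space X \<Longrightarrow> f y \<le> g y) \<Longrightarrow> zmom k t f x \<le> zmom k t g x"
  unfolding zmom_def by (intro nn_integral_mono power_mono zint_mono) auto

lemma zmom_cong: "(\<And>y. y \<in> space X \<Longrightarrow> f y = g y) \<Longrightarrow> zmom k t f x = zmom k t g x"
  unfolding zmom_def by (simp cong: zint_cong)

lemma zmom_cmult:
  assumes "x \<in> space X" "0 \<le> t" "f \<in> borel_measurable X"
  shows "zmom k t (\<lambda>y. c * f y) x = c ^ k * zmom k t f x"
  unfolding zmom_def using zint_measurable_P[OF assms(2,3,1)]
  by (simp add: zint_cmult[OF assms(3)] power_mult_distrib nn_integral_cmult)

text \<open>Conditioning at time \<open>t\<close> decreases the second moment.\<close>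

lemma zmom_2_lower:
  fixes t s :: real
  assumes x: "x \<in> space X" and t: "0 \<le> t" and s: "0 \<le> s" and f: "f \<in> borel_measurable X"
    and fin: "zmom 2 t (zmom 1 s f) x < \<infinity>"
  shows "zmom 2 t (zmom 1 s f) x \<le> zmom 2 (t + s) f x"
proof -
  interpret labelled_branching "P x" X "alive t" "ntrait x t" "noff t s f" "kern s f" x
    by (rule labelled[OF x t s f])
  have f1: "zmom 1 s f \<in> borel_measurable X" by (rule zmom_measurable[OF s f])
  note [measurable] = zint_measurable_P[OF t f1 x] zint_measurable_P[OF add_nonneg_nonneg[OF t s] f x]
  have T: "pop (zmom 1 s f) \<omega> = zint t (zmom 1 s f) \<omega>" if "\<omega> \<in> space (P x)" for \<omega>
    by (rule pop_eq_zint[OF x t s f f1 refl that])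
  have "(\<integral>\<^sup>+\<omega>. zint (t + s) f \<omega> * zint t (zmom 1 s f) \<omega> \<partial>P x) = (\<integral>\<^sup>+\<omega>. tot \<omega> * pop (zmom 1 s f) \<omega> \<partial>P x)"
  proof (rule nn_integral_cong_AE)
    show "AE \<omega> in P x. zint (t + s) f \<omega> * zint t (zmom 1 s f) \<omega> = tot \<omega> * pop (zmom 1 s f) \<omega>"
      using tot_eq_zint[OF x t s f] AE_space by eventually_elim (simp only: T)
  qed
  also have "\<dots> = (\<integral>\<^sup>+\<omega>. pop (mom 1) \<omega> * pop (zmom 1 s f) \<omega> \<partial>P x)"
    by (rule integral_tot_pop[OF f1])
  also have "\<dots> = zmom 2 t (zmom 1 s f) x"
    unfolding zmom_def[of 2 t] power2_eq_square
    by (intro nn_integral_cong) (simp only: T pop_mom[OF x t s f])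
  finally have cross: "(\<integral>\<^sup>+\<omega>. zint (t + s) f \<omega> * zint t (zmom 1 s f) \<omega> \<partial>P x) = zmom 2 t (zmom 1 s f) x" .
  have "zmom 2 t (zmom 1 s f) x + zmom 2 t (zmom 1 s f) x = (\<integral>\<^sup>+\<omega>. 2 * (zint (t + s) f \<omega> * zint t (zmom 1 s f) \<omega>) \<partial>P x)"
    unfolding cross[symmetric] mult_2[symmetric] by (rule nn_integral_cmult[symmetric]) measurable
  also have "\<dots> \<le> (\<integral>\<^sup>+\<omega>. zint (t + s) f \<omega> ^ 2 + zint t (zmom 1 s f) \<omega> ^ 2 \<partial>P x)"
    by (intro nn_integral_mono ennreal_two_mult_le)
  also have "\<dots> = zmom 2 (t + s) f x + zmom 2 t (zmom 1 s f) x"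
    unfolding zmom_def[of 2] by (rule nn_integral_add) measurable
  finally show ?thesis
    using fin by (auto simp: ennreal_add_left_cancel_le add.commute[of "zmom 2 (t + s) f x"])
qed

lemma zint_power_le:
  assumes \<omega>: "\<omega> \<in> space \<Omega>" and t: "0 \<le> t" and [measurable]: "f \<in> borel_measurable X"
  shows "zint t (\<lambda>y. f y ^ Suc k) \<omega> \<le> zint t f \<omega> ^ Suc k"
proof (induction k)
  case (Suc k)
  have "zint t (\<lambda>y. f y ^ Suc (Suc k)) \<omega> = (\<integral>\<^sup>+u. f (trait t \<omega> u) ^ Suc (Suc k) \<partial>count_space (N t \<omega>))"
    by (rule zint_eq[OF \<omega> t]) measurable
  also have "\<dots> \<le> (\<integral>\<^sup>+u. zint t f \<omega> * f (trait t \<omega> u) ^ Suc k \<partial>count_space (N t \<omega>))"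
  proof (rule nn_integral_mono)
    fix u assume "u \<in> space (count_space (N t \<omega>))"
    then have "f (trait t \<omega> u) \<le> (\<integral>\<^sup>+u. f (trait t \<omega> u) \<partial>count_space (N t \<omega>))"
      using nn_integral_ge_point[of u "N t \<omega>" "\<lambda>u. f (trait t \<omega> u)"] by simp
    also have "\<dots> = zint t f \<omega>" by (rule zint_eq[OF \<omega> t, symmetric]) measurable
    finally show "f (trait t \<omega> u) ^ Suc (Suc k) \<le> zint t f \<omega> * f (trait t \<omega> u) ^ Suc k"
      unfolding power_Suc[of _ "Suc k"] by (rule mult_right_mono) simp
  qed
  also have "\<dots> = zint t f \<omega> * (\<integral>\<^sup>+u. f (trait t \<omega> u) ^ Suc k \<partial>count_space (N t \<omega>))"
    by (rule nn_integral_cmult) simp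
  also have "(\<integral>\<^sup>+u. f (trait t \<omega> u) ^ Suc k \<partial>count_space (N t \<omega>)) = zint t (\<lambda>y. f y ^ Suc k) \<omega>"
    by (rule zint_eq[OF \<omega> t, symmetric]) measurable
  also have "zint t f \<omega> * zint t (\<lambda>y. f y ^ Suc k) \<omega> \<le> zint t f \<omega> * zint t f \<omega> ^ Suc k"
    by (rule mult_left_mono[OF Suc]) simp
  finally show ?case by simp
qed simp

lemma integral_Z_eq:
  assumes f: "f \<in> borel_measurable X" and pos: "\<And>y. y \<in> space X \<Longrightarrow> 0 \<le> (f y :: real)"
  shows "(\<integral>y. f y \<partial>Z t \<omega>) = enn2real (zint t (\<lambda>y. ennreal (f y)) \<omega>)"
  unfolding zint_def using f pos by (intro integral_eq_nn_integral) auto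

text \<open>If \<open>Z t (f)\<close> has finite mean, the iterated Bochner integrals agree with the extended ones. Without
  finiteness the former would be \<open>0\<close> by convention.\<close>

lemma mean_semigroup_eq:
  assumes x: "x \<in> space X" and t: "0 \<le> t" and f: "f \<in> borel_measurable X"
    and pos: "\<And>y. y \<in> space X \<Longrightarrow> 0 \<le> (f y :: real)" and fin: "zmom 1 t (\<lambda>y. ennreal (f y)) x < \<infinity>"
  shows "mean_semigroup P Z t f x = enn2real (zmom 1 t (\<lambda>y. ennreal (f y)) x)"
proof -
  have [measurable]: "zint t (\<lambda>y. ennreal (f y)) \<in> borel_measurable (P x)"
    using f by (intro zint_measurable_P[OF t _ x]) auto
  have "AE \<omega> in P x. zint t (\<lambda>y. ennreal (f y)) \<omega> \<noteq> \<infinity>"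
    using fin by (intro nn_integral_noteq_infinite) (auto simp: zmom_def)
  then have "(\<integral>\<^sup>+\<omega>. ennreal (enn2real (zint t (\<lambda>y. ennreal (f y)) \<omega>)) \<partial>P x) = zmom 1 t (\<lambda>y. ennreal (f y)) x"
    unfolding zmom_def by (intro nn_integral_cong_AE) (auto simp: less_top)
  moreover have "(\<integral>y. f y \<partial>Z t \<omega>) = enn2real (zint t (\<lambda>y. ennreal (f y)) \<omega>)" for \<omega>
    using f pos by (rule integral_Z_eq)
  ultimately show ?thesis
    unfolding mean_semigroup_def by (simp add: integral_eq_nn_integral)
qed

end

text \<open>The moment assumptions with explicit constants, for the powers \<open>V\<close>, ..., \<open>V ^ 4\<close> only. The constant
  \<open>ch\<close> compares \<open>h\<close> with these powers and \<open>G\<close> bounds their integrals under \<open>\<gamma>\<close>. The constants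
  \<open>CM\<close>, \<open>C2\<close>, \<open>CB\<close>, ... defined below depend on these data only.\<close>

locale branching_moments = branching_process X \<Omega> P N trait desc
  for X :: "'x measure" and \<Omega> :: "'w measure" and P :: "'x \<Rightarrow> 'w measure"
    and N :: "real \<Rightarrow> 'w \<Rightarrow> ('u::countable) set" and trait :: "real \<Rightarrow> 'w \<Rightarrow> 'u \<Rightarrow> 'x"
    and desc :: "'w \<Rightarrow> 'u \<Rightarrow> 'u \<Rightarrow> bool" +
  fixes V h :: "'x \<Rightarrow> real" and \<gamma> :: "'x measure" and lam \<rho> \<tau> a1 a2 ch G :: real
  assumes V_meas [measurable]: "V \<in> borel_measurable X" and V_pos: "\<And>x. x \<in> space X \<Longrightarrow> 0 < V x"
    and h_meas [measurable]: "h \<in> borel_measurable X" and h_nonneg: "\<And>x. x \<in> space X \<Longrightarrow> 0 \<le> h x"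
    and pos: "0 < lam" "0 < \<rho>" "0 < \<tau>" "0 < a1" "0 < a2" "0 < ch"
    and small_time: "\<And>x k t. x \<in> space X \<Longrightarrow> k \<in> {1..4} \<Longrightarrow> 0 \<le> t \<Longrightarrow> t \<le> \<tau> \<Longrightarrow>
        zmom k t (\<lambda>y. ennreal (V y)) x \<le> ennreal (a1 * V x ^ k)"
    and h_le: "\<And>x k. x \<in> space X \<Longrightarrow> k \<in> {1..4} \<Longrightarrow> h x \<le> ch * V x ^ k"
    and \<gamma>_sets [measurable_cong]: "sets \<gamma> = sets X"
    and \<gamma>_V: "\<And>k. k \<in> {1..4} \<Longrightarrow> integrable \<gamma> (\<lambda>x. V x ^ k)"
    and \<gamma>_G: "\<And>k. k \<in> {1..4} \<Longrightarrow> (\<integral>x. V x ^ k \<partial>\<gamma>) \<le> G"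
    and mean_h: "\<And>x t. x \<in> space X \<Longrightarrow> 0 \<le> t \<Longrightarrow> mean_semigroup P (population X N trait) t h x = exp (lam * t) * h x"
    and ergodic: "\<And>x k f c t. x \<in> space X \<Longrightarrow> k \<in> {1..4} \<Longrightarrow> f \<in> borel_measurable X \<Longrightarrow> 0 \<le> c \<Longrightarrow>
        (\<And>y. y \<in> space X \<Longrightarrow> \<bar>f y\<bar> \<le> c * V y ^ k) \<Longrightarrow> 0 < t \<Longrightarrow>
        \<bar>exp (- lam * t) * mean_semigroup P (population X N trait) t f x - (\<integral>y. f y \<partial>\<gamma>) * h x\<bar>
          \<le> a2 * exp (- \<rho> * t) * c * V x ^ k"
begin

abbreviation Vp :: "nat \<Rightarrow> 'x \<Rightarrow> ennreal" where "Vp k \<equiv> \<lambda>y. ennreal (V y ^ k)"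
abbreviation H :: "'x \<Rightarrow> ennreal" where "H \<equiv> \<lambda>y. ennreal (h y)"

lemma V_nonneg [simp]: "x \<in> space X \<Longrightarrow> 0 \<le> V x"
  using V_pos[of x] by simp

lemma zint_Vp_le: "\<omega> \<in> space \<Omega> \<Longrightarrow> 0 \<le> t \<Longrightarrow> 1 \<le> k \<Longrightarrow> zint t (Vp k) \<omega> \<le> zint t (\<lambda>y. ennreal (V y)) \<omega> ^ k"
  using zint_power_le[of \<omega> t "\<lambda>y. ennreal (V y)" "k - 1"]
  by (simp add: ennreal_power cong: zint_cong)

lemma small_time_Vp:
  assumes x: "x \<in> space X" and k: "1 \<le> k" "1 \<le> j" "j * k \<le> 4" and t: "0 \<le> t" "t \<le> \<tau>"
  shows "zmom j t (Vp k) x \<le> ennreal (a1 * V x ^ (j * k))"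
proof -
  have "zmom j t (Vp k) x \<le> zmom (k * j) t (\<lambda>y. ennreal (V y)) x"
    unfolding zmom_def power_mult
    by (intro nn_integral_mono power_mono zint_Vp_le k t) (simp_all add: P_space[OF x])
  also have "\<dots> \<le> ennreal (a1 * V x ^ (k * j))"
    using k t by (intro small_time x) (auto simp: mult.commute Suc_leI)
  finally show ?thesis by (simp add: mult.commute)
qed

lemma zmom_le_scaled:
  assumes x: "x \<in> space X" and t: "0 \<le> t" and c: "0 \<le> c"
    and f: "\<And>y. y \<in> space X \<Longrightarrow> f y \<le> ennreal (c * V y ^ k)"
  shows "zmom j t f x \<le> ennreal (c ^ j) * zmom j t (Vp k) x"
proof -
  have "zmom j t f x \<le> zmom j t (\<lambda>y. ennreal c * Vp k y) x"
    using f c by (intro zmom_mono) (simp add: ennreal_mult')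
  also have "\<dots> = ennreal c ^ j * zmom j t (Vp k) x" by (rule zmom_cmult[OF x t]) measurable
  finally show ?thesis using c by (simp add: ennreal_power)
qed

text \<open>Finiteness at all times, by iteration of the bound on small times. It is needed before the ergodic
  estimate, stated with Bochner integrals, can be applied to powers of \<open>V\<close>.\<close>

lemma zmom_Vp_finite:
  assumes k: "k \<in> {1..4}" and x: "x \<in> space X" and t: "0 \<le> t"
  shows "zmom 1 t (Vp k) x < \<infinity>"
proof -
  have "\<exists>B\<ge>0. \<forall>x\<in>space X. \<forall>t. 0 \<le> t \<and> t \<le> real n * \<tau> \<longrightarrow> zmom 1 t (Vp k) x \<le> ennreal (B * V x ^ k)" for n
  proof (induction n)
    case 0
    have "zmom 1 t (Vp k) x \<le> ennreal (a1 * V x ^ k)" if "x \<in> space X" "0 \<le> t" "t \<le> real 0 * \<tau>" for x t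
      using small_time_Vp[OF that(1), of k 1 t] that pos k by auto
    then show ?case using pos by (intro exI[of _ a1]) auto
  next
    case (Suc n)
    then obtain B where B: "0 \<le> B" and le: "\<And>x t. x \<in> space X \<Longrightarrow> 0 \<le> t \<Longrightarrow> t \<le> real n * \<tau> \<Longrightarrow>
        zmom 1 t (Vp k) x \<le> ennreal (B * V x ^ k)" by blast
    have "zmom 1 t (Vp k) x \<le> ennreal (max a1 (a1 * B) * V x ^ k)"
      if x: "x \<in> space X" and t: "0 \<le> t" "t \<le> real (Suc n) * \<tau>" for x t
    proof (cases "t \<le> \<tau>")
      case True
      have "zmom 1 t (Vp k) x \<le> ennreal (a1 * V x ^ k)"
        using small_time_Vp[OF x, of k 1 t] t k True by auto
      also have "\<dots> \<le> ennreal (max a1 (a1 * B) * V x ^ k)"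
        using x by (intro ennreal_leI mult_right_mono) auto
      finally show ?thesis .
    next
      case False
      then have t': "0 \<le> t - \<tau>" "t - \<tau> \<le> real n * \<tau>" using t by (auto simp: distrib_right)
      have "zmom 1 t (Vp k) x = zmom 1 ((t - \<tau>) + \<tau>) (Vp k) x" by simp
      also have "\<dots> = zmom 1 (t - \<tau>) (zmom 1 \<tau> (Vp k)) x"
        by (rule zmom_1_add[OF x t'(1)]) (use pos in auto)
      also have "\<dots> \<le> ennreal (a1 ^ 1) * zmom 1 (t - \<tau>) (Vp k) x"
        by (rule zmom_le_scaled[OF x t'(1)]) (use small_time_Vp[of _ k 1 \<tau>] pos k in auto)
      also have "\<dots> \<le> ennreal (a1 ^ 1) * ennreal (B * V x ^ k)"
        by (intro mult_left_mono le[OF x t']) auto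
      also have "\<dots> = ennreal (a1 * B * V x ^ k)"
        using pos B x by (simp add: ennreal_mult[symmetric] mult.assoc)
      also have "\<dots> \<le> ennreal (max a1 (a1 * B) * V x ^ k)"
        using x by (intro ennreal_leI mult_right_mono) auto
      finally show ?thesis .
    qed
    then show ?case using pos B by (intro exI[of _ "max a1 (a1 * B)"]) auto
  qed
  from this[of "nat \<lceil>t / \<tau>\<rceil>"] obtain B where
    "\<And>x t'. x \<in> space X \<Longrightarrow> 0 \<le> t' \<Longrightarrow> t' \<le> real (nat \<lceil>t / \<tau>\<rceil>) * \<tau> \<Longrightarrow> zmom 1 t' (Vp k) x \<le> ennreal (B * V x ^ k)"
    by blast
  moreover have "t / \<tau> \<le> real (nat \<lceil>t / \<tau>\<rceil>)" by linarith
  then have "t \<le> real (nat \<lceil>t / \<tau>\<rceil>) * \<tau>" using pos by (simp add: field_simps)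
  ultimately have "zmom 1 t (Vp k) x \<le> ennreal (B * V x ^ k)" using x t by blast
  then show ?thesis by (rule le_less_trans) simp
qed

text \<open>The constant in the bound on first moments, \<open>zmom_Vp_le\<close>.\<close>

definition CM :: real where "CM = 1 + G * ch + a2"

lemma G_nonneg: "0 \<le> G"
proof -
  have "0 \<le> (\<integral>x. V x ^ 1 \<partial>\<gamma>)"
    using sets_eq_imp_space_eq[OF \<gamma>_sets] by (intro Bochner_Integration.integral_nonneg) simp
  also have "\<dots> \<le> G" by (rule \<gamma>_G) simp
  finally show ?thesis .
qed

lemma CM_pos: "0 < CM" using G_nonneg pos by (simp add: CM_def add_pos_nonneg add_nonneg_pos)

lemma zmom_Vp_le:
  assumes k: "k \<in> {1..4}" and x: "x \<in> space X" and t: "0 \<le> t"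
  shows "zmom 1 t (Vp k) x \<le> ennreal (CM * exp (lam * t) * V x ^ k)"
proof (cases "t = 0")
  case True
  have "0 \<le> G * ch" using G_nonneg pos by simp
  then have "1 \<le> CM" using pos by (simp add: CM_def)
  then have "V x ^ k \<le> CM * V x ^ k"
    using mult_right_mono[of 1 CM "V x ^ k"] zero_le_power[OF V_nonneg[OF x]] by simp
  then show ?thesis using True zmom_0[OF x, of "Vp k" 1] by (simp add: ennreal_leI)
next
  case False
  then have t0: "0 < t" using t by simp
  have Vk: "0 \<le> V x ^ k" using x by simp
  have fin: "zmom 1 t (Vp k) x < \<infinity>" by (rule zmom_Vp_finite[OF k x t])
  have m: "mean_semigroup P Z t (\<lambda>y. V y ^ k) x = enn2real (zmom 1 t (Vp k) x)"
    by (rule mean_semigroup_eq[OF x t _ _ fin]) auto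
  have "\<bar>exp (- lam * t) * mean_semigroup P Z t (\<lambda>y. V y ^ k) x - (\<integral>y. V y ^ k \<partial>\<gamma>) * h x\<bar>
      \<le> a2 * exp (- \<rho> * t) * 1 * V x ^ k"
    by (rule ergodic[OF x k _ _ _ t0]) auto
  also have "\<dots> \<le> a2 * 1 * 1 * V x ^ k"
    using pos Vk t0 by (intro mult_right_mono mult_left_mono) auto
  finally have "exp (- lam * t) * enn2real (zmom 1 t (Vp k) x) \<le> (\<integral>y. V y ^ k \<partial>\<gamma>) * h x + a2 * V x ^ k"
    unfolding m by simp
  also have "\<dots> \<le> G * (ch * V x ^ k) + a2 * V x ^ k"
    using G_nonneg by (intro add_right_mono mult_mono \<gamma>_G[OF k] h_le[OF x k] h_nonneg x) auto
  also have "\<dots> \<le> CM * V x ^ k" using Vk by (simp add: CM_def distrib_right)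
  finally have "exp (lam * t) * (exp (- lam * t) * enn2real (zmom 1 t (Vp k) x)) \<le> exp (lam * t) * (CM * V x ^ k)"
    by (rule mult_left_mono) simp
  then have "enn2real (zmom 1 t (Vp k) x) \<le> CM * exp (lam * t) * V x ^ k"
    by (simp add: mult_ac exp_minus field_simps)
  then show ?thesis using fin by (metis ennreal_enn2real ennreal_leI infinity_ennreal_def)
qed

lemma zmom_1_le:
  assumes k: "k \<in> {1..4}" and x: "x \<in> space X" and t: "0 \<le> t" and c: "0 \<le> c"
    and f: "\<And>y. y \<in> space X \<Longrightarrow> f y \<le> ennreal (c * V y ^ k)"
  shows "zmom 1 t f x \<le> ennreal (c * CM * exp (lam * t) * V x ^ k)"
proof -
  have "zmom 1 t f x \<le> ennreal (c ^ 1) * zmom 1 t (Vp k) x" by (rule zmom_le_scaled[OF x t c f])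
  also have "\<dots> \<le> ennreal (c ^ 1) * ennreal (CM * exp (lam * t) * V x ^ k)"
    by (intro mult_left_mono zmom_Vp_le[OF k x t]) simp
  also have "\<dots> = ennreal (c * CM * exp (lam * t) * V x ^ k)"
    using c x CM_pos by (simp add: ennreal_mult[symmetric] mult.assoc)
  finally show ?thesis .
qed

lemma zmom_1_h:
  assumes x: "x \<in> space X" and t: "0 \<le> t"
  shows "zmom 1 t H x = ennreal (exp (lam * t) * h x)"
proof -
  have "zmom 1 t H x \<le> ennreal (ch * CM * exp (lam * t) * V x ^ 1)"
    using pos h_le[of _ 1] by (intro zmom_1_le x t) (auto intro!: ennreal_leI)
  then have fin: "zmom 1 t H x < \<infinity>" by (rule le_less_trans) simp
  have "ennreal (enn2real (zmom 1 t H x)) = ennreal (exp (lam * t) * h x)"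
    using mean_semigroup_eq[OF x t h_meas h_nonneg fin] mean_h[OF x t] by simp
  then show ?thesis using fin by simp
qed

text \<open>The inverse of the growth of the mean over one step of length \<open>\<tau>\<close>, and the constant in the bound on
  second moments, \<open>zmom_2_le\<close>.\<close>

definition q :: real where "q = exp (- lam * \<tau>)"
definition C2 :: real where "C2 = a1 + a1 * CM / (1 - q)"

lemma q: "0 < q" "q < 1" using pos by (auto simp: q_def)

lemma geometric_q: "(\<Sum>j<n. q ^ j) \<le> 1 / (1 - q)"
proof -
  have "(\<Sum>j<n. q ^ j) \<le> (\<Sum>j. q ^ j)" using q by (intro sum_le_suminf summable_geometric) auto
  then show ?thesis using q by (simp add: suminf_geometric)
qed

lemma C2_pos: "0 < C2" using q pos CM_pos by (simp add: C2_def add_pos_nonneg)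

lemma exp_le_q_power: "real n * \<tau> \<le> t \<Longrightarrow> exp (- lam * t) \<le> q ^ n"
proof -
  assume "real n * \<tau> \<le> t"
  then have "lam * (real n * \<tau>) \<le> lam * t" using pos by (intro mult_left_mono) auto
  then have "exp (- lam * t) \<le> exp (real n * (- lam * \<tau>))" by (simp add: mult_ac)
  then show ?thesis by (simp only: exp_of_nat_mult q_def)
qed

text \<open>Second moments grow at most like \<open>exp (2 * lam * t)\<close>. The induction adds one step of length \<open>\<tau>\<close> at
  a time at the end, and passes from \<open>f\<close> to \<open>g = exp (- lam * \<tau>) * M \<tau> f\<close>, which satisfies the same
  bound on its mean; each step adds a term of a geometric series to the constant.\<close>

lemma zmom_2_le:
  assumes p: "p \<in> {1, 2 :: nat}" and K: "0 \<le> K" and f: "f \<in> borel_measurable X"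
    and fK: "\<And>x r. x \<in> space X \<Longrightarrow> 0 \<le> r \<Longrightarrow> zmom 1 r f x \<le> ennreal (K * exp (lam * r) * V x ^ p)"
    and x: "x \<in> space X" and t: "0 \<le> t"
  shows "zmom 2 t f x \<le> ennreal (K\<^sup>2 * C2 * exp (2 * lam * t) * V x ^ (2 * p))"
proof -
  define c where "c n = a1 + a1 * CM * (\<Sum>j<n. q ^ j)" for n
  have c0: "0 \<le> c n" for n unfolding c_def using pos q CM_pos by (intro add_nonneg_nonneg mult_nonneg_nonneg sum_nonneg) auto
  have small: "zmom 2 \<delta> f x \<le> ennreal (K\<^sup>2 * a1 * V x ^ (2 * p))"
    if "x \<in> space X" "0 \<le> \<delta>" "\<delta> \<le> \<tau>" "f \<in> borel_measurable X"
      "\<And>x r. x \<in> space X \<Longrightarrow> 0 \<le> r \<Longrightarrow> zmom 1 r f x \<le> ennreal (K * exp (lam * r) * V x ^ p)" for x \<delta> f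
  proof -
    have "f y \<le> ennreal (K * V y ^ p)" if y: "y \<in> space X" for y
      using that(1) \<open>f \<in> borel_measurable X\<close> zmom_0[OF y, of f 1] \<open>\<And>x r. x \<in> space X \<Longrightarrow> 0 \<le> r \<Longrightarrow> zmom 1 r f x \<le> ennreal (K * exp (lam * r) * V x ^ p)\<close>[OF y, of 0]
      by simp
    then have "zmom 2 \<delta> f x \<le> ennreal (K ^ 2) * zmom 2 \<delta> (Vp p) x"
      by (intro zmom_le_scaled[OF that(1,2) K])
    also have "\<dots> \<le> ennreal (K ^ 2) * ennreal (a1 * V x ^ (2 * p))"
      using p that by (intro mult_left_mono small_time_Vp) auto
    also have "\<dots> = ennreal (K\<^sup>2 * a1 * V x ^ (2 * p))"
      using pos that(1) by (simp add: ennreal_mult[symmetric] mult.assoc)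
    finally show ?thesis .
  qed
  have main: "zmom 2 (\<delta> + real n * \<tau>) f x
      \<le> ennreal (K\<^sup>2 * c n * exp (2 * lam * (\<delta> + real n * \<tau>)) * V x ^ (2 * p))"
    if "x \<in> space X" "0 \<le> \<delta>" "\<delta> \<le> \<tau>" "f \<in> borel_measurable X"
      "\<And>x r. x \<in> space X \<Longrightarrow> 0 \<le> r \<Longrightarrow> zmom 1 r f x \<le> ennreal (K * exp (lam * r) * V x ^ p)" for x \<delta> f n
    using that
  proof (induction n arbitrary: f)
    case 0
    have "zmom 2 \<delta> f x \<le> ennreal (K\<^sup>2 * a1 * V x ^ (2 * p))" by (rule small) (use 0 in auto)
    also have "\<dots> \<le> ennreal (K\<^sup>2 * a1 * exp (2 * lam * \<delta>) * V x ^ (2 * p))"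
    proof (rule ennreal_leI)
      have "1 \<le> exp (2 * lam * \<delta>)" using pos 0 by simp
      then have "(K\<^sup>2 * a1 * V x ^ (2 * p)) * 1 \<le> (K\<^sup>2 * a1 * V x ^ (2 * p)) * exp (2 * lam * \<delta>)"
        using pos 0 by (intro mult_left_mono) auto
      then show "K\<^sup>2 * a1 * V x ^ (2 * p) \<le> K\<^sup>2 * a1 * exp (2 * lam * \<delta>) * V x ^ (2 * p)"
        by (simp add: mult_ac)
    qed
    finally show ?case by (simp add: c_def)
  next
    case (Suc n)
    note x = \<open>x \<in> space X\<close> and f = \<open>f \<in> borel_measurable X\<close>
    let ?t = "\<delta> + real n * \<tau>"
    have t': "0 \<le> ?t" using Suc pos by simp
    define g where "g = (\<lambda>y. ennreal q * zmom 1 \<tau> f y)"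
    have \<tau>: "0 \<le> \<tau>" using pos by simp
    have m1: "zmom 1 \<tau> f \<in> borel_measurable X" by (rule zmom_measurable[OF \<tau> f])
    have g: "g \<in> borel_measurable X" unfolding g_def using m1 by measurable
    have gK: "zmom 1 r g y \<le> ennreal (K * exp (lam * r) * V y ^ p)" if y: "y \<in> space X" and r: "0 \<le> r" for y r
    proof -
      have "zmom 1 r g y = ennreal q ^ 1 * zmom 1 r (zmom 1 \<tau> f) y"
        unfolding g_def by (rule zmom_cmult[OF y r m1])
      also have "\<dots> = ennreal q * zmom 1 (r + \<tau>) f y"
        by (simp only: zmom_1_add[OF y r \<tau> f] power_one_right)
      also have "\<dots> \<le> ennreal q * ennreal (K * exp (lam * (r + \<tau>)) * V y ^ p)"
        using r \<tau> by (intro mult_left_mono Suc.prems(5) y) auto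
      also have "\<dots> = ennreal (q * (K * exp (lam * (r + \<tau>)) * V y ^ p))"
        using q K y by (simp add: ennreal_mult[symmetric])
      also have "q * (K * exp (lam * (r + \<tau>)) * V y ^ p) = K * exp (lam * r) * V y ^ p"
        by (simp add: q_def distrib_left exp_add exp_minus field_simps)
      finally show ?thesis .
    qed
    have IH: "zmom 2 ?t g x \<le> ennreal (K\<^sup>2 * c n * exp (2 * lam * ?t) * V x ^ (2 * p))"
      using Suc.IH[OF x Suc.prems(2,3) g gK] .
    have fg: "zmom 2 ?t (zmom 1 \<tau> f) x = ennreal ((1 / q)\<^sup>2) * zmom 2 ?t g x"
    proof -
      have "zmom 2 ?t g x = ennreal q ^ 2 * zmom 2 ?t (zmom 1 \<tau> f) x"
        unfolding g_def by (rule zmom_cmult[OF x t' m1])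
      then have "ennreal ((1 / q)\<^sup>2) * zmom 2 ?t g x = (ennreal ((1 / q)\<^sup>2) * ennreal (q\<^sup>2)) * zmom 2 ?t (zmom 1 \<tau> f) x"
        using q by (simp add: ennreal_power mult.assoc)
      also have "ennreal ((1 / q)\<^sup>2) * ennreal (q\<^sup>2) = 1"
        using q by (subst ennreal_mult[symmetric]) (auto simp: power_divide)
      finally show ?thesis by simp
    qed
    have "zmom 2 (\<delta> + real (Suc n) * \<tau>) f x = zmom 2 (?t + \<tau>) f x" by (simp add: algebra_simps)
    also have "\<dots> \<le> zmom 1 ?t (zmom 2 \<tau> f) x + zmom 2 ?t (zmom 1 \<tau> f) x"
      by (rule zmom_2_add[OF x t' \<tau> f])
    also have "\<dots> \<le> ennreal ((K\<^sup>2 * a1) * CM * exp (lam * ?t) * V x ^ (2 * p))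
        + ennreal ((1 / q)\<^sup>2) * ennreal (K\<^sup>2 * c n * exp (2 * lam * ?t) * V x ^ (2 * p))"
      unfolding fg
    proof (intro add_mono mult_left_mono IH)
      show "zmom 1 ?t (zmom 2 \<tau> f) x \<le> ennreal ((K\<^sup>2 * a1) * CM * exp (lam * ?t) * V x ^ (2 * p))"
      proof (rule zmom_1_le[OF _ x t'])
        show "zmom 2 \<tau> f y \<le> ennreal (K\<^sup>2 * a1 * V y ^ (2 * p))" if "y \<in> space X" for y
          by (rule small[OF that \<tau> order_refl f Suc.prems(5)])
      qed (use p pos in auto)
    qed simp
    also have "\<dots> = ennreal ((K\<^sup>2 * a1) * CM * exp (lam * ?t) * V x ^ (2 * p)
        + (1 / q)\<^sup>2 * (K\<^sup>2 * c n * exp (2 * lam * ?t) * V x ^ (2 * p)))"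
      using pos CM_pos q c0[of n] x by (subst ennreal_plus) (auto simp: ennreal_mult)
    also have "\<dots> \<le> ennreal (K\<^sup>2 * c (Suc n) * exp (2 * lam * (\<delta> + real (Suc n) * \<tau>)) * V x ^ (2 * p))"
    proof (rule ennreal_leI)
      have e: "exp (2 * lam * (\<delta> + real (Suc n) * \<tau>)) = (1 / q)\<^sup>2 * exp (2 * lam * ?t)"
        by (simp add: q_def power2_eq_square exp_minus exp_add[symmetric] field_simps)
      have "exp (lam * ?t) = exp (- lam * ?t) * exp (2 * lam * ?t)"
        by (simp add: exp_add[symmetric])
      also have "\<dots> \<le> q ^ n * exp (2 * lam * ?t)"
        using Suc.prems(2) by (intro mult_right_mono exp_le_q_power) auto
      also have "\<dots> \<le> (1 / q)\<^sup>2 * (q ^ n * exp (2 * lam * ?t))"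
      proof -
        have "1 \<le> (1 / q)\<^sup>2" using q by (intro one_le_power) simp
        then have "1 * (q ^ n * exp (2 * lam * ?t)) \<le> (1 / q)\<^sup>2 * (q ^ n * exp (2 * lam * ?t))"
          using q by (intro mult_right_mono) auto
        then show ?thesis by simp
      qed
      finally have "(K\<^sup>2 * a1 * CM * V x ^ (2 * p)) * exp (lam * ?t) \<le>
          (K\<^sup>2 * a1 * CM * V x ^ (2 * p)) * ((1 / q)\<^sup>2 * (q ^ n * exp (2 * lam * ?t)))"
        using pos CM_pos x by (intro mult_left_mono) auto
      then show "(K\<^sup>2 * a1) * CM * exp (lam * ?t) * V x ^ (2 * p)
        + (1 / q)\<^sup>2 * (K\<^sup>2 * c n * exp (2 * lam * ?t) * V x ^ (2 * p))
        \<le> K\<^sup>2 * c (Suc n) * exp (2 * lam * (\<delta> + real (Suc n) * \<tau>)) * V x ^ (2 * p)"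
        unfolding e by (simp add: c_def algebra_simps)
    qed
    finally show ?case .
  qed
  \<comment> \<open>A general time is a multiple of \<open>\<tau>\<close> plus a remainder, put at the beginning.\<close>
  define n where "n = nat \<lfloor>t / \<tau>\<rfloor>"
  define \<delta> where "\<delta> = t - real n * \<tau>"
  have "real n \<le> t / \<tau>" "t / \<tau> \<le> real n + 1" using t pos unfolding n_def by (auto intro: of_nat_floor)
  then have \<delta>: "0 \<le> \<delta>" "\<delta> \<le> \<tau>" using pos by (auto simp: \<delta>_def field_simps)
  have "zmom 2 t f x \<le> ennreal (K\<^sup>2 * c n * exp (2 * lam * t) * V x ^ (2 * p))"
    using main[OF x \<delta> f fK, of n] by (simp add: \<delta>_def)
  also have "\<dots> \<le> ennreal (K\<^sup>2 * C2 * exp (2 * lam * t) * V x ^ (2 * p))"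
  proof -
    have "c n \<le> C2" unfolding c_def C2_def
      using mult_left_mono[OF geometric_q[of n], of "a1 * CM"] pos CM_pos by simp
    then show ?thesis using x by (intro ennreal_leI mult_right_mono mult_left_mono) auto
  qed
  finally show ?thesis .
qed

lemma zmom_2_Vp:
  assumes "p \<in> {1, 2}" "x \<in> space X" "0 \<le> t"
  shows "zmom 2 t (Vp p) x \<le> ennreal (CM\<^sup>2 * C2 * exp (2 * lam * t) * V x ^ (2 * p))"
  using assms CM_pos by (intro zmom_2_le zmom_Vp_le) auto

lemma zmom_2_h:
  assumes "x \<in> space X" "0 \<le> t"
  shows "zmom 2 t H x \<le> ennreal (ch\<^sup>2 * C2 * exp (2 * lam * t) * (V x)\<^sup>2)"
proof -
  have "zmom 2 t H x \<le> ennreal (ch\<^sup>2 * C2 * exp (2 * lam * t) * V x ^ (2 * 1))"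
  proof (rule zmom_2_le)
    show "zmom 1 r H x \<le> ennreal (ch * exp (lam * r) * V x ^ 1)" if "x \<in> space X" "0 \<le> r" for x r
      unfolding zmom_1_h[OF that] using h_le[OF that(1), of 1]
      by (intro ennreal_leI) (simp add: mult_left_mono mult.left_commute)
  qed (use assms pos in auto)
  then show ?thesis by simp
qed

subsection \<open>Third moments of the mass weighted by \<open>h\<close>\<close>

lemma zint_le_scaled:
  assumes "\<And>y. y \<in> space X \<Longrightarrow> f y \<le> ennreal (c * V y ^ k)" "0 \<le> c"
  shows "zint t f \<omega> \<le> ennreal c * zint t (Vp k) \<omega>"
proof -
  have "zint t f \<omega> \<le> zint t (\<lambda>y. ennreal c * Vp k y) \<omega>"
    using assms by (intro zint_mono) (simp add: ennreal_mult')
  also have "\<dots> = ennreal c * zint t (Vp k) \<omega>" by (rule zint_cmult) measurable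
  finally show ?thesis .
qed

text \<open>The constant in the bound on the mixed moments of \<open>Z t (V)\<close> and \<open>Z t (V ^ 2)\<close>, \<open>cross_V_le\<close>.\<close>

definition CB :: real where "CB = 2 * CM\<^sup>2 * C2"

lemma cross_V_le:
  assumes x: "x \<in> space X" and t: "0 \<le> t"
  shows "(\<integral>\<^sup>+\<omega>. zint t (Vp 2) \<omega> * zint t (Vp 1) \<omega> \<partial>P x) \<le> ennreal (CB * exp (2 * lam * t) * V x ^ 3)"
proof -
  note [measurable] = zint_measurable_P[OF t _ x]
  have V: "0 < V x" by (rule V_pos[OF x])
  have "a * b \<le> 2 * (a * b)" for a b :: ennreal
    using mult_right_mono[of 1 2 "a * b"] by simp
  then have "(\<integral>\<^sup>+\<omega>. zint t (Vp 2) \<omega> * zint t (Vp 1) \<omega> \<partial>P x)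
     \<le> (\<integral>\<^sup>+\<omega>. ennreal (1 / V x) * zint t (Vp 2) \<omega> ^ 2 + ennreal (V x) * zint t (Vp 1) \<omega> ^ 2 \<partial>P x)"
    using ennreal_two_mult_le_weighted[OF V] by (intro nn_integral_mono) (blast intro: order_trans)
  also have "\<dots> = ennreal (1 / V x) * zmom 2 t (Vp 2) x + ennreal (V x) * zmom 2 t (Vp 1) x"
    unfolding zmom_def by (subst nn_integral_add) (auto simp: nn_integral_cmult)
  also have "\<dots> \<le> ennreal (1 / V x) * ennreal (CM\<^sup>2 * C2 * exp (2 * lam * t) * V x ^ (2 * 2))
     + ennreal (V x) * ennreal (CM\<^sup>2 * C2 * exp (2 * lam * t) * V x ^ (2 * 1))"
    using x t by (intro add_mono mult_left_mono zmom_2_Vp) auto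
  also have "\<dots> = ennreal (CB * exp (2 * lam * t) * V x ^ 3)"
  proof -
    have "1 / V x * (CM\<^sup>2 * C2 * exp (2 * lam * t) * V x ^ (2 * 2)) + V x * (CM\<^sup>2 * C2 * exp (2 * lam * t) * V x ^ (2 * 1))
      = CB * exp (2 * lam * t) * V x ^ 3"
      using V by (simp add: CB_def field_simps eval_nat_numeral)
    then show ?thesis
      using V C2_pos by (simp add: ennreal_mult[symmetric] ennreal_plus[symmetric] del: ennreal_plus)
  qed
  finally show ?thesis .
qed

text \<open>The constants in the bound on third moments, \<open>zmom_3_h\<close>: the size of one step, and the result of
  summing the geometric series.\<close>

definition CA :: real where "CA = ch ^ 3 * a1 * CM + 3 * ch ^ 3 * a1 * exp (lam * \<tau>) * CB"
definition C3 :: real where "C3 = ch ^ 3 + CA / (1 - q)"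

lemma CB_pos: "0 < CB" using CM_pos C2_pos by (simp add: CB_def)
lemma CA_pos: "0 < CA" using CM_pos CB_pos pos by (simp add: CA_def add_pos_pos)
lemma C3_pos: "0 < C3" using CA_pos q pos by (simp add: C3_def add_pos_pos)

text \<open>The same induction as for second moments, along multiples of \<open>\<tau>\<close>. There is no need to vary \<open>f\<close>,
  because \<open>h\<close> is an eigenfunction.\<close>

lemma zmom_3_h:
  assumes x: "x \<in> space X"
  shows "zmom 3 (real n * \<tau>) H x \<le> ennreal (C3 * exp (3 * lam * (real n * \<tau>)) * V x ^ 3)"
proof -
  define c where "c n = ch ^ 3 + CA * (\<Sum>j<n. q ^ j)" for n
  have c0: "0 \<le> c n" for n
    unfolding c_def using pos q CA_pos by (intro add_nonneg_nonneg mult_nonneg_nonneg sum_nonneg) auto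
  have \<tau>: "0 \<le> \<tau>" using pos by simp
  have hV: "H y \<le> ennreal (ch * V y ^ 1)" if "y \<in> space X" for y
    using h_le[OF that, of 1] by (intro ennreal_leI) simp
  have V: "0 \<le> V x" using x by simp
  have "zmom 3 (real n * \<tau>) H x \<le> ennreal (c n * exp (3 * lam * (real n * \<tau>)) * V x ^ 3)"
  proof (induction n)
    case 0
    have "h x ^ 3 \<le> (ch * V x) ^ 3" using h_le[OF x, of 1] h_nonneg[OF x] by (intro power_mono) auto
    then show ?case using zmom_0[OF x, of H 3] h_nonneg[OF x]
      by (simp add: c_def ennreal_power power_mult_distrib ennreal_leI)
  next
    case (Suc n)
    let ?t = "real n * \<tau>"
    have t: "0 \<le> ?t" using \<tau> by simp
    have m3: "zmom 3 \<tau> H y \<le> ennreal (ch ^ 3 * a1 * V y ^ 3)" if y: "y \<in> space X" for y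
    proof -
      have "zmom 3 \<tau> H y \<le> ennreal (ch ^ 3) * zmom 3 \<tau> (Vp 1) y"
        using pos by (intro zmom_le_scaled[OF y \<tau>] hV) auto
      also have "\<dots> \<le> ennreal (ch ^ 3) * ennreal (a1 * V y ^ (3 * 1))"
        by (intro mult_left_mono small_time_Vp y \<tau>) auto
      finally show ?thesis using pos y by (simp add: ennreal_mult[symmetric] mult.assoc)
    qed
    have m2: "zmom 2 \<tau> H y \<le> ennreal (ch\<^sup>2 * a1 * V y ^ 2)" if y: "y \<in> space X" for y
    proof -
      have "zmom 2 \<tau> H y \<le> ennreal (ch ^ 2) * zmom 2 \<tau> (Vp 1) y"
        using pos by (intro zmom_le_scaled[OF y \<tau>] hV) auto
      also have "\<dots> \<le> ennreal (ch ^ 2) * ennreal (a1 * V y ^ (2 * 1))"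
        by (intro mult_left_mono small_time_Vp y \<tau>) auto
      finally show ?thesis using pos y by (simp add: ennreal_mult[symmetric] mult.assoc)
    qed
    have m1: "zmom 1 \<tau> H y \<le> ennreal (exp (lam * \<tau>) * ch * V y ^ 1)" if y: "y \<in> space X" for y
      unfolding zmom_1_h[OF y \<tau>] using h_le[OF y, of 1] by (intro ennreal_leI) (simp add: mult.assoc)
    note [measurable] = zint_measurable_P[OF t _ x]
    have t1: "zmom 1 ?t (zmom 3 \<tau> H) x \<le> ennreal (ch ^ 3 * a1 * CM * exp (lam * ?t) * V x ^ 3)"
      using pos by (intro zmom_1_le x t m3) auto
    have t2: "(\<integral>\<^sup>+\<omega>. zint ?t (zmom 2 \<tau> H) \<omega> * zint ?t (zmom 1 \<tau> H) \<omega> \<partial>P x)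
        \<le> ennreal ((ch\<^sup>2 * a1) * (exp (lam * \<tau>) * ch) * (CB * exp (2 * lam * ?t) * V x ^ 3))"
    proof -
      have "zint ?t (zmom 2 \<tau> H) \<omega> * zint ?t (zmom 1 \<tau> H) \<omega>
          \<le> ennreal ((ch\<^sup>2 * a1) * (exp (lam * \<tau>) * ch)) * (zint ?t (Vp 2) \<omega> * zint ?t (Vp 1) \<omega>)" for \<omega>
      proof -
        have "zint ?t (zmom 2 \<tau> H) \<omega> * zint ?t (zmom 1 \<tau> H) \<omega>
          \<le> (ennreal (ch\<^sup>2 * a1) * zint ?t (Vp 2) \<omega>) * (ennreal (exp (lam * \<tau>) * ch) * zint ?t (Vp 1) \<omega>)"
          using pos by (intro mult_mono zint_le_scaled m2 m1) auto
        then show ?thesis using pos by (simp add: ennreal_mult mult_ac)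
      qed
      then have "(\<integral>\<^sup>+\<omega>. zint ?t (zmom 2 \<tau> H) \<omega> * zint ?t (zmom 1 \<tau> H) \<omega> \<partial>P x)
        \<le> (\<integral>\<^sup>+\<omega>. ennreal ((ch\<^sup>2 * a1) * (exp (lam * \<tau>) * ch)) * (zint ?t (Vp 2) \<omega> * zint ?t (Vp 1) \<omega>) \<partial>P x)"
        by (intro nn_integral_mono)
      also have "\<dots> = ennreal ((ch\<^sup>2 * a1) * (exp (lam * \<tau>) * ch)) * (\<integral>\<^sup>+\<omega>. zint ?t (Vp 2) \<omega> * zint ?t (Vp 1) \<omega> \<partial>P x)"
        by (rule nn_integral_cmult) measurable
      also have "\<dots> \<le> ennreal ((ch\<^sup>2 * a1) * (exp (lam * \<tau>) * ch)) * ennreal (CB * exp (2 * lam * ?t) * V x ^ 3)"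
        by (intro mult_left_mono cross_V_le x t) auto
      also have "\<dots> = ennreal ((ch\<^sup>2 * a1) * (exp (lam * \<tau>) * ch) * (CB * exp (2 * lam * ?t) * V x ^ 3))"
        using pos CB_pos V by (simp add: ennreal_mult[symmetric])
      finally show ?thesis .
    qed
    have t3: "zmom 3 ?t (zmom 1 \<tau> H) x \<le> ennreal (exp (lam * \<tau>) ^ 3 * (c n * exp (3 * lam * ?t) * V x ^ 3))"
    proof -
      have "zmom 3 ?t (zmom 1 \<tau> H) x = zmom 3 ?t (\<lambda>y. ennreal (exp (lam * \<tau>)) * H y) x"
        by (rule zmom_cong) (simp only: zmom_1_h[OF _ \<tau>] ennreal_mult'[OF exp_ge_zero])
      also have "\<dots> = ennreal (exp (lam * \<tau>)) ^ 3 * zmom 3 ?t H x"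
        by (rule zmom_cmult[OF x t]) measurable
      also have "\<dots> \<le> ennreal (exp (lam * \<tau>)) ^ 3 * ennreal (c n * exp (3 * lam * ?t) * V x ^ 3)"
        by (intro mult_left_mono Suc.IH) auto
      finally show ?thesis using c0 V by (simp add: ennreal_power ennreal_mult[symmetric])
    qed
    have plus3: "ennreal a + ennreal 3 * ennreal b + ennreal c = ennreal (a + 3 * b + c)"
      if "0 \<le> a" "0 \<le> b" "0 \<le> c" for a b c
    proof -
      have "ennreal (a + 3 * b + c) = ennreal a + ennreal (3 * b) + ennreal c"
        using that by (simp add: ennreal_plus)
      also have "ennreal (3 * b) = ennreal 3 * ennreal b" using that by (intro ennreal_mult) auto
      finally show ?thesis ..
    qed
    have "zmom 3 (real (Suc n) * \<tau>) H x = zmom 3 (?t + \<tau>) H x" by (simp add: algebra_simps)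
    also have "\<dots> \<le> zmom 1 ?t (zmom 3 \<tau> H) x + 3 * (\<integral>\<^sup>+\<omega>. zint ?t (zmom 2 \<tau> H) \<omega> * zint ?t (zmom 1 \<tau> H) \<omega> \<partial>P x)
        + zmom 3 ?t (zmom 1 \<tau> H) x"
      by (rule zmom_3_add[OF x t \<tau>]) measurable
    also have "\<dots> \<le> ennreal (ch ^ 3 * a1 * CM * exp (lam * ?t) * V x ^ 3)
        + ennreal 3 * ennreal ((ch\<^sup>2 * a1) * (exp (lam * \<tau>) * ch) * (CB * exp (2 * lam * ?t) * V x ^ 3))
        + ennreal (exp (lam * \<tau>) ^ 3 * (c n * exp (3 * lam * ?t) * V x ^ 3))"
      using t1 t2 t3 by (intro add_mono mult_mono) auto
    also have "\<dots> = ennreal (ch ^ 3 * a1 * CM * exp (lam * ?t) * V x ^ 3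
        + 3 * ((ch\<^sup>2 * a1) * (exp (lam * \<tau>) * ch) * (CB * exp (2 * lam * ?t) * V x ^ 3))
        + exp (lam * \<tau>) ^ 3 * (c n * exp (3 * lam * ?t) * V x ^ 3))"
      using pos CM_pos CB_pos V c0[of n] by (intro plus3) auto
    also have "\<dots> \<le> ennreal (c (Suc n) * exp (3 * lam * (real (Suc n) * \<tau>)) * V x ^ 3)"
    proof (rule ennreal_leI)
      define a where "a = exp (lam * ?t)"
      define b where "b = exp (lam * \<tau>)"
      have CA: "CA = ch ^ 3 * a1 * CM + 3 * ch ^ 3 * a1 * b * CB" by (simp add: CA_def b_def)
      have a: "1 \<le> a" and b: "1 \<le> b" using pos t by (simp_all add: a_def b_def)
      have qa: "1 \<le> q ^ n * a"
        using q_def by (simp add: a_def exp_of_nat_mult[symmetric] exp_add[symmetric] algebra_simps)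
      have e: "exp (3 * lam * (real (Suc n) * \<tau>)) = b ^ 3 * a ^ 3" "exp (2 * lam * ?t) = a ^ 2" "exp (3 * lam * ?t) = a ^ 3"
        by (simp_all add: a_def b_def exp_of_nat_mult[symmetric] exp_add[symmetric] algebra_simps)
      have k1: "a \<le> b ^ 3 * (q ^ n * a ^ 3)"
      proof -
        have "a * 1 \<le> a * (q ^ n * a)" using qa a by (intro mult_left_mono) auto
        also have "\<dots> \<le> a * (q ^ n * a) * a" using a q mult_left_mono[of 1 a "a * (q ^ n * a)"] by auto
        also have "\<dots> \<le> b ^ 3 * (a * (q ^ n * a) * a)"
          using b a q mult_right_mono[of 1 "b ^ 3" "a * (q ^ n * a) * a"] one_le_power[of b 3] by auto
        finally show ?thesis by (simp add: power3_eq_cube mult_ac)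
      qed
      have k2: "a\<^sup>2 \<le> b ^ 3 * (q ^ n * a ^ 3)"
      proof -
        have "a\<^sup>2 * 1 \<le> a\<^sup>2 * (q ^ n * a)" using qa a by (intro mult_left_mono) auto
        also have "\<dots> \<le> b ^ 3 * (a\<^sup>2 * (q ^ n * a))"
          using b a q mult_right_mono[of 1 "b ^ 3" "a\<^sup>2 * (q ^ n * a)"] one_le_power[of b 3] by auto
        finally show ?thesis by (simp add: power3_eq_cube power2_eq_square mult_ac)
      qed
      have p1: "0 \<le> ch ^ 3 * a1 * CM * V x ^ 3" and p2: "0 \<le> 3 * ch ^ 3 * a1 * b * CB * V x ^ 3"
        using pos CM_pos CB_pos V b by auto
      have "ch ^ 3 * a1 * CM * exp (lam * ?t) * V x ^ 3
        + 3 * ((ch\<^sup>2 * a1) * (exp (lam * \<tau>) * ch) * (CB * exp (2 * lam * ?t) * V x ^ 3))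
        + exp (lam * \<tau>) ^ 3 * (c n * exp (3 * lam * ?t) * V x ^ 3)
        = (ch ^ 3 * a1 * CM * V x ^ 3) * a + (3 * ch ^ 3 * a1 * b * CB * V x ^ 3) * a\<^sup>2
          + c n * (b ^ 3 * a ^ 3) * V x ^ 3"
        unfolding e a_def[symmetric] b_def[symmetric]
        by (simp add: power3_eq_cube power2_eq_square mult_ac)
      also have "\<dots> \<le> (ch ^ 3 * a1 * CM * V x ^ 3) * (b ^ 3 * (q ^ n * a ^ 3))
          + (3 * ch ^ 3 * a1 * b * CB * V x ^ 3) * (b ^ 3 * (q ^ n * a ^ 3)) + c n * (b ^ 3 * a ^ 3) * V x ^ 3"
        by (intro add_mono mult_left_mono k1 k2 p1 p2 order_refl)
      also have "\<dots> = c (Suc n) * exp (3 * lam * (real (Suc n) * \<tau>)) * V x ^ 3"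
        unfolding e c_def CA by (simp add: algebra_simps)
      finally show "ch ^ 3 * a1 * CM * exp (lam * ?t) * V x ^ 3
        + 3 * ((ch\<^sup>2 * a1) * (exp (lam * \<tau>) * ch) * (CB * exp (2 * lam * ?t) * V x ^ 3))
        + exp (lam * \<tau>) ^ 3 * (c n * exp (3 * lam * ?t) * V x ^ 3)
        \<le> c (Suc n) * exp (3 * lam * (real (Suc n) * \<tau>)) * V x ^ 3" .
    qed
    finally show ?case .
  qed
  also have "ennreal (c n * exp (3 * lam * (real n * \<tau>)) * V x ^ 3) \<le> ennreal (C3 * exp (3 * lam * (real n * \<tau>)) * V x ^ 3)"
  proof -
    have "c n \<le> C3" unfolding c_def C3_def
      using mult_left_mono[OF geometric_q[of n], of CA] CA_pos by simp
    then show ?thesis using V by (intro ennreal_leI mult_right_mono) auto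
  qed
  finally show ?thesis .
qed

subsection \<open>The variance of the normalised mass at the times \<open>n * \<tau>\<close>\<close>

text \<open>The function \<open>h\<close> normalised so that \<open>Z (n * \<tau>) (hz n) = W (n * \<tau>)\<close>.\<close>

definition hz :: "nat \<Rightarrow> 'x \<Rightarrow> ennreal" where
  "hz n y = ennreal (exp (- lam * (real n * \<tau>))) * H y"

text \<open>The variance of \<open>W (n * \<tau>)\<close> under \<open>P y\<close>, whose mean is \<open>h y\<close>.\<close>

definition vr :: "nat \<Rightarrow> 'x \<Rightarrow> real" where
  "vr n y = enn2real (zmom 2 (real n * \<tau>) (hz n) y) - (h y)\<^sup>2"

text \<open>The constant in \<open>vr n \<le> Cv * V ^ 2\<close>, uniform in \<open>n\<close>.\<close>

definition Cv :: real where "Cv = ch\<^sup>2 * C2"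

lemma Cv_pos: "0 < Cv" using pos C2_pos by (simp add: Cv_def)

lemma n\<tau> [simp]: "0 \<le> real n * \<tau>" using pos by simp

lemma hz_measurable [measurable]: "hz n \<in> borel_measurable X"
  unfolding hz_def[abs_def] by measurable

lemma vr_measurable [measurable]: "vr n \<in> borel_measurable X"
proof -
  have [measurable]: "zmom 2 (real n * \<tau>) (hz n) \<in> borel_measurable X" by (rule zmom_measurable) auto
  show ?thesis unfolding vr_def[abs_def] by measurable
qed

lemma zmom_hz:
  assumes y: "y \<in> space X" and t: "0 \<le> t"
  shows "zmom k t (hz n) y = ennreal (exp (- lam * (real n * \<tau>))) ^ k * zmom k t H y"
  unfolding hz_def[abs_def] by (rule zmom_cmult[OF y t]) measurable

lemma zmom_1_hz:
  assumes y: "y \<in> space X"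
  shows "zmom 1 (real n * \<tau>) (hz n) y = ennreal (h y)"
  unfolding zmom_hz[OF y n\<tau>] zmom_1_h[OF y n\<tau>] power_one_right
  by (subst ennreal_mult'[symmetric]) (simp_all add: mult.assoc[symmetric] exp_add[symmetric])

lemma zmom_2_hz_le:
  assumes y: "y \<in> space X"
  shows "zmom 2 (real n * \<tau>) (hz n) y \<le> ennreal (Cv * (V y)\<^sup>2)"
proof -
  have "zmom 2 (real n * \<tau>) (hz n) y \<le> ennreal (exp (- lam * (real n * \<tau>))) ^ 2 * ennreal (ch\<^sup>2 * C2 * exp (2 * lam * (real n * \<tau>)) * (V y)\<^sup>2)"
    unfolding zmom_hz[OF y n\<tau>] by (intro mult_left_mono zmom_2_h y n\<tau>) auto
  also have "\<dots> = ennreal (exp (- lam * (real n * \<tau>)) ^ 2 * (ch\<^sup>2 * C2 * exp (2 * lam * (real n * \<tau>)) * (V y)\<^sup>2))"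
    using C2_pos by (simp add: ennreal_power ennreal_mult[symmetric])
  also have "exp (- lam * (real n * \<tau>)) ^ 2 * (ch\<^sup>2 * C2 * exp (2 * lam * (real n * \<tau>)) * (V y)\<^sup>2)
     = (exp (- lam * (real n * \<tau>)) ^ 2 * exp (2 * lam * (real n * \<tau>))) * (Cv * (V y)\<^sup>2)"
    by (simp add: Cv_def)
  also have "exp (- lam * (real n * \<tau>)) ^ 2 * exp (2 * lam * (real n * \<tau>)) = 1"
    by (simp add: power2_eq_square exp_add[symmetric])
  finally show ?thesis by simp
qed

lemma zmom_3_hz_le:
  assumes y: "y \<in> space X"
  shows "zmom 3 (real n * \<tau>) (hz n) y \<le> ennreal (C3 * V y ^ 3)"
proof -
  have "zmom 3 (real n * \<tau>) (hz n) y \<le> ennreal (exp (- lam * (real n * \<tau>))) ^ 3 * ennreal (C3 * exp (3 * lam * (real n * \<tau>)) * V y ^ 3)"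
    unfolding zmom_hz[OF y n\<tau>] by (intro mult_left_mono zmom_3_h y) auto
  also have "\<dots> = ennreal (exp (- lam * (real n * \<tau>)) ^ 3 * (C3 * exp (3 * lam * (real n * \<tau>)) * V y ^ 3))"
    using C3_pos y by (simp add: ennreal_power ennreal_mult[symmetric])
  also have "exp (- lam * (real n * \<tau>)) ^ 3 * (C3 * exp (3 * lam * (real n * \<tau>)) * V y ^ 3)
     = (exp (- lam * (real n * \<tau>)) ^ 3 * exp (3 * lam * (real n * \<tau>))) * (C3 * V y ^ 3)"
    by simp
  also have "exp (- lam * (real n * \<tau>)) ^ 3 * exp (3 * lam * (real n * \<tau>)) = 1"
    by (simp add: power3_eq_cube exp_add[symmetric])
  finally show ?thesis by simp
qed

lemma h_square_le_zmom_2: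
  assumes y: "y \<in> space X"
  shows "ennreal ((h y)\<^sup>2) \<le> zmom 2 (real n * \<tau>) (hz n) y"
proof -
  have m: "zmom 1 (real n * \<tau>) (hz n) \<in> borel_measurable X" by (rule zmom_measurable) auto
  \<comment> \<open>Jensen: the case \<open>t = 0\<close> of \<open>zmom_2_lower\<close>.\<close>
  have e: "zmom 2 0 (zmom 1 (real n * \<tau>) (hz n)) y = ennreal ((h y)\<^sup>2)"
    unfolding zmom_0[OF y m] zmom_1_hz[OF y] using h_nonneg[OF y] by (simp add: ennreal_power)
  have "zmom 2 0 (zmom 1 (real n * \<tau>) (hz n)) y \<le> zmom 2 (0 + real n * \<tau>) (hz n) y"
    by (rule zmom_2_lower[OF y order_refl n\<tau> hz_measurable]) (simp only: e ennreal_less_top infinity_ennreal_def)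
  then show ?thesis unfolding e by simp
qed

lemma zmom_2_hz:
  assumes y: "y \<in> space X"
  shows "zmom 2 (real n * \<tau>) (hz n) y = ennreal ((h y)\<^sup>2 + vr n y)"
  using le_less_trans[OF zmom_2_hz_le[OF y, of n] ennreal_less_top] by (simp add: vr_def)

lemma vr_nonneg:
  assumes y: "y \<in> space X"
  shows "0 \<le> vr n y"
proof -
  have "enn2real (ennreal ((h y)\<^sup>2)) \<le> enn2real (zmom 2 (real n * \<tau>) (hz n) y)"
    using le_less_trans[OF zmom_2_hz_le[OF y, of n] ennreal_less_top]
    by (intro enn2real_mono h_square_le_zmom_2 y) auto
  then show ?thesis by (simp add: vr_def)
qed

lemma vr_le:
  assumes y: "y \<in> space X"
  shows "(h y)\<^sup>2 + vr n y \<le> Cv * (V y)\<^sup>2" and "vr n y \<le> Cv * (V y)\<^sup>2"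
proof -
  show *: "(h y)\<^sup>2 + vr n y \<le> Cv * (V y)\<^sup>2"
    using zmom_2_hz_le[OF y, of n] Cv_pos unfolding zmom_2_hz[OF y] by (subst (asm) ennreal_le_iff) auto
  have "0 \<le> (h y)\<^sup>2" by simp
  with * show "vr n y \<le> Cv * (V y)\<^sup>2" by linarith
qed

lemma vr_mono:
  assumes y: "y \<in> space X"
  shows "vr n y \<le> vr (Suc n) y"
proof -
  have \<tau>: "0 \<le> \<tau>" using pos by simp
  have e: "zmom 1 \<tau> (hz (Suc n)) z = hz n z" if z: "z \<in> space X" for z
  proof -
    have a: "- lam * (real (Suc n) * \<tau>) + lam * \<tau> = - lam * (real n * \<tau>)" by (simp add: algebra_simps)
    have "zmom 1 \<tau> (hz (Suc n)) z = ennreal (exp (- lam * (real (Suc n) * \<tau>))) * (ennreal (exp (lam * \<tau>)) * H z)"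
      unfolding zmom_hz[OF z \<tau>] zmom_1_h[OF z \<tau>] power_one_right by (simp only: ennreal_mult'[OF exp_ge_zero])
    also have "\<dots> = ennreal (exp (- lam * (real (Suc n) * \<tau>)) * exp (lam * \<tau>)) * H z"
      by (simp only: ennreal_mult'[OF exp_ge_zero] mult.assoc)
    also have "\<dots> = hz n z" unfolding exp_add[symmetric] a hz_def ..
    finally show ?thesis .
  qed
  have e2: "zmom 2 (real n * \<tau>) (zmom 1 \<tau> (hz (Suc n))) y = zmom 2 (real n * \<tau>) (hz n) y"
    by (rule zmom_cong[OF e])
  have "zmom 2 (real n * \<tau>) (zmom 1 \<tau> (hz (Suc n))) y \<le> zmom 2 (real n * \<tau> + \<tau>) (hz (Suc n)) y"
    using le_less_trans[OF zmom_2_hz_le[OF y, of n] ennreal_less_top]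
    by (intro zmom_2_lower[OF y n\<tau> \<tau> hz_measurable]) (simp only: e2 infinity_ennreal_def)
  also have "real n * \<tau> + \<tau> = real (Suc n) * \<tau>" by (simp add: algebra_simps)
  finally have "ennreal ((h y)\<^sup>2 + vr n y) \<le> ennreal ((h y)\<^sup>2 + vr (Suc n) y)"
    unfolding e2 zmom_2_hz[OF y] .
  then show ?thesis using vr_nonneg[OF y] by (subst (asm) ennreal_le_iff) auto
qed

section \<open>The limit martingale\<close>

text \<open>The martingale \<open>exp (- lam * t) * Z t (h)\<close>.\<close>

definition Wt :: "real \<Rightarrow> 'w \<Rightarrow> real" where "Wt t \<omega> = exp (- lam * t) * enn2real (zint t H \<omega>)"

text \<open>The constant in the \<open>L1\<close> rate of convergence of the martingale.\<close>

definition CW :: real where "CW = Cv * CM + 1"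

lemma Wt_measurable: "0 \<le> t \<Longrightarrow> x \<in> space X \<Longrightarrow> Wt t \<in> borel_measurable (P x)"
  unfolding Wt_def[abs_def] using zint_measurable_P[of t H x] by measurable

lemma Wt_increment:
  assumes x: "x \<in> space X" and t: "0 \<le> t" and s: "0 \<le> s"
  shows "(\<integral>\<^sup>+\<omega>. ennreal \<bar>Wt (t + s) \<omega> - Wt t \<omega>\<bar> \<partial>P x) \<le> ennreal (CW * (exp (- lam * t / 2) * V x))"
proof -
  interpret prob_space "P x" by (rule P_prob[OF x])
  have ts: "0 \<le> t + s" using t s by simp
  note [measurable] = Wt_measurable[OF t x] Wt_measurable[OF ts x] zint_measurable_P[OF t _ x] zint_measurable_P[OF ts _ x]
  let ?e = "exp (- lam * t / 2) * V x"
  have m1: "zmom 1 s H \<in> borel_measurable X" by (rule zmom_measurable[OF s]) measurable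
  have T: "zint t (zmom 1 s H) \<omega> = ennreal (exp (lam * s)) * zint t H \<omega>" for \<omega>
  proof -
    have "zint t (zmom 1 s H) \<omega> = zint t (\<lambda>y. ennreal (exp (lam * s)) * H y) \<omega>"
      by (rule zint_cong) (simp only: zmom_1_h[OF _ s] ennreal_mult'[OF exp_ge_zero])
    also have "\<dots> = ennreal (exp (lam * s)) * zint t H \<omega>" by (rule zint_cmult) measurable
    finally show ?thesis .
  qed
  have zmom2: "zmom 1 t (zmom 2 s H) x \<le> ennreal ((Cv * exp (2 * lam * s)) * CM * exp (lam * t) * V x ^ 2)"
  proof (rule zmom_1_le[OF _ x t])
    show "zmom 2 s H y \<le> ennreal (Cv * exp (2 * lam * s) * V y ^ 2)" if "y \<in> space X" for y
      using zmom_2_h[OF that s] by (simp add: Cv_def)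
  qed (use Cv_pos in auto)
  have "zmom 2 t (zmom 1 s H) x = zmom 2 t (\<lambda>y. ennreal (exp (lam * s)) * H y) x"
    by (rule zmom_cong) (simp only: zmom_1_h[OF _ s] ennreal_mult'[OF exp_ge_zero])
  also have "\<dots> = ennreal (exp (lam * s)) ^ 2 * zmom 2 t H x"
    by (rule zmom_cmult[OF x t]) measurable
  also have "\<dots> \<le> ennreal (exp (lam * s)) ^ 2 * ennreal (ch\<^sup>2 * C2 * exp (2 * lam * t) * (V x)\<^sup>2)"
    by (intro mult_left_mono zmom_2_h[OF x t]) simp
  also have "\<dots> < \<infinity>" by (simp add: ennreal_power ennreal_mult_less_top)
  finally have fin: "zmom 2 t (zmom 1 s H) x < \<infinity>" .
  have cen: "(\<integral>\<^sup>+\<omega>. ennreal ((enn2real (zint (t + s) H \<omega>) - enn2real (zint t (zmom 1 s H) \<omega>))\<^sup>2) \<partial>P x)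
     \<le> zmom 1 t (zmom 2 s H) x"
  proof (rule zint_centred[OF x t s _ fin])
    show "zmom 1 t (zmom 2 s H) x < \<infinity>" using zmom2 by (rule le_less_trans) simp
  qed measurable
  have D: "(Wt (t + s) \<omega> - Wt t \<omega>)\<^sup>2 = exp (- lam * (t + s)) ^ 2 * (enn2real (zint (t + s) H \<omega>) - enn2real (zint t (zmom 1 s H) \<omega>))\<^sup>2" for \<omega>
  proof -
    have "exp (- lam * t) = exp (- lam * (t + s)) * exp (lam * s)"
      by (simp add: exp_add[symmetric] algebra_simps)
    then have "Wt (t + s) \<omega> - Wt t \<omega> = exp (- lam * (t + s)) * (enn2real (zint (t + s) H \<omega>) - enn2real (zint t (zmom 1 s H) \<omega>))"
      unfolding Wt_def T enn2real_mult enn2real_ennreal[OF exp_ge_zero] by (simp add: right_diff_distrib)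
    then show ?thesis by (simp add: power_mult_distrib)
  qed
  have "(\<integral>\<^sup>+\<omega>. ennreal ((Wt (t + s) \<omega> - Wt t \<omega>)\<^sup>2) \<partial>P x)
     = ennreal (exp (- lam * (t + s)) ^ 2) * (\<integral>\<^sup>+\<omega>. ennreal ((enn2real (zint (t + s) H \<omega>) - enn2real (zint t (zmom 1 s H) \<omega>))\<^sup>2) \<partial>P x)"
    unfolding D using m1 by (subst nn_integral_cmult[symmetric]) (auto simp: ennreal_mult)
  also have "\<dots> \<le> ennreal (exp (- lam * (t + s)) ^ 2) * ennreal ((Cv * exp (2 * lam * s)) * CM * exp (lam * t) * V x ^ 2)"
    by (intro mult_left_mono order_trans[OF cen zmom2]) simp
  also have "\<dots> = ennreal (exp (- lam * (t + s)) ^ 2 * ((Cv * exp (2 * lam * s)) * CM * exp (lam * t) * V x ^ 2))"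
    using Cv_pos CM_pos by (simp add: ennreal_mult[symmetric])
  also have "exp (- lam * (t + s)) ^ 2 * ((Cv * exp (2 * lam * s)) * CM * exp (lam * t) * V x ^ 2)
      = (exp (- lam * (t + s)) ^ 2 * exp (2 * lam * s) * exp (lam * t)) * (Cv * CM * V x ^ 2)" by simp
  also have "exp (- lam * (t + s)) ^ 2 * exp (2 * lam * s) * exp (lam * t) = exp (- lam * t / 2) ^ 2"
    by (simp add: power2_eq_square exp_add[symmetric] algebra_simps)
  also have "exp (- lam * t / 2) ^ 2 * (Cv * CM * V x ^ 2) = Cv * CM * ?e\<^sup>2" by (simp add: power_mult_distrib)
  finally have "(\<integral>\<^sup>+\<omega>. ennreal \<bar>Wt (t + s) \<omega> - Wt t \<omega>\<bar> \<partial>P x) \<le> ennreal ((Cv * CM + 1) * ?e)"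
    using V_pos[OF x] Cv_pos CM_pos by (intro nn_integral_abs_le_of_square) auto
  then show ?thesis by (simp add: CW_def)
qed

text \<open>The limit inherits the bound on the increments by Fatou's lemma.\<close>

lemma W_error:
  assumes x: "x \<in> space X" and t: "0 \<le> t" and W: "W \<in> borel_measurable \<Omega>"
    and lim: "AE \<omega> in P x. ((\<lambda>t. exp (- lam * t) * (\<integral>y. h y \<partial>Z t \<omega>)) \<longlongrightarrow> W \<omega>) at_top"
  shows "(\<integral>\<^sup>+\<omega>. ennreal \<bar>W \<omega> - Wt t \<omega>\<bar> \<partial>P x) \<le> ennreal (CW * (exp (- lam * t / 2) * V x))"
proof -
  note [measurable] = P_measurable[OF x W] Wt_measurable[OF t x]
  have m [measurable]: "Wt (t + real n) \<in> borel_measurable (P x)" for n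
    using t by (intro Wt_measurable x) simp
  have ae: "AE \<omega> in P x. ennreal \<bar>W \<omega> - Wt t \<omega>\<bar> = liminf (\<lambda>n. ennreal \<bar>Wt (t + real n) \<omega> - Wt t \<omega>\<bar>)"
    using lim
  proof eventually_elim
    case (elim \<omega>)
    have "exp (- lam * t) * (\<integral>y. h y \<partial>Z t \<omega>) = Wt t \<omega>" for t
      unfolding Wt_def using h_meas h_nonneg by (subst integral_Z_eq) auto
    then have "((\<lambda>t. Wt t \<omega>) \<longlongrightarrow> W \<omega>) at_top" using elim by simp
    moreover have "filterlim (\<lambda>n. t + real n) at_top sequentially"
      by (rule filterlim_tendsto_add_at_top[OF tendsto_const filterlim_real_sequentially])
    ultimately have "(\<lambda>n. Wt (t + real n) \<omega>) \<longlonglongrightarrow> W \<omega>"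
      by (rule filterlim_compose)
    then have "(\<lambda>n. ennreal \<bar>Wt (t + real n) \<omega> - Wt t \<omega>\<bar>) \<longlonglongrightarrow> ennreal \<bar>W \<omega> - Wt t \<omega>\<bar>"
      by (intro tendsto_ennrealI tendsto_rabs tendsto_diff tendsto_const)
    from lim_imp_Liminf[OF trivial_limit_sequentially this] show ?case by (rule sym)
  qed
  have "(\<integral>\<^sup>+\<omega>. ennreal \<bar>W \<omega> - Wt t \<omega>\<bar> \<partial>P x) = (\<integral>\<^sup>+\<omega>. liminf (\<lambda>n. ennreal \<bar>Wt (t + real n) \<omega> - Wt t \<omega>\<bar>) \<partial>P x)"
    by (rule nn_integral_cong_AE[OF ae])
  also have "\<dots> \<le> liminf (\<lambda>n. \<integral>\<^sup>+\<omega>. ennreal \<bar>Wt (t + real n) \<omega> - Wt t \<omega>\<bar> \<partial>P x)"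
    by (rule nn_integral_liminf) measurable
  also have "\<dots> \<le> ennreal (CW * (exp (- lam * t / 2) * V x))"
    by (rule Liminf_le) (use Wt_increment[OF x t] in \<open>auto intro!: always_eventually\<close>)
  finally show ?thesis .
qed

section \<open>The conditional variance\<close>

text \<open>The constant in the bound on the deviation of \<open>Z (r + s) (v)\<close> from its conditional mean given the
  population at time \<open>r\<close>.\<close>

definition CD :: real where "CD = (Cv * CM)\<^sup>2 * C2 * CM + 1"

lemma variance_increment:
  assumes x: "x \<in> space X" and r: "0 \<le> r" and s: "0 \<le> s"
    and v [measurable]: "v \<in> borel_measurable X" and v0: "\<And>y. y \<in> space X \<Longrightarrow> 0 \<le> v y"
    and vV: "\<And>y. y \<in> space X \<Longrightarrow> v y \<le> Cv * (V y)\<^sup>2"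
  shows "(\<integral>\<^sup>+\<omega>. ennreal \<bar>exp (- lam * (r + s)) * enn2real (zint (r + s) (\<lambda>y. ennreal (v y)) \<omega>)
      - exp (- lam * (r + s)) * enn2real (zint r (zmom 1 s (\<lambda>y. ennreal (v y))) \<omega>)\<bar> \<partial>P x)
    \<le> ennreal (CD * (exp (- lam * r / 2) * (V x)\<^sup>2))"
proof -
  interpret prob_space "P x" by (rule P_prob[OF x])
  let ?f = "\<lambda>y. ennreal (v y)"
  let ?e = "exp (- lam * r / 2) * (V x)\<^sup>2"
  let ?D = "\<lambda>\<omega>. enn2real (zint (r + s) ?f \<omega>) - enn2real (zint r (zmom 1 s ?f) \<omega>)"
  have rs: "0 \<le> r + s" using r s by simp
  have m1: "zmom 1 s ?f \<in> borel_measurable X" by (rule zmom_measurable[OF s]) measurable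
  note [measurable] = zint_measurable_P[OF rs _ x] zint_measurable_P[OF r m1 x]
  have V0: "0 < V x" by (rule V_pos[OF x])
  have K0: "0 \<le> Cv * CM" using Cv_pos CM_pos by simp
  have mf: "zmom 1 t ?f y \<le> ennreal (Cv * CM * exp (lam * t) * V y ^ 2)" if "y \<in> space X" "0 \<le> t" for y t
    using Cv_pos vV by (intro zmom_1_le that ennreal_leI) auto
  have m2: "zmom 2 t ?f y \<le> ennreal ((Cv * CM)\<^sup>2 * C2 * exp (2 * lam * t) * V y ^ (2 * 2))" if "y \<in> space X" "0 \<le> t" for y t
    by (rule zmom_2_le[OF _ K0 _ mf that]) auto
  have m12: "zmom 1 r (zmom 2 s ?f) x \<le> ennreal (((Cv * CM)\<^sup>2 * C2 * exp (2 * lam * s)) * CM * exp (lam * r) * V x ^ 4)"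
  proof (rule zmom_1_le[OF _ x r])
    show "zmom 2 s ?f y \<le> ennreal ((Cv * CM)\<^sup>2 * C2 * exp (2 * lam * s) * V y ^ 4)" if "y \<in> space X" for y
      using m2[OF that s] by simp
  qed (use C2_pos in auto)
  have "zmom 2 r (zmom 1 s ?f) x \<le> ennreal ((Cv * CM * exp (lam * s)) ^ 2) * zmom 2 r (Vp 2) x"
    using K0 by (intro zmom_le_scaled[OF x r] mf s) auto
  also have "\<dots> \<le> ennreal ((Cv * CM * exp (lam * s)) ^ 2) * ennreal (CM\<^sup>2 * C2 * exp (2 * lam * r) * V x ^ (2 * 2))"
    by (intro mult_left_mono zmom_2_Vp x r) auto
  also have "\<dots> < \<infinity>" by (simp add: ennreal_mult_less_top)
  finally have fin: "zmom 2 r (zmom 1 s ?f) x < \<infinity>" .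
  have cen: "(\<integral>\<^sup>+\<omega>. ennreal ((?D \<omega>)\<^sup>2) \<partial>P x) \<le> zmom 1 r (zmom 2 s ?f) x"
  proof (rule zint_centred[OF x r s _ fin])
    show "zmom 1 r (zmom 2 s ?f) x < \<infinity>" using m12 by (rule le_less_trans) simp
  qed measurable
  have "(\<integral>\<^sup>+\<omega>. ennreal ((exp (- lam * (r + s)) * enn2real (zint (r + s) ?f \<omega>) - exp (- lam * (r + s)) * enn2real (zint r (zmom 1 s ?f) \<omega>))\<^sup>2) \<partial>P x)
     = (\<integral>\<^sup>+\<omega>. ennreal (exp (- lam * (r + s)) ^ 2) * ennreal ((?D \<omega>)\<^sup>2) \<partial>P x)"
    unfolding right_diff_distrib[symmetric] power_mult_distrib
    by (intro nn_integral_cong) (simp add: ennreal_mult)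
  also have "\<dots> = ennreal (exp (- lam * (r + s)) ^ 2) * (\<integral>\<^sup>+\<omega>. ennreal ((?D \<omega>)\<^sup>2) \<partial>P x)"
    by (rule nn_integral_cmult) measurable
  also have "\<dots> \<le> ennreal (exp (- lam * (r + s)) ^ 2) * ennreal (((Cv * CM)\<^sup>2 * C2 * exp (2 * lam * s)) * CM * exp (lam * r) * V x ^ 4)"
    by (intro mult_left_mono order_trans[OF cen m12]) simp
  also have "\<dots> = ennreal (exp (- lam * (r + s)) ^ 2 * (((Cv * CM)\<^sup>2 * C2 * exp (2 * lam * s)) * CM * exp (lam * r) * V x ^ 4))"
    using C2_pos CM_pos by (simp add: ennreal_mult[symmetric])
  also have "exp (- lam * (r + s)) ^ 2 * (((Cv * CM)\<^sup>2 * C2 * exp (2 * lam * s)) * CM * exp (lam * r) * V x ^ 4)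
      = (exp (- lam * (r + s)) ^ 2 * exp (2 * lam * s) * exp (lam * r)) * ((Cv * CM)\<^sup>2 * C2 * CM * V x ^ 4)" by simp
  also have "exp (- lam * (r + s)) ^ 2 * exp (2 * lam * s) * exp (lam * r) = exp (- lam * r / 2) ^ 2"
    by (simp add: power2_eq_square exp_add[symmetric] algebra_simps)
  also have "exp (- lam * r / 2) ^ 2 * ((Cv * CM)\<^sup>2 * C2 * CM * V x ^ 4) = ((Cv * CM)\<^sup>2 * C2 * CM) * ?e\<^sup>2"
    by (simp add: power_mult_distrib eval_nat_numeral)
  finally have sq: "(\<integral>\<^sup>+\<omega>. ennreal ((exp (- lam * (r + s)) * enn2real (zint (r + s) ?f \<omega>) - exp (- lam * (r + s)) * enn2real (zint r (zmom 1 s ?f) \<omega>))\<^sup>2) \<partial>P x)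
      \<le> ennreal (((Cv * CM)\<^sup>2 * C2 * CM) * ?e\<^sup>2)" .
  show ?thesis
    unfolding CD_def
  proof (rule nn_integral_abs_le_of_square[OF _ _ _ sq])
    show "0 < ?e" using V0 by simp
    show "0 \<le> (Cv * CM)\<^sup>2 * C2 * CM" using C2_pos CM_pos by simp
  qed measurable
qed

text \<open>The conditional mean given the population at time \<open>r\<close> is compared with \<open>\<gamma> (v) * Wt r\<close> by applying
  the ergodic estimate at the position of each individual.\<close>

lemma mean_error:
  assumes x: "x \<in> space X" and r: "0 \<le> r" and s: "0 < s"
    and v [measurable]: "v \<in> borel_measurable X" and v0: "\<And>y. y \<in> space X \<Longrightarrow> 0 \<le> v y"
    and vV: "\<And>y. y \<in> space X \<Longrightarrow> v y \<le> Cv * (V y)\<^sup>2"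
  shows "(\<integral>\<^sup>+\<omega>. ennreal \<bar>exp (- lam * (r + s)) * enn2real (zint r (zmom 1 s (\<lambda>y. ennreal (v y))) \<omega>)
      - (\<integral>y. v y \<partial>\<gamma>) * Wt r \<omega>\<bar> \<partial>P x) \<le> ennreal (a2 * Cv * CM * (exp (- \<rho> * s) * (V x)\<^sup>2))"
proof -
  let ?f = "\<lambda>y. ennreal (v y)"
  define \<sigma>2 where "\<sigma>2 = (\<integral>y. v y \<partial>\<gamma>)"
  define b where "b = a2 * exp (- \<rho> * s) * Cv"
  define el where "el = exp (- lam * s)"
  have s0: "0 \<le> s" using s by simp
  have b0: "0 \<le> b" using pos Cv_pos by (simp add: b_def)
  have \<sigma>0: "0 \<le> \<sigma>2" unfolding \<sigma>2_def
    using sets_eq_imp_space_eq[OF \<gamma>_sets] v0 by (intro Bochner_Integration.integral_nonneg) simp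
  have m1 [measurable]: "zmom 1 s ?f \<in> borel_measurable X" by (rule zmom_measurable[OF s0]) measurable
  have fin: "zmom 1 s ?f y < \<infinity>" if y: "y \<in> space X" for y
  proof -
    have "zmom 1 s ?f y \<le> ennreal (Cv * CM * exp (lam * s) * V y ^ 2)"
      using Cv_pos vV by (intro zmom_1_le y s0 ennreal_leI) auto
    then show ?thesis by (rule le_less_trans) simp
  qed
  define m where "m y = enn2real (zmom 1 s ?f y)" for y
  have m_eq: "zmom 1 s ?f y = ennreal (m y)" if "y \<in> space X" for y using fin[OF that] by (simp add: m_def)
  have m0: "0 \<le> m y" for y by (simp add: m_def)
  have [measurable]: "m \<in> borel_measurable X" unfolding m_def[abs_def] by measurable
  have err: "\<bar>el * m y - \<sigma>2 * h y\<bar> \<le> b * (V y)\<^sup>2" if y: "y \<in> space X" for y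
  proof -
    have "mean_semigroup P Z s v y = m y"
      unfolding m_def by (rule mean_semigroup_eq[OF y s0 v v0 fin[OF y]])
    moreover have "\<bar>exp (- lam * s) * mean_semigroup P Z s v y - (\<integral>y. v y \<partial>\<gamma>) * h y\<bar>
      \<le> a2 * exp (- \<rho> * s) * Cv * V y ^ 2"
      by (rule ergodic[OF y _ v _ _ s]) (use v0 vV Cv_pos in auto)
    ultimately show ?thesis by (simp add: el_def b_def \<sigma>2_def)
  qed
  have le1: "zint r (\<lambda>y. ennreal (el * m y)) \<omega> \<le> ennreal \<sigma>2 * zint r H \<omega> + ennreal b * zint r (Vp 2) \<omega>" for \<omega>
  proof -
    have "zint r (\<lambda>y. ennreal (el * m y)) \<omega> \<le> zint r (\<lambda>y. ennreal \<sigma>2 * H y + ennreal b * Vp 2 y) \<omega>"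
    proof (rule zint_mono)
      fix y assume y: "y \<in> space X"
      have "el * m y \<le> \<sigma>2 * h y + b * (V y)\<^sup>2" using err[OF y] by linarith
      then show "ennreal (el * m y) \<le> ennreal \<sigma>2 * H y + ennreal b * Vp 2 y"
        using \<sigma>0 b0 h_nonneg[OF y] by (simp add: ennreal_mult[symmetric] ennreal_plus[symmetric] ennreal_leI del: ennreal_plus)
    qed
    also have "\<dots> = ennreal \<sigma>2 * zint r H \<omega> + ennreal b * zint r (Vp 2) \<omega>"
      by (subst zint_add_fun, measurable, subst zint_cmult, measurable, subst zint_cmult, measurable)
    finally show ?thesis .
  qed
  have le2: "ennreal \<sigma>2 * zint r H \<omega> \<le> zint r (\<lambda>y. ennreal (el * m y)) \<omega> + ennreal b * zint r (Vp 2) \<omega>" for \<omega>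
  proof -
    have "ennreal \<sigma>2 * zint r H \<omega> = zint r (\<lambda>y. ennreal \<sigma>2 * H y) \<omega>"
      by (subst zint_cmult) measurable
    also have "\<dots> \<le> zint r (\<lambda>y. ennreal (el * m y) + ennreal b * Vp 2 y) \<omega>"
    proof (rule zint_mono)
      fix y assume y: "y \<in> space X"
      have "\<sigma>2 * h y \<le> el * m y + b * (V y)\<^sup>2" using err[OF y] by linarith
      then show "ennreal \<sigma>2 * H y \<le> ennreal (el * m y) + ennreal b * Vp 2 y"
        using \<sigma>0 b0 h_nonneg[OF y] m0[of y]
        by (simp add: el_def ennreal_mult[symmetric] ennreal_plus[symmetric] ennreal_leI del: ennreal_plus)
    qed
    also have "\<dots> = zint r (\<lambda>y. ennreal (el * m y)) \<omega> + ennreal b * zint r (Vp 2) \<omega>"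
      by (subst zint_add_fun, measurable, subst zint_cmult, measurable)
    finally show ?thesis .
  qed
  have zm: "zint r (\<lambda>y. ennreal (el * m y)) \<omega> = ennreal el * zint r (zmom 1 s ?f) \<omega>" for \<omega>
  proof -
    have "zint r (\<lambda>y. ennreal (el * m y)) \<omega> = zint r (\<lambda>y. ennreal el * zmom 1 s ?f y) \<omega>"
      by (rule zint_cong) (simp only: m_eq, simp add: el_def ennreal_mult' m0)
    then show ?thesis by (simp only: zint_cmult[OF m1])
  qed
  note [measurable] = zint_measurable_P[OF r _ x] Wt_measurable[OF r x]
  have finV: "zmom 1 r (Vp 2) x < \<infinity>" and finH: "zmom 1 r H x < \<infinity>"
    using zmom_Vp_finite[of 2, OF _ x r] zmom_1_h[OF x r] by simp_all
  have "AE \<omega> in P x. zint r (Vp 2) \<omega> \<noteq> \<infinity>"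
    by (rule nn_integral_noteq_infinite, measurable) (use finV in \<open>simp add: zmom_def\<close>)
  moreover have "AE \<omega> in P x. zint r H \<omega> \<noteq> \<infinity>"
    by (rule nn_integral_noteq_infinite, measurable) (use finH in \<open>simp add: zmom_def\<close>)
  ultimately have ae: "AE \<omega> in P x. ennreal \<bar>exp (- lam * (r + s)) * enn2real (zint r (zmom 1 s ?f) \<omega>) - \<sigma>2 * Wt r \<omega>\<bar>
      \<le> ennreal (exp (- lam * r) * b) * zint r (Vp 2) \<omega>"
  proof eventually_elim
    case (elim \<omega>)
    define A where "A = enn2real (zint r (zmom 1 s ?f) \<omega>)"
    define B where "B = enn2real (zint r H \<omega>)"
    define C where "C = enn2real (zint r (Vp 2) \<omega>)"
    have Beq: "zint r H \<omega> = ennreal B" and Ceq: "zint r (Vp 2) \<omega> = ennreal C"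
      using elim by (simp_all add: B_def C_def less_top)
    have l: "ennreal el * zint r (zmom 1 s ?f) \<omega> \<le> ennreal (\<sigma>2 * B + b * C)"
      using le1[of \<omega>] \<sigma>0 b0 unfolding zm Beq Ceq
      by (simp add: ennreal_mult[symmetric] ennreal_plus[symmetric] B_def C_def del: ennreal_plus)
    then have "ennreal el * zint r (zmom 1 s ?f) \<omega> < top" by (rule le_less_trans) simp
    then have "zint r (zmom 1 s ?f) \<omega> < top" by (auto simp: ennreal_mult_less_top el_def)
    then have Aeq: "zint r (zmom 1 s ?f) \<omega> = ennreal A" by (simp add: A_def)
    have nn: "0 \<le> A" "0 \<le> B" "0 \<le> C" "0 \<le> el" by (simp_all add: A_def B_def C_def el_def)
    have "ennreal (el * A) \<le> ennreal (\<sigma>2 * B + b * C)"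
      using l nn unfolding Aeq by (simp add: ennreal_mult)
    then have 1: "el * A \<le> \<sigma>2 * B + b * C" using \<sigma>0 b0 nn by (subst (asm) ennreal_le_iff) auto
    have "ennreal (\<sigma>2 * B) \<le> ennreal (el * A + b * C)"
      using le2[of \<omega>] nn \<sigma>0 b0 unfolding zm Aeq Beq Ceq
      by (simp add: ennreal_mult[symmetric] ennreal_plus[symmetric] del: ennreal_plus)
    then have 2: "\<sigma>2 * B \<le> el * A + b * C" using b0 nn by (subst (asm) ennreal_le_iff) auto
    have 3: "\<bar>el * A - \<sigma>2 * B\<bar> \<le> b * C" using 1 2 by linarith
    have "exp (- lam * (r + s)) = exp (- lam * r) * el" by (simp add: el_def exp_add[symmetric] algebra_simps)
    then have "exp (- lam * (r + s)) * A - \<sigma>2 * Wt r \<omega> = exp (- lam * r) * (el * A - \<sigma>2 * B)"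
      by (simp add: Wt_def B_def algebra_simps)
    then have "\<bar>exp (- lam * (r + s)) * A - \<sigma>2 * Wt r \<omega>\<bar> = exp (- lam * r) * \<bar>el * A - \<sigma>2 * B\<bar>"
      by (simp add: abs_mult)
    also have "\<dots> \<le> exp (- lam * r) * (b * C)" using 3 by (intro mult_left_mono) auto
    finally have "ennreal \<bar>exp (- lam * (r + s)) * A - \<sigma>2 * Wt r \<omega>\<bar> \<le> ennreal (exp (- lam * r) * b * C)"
      by (intro ennreal_leI) (simp add: mult.assoc)
    also have "\<dots> = ennreal (exp (- lam * r) * b) * zint r (Vp 2) \<omega>"
      unfolding Ceq using b0 nn by (intro ennreal_mult) auto
    finally show ?case by (simp add: A_def)
  qed
  have "(\<integral>\<^sup>+\<omega>. ennreal \<bar>exp (- lam * (r + s)) * enn2real (zint r (zmom 1 s ?f) \<omega>) - \<sigma>2 * Wt r \<omega>\<bar> \<partial>P x)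
     \<le> (\<integral>\<^sup>+\<omega>. ennreal (exp (- lam * r) * b) * zint r (Vp 2) \<omega> \<partial>P x)"
    by (rule nn_integral_mono_AE[OF ae])
  also have "\<dots> = ennreal (exp (- lam * r) * b) * zmom 1 r (Vp 2) x"
    unfolding zmom_def by (subst nn_integral_cmult) auto
  also have "\<dots> \<le> ennreal (exp (- lam * r) * b) * ennreal (CM * exp (lam * r) * V x ^ 2)"
    by (intro mult_left_mono zmom_Vp_le x r) auto
  also have "\<dots> = ennreal (exp (- lam * r) * b * (CM * exp (lam * r) * V x ^ 2))"
    using b0 CM_pos by (simp add: ennreal_mult[symmetric])
  also have "exp (- lam * r) * b * (CM * exp (lam * r) * V x ^ 2)
     = (exp (- lam * r) * exp (lam * r)) * (b * CM * V x ^ 2)" by simp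
  also have "exp (- lam * r) * exp (lam * r) = 1" by (simp add: exp_add[symmetric])
  also have "1 * (b * CM * V x ^ 2) = a2 * Cv * CM * (exp (- \<rho> * s) * (V x)\<^sup>2)"
    by (simp add: b_def)
  finally show ?thesis by (simp add: \<sigma>2_def)
qed

end


section \<open>Convergence in law from smooth test functions\<close>

text \<open>The phase \<open>\<phi>\<close> makes the family stable under differentiation and covers the sine.\<close>

lemma cosine_smooth_test:
  assumes "\<bar>a\<bar> * (1 + \<bar>\<theta>\<bar>) ^ 3 \<le> 1"
  shows "(\<lambda>y. a * cos (\<theta> * y + \<phi>)) \<in> smooth_tests"
proof -
  let ?T = "\<lambda>a \<phi> y. a * cos (\<theta> * y + \<phi>)"
  have D: "(?T a \<phi> has_real_derivative ?T (a * \<theta>) (\<phi> + pi / 2) y) (at y)" for a \<phi> y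
    by (auto intro!: derivative_eq_intros simp: cos_add)
       (simp add: sin_add cos_add algebra_simps)
  then have d: "deriv (?T a \<phi>) = ?T (a * \<theta>) (\<phi> + pi / 2)" for a \<phi>
    by (intro ext DERIV_imp_deriv)
  have dj: "(deriv ^^ j) (?T a \<phi>) = ?T (a * \<theta> ^ j) (\<phi> + real j * (pi / 2))" for j a \<phi>
  proof (induction j arbitrary: a \<phi>)
    case (Suc j)
    have "(deriv ^^ Suc j) (?T a \<phi>) = (deriv ^^ j) (?T (a * \<theta>) (\<phi> + pi / 2))"
      by (simp only: funpow_Suc_right comp_apply d)
    also have "\<dots> = ?T (a * \<theta> ^ Suc j) (\<phi> + real (Suc j) * (pi / 2))"
      unfolding Suc by (simp add: algebra_simps add_divide_distrib)
    finally show ?case .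
  qed simp
  have "\<bar>(deriv ^^ j) (?T a \<phi>) y\<bar> \<le> 1" if "j \<le> 3" for j y
  proof -
    have "\<bar>(deriv ^^ j) (?T a \<phi>) y\<bar> = \<bar>a\<bar> * \<bar>\<theta>\<bar> ^ j * \<bar>cos (\<theta> * y + (\<phi> + real j * (pi / 2)))\<bar>"
      unfolding dj by (simp add: abs_mult power_abs)
    also have "\<dots> \<le> \<bar>a\<bar> * \<bar>\<theta>\<bar> ^ j * 1" by (intro mult_left_mono) auto
    also have "\<dots> \<le> \<bar>a\<bar> * (1 + \<bar>\<theta>\<bar>) ^ 3"
    proof -
      have "\<bar>\<theta>\<bar> ^ j \<le> (1 + \<bar>\<theta>\<bar>) ^ j" by (intro power_mono) auto
      also have "\<dots> \<le> (1 + \<bar>\<theta>\<bar>) ^ 3" using that by (intro power_increasing) auto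
      finally show ?thesis by (simp add: mult_left_mono)
    qed
    finally show ?thesis using assms by simp
  qed
  moreover have "((deriv ^^ j) (?T a \<phi>)) differentiable (at y)" for j y
    unfolding dj using D real_differentiable_def by blast
  ultimately show ?thesis by (simp add: smooth_tests_def)
qed

lemma (in real_distribution) char_cos_sin:
  "char M \<theta> = complex_of_real (\<integral>y. cos (\<theta> * y) \<partial>M) + \<i> * complex_of_real (\<integral>y. sin (\<theta> * y) \<partial>M)"
proof -
  have c: "integrable M (\<lambda>y. cos (\<theta> * y))" and s: "integrable M (\<lambda>y. sin (\<theta> * y))"
    by (intro integrable_const_bound[where B = 1]; simp)+
  have "char M \<theta> = (\<integral>y. complex_of_real (cos (\<theta> * y)) + \<i> * complex_of_real (sin (\<theta> * y)) \<partial>M)"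
    unfolding char_def by (intro Bochner_Integration.integral_cong refl) (simp add: cis_conv_exp[symmetric] complex_eq_iff del: of_real_mult)
  also have "\<dots> = complex_of_real (\<integral>y. cos (\<theta> * y) \<partial>M) + \<i> * complex_of_real (\<integral>y. sin (\<theta> * y) \<partial>M)"
    using c s by (subst Bochner_Integration.integral_add) (auto intro: integrable_of_real)
  finally show ?thesis .
qed

lemma weak_conv_at_top_of_smooth_tests:
  assumes \<mu>: "\<And>t. real_distribution (\<mu> t)" and \<nu>: "real_distribution \<nu>"
    and conv: "\<And>F. F \<in> smooth_tests \<Longrightarrow> ((\<lambda>t. \<integral>y. F y \<partial>\<mu> t) \<longlongrightarrow> (\<integral>y. F y \<partial>\<nu>)) at_top"
  shows "weak_conv_at_top \<mu> \<nu>"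
proof -
  have cosine: "((\<lambda>t. \<integral>y. cos (\<theta> * y + \<phi>) \<partial>\<mu> t) \<longlongrightarrow> (\<integral>y. cos (\<theta> * y + \<phi>) \<partial>\<nu>)) at_top" for \<theta> \<phi>
  proof -
    define a where "a = 1 / (1 + \<bar>\<theta>\<bar>) ^ 3"
    have a: "0 < a" "\<bar>a\<bar> * (1 + \<bar>\<theta>\<bar>) ^ 3 \<le> 1" by (auto simp: a_def abs_div add_pos_nonneg)
    have "((\<lambda>t. (1 / a) * (\<integral>y. a * cos (\<theta> * y + \<phi>) \<partial>\<mu> t)) \<longlongrightarrow> (1 / a) * (\<integral>y. a * cos (\<theta> * y + \<phi>) \<partial>\<nu>)) at_top"
      by (intro tendsto_mult tendsto_const conv cosine_smooth_test a)
    then show ?thesis using a(1) by simp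
  qed
  have sine: "((\<lambda>t. \<integral>y. sin (\<theta> * y) \<partial>\<mu> t) \<longlongrightarrow> (\<integral>y. sin (\<theta> * y) \<partial>\<nu>)) at_top" for \<theta>
    using cosine[of \<theta> "- (pi / 2)"] by (simp add: cos_diff)
  have "((\<lambda>t. char (\<mu> t) \<theta>) \<longlongrightarrow> char \<nu> \<theta>) at_top" for \<theta>
    unfolding real_distribution.char_cos_sin[OF \<mu>] real_distribution.char_cos_sin[OF \<nu>]
    using cosine[of \<theta> 0] sine[of \<theta>]
    by (intro tendsto_add tendsto_mult tendsto_const tendsto_of_real) auto
  then have "weak_conv_m (\<lambda>n. \<mu> (X n)) \<nu>" if "filterlim X at_top sequentially" for X
    using that by (intro levy_continuity \<mu> \<nu>) (rule filterlim_compose)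
  then show ?thesis
    unfolding weak_conv_at_top_def weak_conv_m_def weak_conv_def
    by (auto intro!: tendsto_at_topI_sequentially)
qed

lemma (in prob_space) expectation_diff_le:
  assumes f: "integrable M f" and g: "integrable M (g :: 'a \<Rightarrow> real)" and B: "0 \<le> B"
    and le: "(\<integral>\<^sup>+\<omega>. ennreal \<bar>f \<omega> - g \<omega>\<bar> \<partial>M) \<le> ennreal B"
  shows "\<bar>expectation f - expectation g\<bar> \<le> B"
proof -
  have i: "integrable M (\<lambda>\<omega>. \<bar>f \<omega> - g \<omega>\<bar>)" using f g by simp
  have "\<bar>expectation f - expectation g\<bar> = \<bar>expectation (\<lambda>\<omega>. f \<omega> - g \<omega>)\<bar>" using f g by simp
  also have "\<dots> \<le> expectation (\<lambda>\<omega>. \<bar>f \<omega> - g \<omega>\<bar>)" by (rule integral_abs_bound)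
  also have "\<dots> \<le> B"
    using le B unfolding nn_integral_eq_integral[OF i AE_I2[OF abs_ge_zero]] by (subst (asm) ennreal_le_iff) auto
  finally show ?thesis .
qed

section \<open>Fluctuations of the weighted mass\<close>

text \<open>The martingale converges almost surely to \<open>W\<close>.\<close>

locale branching_fluctuation = branching_moments X \<Omega> P N trait desc V h \<gamma> lam \<rho> \<tau> a1 a2 ch G
  for X :: "'x measure" and \<Omega> :: "'w measure" and P :: "'x \<Rightarrow> 'w measure"
    and N :: "real \<Rightarrow> 'w \<Rightarrow> ('u::countable) set" and trait :: "real \<Rightarrow> 'w \<Rightarrow> 'u \<Rightarrow> 'x"
    and desc :: "'w \<Rightarrow> 'u \<Rightarrow> 'u \<Rightarrow> bool"
    and V h :: "'x \<Rightarrow> real" and \<gamma> :: "'x measure" and lam \<rho> \<tau> a1 a2 ch G :: real +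
  fixes W :: "'w \<Rightarrow> real"
  assumes W_meas: "W \<in> borel_measurable \<Omega>"
    and W_lim: "\<And>x. x \<in> space X \<Longrightarrow>
      AE \<omega> in P x. ((\<lambda>t. exp (- lam * t) * (\<integral>y. h y \<partial>population X N trait t \<omega>)) \<longlongrightarrow> W \<omega>) at_top"
begin

lemma W_P [measurable]: "x \<in> space X \<Longrightarrow> W \<in> borel_measurable (P x)"
  by (rule P_measurable[OF _ W_meas])

lemma Wt_eq: "exp (- lam * t) * (\<integral>y. h y \<partial>Z t \<omega>) = Wt t \<omega>"
  unfolding Wt_def using h_meas h_nonneg by (subst integral_Z_eq) auto

lemma Wt_lim: "x \<in> space X \<Longrightarrow> AE \<omega> in P x. ((\<lambda>t. Wt t \<omega>) \<longlongrightarrow> W \<omega>) at_top"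
  using W_lim unfolding Wt_eq .

lemma Wt_nonneg: "0 \<le> Wt t \<omega>" by (simp add: Wt_def)

lemma W_nonneg: "x \<in> space X \<Longrightarrow> AE \<omega> in P x. 0 \<le> W \<omega>"
  using Wt_lim[of x] Wt_nonneg
  by (auto elim!: eventually_mono intro: tendsto_lowerbound[OF _ always_eventually])

lemma W_L1: "x \<in> space X \<Longrightarrow> 0 \<le> t \<Longrightarrow>
    (\<integral>\<^sup>+\<omega>. ennreal \<bar>W \<omega> - Wt t \<omega>\<bar> \<partial>P x) \<le> ennreal (CW * (exp (- lam * t / 2) * V x))"
  using W_error[OF _ _ W_meas W_lim] .

lemma W_finite: "x \<in> space X \<Longrightarrow> (\<integral>\<^sup>+\<omega>. ennreal \<bar>W \<omega>\<bar> \<partial>P x) < \<infinity>"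
proof -
  assume x: "x \<in> space X"
  note [measurable] = W_P[OF x] Wt_measurable[OF order_refl x] zint_measurable_P[OF order_refl _ x]
  have "(\<integral>\<^sup>+\<omega>. ennreal \<bar>W \<omega>\<bar> \<partial>P x) \<le> (\<integral>\<^sup>+\<omega>. ennreal \<bar>W \<omega> - Wt 0 \<omega>\<bar> + zint 0 H \<omega> \<partial>P x)"
  proof (rule nn_integral_mono)
    fix \<omega>
    show "ennreal \<bar>W \<omega>\<bar> \<le> ennreal \<bar>W \<omega> - Wt 0 \<omega>\<bar> + zint 0 H \<omega>"
    proof (cases "zint 0 H \<omega>")
      case (real r)
      have "\<bar>W \<omega>\<bar> \<le> \<bar>W \<omega> - r\<bar> + r" using real by linarith
      then show ?thesis using real
        by (simp add: Wt_def ennreal_plus[symmetric] ennreal_leI del: ennreal_plus)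
    qed simp
  qed
  also have "\<dots> = (\<integral>\<^sup>+\<omega>. ennreal \<bar>W \<omega> - Wt 0 \<omega>\<bar> \<partial>P x) + zmom 1 0 H x"
    unfolding zmom_def by (subst nn_integral_add) auto
  also have "\<dots> < \<infinity>"
    using le_less_trans[OF W_L1[OF x order_refl] ennreal_less_top] zmom_1_h[OF x order_refl] by simp
  finally show ?thesis .
qed

text \<open>The mean of \<open>vr n\<close> under \<open>\<gamma>\<close>, and its limit, which is the square of the constant \<open>\<sigma>\<close> of the theorem.\<close>

definition var :: "nat \<Rightarrow> real" where "var n = (\<integral>y. vr n y \<partial>\<gamma>)"
definition \<sigma>2 :: real where "\<sigma>2 = lim var"

lemma space_\<gamma>: "space \<gamma> = space X" by (rule sets_eq_imp_space_eq[OF \<gamma>_sets])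

lemma vr_\<gamma>: "integrable \<gamma> (vr n)"
proof (rule Bochner_Integration.integrable_bound)
  show "integrable \<gamma> (\<lambda>y. Cv * V y ^ 2)" using \<gamma>_V[of 2] by simp
  show "vr n \<in> borel_measurable \<gamma>" by measurable
  show "AE y in \<gamma>. norm (vr n y) \<le> norm (Cv * V y ^ 2)"
  proof (rule AE_I2)
    fix y assume "y \<in> space \<gamma>"
    then have y: "y \<in> space X" by (simp add: space_\<gamma>)
    show "norm (vr n y) \<le> norm (Cv * V y ^ 2)"
      using vr_nonneg[OF y, of n] vr_le(2)[OF y, of n] Cv_pos by simp
  qed
qed

lemma var_nonneg: "0 \<le> var n"
  unfolding var_def by (intro Bochner_Integration.integral_nonneg vr_nonneg) (simp add: space_\<gamma>)

lemma var_le: "var n \<le> Cv * G"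
proof -
  have "var n \<le> (\<integral>y. Cv * V y ^ 2 \<partial>\<gamma>)"
    unfolding var_def using \<gamma>_V[of 2] by (intro integral_mono vr_\<gamma> vr_le) (auto simp: space_\<gamma>)
  also have "\<dots> = Cv * (\<integral>y. V y ^ 2 \<partial>\<gamma>)" by simp
  also have "\<dots> \<le> Cv * G" using Cv_pos by (intro mult_left_mono \<gamma>_G) auto
  finally show ?thesis .
qed

lemma var_incseq: "incseq var"
  unfolding var_def by (intro incseq_SucI integral_mono vr_\<gamma> vr_mono) (simp add: space_\<gamma>)

lemma var_lim: "var \<longlonglongrightarrow> \<sigma>2"
proof -
  obtain L where "var \<longlonglongrightarrow> L" using incseq_convergent[OF var_incseq, of "Cv * G"] var_le by blast
  then show ?thesis unfolding \<sigma>2_def by (metis limI)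
qed

lemma var_le_\<sigma>2: "var n \<le> \<sigma>2"
  by (rule incseq_le[OF var_incseq var_lim])

lemma \<sigma>2_nonneg: "0 \<le> \<sigma>2"
  using var_nonneg[of 0] var_le_\<sigma>2[of 0] by linarith

text \<open>The normalised fluctuation.\<close>

definition fluct :: "real \<Rightarrow> 'w \<Rightarrow> real" where
  "fluct t \<omega> = exp (- lam * t / 2) * ((\<integral>y. h y \<partial>Z t \<omega>) - exp (lam * t) * W \<omega>)"

lemma integral_h_eq: "(\<integral>y. h y \<partial>Z t \<omega>) = enn2real (zint t H \<omega>)"
  using h_meas h_nonneg by (intro integral_Z_eq) auto

lemma fluct_measurable: "x \<in> space X \<Longrightarrow> 0 \<le> t \<Longrightarrow> fluct t \<in> borel_measurable (P x)"
  unfolding fluct_def[abs_def] integral_h_eq using zint_measurable_P[of t H x] W_P[of x] by measurable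

subsection \<open>Comparison with the Gaussian mixture\<close>

text \<open>The fluctuation with \<open>W\<close> replaced by the martingale at time \<open>t + n * \<tau>\<close>, written as a functional of
  the populations at the times \<open>t\<close> and \<open>t + n * \<tau>\<close>.\<close>

definition fluctn :: "nat \<Rightarrow> real \<Rightarrow> 'w \<Rightarrow> real" where
  "fluctn n t \<omega> = exp (- lam * t / 2) * (enn2real (zint t H \<omega>) - enn2real (zint (t + real n * \<tau>) (hz n) \<omega>))"

lemma fluctn_eq: "fluctn n t \<omega> = exp (- lam * t / 2) * (enn2real (zint t H \<omega>) - exp (lam * t) * Wt (t + real n * \<tau>) \<omega>)"
proof -
  have "zint (t + real n * \<tau>) (hz n) \<omega> = ennreal (exp (- lam * (real n * \<tau>))) * zint (t + real n * \<tau>) H \<omega>"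
    unfolding hz_def[abs_def] by (rule zint_cmult) measurable
  moreover have "exp (- lam * (real n * \<tau>)) = exp (lam * t) * exp (- lam * (t + real n * \<tau>))"
    unfolding exp_add[symmetric] by (simp add: algebra_simps)
  ultimately show ?thesis
    unfolding fluctn_def Wt_def by (simp only: enn2real_mult enn2real_ennreal[OF mult_nonneg_nonneg[OF exp_ge_zero exp_ge_zero]] mult.assoc)
qed

lemma test_measurable: "F \<in> smooth_tests \<Longrightarrow> F \<in> borel_measurable borel"
  using smooth_tests_measurable[of F 0] by simp

lemma fluctn_measurable: "x \<in> space X \<Longrightarrow> 0 \<le> t \<Longrightarrow> fluctn n t \<in> borel_measurable (P x)"
  unfolding fluctn_eq[abs_def] using zint_measurable_P[of t H x] Wt_measurable[of "t + real n * \<tau>" x] by measurable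

lemma horizon_error:
  assumes F: "F \<in> smooth_tests" and x: "x \<in> space X" and t: "0 \<le> t"
  shows "\<bar>(\<integral>\<omega>. F (fluct t \<omega>) \<partial>P x) - (\<integral>\<omega>. F (fluctn n t \<omega>) \<partial>P x)\<bar> \<le> CW * V x * exp (- lam * (real n * \<tau>) / 2)"
proof -
  interpret prob_space "P x" by (rule P_prob[OF x])
  have tn: "0 \<le> t + real n * \<tau>" using t by simp
  note [measurable] = W_P[OF x] Wt_measurable[OF tn x]
  have d: "\<bar>fluct t \<omega> - fluctn n t \<omega>\<bar> = exp (lam * t / 2) * \<bar>W \<omega> - Wt (t + real n * \<tau>) \<omega>\<bar>" for \<omega>
  proof -
    have e: "exp (lam * t / 2) = exp (- lam * t / 2) * exp (lam * t)" by (simp add: exp_add[symmetric])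
    have "fluct t \<omega> - fluctn n t \<omega> = - (exp (lam * t / 2) * (W \<omega> - Wt (t + real n * \<tau>) \<omega>))"
      unfolding fluct_def fluctn_eq integral_h_eq e by (simp add: algebra_simps)
    then show ?thesis by (simp add: abs_mult)
  qed
  have CW0: "0 \<le> CW * V x" using Cv_pos CM_pos x by (simp add: CW_def)
  show ?thesis
  proof (rule expectation_diff_le)
    show "integrable (P x) (\<lambda>\<omega>. F (fluct t \<omega>))"
      using smooth_tests_integrable[OF F, of 0 "P x" "fluct t"] fluct_measurable[OF x t] finite_measure_axioms by simp
    show "integrable (P x) (\<lambda>\<omega>. F (fluctn n t \<omega>))"
      using smooth_tests_integrable[OF F, of 0 "P x" "fluctn n t"] fluctn_measurable[OF x t] finite_measure_axioms by simp
    have "(\<integral>\<^sup>+\<omega>. ennreal \<bar>F (fluct t \<omega>) - F (fluctn n t \<omega>)\<bar> \<partial>P x)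
        \<le> (\<integral>\<^sup>+\<omega>. ennreal (exp (lam * t / 2)) * ennreal \<bar>W \<omega> - Wt (t + real n * \<tau>) \<omega>\<bar> \<partial>P x)"
    proof (rule nn_integral_mono)
      fix \<omega>
      have "\<bar>F (fluct t \<omega>) - F (fluctn n t \<omega>)\<bar> \<le> exp (lam * t / 2) * \<bar>W \<omega> - Wt (t + real n * \<tau>) \<omega>\<bar>"
        unfolding d[symmetric] by (rule smooth_tests_taylor1[OF F])
      then show "ennreal \<bar>F (fluct t \<omega>) - F (fluctn n t \<omega>)\<bar> \<le> ennreal (exp (lam * t / 2)) * ennreal \<bar>W \<omega> - Wt (t + real n * \<tau>) \<omega>\<bar>"
        by (simp only: ennreal_mult[symmetric, OF exp_ge_zero abs_ge_zero] ennreal_leI)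
    qed
    also have "\<dots> = ennreal (exp (lam * t / 2)) * (\<integral>\<^sup>+\<omega>. ennreal \<bar>W \<omega> - Wt (t + real n * \<tau>) \<omega>\<bar> \<partial>P x)"
      by (rule nn_integral_cmult) measurable
    also have "\<dots> \<le> ennreal (exp (lam * t / 2)) * ennreal (CW * (exp (- lam * (t + real n * \<tau>) / 2) * V x))"
      by (intro mult_left_mono W_L1 x tn) simp
    also have "\<dots> = ennreal (exp (lam * t / 2) * (CW * (exp (- lam * (t + real n * \<tau>) / 2) * V x)))"
      by (rule ennreal_mult'[symmetric]) simp
    also have "exp (lam * t / 2) * (CW * (exp (- lam * (t + real n * \<tau>) / 2) * V x))
        = CW * V x * (exp (lam * t / 2) * exp (- lam * (t + real n * \<tau>) / 2))" by simp
    also have "exp (lam * t / 2) * exp (- lam * (t + real n * \<tau>) / 2) = exp (- lam * (real n * \<tau>) / 2)"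
      unfolding exp_add[symmetric] by (simp add: field_simps)
    finally show "(\<integral>\<^sup>+\<omega>. ennreal \<bar>F (fluct t \<omega>) - F (fluctn n t \<omega>)\<bar> \<partial>P x)
        \<le> ennreal (CW * V x * exp (- lam * (real n * \<tau>) / 2))" .
  qed (use CW0 in simp)
qed

text \<open>The constants of the Lindeberg error: \<open>CE * V ^ 3\<close> dominates the third moments.\<close>

definition CE :: real where "CE = C3 + ch ^ 3 + Cv * sqrt Cv"
definition CL :: real where "CL = (2 + gauss_abs_moment3) / 6 * (CE * CM)"

lemma CE_pos: "0 < CE" using C3_pos pos Cv_pos by (simp add: CE_def add_pos_nonneg)
lemma CL_pos: "0 < CL" using CE_pos CM_pos gauss_abs_moment3_nonneg by (simp add: CL_def)

lemma lindeberg_error: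
  assumes F: "F \<in> smooth_tests" and x: "x \<in> space X" and t: "0 \<le> t"
  shows "\<bar>(\<integral>\<omega>. F (fluctn n t \<omega>) \<partial>P x)
      - (\<integral>\<omega>. gauss_smooth F (exp (- lam * t) * enn2real (zint t (\<lambda>y. ennreal (vr n y)) \<omega>)) 0 \<partial>P x)\<bar>
    \<le> CL * (exp (- lam * t / 2) * V x ^ 3)"
proof -
  let ?c = "exp (- lam * t / 2)"
  have V3: "0 \<le> V y ^ 3" if "y \<in> space X" for y using that by simp
  have c2: "?c\<^sup>2 = exp (- lam * t)" by (simp add: power2_eq_square exp_add[symmetric])
  have m\<beta>: "zmom 1 t (\<lambda>y. ennreal (CE * V y ^ 3)) x \<le> ennreal (CE * CM * exp (lam * t) * V x ^ 3)"
    using CE_pos by (intro zmom_1_le x t) auto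
  have "\<bar>(\<integral>\<omega>. F (?c * (enn2real (zint t H \<omega>) - enn2real (zint (t + real n * \<tau>) (hz n) \<omega>))) \<partial>P x)
      - (\<integral>\<omega>. gauss_smooth F (?c\<^sup>2 * enn2real (zint t (\<lambda>y. ennreal (vr n y)) \<omega>)) 0 \<partial>P x)\<bar>
    \<le> ?c ^ 3 * ((2 + gauss_abs_moment3) / 6) * enn2real (zmom 1 t (\<lambda>y. ennreal (CE * V y ^ 3)) x)"
  proof (rule zint_lindeberg[OF x t n\<tau> hz_measurable F])
    fix y assume y: "y \<in> space X"
    show "0 \<le> h y" by (rule h_nonneg[OF y])
    show "0 \<le> vr n y" by (rule vr_nonneg[OF y])
    show "zmom 1 (real n * \<tau>) (hz n) y = ennreal (h y)" by (rule zmom_1_hz[OF y])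
    show "zmom 2 (real n * \<tau>) (hz n) y = ennreal ((h y)\<^sup>2 + vr n y)" by (rule zmom_2_hz[OF y])
    have C: "C3 \<le> CE" "ch ^ 3 \<le> CE" "Cv * sqrt Cv \<le> CE" using C3_pos pos Cv_pos by (auto simp: CE_def)
    show "zmom 3 (real n * \<tau>) (hz n) y \<le> ennreal (CE * V y ^ 3)"
      by (rule order_trans[OF zmom_3_hz_le[OF y]]) (intro ennreal_leI mult_right_mono C V3 y)
    have "h y ^ 3 \<le> (ch * V y) ^ 3" using h_le[OF y, of 1] h_nonneg[OF y] by (intro power_mono) auto
    also have "\<dots> = ch ^ 3 * V y ^ 3" by (rule power_mult_distrib)
    also have "\<dots> \<le> CE * V y ^ 3" by (intro mult_right_mono C V3 y)
    finally show "h y ^ 3 \<le> CE * V y ^ 3" .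
    have "vr n y * sqrt (vr n y) \<le> (Cv * (V y)\<^sup>2) * sqrt (Cv * (V y)\<^sup>2)"
      using vr_nonneg[OF y, of n] vr_le(2)[OF y, of n] by (intro mult_mono real_sqrt_le_mono) auto
    also have "\<dots> = (Cv * sqrt Cv) * V y ^ 3"
      using y by (simp add: real_sqrt_mult power2_eq_square power3_eq_cube)
    also have "\<dots> \<le> CE * V y ^ 3" by (intro mult_right_mono C V3 y)
    finally show "vr n y * sqrt (vr n y) \<le> CE * V y ^ 3" .
  next
    show "zmom 1 t H x < \<infinity>" using zmom_1_h[OF x t] by simp
    have "zmom 1 t (\<lambda>y. ennreal ((h y)\<^sup>2 + vr n y)) x \<le> ennreal (Cv * CM * exp (lam * t) * V x ^ 2)"
      using Cv_pos vr_le(1) by (intro zmom_1_le x t ennreal_leI) auto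
    then show "zmom 1 t (\<lambda>y. ennreal ((h y)\<^sup>2 + vr n y)) x < \<infinity>" by (rule le_less_trans) simp
    show "zmom 1 t (\<lambda>y. ennreal (CE * V y ^ 3)) x < \<infinity>" using m\<beta> by (rule le_less_trans) simp
  qed auto
  also have "\<dots> \<le> ?c ^ 3 * ((2 + gauss_abs_moment3) / 6) * (CE * CM * exp (lam * t) * V x ^ 3)"
  proof (intro mult_left_mono)
    have "enn2real (zmom 1 t (\<lambda>y. ennreal (CE * V y ^ 3)) x) \<le> enn2real (ennreal (CE * CM * exp (lam * t) * V x ^ 3))"
      by (rule enn2real_mono[OF m\<beta>]) simp
    also have "\<dots> = CE * CM * exp (lam * t) * V x ^ 3" using CE_pos CM_pos x by (intro enn2real_ennreal) simp
    finally show "enn2real (zmom 1 t (\<lambda>y. ennreal (CE * V y ^ 3)) x) \<le> CE * CM * exp (lam * t) * V x ^ 3" .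
  qed (use gauss_abs_moment3_nonneg in auto)
  also have "\<dots> = CL * ((?c ^ 3 * exp (lam * t)) * V x ^ 3)" by (simp add: CL_def)
  also have "?c ^ 3 * exp (lam * t) = ?c"
    by (simp add: power3_eq_cube exp_add[symmetric] field_simps)
  finally show ?thesis unfolding c2 fluctn_def .
qed

lemma gauss_smooth_L1:
  assumes F: "F \<in> smooth_tests" and x: "x \<in> space X"
    and [measurable]: "a \<in> borel_measurable (P x)" "b \<in> borel_measurable (P x)"
    and a: "AE \<omega> in P x. 0 \<le> a \<omega>" and b: "AE \<omega> in P x. 0 \<le> b \<omega>" and B: "0 \<le> B"
    and le: "(\<integral>\<^sup>+\<omega>. ennreal \<bar>a \<omega> - b \<omega>\<bar> \<partial>P x) \<le> ennreal B"
  shows "\<bar>(\<integral>\<omega>. gauss_smooth F (a \<omega>) 0 \<partial>P x) - (\<integral>\<omega>. gauss_smooth F (b \<omega>) 0 \<partial>P x)\<bar> \<le> B"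
proof -
  interpret prob_space "P x" by (rule P_prob[OF x])
  have i: "integrable (P x) (\<lambda>\<omega>. gauss_smooth F (c \<omega>) 0)" if "c \<in> borel_measurable (P x)" for c
    using gauss_smooth_integrable[OF F, of 0 "P x" c "\<lambda>_. 0"] that finite_measure_axioms by simp
  show ?thesis
  proof (rule expectation_diff_le[OF i i B])
    have "(\<integral>\<^sup>+\<omega>. ennreal \<bar>gauss_smooth F (a \<omega>) 0 - gauss_smooth F (b \<omega>) 0\<bar> \<partial>P x) \<le> (\<integral>\<^sup>+\<omega>. ennreal \<bar>a \<omega> - b \<omega>\<bar> \<partial>P x)"
    proof (rule nn_integral_mono_AE)
      show "AE \<omega> in P x. ennreal \<bar>gauss_smooth F (a \<omega>) 0 - gauss_smooth F (b \<omega>) 0\<bar> \<le> ennreal \<bar>a \<omega> - b \<omega>\<bar>"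
        using a b
      proof eventually_elim
        case (elim \<omega>)
        have "\<bar>gauss_smooth F (a \<omega>) 0 - gauss_smooth F (b \<omega>) 0\<bar> \<le> \<bar>a \<omega> - b \<omega>\<bar> / 2"
          by (rule gauss_smooth_lipschitz[OF F elim])
        also have "\<dots> \<le> \<bar>a \<omega> - b \<omega>\<bar>" by simp
        finally show ?case by (rule ennreal_leI)
      qed
    qed
    also note le
    finally show "(\<integral>\<^sup>+\<omega>. ennreal \<bar>gauss_smooth F (a \<omega>) 0 - gauss_smooth F (b \<omega>) 0\<bar> \<partial>P x) \<le> ennreal B" .
  qed measurable
qed

text \<open>The conditional variance at time \<open>r + s\<close> is close to its mean given the population at
  time \<open>r\<close>, and this mean is close to \<open>var n * W\<close>.\<close>

lemma variance_error:
  assumes F: "F \<in> smooth_tests" and x: "x \<in> space X" and r: "0 \<le> r" and s: "0 < s"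
  shows "\<bar>(\<integral>\<omega>. gauss_smooth F (exp (- lam * (r + s)) * enn2real (zint (r + s) (\<lambda>y. ennreal (vr n y)) \<omega>)) 0 \<partial>P x)
      - (\<integral>\<omega>. gauss_smooth F (var n * W \<omega>) 0 \<partial>P x)\<bar>
    \<le> CD * (exp (- lam * r / 2) * (V x)\<^sup>2) + a2 * Cv * CM * (exp (- \<rho> * s) * (V x)\<^sup>2)
       + Cv * G * (CW * (exp (- lam * r / 2) * V x))"
proof -
  let ?f = "\<lambda>y. ennreal (vr n y)"
  have s0: "0 \<le> s" and rs: "0 \<le> r + s" using r s by auto
  have m1: "zmom 1 s ?f \<in> borel_measurable X" by (rule zmom_measurable[OF s0]) measurable
  note [measurable] = W_P[OF x] Wt_measurable[OF r x] zint_measurable_P[OF rs _ x] zint_measurable_P[OF r m1 x]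
  have pos': "0 \<le> CD" "0 \<le> CW" "0 \<le> a2 * Cv * CM" "0 \<le> Cv * G" "0 \<le> V x"
    using Cv_pos CM_pos C2_pos pos G_nonneg x by (auto simp: CD_def CW_def)
  let ?A = "\<lambda>\<omega>. exp (- lam * (r + s)) * enn2real (zint (r + s) ?f \<omega>)"
  let ?A' = "\<lambda>\<omega>. exp (- lam * (r + s)) * enn2real (zint r (zmom 1 s ?f) \<omega>)"
  have e1: "(\<integral>\<^sup>+\<omega>. ennreal \<bar>?A \<omega> - ?A' \<omega>\<bar> \<partial>P x) \<le> ennreal (CD * (exp (- lam * r / 2) * (V x)\<^sup>2))"
    by (rule variance_increment[OF x r s0]) (auto intro: vr_nonneg vr_le)
  have e2: "(\<integral>\<^sup>+\<omega>. ennreal \<bar>?A' \<omega> - var n * Wt r \<omega>\<bar> \<partial>P x) \<le> ennreal (a2 * Cv * CM * (exp (- \<rho> * s) * (V x)\<^sup>2))"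
    unfolding var_def by (rule mean_error[OF x r s]) (auto intro: vr_nonneg vr_le)
  have e3: "(\<integral>\<^sup>+\<omega>. ennreal \<bar>var n * Wt r \<omega> - var n * W \<omega>\<bar> \<partial>P x) \<le> ennreal (Cv * G * (CW * (exp (- lam * r / 2) * V x)))"
  proof -
    have "(\<integral>\<^sup>+\<omega>. ennreal \<bar>var n * Wt r \<omega> - var n * W \<omega>\<bar> \<partial>P x) = (\<integral>\<^sup>+\<omega>. ennreal (var n) * ennreal \<bar>W \<omega> - Wt r \<omega>\<bar> \<partial>P x)"
      using var_nonneg[of n]
      by (intro nn_integral_cong) (simp add: ennreal_mult[symmetric] abs_minus_commute abs_mult right_diff_distrib[symmetric])
    also have "\<dots> = ennreal (var n) * (\<integral>\<^sup>+\<omega>. ennreal \<bar>W \<omega> - Wt r \<omega>\<bar> \<partial>P x)"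
      by (rule nn_integral_cmult) measurable
    also have "\<dots> \<le> ennreal (Cv * G) * ennreal (CW * (exp (- lam * r / 2) * V x))"
      by (intro mult_mono W_L1 x r ennreal_leI var_le) auto
    also have "\<dots> = ennreal (Cv * G * (CW * (exp (- lam * r / 2) * V x)))"
      using pos' by (simp add: ennreal_mult[symmetric])
    finally show ?thesis .
  qed
  have "(\<integral>\<^sup>+\<omega>. ennreal \<bar>?A \<omega> - var n * W \<omega>\<bar> \<partial>P x)
      \<le> (\<integral>\<^sup>+\<omega>. ennreal \<bar>?A \<omega> - ?A' \<omega>\<bar> + ennreal \<bar>?A' \<omega> - var n * Wt r \<omega>\<bar> + ennreal \<bar>var n * Wt r \<omega> - var n * W \<omega>\<bar> \<partial>P x)"
    by (intro nn_integral_mono) (simp only: ennreal_plus[symmetric] abs_ge_zero add_nonneg_nonneg, intro ennreal_leI, linarith)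
  also have "\<dots> = (\<integral>\<^sup>+\<omega>. ennreal \<bar>?A \<omega> - ?A' \<omega>\<bar> \<partial>P x) + (\<integral>\<^sup>+\<omega>. ennreal \<bar>?A' \<omega> - var n * Wt r \<omega>\<bar> \<partial>P x)
      + (\<integral>\<^sup>+\<omega>. ennreal \<bar>var n * Wt r \<omega> - var n * W \<omega>\<bar> \<partial>P x)"
    by (subst nn_integral_add, measurable, subst nn_integral_add, measurable)
  also have "\<dots> \<le> ennreal (CD * (exp (- lam * r / 2) * (V x)\<^sup>2)) + ennreal (a2 * Cv * CM * (exp (- \<rho> * s) * (V x)\<^sup>2))
       + ennreal (Cv * G * (CW * (exp (- lam * r / 2) * V x)))"
    by (intro add_mono e1 e2 e3)
  also have "\<dots> = ennreal (CD * (exp (- lam * r / 2) * (V x)\<^sup>2) + a2 * Cv * CM * (exp (- \<rho> * s) * (V x)\<^sup>2)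
       + Cv * G * (CW * (exp (- lam * r / 2) * V x)))"
    using pos' by (simp add: ennreal_plus)
  finally have le: "(\<integral>\<^sup>+\<omega>. ennreal \<bar>?A \<omega> - var n * W \<omega>\<bar> \<partial>P x) \<le> ennreal (CD * (exp (- lam * r / 2) * (V x)\<^sup>2) + a2 * Cv * CM * (exp (- \<rho> * s) * (V x)\<^sup>2)
       + Cv * G * (CW * (exp (- lam * r / 2) * V x)))" .
  show ?thesis
  proof (rule gauss_smooth_L1[OF F x _ _ _ _ _ le])
    show "AE \<omega> in P x. 0 \<le> var n * W \<omega>" using W_nonneg[OF x] by eventually_elim (simp add: var_nonneg)
    show "0 \<le> CD * (exp (- lam * r / 2) * (V x)\<^sup>2) + a2 * Cv * CM * (exp (- \<rho> * s) * (V x)\<^sup>2)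
       + Cv * G * (CW * (exp (- lam * r / 2) * V x))"
      using pos' Cv_pos CM_pos G_nonneg pos by (intro add_nonneg_nonneg mult_nonneg_nonneg) auto
  qed auto
qed

lemma limit_variance_error:
  assumes F: "F \<in> smooth_tests" and x: "x \<in> space X"
  shows "\<bar>(\<integral>\<omega>. gauss_smooth F (var n * W \<omega>) 0 \<partial>P x) - (\<integral>\<omega>. gauss_smooth F (\<sigma>2 * W \<omega>) 0 \<partial>P x)\<bar>
    \<le> (\<sigma>2 - var n) * enn2real (\<integral>\<^sup>+\<omega>. ennreal \<bar>W \<omega>\<bar> \<partial>P x)"
proof (rule gauss_smooth_L1[OF F x])
  note [measurable] = W_P[OF x]
  show "AE \<omega> in P x. 0 \<le> var n * W \<omega>" using W_nonneg[OF x] by eventually_elim (simp add: var_nonneg)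
  show "AE \<omega> in P x. 0 \<le> \<sigma>2 * W \<omega>" using W_nonneg[OF x] by eventually_elim (simp add: \<sigma>2_nonneg)
  have d: "0 \<le> \<sigma>2 - var n" using var_le_\<sigma>2[of n] by simp
  then show "0 \<le> (\<sigma>2 - var n) * enn2real (\<integral>\<^sup>+\<omega>. ennreal \<bar>W \<omega>\<bar> \<partial>P x)" by simp
  have "(\<integral>\<^sup>+\<omega>. ennreal \<bar>var n * W \<omega> - \<sigma>2 * W \<omega>\<bar> \<partial>P x) = (\<integral>\<^sup>+\<omega>. ennreal (\<sigma>2 - var n) * ennreal \<bar>W \<omega>\<bar> \<partial>P x)"
    using d by (intro nn_integral_cong) (simp add: ennreal_mult[symmetric] left_diff_distrib[symmetric] abs_mult)
  also have "\<dots> = ennreal (\<sigma>2 - var n) * (\<integral>\<^sup>+\<omega>. ennreal \<bar>W \<omega>\<bar> \<partial>P x)"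
    by (rule nn_integral_cmult) measurable
  also have "\<dots> = ennreal ((\<sigma>2 - var n) * enn2real (\<integral>\<^sup>+\<omega>. ennreal \<bar>W \<omega>\<bar> \<partial>P x))"
    using W_finite[OF x] d by (simp add: ennreal_mult)
  finally show "(\<integral>\<^sup>+\<omega>. ennreal \<bar>var n * W \<omega> - \<sigma>2 * W \<omega>\<bar> \<partial>P x) \<le> ennreal ((\<sigma>2 - var n) * enn2real (\<integral>\<^sup>+\<omega>. ennreal \<bar>W \<omega>\<bar> \<partial>P x))"
    by simp
qed (use W_P[OF x] in measurable)

text \<open>The constant of the theorem.\<close>

definition CK :: real where "CK = CL + (CD + a2 * Cv * CM + Cv * G * CW)"

lemma CK_pos: "0 < CK"
proof -
  have "0 \<le> CD" "0 \<le> a2 * Cv * CM" "0 \<le> Cv * G * CW"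
    using Cv_pos CM_pos C2_pos pos G_nonneg by (auto simp: CD_def CW_def)
  then show ?thesis using CL_pos by (simp add: CK_def)
qed

lemma V_star_ge:
  fixes v :: real
  assumes "0 < v"
  shows "v \<le> max (sqrt v) (v ^ 3)" "v\<^sup>2 \<le> max (sqrt v) (v ^ 3)" "v ^ 3 \<le> max (sqrt v) (v ^ 3)"
proof -
  have *: "v ^ k \<le> max (sqrt v) (v ^ 3)" if "1 \<le> k" "k \<le> 3" for k
  proof (cases "v \<le> 1")
    case True
    have "sqrt v * sqrt v \<le> sqrt v * 1" using assms True by (intro mult_left_mono) auto
    then have "v \<le> sqrt v" using assms by simp
    moreover have "v ^ k \<le> v ^ 1" using that assms True by (intro power_decreasing) auto
    ultimately show ?thesis by simp
  next
    case False
    then have "v ^ k \<le> v ^ 3" using that by (intro power_increasing) auto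
    then show ?thesis by simp
  qed
  show "v \<le> max (sqrt v) (v ^ 3)" "v\<^sup>2 \<le> max (sqrt v) (v ^ 3)" "v ^ 3 \<le> max (sqrt v) (v ^ 3)"
    using *[of 1] *[of 2] *[of 3] by auto
qed

lemma test_function_bound:
  assumes F: "F \<in> smooth_tests" and x: "x \<in> space X" and t: "0 < t"
  shows "\<bar>(\<integral>\<omega>. F (fluct t \<omega>) \<partial>P x) - (\<integral>\<omega>. gauss_smooth F (\<sigma>2 * W \<omega>) 0 \<partial>P x)\<bar>
    \<le> CK * exp (- (lam * \<rho> / (2 * \<rho> + lam)) * t) * max (sqrt (V x)) (V x ^ 3)" (is "?L \<le> ?R")
proof -
  define \<theta> where "\<theta> = lam * \<rho> / (2 * \<rho> + lam)"
  \<comment> \<open>This intermediate time balances the two errors: both decay like \<open>exp (- \<theta> * t)\<close>.\<close>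
  define r where "r = 2 * \<rho> * t / (2 * \<rho> + lam)"
  define s where "s = lam * t / (2 * \<rho> + lam)"
  have d0: "0 < 2 * \<rho> + lam" using pos by simp
  have r: "0 \<le> r" and s: "0 < s" using pos t by (auto simp: r_def s_def)
  have "r + s = (2 * \<rho> + lam) * t / (2 * \<rho> + lam)"
    by (simp add: r_def s_def add_divide_distrib[symmetric] distrib_right)
  then have rs: "r + s = t" using d0 by simp
  have "- lam * (2 * \<rho> * t / d) / 2 = - (lam * \<rho> / d) * t" for d by simp
  then have er: "- lam * r / 2 = - \<theta> * t" unfolding r_def \<theta>_def .
  have es: "- \<rho> * s = - \<theta> * t" by (simp add: s_def \<theta>_def)
  have "\<theta> \<le> lam / 2" using d0 pos by (simp add: \<theta>_def divide_simps)
  then have et: "exp (- lam * t / 2) \<le> exp (- \<theta> * t)" using t mult_right_mono[of \<theta> "lam / 2" t] by simp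
  let ?V = "max (sqrt (V x)) (V x ^ 3)" and ?e = "exp (- \<theta> * t)"
  note Vs = V_star_ge[OF V_pos[OF x]]
  have V0: "0 \<le> V x" using x by simp
  have c: "0 \<le> CL" "0 \<le> CD" "0 \<le> CW" "0 \<le> a2 * Cv * CM" "0 \<le> Cv * G"
    using CL_pos Cv_pos CM_pos C2_pos pos G_nonneg by (auto simp: CD_def CW_def)
  let ?err = "\<lambda>n. CW * V x * exp (- lam * (real n * \<tau>) / 2) + (\<sigma>2 - var n) * enn2real (\<integral>\<^sup>+\<omega>. ennreal \<bar>W \<omega>\<bar> \<partial>P x)"
  have "?L \<le> ?R + ?err n" for n
  proof -
    have "?L \<le> CW * V x * exp (- lam * (real n * \<tau>) / 2) + CL * (exp (- lam * t / 2) * V x ^ 3)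
       + (CD * (exp (- lam * r / 2) * (V x)\<^sup>2) + a2 * Cv * CM * (exp (- \<rho> * s) * (V x)\<^sup>2)
       + Cv * G * (CW * (exp (- lam * r / 2) * V x)))
       + (\<sigma>2 - var n) * enn2real (\<integral>\<^sup>+\<omega>. ennreal \<bar>W \<omega>\<bar> \<partial>P x)"
      using horizon_error[OF F x less_imp_le[OF t], of n] lindeberg_error[OF F x less_imp_le[OF t], of n]
        variance_error[OF F x r s, of n] limit_variance_error[OF F x, of n]
      unfolding rs by linarith
    also have "CL * (exp (- lam * t / 2) * V x ^ 3) \<le> CL * (?e * ?V)"
      by (intro mult_left_mono mult_mono et Vs c) (use V0 in auto)
    also have "CD * (exp (- lam * r / 2) * (V x)\<^sup>2) \<le> CD * (?e * ?V)"
      unfolding er by (intro mult_left_mono Vs c) auto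
    also have "a2 * Cv * CM * (exp (- \<rho> * s) * (V x)\<^sup>2) \<le> a2 * Cv * CM * (?e * ?V)"
      unfolding es by (intro mult_left_mono Vs c) auto
    also have "Cv * G * (CW * (exp (- lam * r / 2) * V x)) \<le> Cv * G * (CW * (?e * ?V))"
      unfolding er by (intro mult_left_mono Vs c) auto
    finally have "?L \<le> CW * V x * exp (- lam * (real n * \<tau>) / 2) + CL * (?e * ?V)
       + (CD * (?e * ?V) + a2 * Cv * CM * (?e * ?V) + Cv * G * (CW * (?e * ?V)))
       + (\<sigma>2 - var n) * enn2real (\<integral>\<^sup>+\<omega>. ennreal \<bar>W \<omega>\<bar> \<partial>P x)"
      by simp
    also have "\<dots> = CK * ?e * ?V + ?err n" by (simp add: CK_def algebra_simps)
    finally show ?thesis by (simp add: \<theta>_def)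
  qed
  moreover have "?err \<longlonglongrightarrow> 0"
  proof -
    have "(\<lambda>n. exp (- lam * \<tau> / 2) ^ n) \<longlonglongrightarrow> 0" using pos by (intro LIMSEQ_realpow_zero) auto
    then have "(\<lambda>n. exp (- lam * (real n * \<tau>) / 2)) \<longlonglongrightarrow> 0"
      by (simp add: exp_of_nat_mult[symmetric] mult_ac)
    then have "?err \<longlonglongrightarrow> CW * V x * 0 + (\<sigma>2 - \<sigma>2) * enn2real (\<integral>\<^sup>+\<omega>. ennreal \<bar>W \<omega>\<bar> \<partial>P x)"
      by (intro tendsto_add tendsto_mult tendsto_diff tendsto_const var_lim)
    then show ?thesis by simp
  qed
  then have "(\<lambda>n. ?R + ?err n) \<longlonglongrightarrow> ?R + 0" by (intro tendsto_add tendsto_const)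
  ultimately show ?thesis by (intro LIMSEQ_le_const[of _ "?R" ?L]) auto
qed

subsection \<open>The laws\<close>

lemma integral_fluctuation_law:
  assumes x: "x \<in> space X" and t: "0 \<le> t" and F: "F \<in> smooth_tests"
  shows "(\<integral>y. F y \<partial>fluctuation_law P Z h lam W x t) = (\<integral>\<omega>. F (fluct t \<omega>) \<partial>P x)"
  unfolding fluctuation_law_def fluct_def[symmetric]
  by (rule integral_distr[OF fluct_measurable[OF x t] test_measurable[OF F]])

lemma integral_gaussian_mixture_law:
  assumes x: "x \<in> space X" and F: "F \<in> smooth_tests"
  shows "(\<integral>y. F y \<partial>gaussian_mixture_law P W (sqrt \<sigma>2) x) = (\<integral>\<omega>. gauss_smooth F (\<sigma>2 * W \<omega>) 0 \<partial>P x)"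
proof -
  interpret p: prob_space "P x" by (rule P_prob[OF x])
  interpret pp: pair_prob_space "P x" std_normal_distribution ..
  note [measurable] = W_P[OF x] test_measurable[OF F]
  have m: "(\<lambda>(\<omega>, z). sqrt \<sigma>2 * sqrt (W \<omega>) * z) \<in> borel_measurable (P x \<Otimes>\<^sub>M std_normal_distribution)"
    by measurable
  have "(\<integral>y. F y \<partial>gaussian_mixture_law P W (sqrt \<sigma>2) x)
     = (\<integral>p. F (case p of (\<omega>, z) \<Rightarrow> sqrt \<sigma>2 * sqrt (W \<omega>) * z) \<partial>(P x \<Otimes>\<^sub>M std_normal_distribution))"
    unfolding gaussian_mixture_law_def by (rule integral_distr[OF m]) measurable
  also have "\<dots> = (\<integral>p. (case p of (\<omega>, z) \<Rightarrow> F (sqrt \<sigma>2 * sqrt (W \<omega>) * z)) \<partial>(P x \<Otimes>\<^sub>M std_normal_distribution))"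
    by (intro Bochner_Integration.integral_cong refl) auto
  also have "\<dots> = (\<integral>\<omega>. (\<integral>z. F (sqrt \<sigma>2 * sqrt (W \<omega>) * z) \<partial>std_normal_distribution) \<partial>P x)"
  proof (rule pp.integral_fst[symmetric])
    show "integrable (P x \<Otimes>\<^sub>M std_normal_distribution) (\<lambda>(\<omega>, z). F (sqrt \<sigma>2 * sqrt (W \<omega>) * z))"
      using smooth_tests_bound[OF F, of 0] by (intro pp.integrable_const_bound[where B = 1]) auto
  qed
  also have "\<dots> = (\<integral>\<omega>. gauss_smooth F (\<sigma>2 * W \<omega>) 0 \<partial>P x)"
    by (simp add: gauss_smooth_def real_sqrt_mult)
  finally show ?thesis .
qed

lemma fluctuation_bound:
  assumes F: "F \<in> smooth_tests" and x: "x \<in> space X" and t: "0 < t"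
  shows "\<bar>(\<integral>y. F y \<partial>fluctuation_law P Z h lam W x t) - (\<integral>y. F y \<partial>gaussian_mixture_law P W (sqrt \<sigma>2) x)\<bar>
    \<le> CK * exp (- (lam * \<rho> / (2 * \<rho> + lam)) * t) * max (sqrt (V x)) (V x ^ 3)"
  using test_function_bound[OF F x t]
  unfolding integral_fluctuation_law[OF x less_imp_le[OF t] F] integral_gaussian_mixture_law[OF x F] .

lemma smooth_dist_bound:
  assumes x: "x \<in> space X" and t: "0 < t"
  shows "smooth_dist (fluctuation_law P Z h lam W x t) (gaussian_mixture_law P W (sqrt \<sigma>2) x)
    \<le> CK * exp (- (lam * \<rho> / (2 * \<rho> + lam)) * t) * max (sqrt (V x)) (V x ^ 3)"
  unfolding smooth_dist_def
proof (rule cSUP_least)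
  show "smooth_tests \<noteq> {}" using cosine_smooth_test[of 0 0 0] by auto
qed (rule fluctuation_bound[OF _ x t])

lemma real_distribution_fluctuation_law:
  assumes x: "x \<in> space X" and t: "0 \<le> t"
  shows "real_distribution (fluctuation_law P Z h lam W x t)"
  unfolding fluctuation_law_def fluct_def[symmetric]
  by (rule prob_space.real_distribution_distr[OF P_prob[OF x] fluct_measurable[OF x t]])

lemma real_distribution_gaussian_mixture_law:
  assumes x: "x \<in> space X"
  shows "real_distribution (gaussian_mixture_law P W \<sigma> x)"
proof -
  interpret p: prob_space "P x" by (rule P_prob[OF x])
  interpret pp: pair_prob_space "P x" std_normal_distribution ..
  note [measurable] = W_P[OF x]
  show ?thesis unfolding gaussian_mixture_law_def by (rule pp.real_distribution_distr) measurable
qed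

lemma fluctuation_weak_conv:
  assumes x: "x \<in> space X"
  shows "weak_conv_at_top (fluctuation_law P Z h lam W x) (gaussian_mixture_law P W (sqrt \<sigma>2) x)"
proof -
  let ?\<nu> = "gaussian_mixture_law P W (sqrt \<sigma>2) x"
  \<comment> \<open>Negative times, at which measurability is not available, are irrelevant for the limit.\<close>
  let ?\<mu> = "\<lambda>t. fluctuation_law P Z h lam W x (max 0 t)"
  define \<theta> where "\<theta> = lam * \<rho> / (2 * \<rho> + lam)"
  define C where "C = CK * max (sqrt (V x)) (V x ^ 3)"
  have \<theta>: "0 < \<theta>" using pos by (simp add: \<theta>_def)
  have "weak_conv_at_top ?\<mu> ?\<nu>"
  proof (rule weak_conv_at_top_of_smooth_tests)
    show "real_distribution (?\<mu> t)" for t by (rule real_distribution_fluctuation_law[OF x]) simp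
    show "real_distribution ?\<nu>" by (rule real_distribution_gaussian_mixture_law[OF x])
    fix F :: "real \<Rightarrow> real" assume F: "F \<in> smooth_tests"
    have "((\<lambda>t. - \<theta> * t) \<longlongrightarrow> 0) at_bot \<or> filterlim (\<lambda>t. - \<theta> * t) at_bot at_top"
      using \<theta> filterlim_tendsto_neg_mult_at_bot[OF tendsto_const _ filterlim_ident, of "- \<theta>"] by simp
    then have "filterlim (\<lambda>t. - \<theta> * t) at_bot at_top"
      using \<theta> filterlim_tendsto_neg_mult_at_bot[OF tendsto_const _ filterlim_ident, of "- \<theta>"] by simp
    then have "((\<lambda>t. exp (- \<theta> * t)) \<longlongrightarrow> 0) at_top" by (rule filterlim_compose[OF exp_at_bot])
    then have lim0: "((\<lambda>t. C * exp (- \<theta> * t)) \<longlongrightarrow> C * 0) at_top" by (intro tendsto_mult tendsto_const)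
    have "((\<lambda>t. (\<integral>y. F y \<partial>?\<mu> t) - (\<integral>y. F y \<partial>?\<nu>)) \<longlongrightarrow> 0) at_top"
    proof (rule Lim_null_comparison)
      show "\<forall>\<^sub>F t in at_top. norm ((\<integral>y. F y \<partial>?\<mu> t) - (\<integral>y. F y \<partial>?\<nu>)) \<le> C * exp (- \<theta> * t)"
        using eventually_gt_at_top[of 0]
      proof eventually_elim
        case (elim t)
        then show ?case using fluctuation_bound[OF F x elim] by (simp add: C_def \<theta>_def mult_ac)
      qed
    qed (use lim0 in simp)
    then show "((\<lambda>t. \<integral>y. F y \<partial>?\<mu> t) \<longlongrightarrow> (\<integral>y. F y \<partial>?\<nu>)) at_top" by (rule LIM_zero_cancel)
  qed
  moreover have "((\<lambda>t. cdf (?\<mu> t) y) \<longlongrightarrow> l) at_top \<longleftrightarrow> ((\<lambda>t. cdf (fluctuation_law P Z h lam W x t) y) \<longlongrightarrow> l) at_top" for y l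
    by (intro tendsto_cong eventually_mono[OF eventually_ge_at_top[of 0]]) simp
  ultimately show ?thesis unfolding weak_conv_at_top_def by simp
qed

subsection \<open>The degenerate case\<close>

text \<open>If all the variances vanish at \<open>y\<close>, then \<open>Wt (n * \<tau>) = h y\<close> almost surely for all \<open>n\<close>.\<close>

lemma degenerate_at:
  assumes y: "y \<in> space X" and v: "\<And>n. vr n y = 0"
  shows "AE \<omega> in P y. W \<omega> = h y"
proof -
  interpret prob_space "P y" by (rule P_prob[OF y])
  have "AE \<omega> in P y. Wt (real n * \<tau>) \<omega> = h y" for n
  proof -
    let ?S = "zint (real n * \<tau>) (hz n)"
    note [measurable] = zint_measurable_P[OF n\<tau> hz_measurable y, of n]
    have i1: "(\<integral>\<^sup>+\<omega>. ?S \<omega> \<partial>P y) = ennreal (h y)" using zmom_1_hz[OF y, of n] by (simp add: zmom_def)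
    have i2: "(\<integral>\<^sup>+\<omega>. ?S \<omega> ^ 2 \<partial>P y) = ennreal ((h y)\<^sup>2)" using zmom_2_hz[OF y, of n] v[of n] by (simp add: zmom_def)
    have fin: "AE \<omega> in P y. ?S \<omega> \<noteq> \<infinity>" by (rule nn_integral_noteq_infinite) (simp_all add: i1)
    define S where "S \<omega> = enn2real (?S \<omega>)" for \<omega>
    have [measurable]: "S \<in> borel_measurable (P y)" unfolding S_def[abs_def] by measurable
    have S0: "0 \<le> S \<omega>" for \<omega> by (simp add: S_def)
    have j1: "(\<integral>\<^sup>+\<omega>. ennreal (S \<omega>) \<partial>P y) = ennreal (h y)"
      unfolding i1[symmetric] by (rule nn_integral_cong_AE, use fin in eventually_elim) (simp add: S_def less_top)
    have j2: "(\<integral>\<^sup>+\<omega>. ennreal ((S \<omega>)\<^sup>2) \<partial>P y) = ennreal ((h y)\<^sup>2)"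
      unfolding i2[symmetric]
      by (rule nn_integral_cong_AE, use fin in eventually_elim) (simp add: S_def less_top ennreal_power[symmetric])
    have k1: "integrable (P y) S" "expectation S = h y"
      using j1 S0 h_nonneg[OF y] nn_integral_eq_integrable[of S "P y" "h y"] by auto
    have k2: "integrable (P y) (\<lambda>\<omega>. (S \<omega>)\<^sup>2)" "expectation (\<lambda>\<omega>. (S \<omega>)\<^sup>2) = (h y)\<^sup>2"
      using j2 nn_integral_eq_integrable[of "\<lambda>\<omega>. (S \<omega>)\<^sup>2" "P y" "(h y)\<^sup>2"] by auto
    have e: "(\<lambda>\<omega>. (S \<omega> - h y)\<^sup>2) = (\<lambda>\<omega>. (S \<omega>)\<^sup>2 - 2 * h y * S \<omega> + (h y)\<^sup>2)"
      by (rule ext) (simp add: power2_diff)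
    have "integrable (P y) (\<lambda>\<omega>. (S \<omega> - h y)\<^sup>2)" "expectation (\<lambda>\<omega>. (S \<omega> - h y)\<^sup>2) = 0"
      unfolding e using k1 k2 prob_space by (simp_all add: power2_eq_square)
    then have "AE \<omega> in P y. (S \<omega> - h y)\<^sup>2 = 0" by (subst (asm) integral_nonneg_eq_0_iff_AE) auto
    then show ?thesis
    proof eventually_elim
      case (elim \<omega>)
      have "?S \<omega> = ennreal (exp (- lam * (real n * \<tau>))) * zint (real n * \<tau>) H \<omega>"
        unfolding hz_def[abs_def] by (rule zint_cmult) measurable
      then have "S \<omega> = Wt (real n * \<tau>) \<omega>"
        by (simp only: S_def Wt_def enn2real_mult enn2real_ennreal[OF exp_ge_zero])
      with elim show ?case by simp
    qed
  qed
  then have "AE \<omega> in P y. \<forall>n. Wt (real n * \<tau>) \<omega> = h y" by (simp add: AE_all_countable)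
  then show ?thesis
    using Wt_lim[OF y]
  proof eventually_elim
    case (elim \<omega>)
    have "filterlim (\<lambda>n. real n * \<tau>) at_top sequentially"
      using pos by (intro filterlim_at_top_mult_tendsto_pos[OF tendsto_const _ filterlim_real_sequentially]) auto
    from filterlim_compose[OF elim(2) this] have "(\<lambda>n. h y) \<longlonglongrightarrow> W \<omega>" using elim(1) by simp
    then show ?case by (simp add: LIMSEQ_const_iff)
  qed
qed

lemma degenerate:
  assumes "\<sigma>2 = 0"
  shows "AE y in \<gamma>. AE \<omega> in P y. W \<omega> = h y"
proof -
  have "AE y in \<gamma>. vr n y = 0" for n
  proof -
    have "var n = 0" using var_le_\<sigma>2[of n] var_nonneg[of n] assms by simp
    moreover have "AE y in \<gamma>. 0 \<le> vr n y" by (intro AE_I2 vr_nonneg) (simp add: space_\<gamma>)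
    ultimately show ?thesis using integral_nonneg_eq_0_iff_AE[OF vr_\<gamma>] by (simp add: var_def)
  qed
  then have "AE y in \<gamma>. \<forall>n. vr n y = 0" by (simp add: AE_all_countable)
  then show ?thesis
    using AE_space by eventually_elim (auto intro: degenerate_at simp: space_\<gamma>)
qed

end

section \<open>The central limit theorem\<close>

lemma weighted_norm_le:
  assumes "x \<in> space X" and w: "\<And>y. y \<in> space X \<Longrightarrow> 0 < w y" and f: "f \<in> borel_measurable X"
    and le: "\<And>y. y \<in> space X \<Longrightarrow> \<bar>f y\<bar> \<le> c * w y"
  shows "f \<in> weighted_space X w" "weighted_norm X w f \<le> c"
proof -
  have *: "\<bar>f y\<bar> / w y \<le> c" if "y \<in> space X" for y
    using le[OF that] w[OF that] by (simp add: pos_divide_le_eq)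
  show "f \<in> weighted_space X w"
    unfolding weighted_space_def using f * by (auto intro!: bdd_aboveI2)
  show "weighted_norm X w f \<le> c"
    unfolding weighted_norm_def using assms(1) * by (intro cSUP_least) auto
qed

theorem theorem2p2:
  fixes X :: "'x measure" and \<Omega> :: "'w measure" and P :: "'x \<Rightarrow> 'w measure"
    and N :: "real \<Rightarrow> 'w \<Rightarrow> ('u::countable) set" and trait :: "real \<Rightarrow> 'w \<Rightarrow> 'u \<Rightarrow> 'x"
    and desc :: "'w \<Rightarrow> 'u \<Rightarrow> 'u \<Rightarrow> bool" and Z :: "real \<Rightarrow> 'w \<Rightarrow> 'x measure"
    and V h :: "'x \<Rightarrow> real" and \<kappa> :: nat and \<gamma> :: "'x measure" and lam \<rho> :: real
    and W :: "'w \<Rightarrow> real"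
  assumes "branching_markov_process X \<Omega> P N trait desc"
    and "Z = population X N trait"
    and "V \<in> borel_measurable X" and "\<forall>x\<in>space X. V x > 0"
    and "\<kappa> \<ge> 4"
    and "assumption1 X P Z V \<kappa>"
    and "assumption2 X P Z V \<kappa> \<gamma> h lam \<rho>"
    and "martingale_limit X \<Omega> P Z h lam W"
  shows "\<exists>\<sigma>\<^sub>h. (\<sigma>\<^sub>h > 0 \<or> \<sigma>\<^sub>h = 0 \<and> (AE x in \<gamma>. AE \<omega> in P x. W \<omega> = h x)) \<and>
    (\<forall>x\<in>space X.
       weak_conv_at_top (fluctuation_law P Z h lam W x) (gaussian_mixture_law P W \<sigma>\<^sub>h x)) \<and>
    (\<exists>K>0. \<forall>t>0. \<forall>x\<in>space X.
       smooth_dist (fluctuation_law P Z h lam W x t) (gaussian_mixture_law P W \<sigma>\<^sub>h x)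
         \<le> K * exp (- (lam * \<rho> / (2 * \<rho> + lam)) * t) *
           (\<integral>\<omega>. (\<integral>y. max (sqrt (V y)) (V y ^ 3) \<partial>Z 0 \<omega>) \<partial>P x))"
proof -
  have Z: "Z = population X N trait" by fact
  interpret bp: branching_process X \<Omega> P N trait desc by unfold_locales fact
  note Vm [measurable] = \<open>V \<in> borel_measurable X\<close>
  have Vpos: "0 < V x" if "x \<in> space X" for x using assms(4) that by blast
  have k\<kappa>: "k \<in> {1..\<kappa>}" if "k \<in> {1..4}" for k using that \<open>\<kappa> \<ge> 4\<close> by auto
  obtain \<tau> a1 where \<tau>: "0 < \<tau>" "0 < a1" and A1: "\<And>x k. x \<in> space X \<Longrightarrow> k \<in> {1..\<kappa>} \<Longrightarrow>
      (SUP t\<in>{0..\<tau>}. \<integral>\<^sup>+\<omega>. (\<integral>\<^sup>+y. ennreal (V y) \<partial>Z t \<omega>) ^ k \<partial>P x) \<le> ennreal (a1 * V x ^ k)"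
    using assms(6) unfolding assumption1_def by blast
  have A2: "sets \<gamma> = sets X" "(\<integral>\<^sup>+x. ennreal (max_weight V \<kappa> x) \<partial>\<gamma>) < \<infinity>"
     "\<And>x. x \<in> space X \<Longrightarrow> 0 \<le> h x" "h \<in> weighted_space X (min_weight V \<kappa>)" "lam > 0" "\<rho> > 0"
     "\<And>t x. 0 \<le> t \<Longrightarrow> x \<in> space X \<Longrightarrow> mean_semigroup P Z t h x = exp (lam * t) * h x"
    using assms(7) unfolding assumption2_def by simp_all
  have "\<exists>a2>0. \<forall>x\<in>space X. \<forall>k\<in>{1..\<kappa>}. \<forall>f\<in>weighted_space X (\<lambda>y. V y ^ k). \<forall>t>0.
        \<bar>exp (- lam * t) * mean_semigroup P Z t f x - (\<integral>y. f y \<partial>\<gamma>) * h x\<bar>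
          \<le> a2 * exp (- \<rho> * t) * weighted_norm X (\<lambda>y. V y ^ k) f * V x ^ k"
    using assms(7) unfolding assumption2_def by (elim conjE)
  then obtain a2 where a2: "0 < a2" and erg: "\<And>x k f t. x \<in> space X \<Longrightarrow> k \<in> {1..\<kappa>} \<Longrightarrow> f \<in> weighted_space X (\<lambda>y. V y ^ k) \<Longrightarrow> 0 < t \<Longrightarrow>
        \<bar>exp (- lam * t) * mean_semigroup P Z t f x - (\<integral>y. f y \<partial>\<gamma>) * h x\<bar>
          \<le> a2 * exp (- \<rho> * t) * weighted_norm X (\<lambda>y. V y ^ k) f * V x ^ k"
    by blast
  have \<kappa>_ne: "{1..\<kappa>} \<noteq> {}" using \<open>\<kappa> \<ge> 4\<close> by auto
  have min_le: "min_weight V \<kappa> x \<le> V x ^ k" if "k \<in> {1..\<kappa>}" for x k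
    unfolding min_weight_def using that by (intro Min_le) auto
  have min_pos: "0 < min_weight V \<kappa> x" if "x \<in> space X" for x
    unfolding min_weight_def using \<kappa>_ne Vpos[OF that] by (subst Min_gr_iff) auto
  have le_max: "V x ^ k \<le> max_weight V \<kappa> x" if "k \<in> {1..\<kappa>}" for x k
    unfolding max_weight_def using that by (intro Max_ge) auto
  obtain c where c: "\<And>x. x \<in> space X \<Longrightarrow> \<bar>h x\<bar> / min_weight V \<kappa> x \<le> c"
    using A2(4) unfolding weighted_space_def bdd_above_def by auto
  define ch where "ch = max 1 c"
  have h_le: "h x \<le> ch * V x ^ k" if x: "x \<in> space X" and k: "k \<in> {1..\<kappa>}" for x k
  proof -
    have "h x \<le> c * min_weight V \<kappa> x" using c[OF x] min_pos[OF x] by (simp add: pos_divide_le_eq)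
    also have "\<dots> \<le> ch * min_weight V \<kappa> x" using min_pos[OF x] by (intro mult_right_mono) (auto simp: ch_def)
    also have "\<dots> \<le> ch * V x ^ k" by (intro mult_left_mono min_le k) (simp add: ch_def)
    finally show ?thesis .
  qed
  define G where "G = enn2real (\<integral>\<^sup>+x. ennreal (max_weight V \<kappa> x) \<partial>\<gamma>)"
  note [measurable_cong] = A2(1)
  have Vnn: "(\<integral>\<^sup>+x. ennreal (V x ^ k) \<partial>\<gamma>) \<le> (\<integral>\<^sup>+x. ennreal (max_weight V \<kappa> x) \<partial>\<gamma>)" if "k \<in> {1..4}" for k
    by (intro nn_integral_mono ennreal_leI le_max k\<kappa> that)
  have sp\<gamma>: "space \<gamma> = space X" by (rule sets_eq_imp_space_eq[OF A2(1)])
  have V\<gamma>: "integrable \<gamma> (\<lambda>x. V x ^ k)" if "k \<in> {1..4}" for k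
  proof (rule integrableI_nonneg)
    show "AE x in \<gamma>. 0 \<le> V x ^ k"
      using Vpos by (intro AE_I2) (simp add: sp\<gamma> less_imp_le)
    show "(\<integral>\<^sup>+x. ennreal (V x ^ k) \<partial>\<gamma>) < \<infinity>" using Vnn[OF that] A2(2) by (rule le_less_trans)
  qed measurable
  interpret branching_fluctuation X \<Omega> P N trait desc V h \<gamma> lam \<rho> \<tau> a1 a2 ch G W
  proof unfold_locales
    show "V \<in> borel_measurable X" by (rule Vm)
    show "h \<in> borel_measurable X" using A2(4) by (simp add: weighted_space_def)
    show "0 < ch" by (simp add: ch_def)
    show "bp.zmom k t (\<lambda>y. ennreal (V y)) x \<le> ennreal (a1 * V x ^ k)"
      if "x \<in> space X" "k \<in> {1..4}" "0 \<le> t" "t \<le> \<tau>" for x k t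
    proof -
      have "bp.zmom k t (\<lambda>y. ennreal (V y)) x \<le> (SUP t\<in>{0..\<tau>}. \<integral>\<^sup>+\<omega>. (\<integral>\<^sup>+y. ennreal (V y) \<partial>Z t \<omega>) ^ k \<partial>P x)"
        unfolding bp.zmom_def bp.zint_def Z[symmetric] using that by (intro SUP_upper) auto
      also have "\<dots> \<le> ennreal (a1 * V x ^ k)" by (rule A1[OF that(1) k\<kappa>[OF that(2)]])
      finally show ?thesis .
    qed
    show "h x \<le> ch * V x ^ k" if "x \<in> space X" "k \<in> {1..4}" for x k by (rule h_le[OF that(1) k\<kappa>[OF that(2)]])
    show "integrable \<gamma> (\<lambda>x. V x ^ k)" if "k \<in> {1..4}" for k by (rule V\<gamma>[OF that])
    show "(\<integral>x. V x ^ k \<partial>\<gamma>) \<le> G" if "k \<in> {1..4}" for k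
    proof -
      have "(\<integral>x. V x ^ k \<partial>\<gamma>) = enn2real (\<integral>\<^sup>+x. ennreal (V x ^ k) \<partial>\<gamma>)"
        using Vpos by (intro integral_eq_nn_integral AE_I2) (auto simp: sp\<gamma> less_imp_le)
      also have "\<dots> \<le> G" unfolding G_def using A2(2) by (intro enn2real_mono Vnn that) auto
      finally show ?thesis .
    qed
    show "mean_semigroup P (population X N trait) t h x = exp (lam * t) * h x" if "x \<in> space X" "0 \<le> t" for x t
      using A2(7)[OF that(2,1)] unfolding Z .
    show "\<bar>exp (- lam * t) * mean_semigroup P (population X N trait) t f x - (\<integral>y. f y \<partial>\<gamma>) * h x\<bar>
          \<le> a2 * exp (- \<rho> * t) * c * V x ^ k"
      if x: "x \<in> space X" and k: "k \<in> {1..4}" and f: "f \<in> borel_measurable X" and c: "0 \<le> c"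
        and le: "\<And>y. y \<in> space X \<Longrightarrow> \<bar>f y\<bar> \<le> c * V y ^ k" and t: "0 < t" for x k f c t
    proof -
      have wn: "f \<in> weighted_space X (\<lambda>y. V y ^ k)" "weighted_norm X (\<lambda>y. V y ^ k) f \<le> c"
        using weighted_norm_le[OF x _ f le] Vpos by auto
      have "\<bar>exp (- lam * t) * mean_semigroup P Z t f x - (\<integral>y. f y \<partial>\<gamma>) * h x\<bar>
          \<le> a2 * exp (- \<rho> * t) * weighted_norm X (\<lambda>y. V y ^ k) f * V x ^ k"
        by (rule erg[OF x k\<kappa>[OF k] wn(1) t])
      also have "\<dots> \<le> a2 * exp (- \<rho> * t) * c * V x ^ k"
        using a2 Vpos[OF x] by (intro mult_right_mono mult_left_mono wn) auto
      finally show ?thesis unfolding Z .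
    qed
    show "W \<in> borel_measurable \<Omega>" using assms(8) by (simp add: martingale_limit_def)
    show "AE \<omega> in P x. ((\<lambda>t. exp (- lam * t) * (\<integral>y. h y \<partial>population X N trait t \<omega>)) \<longlongrightarrow> W \<omega>) at_top" if "x \<in> space X" for x
      using assms(8) that unfolding martingale_limit_def Z by blast
  qed (fact Vpos A2 \<tau> a2)+
  have V_start: "(\<integral>\<omega>. (\<integral>y. max (sqrt (V y)) (V y ^ 3) \<partial>Z 0 \<omega>) \<partial>P x) = max (sqrt (V x)) (V x ^ 3)"
    if x: "x \<in> space X" for x
  proof -
    interpret prob_space "P x" by (rule bp.P_prob[OF x])
    have "(\<integral>\<omega>. (\<integral>y. max (sqrt (V y)) (V y ^ 3) \<partial>Z 0 \<omega>) \<partial>P x) = (\<integral>\<omega>. max (sqrt (V x)) (V x ^ 3) \<partial>P x)"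
    proof (rule integral_cong_AE)
      show "AE \<omega> in P x. (\<integral>y. max (sqrt (V y)) (V y ^ 3) \<partial>Z 0 \<omega>) = max (sqrt (V x)) (V x ^ 3)"
        using bp.Z_start[OF x] unfolding Z[symmetric] by eventually_elim (simp add: integral_return x)
      have "(\<lambda>\<omega>. enn2real (bp.zint 0 (\<lambda>y. ennreal (max (sqrt (V y)) (V y ^ 3))) \<omega>)) \<in> borel_measurable (P x)"
        using bp.zint_measurable_P[OF order_refl _ x, of "\<lambda>y. ennreal (max (sqrt (V y)) (V y ^ 3))"] by measurable
      moreover have "(\<integral>y. max (sqrt (V y)) (V y ^ 3) \<partial>Z 0 \<omega>) = enn2real (bp.zint 0 (\<lambda>y. ennreal (max (sqrt (V y)) (V y ^ 3))) \<omega>)" for \<omega>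
        unfolding Z by (rule bp.integral_Z_eq) (auto intro: max.coboundedI1 less_imp_le[OF Vpos])
      ultimately show "(\<lambda>\<omega>. \<integral>y. max (sqrt (V y)) (V y ^ 3) \<partial>Z 0 \<omega>) \<in> borel_measurable (P x)" by simp
    qed simp
    then show ?thesis using prob_space by simp
  qed
  show ?thesis
  proof (rule exI[of _ "sqrt \<sigma>2"], intro conjI ballI)
    show "0 < sqrt \<sigma>2 \<or> sqrt \<sigma>2 = 0 \<and> (AE x in \<gamma>. AE \<omega> in P x. W \<omega> = h x)"
      using \<sigma>2_nonneg degenerate by (cases "\<sigma>2 = 0") auto
    show "weak_conv_at_top (fluctuation_law P Z h lam W x) (gaussian_mixture_law P W (sqrt \<sigma>2) x)"
      if "x \<in> space X" for x
      unfolding Z by (rule fluctuation_weak_conv[OF that])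
    have "smooth_dist (fluctuation_law P Z h lam W x t) (gaussian_mixture_law P W (sqrt \<sigma>2) x)
         \<le> CK * exp (- (lam * \<rho> / (2 * \<rho> + lam)) * t) *
           (\<integral>\<omega>. (\<integral>y. max (sqrt (V y)) (V y ^ 3) \<partial>Z 0 \<omega>) \<partial>P x)"
      if "0 < t" "x \<in> space X" for t x
      unfolding V_start[OF that(2)] unfolding Z by (rule smooth_dist_bound[OF that(2,1)])
    then show "\<exists>K>0. \<forall>t>0. \<forall>x\<in>space X.
       smooth_dist (fluctuation_law P Z h lam W x t) (gaussian_mixture_law P W (sqrt \<sigma>2) x)
         \<le> K * exp (- (lam * \<rho> / (2 * \<rho> + lam)) * t) *
           (\<integral>\<omega>. (\<integral>y. max (sqrt (V y)) (V y ^ 3) \<partial>Z 0 \<omega>) \<partial>P x)"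
      using CK_pos by blast
  qed
qed

end
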